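(* Let $\mathcal{G}$ be the plane graph constructed as follows. $\mathcal{G}_0$ is a copy of the cycle $C_3$ embedded in the sphere $\mathbb{S}^2$. For $n>0$, $\mathcal{G}_n$ is the plane graph obtained from $\mathcal{G}_{n-1}$ as follows: in each face $F$ of $\mathcal{G}_{n-1}$ place a new vertex $v_F$, join $v_F$ by an edge (drawn inside $F$) to each vertex $u$ on the boundary $\partial F$, and subdivide each such edge $\{v_F,u\}$ exactly $n$ times. Finally, $\mathcal{G}:=\bigcup_{n=0}^{\infty}\mathcal{G}_n$. Then $\mathcal{G}$ is a countable planar graph, and every countable (i.e. finite or countably infinite) planar graph is a minor of $\mathcal{G}$; that is, $\mathcal{G}$ is minor-universal for the class of countable planar graphs.
   Context: A graph $G$ is a minor of a graph $G'$ if $G'$ contains as a subgraph an inflated copy of $G$, i.e. a graph $H$ together with a map $\phi$ sending each vertex $v$ of $G$ to a connected subgraph $\phi(v)$ of $H$ and each edge $e=\{x,y\}$ of $G$ to an open path $\phi(e)$ between $\phi(x)$ and $\phi(y)$, such that the images of distinct elements of $G$ are pairwise disjoint and their union is $H$. A graph is minor-universal for a class if it belongs to the class and every member of the class is a minor of it. *)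

theory Defs
  imports "HOL-Analysis.Analysis"
begin

record 'a sgraph =
  verts :: "'a set"
  edges :: "'a set set"

definition simple_graph :: "'a sgraph \<Rightarrow> bool" where
  "simple_graph G \<longleftrightarrow>
     (\<forall>e\<in>edges G. \<exists>x\<in>verts G. \<exists>y\<in>verts G. x \<noteq> y \<and> e = {x, y})"

definition subgraph :: "'a sgraph \<Rightarrow> 'a sgraph \<Rightarrow> bool" where
  "subgraph H G \<longleftrightarrow> simple_graph H \<and> verts H \<subseteq> verts G \<and> edges H \<subseteq> edges G"

definition connected_graph :: "'a sgraph \<Rightarrow> bool" where
  "connected_graph G \<longleftrightarrow> verts G \<noteq> {} \<and>
     (\<forall>x\<in>verts G. \<forall>y\<in>verts G. (x, y) \<in> {(u, v). {u, v} \<in> edges G}\<^sup>*)"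

definition isomorphic_graphs :: "'a sgraph \<Rightarrow> 'b sgraph \<Rightarrow> bool" where
  "isomorphic_graphs G H \<longleftrightarrow>
     (\<exists>f. bij_betw f (verts G) (verts H) \<and> edges H = (\<lambda>e. f ` e) ` edges G)"

text \<open>An open path between \<open>A\<close> and \<open>B\<close> is a path from a vertex of \<open>A\<close> to a vertex of \<open>B\<close> with
  its two end-vertices removed but all its edges kept. It is stored in the same record type as
  a graph, although its first and last edge have an end outside its vertex set.\<close>

definition open_path_between :: "'a sgraph \<Rightarrow> 'a sgraph \<Rightarrow> 'a sgraph \<Rightarrow> bool" where
  "open_path_between P A B \<longleftrightarrow>
     (\<exists>p. distinct p \<and> length p \<ge> 2 \<and> hd p \<in> verts A \<and> last p \<in> verts B \<and>
          verts P = set p - {hd p, last p} \<and>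
          edges P = {{p ! i, p ! Suc i} | i. Suc i < length p})"

definition disjoint_parts :: "'a sgraph \<Rightarrow> 'a sgraph \<Rightarrow> bool" where
  "disjoint_parts A B \<longleftrightarrow> verts A \<inter> verts B = {} \<and> edges A \<inter> edges B = {}"

text \<open>The map on the elements of \<open>G\<close> is split into its restrictions \<open>\<phi>\<close> to the vertices and
  \<open>\<psi>\<close> to the edges.\<close>

definition inflated_copy ::
  "'a sgraph \<Rightarrow> 'b sgraph \<Rightarrow> ('a \<Rightarrow> 'b sgraph) \<Rightarrow> ('a set \<Rightarrow> 'b sgraph) \<Rightarrow> bool" where
  "inflated_copy G H \<phi> \<psi> \<longleftrightarrow>
     (\<forall>v\<in>verts G. subgraph (\<phi> v) H \<and> connected_graph (\<phi> v)) \<and>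
     (\<forall>x y. {x, y} \<in> edges G \<longrightarrow> open_path_between (\<psi> {x, y}) (\<phi> x) (\<phi> y)) \<and>
     (\<forall>v\<in>verts G. \<forall>w\<in>verts G. v \<noteq> w \<longrightarrow> disjoint_parts (\<phi> v) (\<phi> w)) \<and>
     (\<forall>e\<in>edges G. \<forall>f\<in>edges G. e \<noteq> f \<longrightarrow> disjoint_parts (\<psi> e) (\<psi> f)) \<and>
     (\<forall>v\<in>verts G. \<forall>e\<in>edges G. disjoint_parts (\<phi> v) (\<psi> e)) \<and>
     verts H = (\<Union>v\<in>verts G. verts (\<phi> v)) \<union> (\<Union>e\<in>edges G. verts (\<psi> e)) \<and>
     edges H = (\<Union>v\<in>verts G. edges (\<phi> v)) \<union> (\<Union>e\<in>edges G. edges (\<psi> e))"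

definition graph_minor :: "'a sgraph \<Rightarrow> 'b sgraph \<Rightarrow> bool" where
  "graph_minor G G' \<longleftrightarrow> (\<exists>H \<phi> \<psi>. subgraph H G' \<and> inflated_copy G H \<phi> \<psi>)"

abbreviation S2 :: "(real^3) set" where
  "S2 \<equiv> sphere 0 1"

text \<open>A graph drawn in the sphere: its vertices are points and its edges are the point sets of
  closed arcs. An edge meets the vertex set exactly in its two ends, and two edges meet only in
  vertices; so the abstract graph can be read off by intersecting each edge with the vertex set.
  Infinite graphs are allowed and nothing is required about accumulation points.\<close>

record drawing =
  points :: "(real^3) set"
  curves :: "(real^3) set set"

definition plane_graph :: "drawing \<Rightarrow> bool" where
  "plane_graph P \<longleftrightarrow>
     points P \<subseteq> S2 \<and>
     (\<forall>e\<in>curves P. e \<subseteq> S2 \<and>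
        (\<exists>g. arc g \<and> path_image g = e \<and> e \<inter> points P = {pathstart g, pathfinish g})) \<and>
     (\<forall>e\<in>curves P. \<forall>f\<in>curves P. e \<noteq> f \<longrightarrow> e \<inter> f \<subseteq> points P) \<and>
     inj_on (\<lambda>e. e \<inter> points P) (curves P)"

definition abstract_graph :: "drawing \<Rightarrow> (real^3) sgraph" where
  "abstract_graph P = \<lparr>verts = points P, edges = (\<lambda>e. e \<inter> points P) ` curves P\<rparr>"

definition planar :: "'a sgraph \<Rightarrow> bool" where
  "planar G \<longleftrightarrow> (\<exists>P. plane_graph P \<and> isomorphic_graphs G (abstract_graph P))"

definition countable_planar_graph :: "'a sgraph \<Rightarrow> bool" where
  "countable_planar_graph G \<longleftrightarrow> simple_graph G \<and> countable (verts G) \<and> planar G"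

definition faces :: "drawing \<Rightarrow> (real^3) set set" where
  "faces P = components (S2 - (points P \<union> \<Union>(curves P)))"

definition boundary_vertices :: "drawing \<Rightarrow> (real^3) set \<Rightarrow> (real^3) set" where
  "boundary_vertices P F = points P \<inter> (top_of_set S2 frontier_of F)"

definition embedded_triangle :: "drawing \<Rightarrow> bool" where
  "embedded_triangle P \<longleftrightarrow> plane_graph P \<and>
     (\<exists>x y z. x \<noteq> y \<and> y \<noteq> z \<and> x \<noteq> z \<and>
        abstract_graph P = \<lparr>verts = {x, y, z}, edges = {{x, y}, {y, z}, {x, z}}\<rparr>)"

text \<open>Here \<open>c F\<close> is the new vertex in the face \<open>F\<close>, and \<open>g F u\<close> parametrises the edge drawn from
  it to the boundary vertex \<open>u\<close>. The \<open>n\<close> subdividing vertices are put at the parameters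
  \<open>i / (n + 1)\<close>; up to reparametrisation of \<open>g F u\<close> this covers every choice of \<open>n\<close> inner points.\<close>

definition stellar_step :: "nat \<Rightarrow> drawing \<Rightarrow> drawing \<Rightarrow> bool" where
  "stellar_step n P Q \<longleftrightarrow>
     (\<exists>(c :: (real^3) set \<Rightarrow> real^3) (g :: (real^3) set \<Rightarrow> real^3 \<Rightarrow> real \<Rightarrow> real^3).
        (\<forall>F\<in>faces P. c F \<in> F) \<and>
        (\<forall>F\<in>faces P. \<forall>u\<in>boundary_vertices P F.
           arc (g F u) \<and> pathstart (g F u) = c F \<and> pathfinish (g F u) = u \<and>
           path_image (g F u) - {u} \<subseteq> F) \<and>
        (\<forall>F\<in>faces P. \<forall>u\<in>boundary_vertices P F. \<forall>w\<in>boundary_vertices P F.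
           u \<noteq> w \<longrightarrow> path_image (g F u) \<inter> path_image (g F w) = {c F}) \<and>
        points Q = points P \<union> c ` faces P \<union>
          {g F u (real i / real (n + 1)) | F u i.
             F \<in> faces P \<and> u \<in> boundary_vertices P F \<and> 1 \<le> i \<and> i \<le> n} \<and>
        curves Q = curves P \<union>
          {g F u ` {real i / real (n + 1) .. real (i + 1) / real (n + 1)} | F u i.
             F \<in> faces P \<and> u \<in> boundary_vertices P F \<and> i \<le> n})"

definition stellar_sequence :: "(nat \<Rightarrow> drawing) \<Rightarrow> bool" where
  "stellar_sequence \<G> \<longleftrightarrow>
     embedded_triangle (\<G> 0) \<and> (\<forall>n>0. stellar_step n (\<G> (n - 1)) (\<G> n))"

definition union_drawing :: "(nat \<Rightarrow> drawing) \<Rightarrow> drawing" where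
  "union_drawing \<G> = \<lparr>points = (\<Union>n. points (\<G> n)), curves = (\<Union>n. curves (\<G> n))\<rparr>"

end

theory Submission
  imports Defs "HOL-Library.Sublist"
begin

text \<open>
  A minor is given by pairwise disjoint connected branch sets with an edge of \<open>\<G>\<close> between any two that
  belong to adjacent vertices. For a countable plane graph they are grown along a decomposition:
  blocks hang at single vertices, each block arises from one edge by adding ears, and an ear runs inside
  one of the discs into which the part drawn so far divides the sphere. Every disc is represented by a face
  of some \<open>\<G>\<^sub>n\<close> whose boundary cycle meets the branch sets of the boundary vertices of the disc in their
  cyclic order. Inside that face the subdivided spokes of the later steps leave enough room to extend these
  branch sets along disjoint paths, to insert the new vertices of the ear, and to end up with two faces of a
  deeper level that represent the two halves of the disc; waiting longer makes any number of new
  vertices fit. In the same way a face is set aside for every vertex, where later blocks can be attached.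
  Branch sets only grow, so countably many steps have a limit.

  A sequence \<open>\<G>\<^sub>n\<close> exists because it can be drawn with arcs of great circles: all faces stay
  intersections of the sphere with open convex cones, and for a generic centre the new faces are
  spherical triangles.
\<close>


section \<open>Regions of the sphere\<close>

text \<open>The given graph may have vertices of infinite degree, and its drawing may accumulate
  anywhere, so no topological information survives a limit. At every finite stage only the cyclic
  order of the vertices around each disc is therefore carried over. To continue from such an order
  one needs room: after the step from level n every new spoke has n + 1 inner vertices, which bounds
  the number of disjoint connections that can cross it. This is why the number of subdivisions has
  to grow. The key manoeuvre is a spiral: the branch sets on the rim of a face wind around its
  centre at different depths until all of them meet one spoke, and a sector next to that spoke then
  sees them all in order while its interior is still empty. Ears have distinct ends, so once a block
  admits no further ear, each connected piece left over is attached to at most one vertex, and a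
  face that touches this one branch set is enough to go on. Universality is shown for every
  sequence, hence for arbitrary arcs, and needs Jordan and theta curves on the sphere; only the
  existence proof may choose convenient geometry.\<close>

definition region :: "(real^3) set \<Rightarrow> (real^3) set \<Rightarrow> bool" where
  "region J R \<longleftrightarrow> R \<noteq> {} \<and> connected R \<and> openin (top_of_set S2) R \<and> R \<inter> J = {} \<and> closure R = R \<union> J"

lemma region_sub: "region J R \<Longrightarrow> R \<subseteq> S2" "region J R \<Longrightarrow> J \<subseteq> S2"
proof -
  assume r: "region J R"
  then show R: "R \<subseteq> S2" by (auto simp: region_def openin_subset dest: openin_imp_subset)
  then have "closure R \<subseteq> S2" by (simp add: closure_minimal)
  then show "J \<subseteq> S2" using r by (auto simp: region_def)
qed

text \<open>\<open>T \<inter> R\<close> is open in \<open>T\<close>, and also closed there, because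
  the closure of \<open>R\<close> adds only points of \<open>J\<close>, which \<open>T\<close>
  avoids. So a connected set off the boundary cannot leave a region.\<close>

lemma region_absorb:
  assumes r: "region J R" and T: "connected T" "T \<subseteq> S2" "T \<inter> J = {}" "T \<inter> R \<noteq> {}"
  shows "T \<subseteq> R"
proof -
  have 1: "openin (top_of_set T) (T \<inter> R)"
  proof -
    obtain W where W: "open W" "R = S2 \<inter> W" using r unfolding region_def by (metis openin_open)
    then have "T \<inter> R = T \<inter> W" using T(2) by blast
    then show ?thesis using W by (simp add: openin_open_Int)
  qed
  have "T \<inter> R = T \<inter> closure R" using r T(3) by (auto simp: region_def)
  then have 2: "closedin (top_of_set T) (T \<inter> R)" by (simp add: closedin_closed_Int)
  have "T \<inter> R = T" using T(1,4) 1 2 by (auto simp: connected_clopen)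
  then show ?thesis by blast
qed

section \<open>Transfer of regions between the punctured sphere and the plane\<close>

lemma homeomorphism_punctured_S2:
  assumes "q \<in> S2"
  shows "\<exists>h k. homeomorphism (S2 - {q}) (UNIV :: complex set) h k"
proof -
  let ?H = "{x::real^3. axis 1 1 \<bullet> x = 0}"
  have ne: "axis 1 1 \<noteq> (0::real^3)" by (simp add: axis_eq_0_iff)
  have "(S2 - {q}) homeomorphic ?H"
    using assms ne by (intro homeomorphic_punctured_sphere_hyperplane) auto
  moreover have "?H homeomorphic (UNIV :: complex set)"
    by (rule homeomorphic_affine_sets) (use ne in \<open>auto simp: affine_hyperplane aff_dim_hyperplane\<close>)
  ultimately show ?thesis unfolding homeomorphic_def[symmetric] by (rule homeomorphic_trans)
qed

lemma closure_compact_image: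
  fixes f :: "'a::metric_space \<Rightarrow> 'b::metric_space"
  assumes "continuous_on (closure U) f" "compact (closure U)"
  shows "closure (f ` U) = f ` closure U"
proof
  have "closed (f ` closure U)" using assms by (simp add: compact_continuous_image compact_imp_closed)
  then show "closure (f ` U) \<subseteq> f ` closure U" by (simp add: closure_minimal closure_subset image_mono)
  show "f ` closure U \<subseteq> closure (f ` U)"
    by (rule image_closure_subset[OF assms(1)]) (auto simp: closure_subset)
qed

text \<open>The puncture has to stay off the closed region: then the closure of \<open>R\<close> is
  a compact set on which \<open>h\<close> is continuous, which makes the image bounded and lets
  \<open>h\<close> commute with closure.\<close>

lemma region_to_plane:
  assumes hk: "homeomorphism (S2 - {q}) (UNIV :: complex set) h k"
    and r: "region J R" and q: "q \<notin> R \<union> J"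
  shows "h ` R \<noteq> {}" "open (h ` R)" "connected (h ` R)" "bounded (h ` R)" "h ` R \<inter> h ` J = {}"
    "closure (h ` R) = h ` R \<union> h ` J"
proof -
  have sub: "R \<subseteq> S2 - {q}" "J \<subseteq> S2 - {q}" using region_sub[OF r] q by auto
  have cl: "closure R = R \<union> J" using r by (simp add: region_def)
  have com: "compact (closure R)" using region_sub(1)[OF r] bounded_subset[OF bounded_sphere] by (metis compact_closure)
  have cont: "continuous_on (S2 - {q}) h" using hk by (simp add: homeomorphism_def)
  show "h ` R \<noteq> {}" using r by (simp add: region_def)
  have "openin (top_of_set (S2 - {q})) R"
    using r sub(1) unfolding region_def by (meson Diff_subset openin_subset_trans)
  then show "open (h ` R)" using homeomorphism_imp_open_map[OF hk] by auto
  show "connected (h ` R)" using r cont sub by (metis region_def connected_continuous_image continuous_on_subset)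
  have "continuous_on (closure R) h" using cont sub cl by (metis Un_least continuous_on_subset)
  then have c: "closure (h ` R) = h ` closure R" and "compact (h ` closure R)"
    using closure_compact_image com compact_continuous_image by blast+
  then show "closure (h ` R) = h ` R \<union> h ` J" by (simp add: cl image_Un)
  show "bounded (h ` R)" using \<open>compact (h ` closure R)\<close> by (metis bounded_subset closure_subset compact_imp_bounded image_mono)
  have "inj_on h (S2 - {q})" using hk by (metis homeomorphism_def inj_on_inverseI)
  then show "h ` R \<inter> h ` J = {}" using sub r by (metis inj_on_image_Int image_empty region_def)
qed

lemma region_from_plane:
  assumes hk: "homeomorphism (S2 - {q}) (UNIV :: complex set) h k" and q: "q \<in> S2"
    and U: "U \<noteq> {}" "open U" "connected U" "bounded U" "U \<inter> K = {}" "closure U = U \<union> K"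
  shows "region (k ` K) (k ` U)"
proof -
  have kh: "homeomorphism UNIV (S2 - {q}) k h" using hk by (rule homeomorphism_symD)
  have cont: "continuous_on T k" for T using kh by (metis homeomorphism_def continuous_on_subset subset_UNIV)
  have "openin (top_of_set (S2 - {q})) (k ` U)"
    using homeomorphism_imp_open_map[OF kh, of U] U by simp
  moreover have "openin (top_of_set S2) (S2 - {q})" by (simp add: openin_delete)
  ultimately have o: "openin (top_of_set S2) (k ` U)" by (rule openin_trans)
  have "inj k" using kh by (metis homeomorphism_def inj_on_inverseI)
  then have "k ` U \<inter> k ` K = {}" using U by (metis image_Int image_empty)
  moreover have "closure (k ` U) = k ` U \<union> k ` K"
  proof -
    have "compact (closure U)" using U(4) by (simp add: compact_closure)
    then have "closure (k ` U) = k ` closure U" by (rule closure_compact_image[OF cont])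
    then show ?thesis using U(6) by (simp add: image_Un)
  qed
  moreover have "connected (k ` U)" using U cont connected_continuous_image by blast
  ultimately show ?thesis using o U by (simp add: region_def)
qed

section \<open>Jordan and theta curves on the sphere\<close>

lemma arc_inner_point: "arc c \<Longrightarrow> path_image c - {pathstart c, pathfinish c} \<noteq> {}"
proof -
  assume "arc c"
  then have i: "inj_on c {0..1}" by (simp add: arc_def)
  have "c (1/2) \<noteq> c 0" "c (1/2) \<noteq> c 1" using inj_onD[OF i, of "1/2" 0] inj_onD[OF i, of "1/2" 1] by auto
  moreover have "c (1/2) \<in> path_image c" by (simp add: path_image_def)
  ultimately show ?thesis by (auto simp: pathstart_def pathfinish_def)
qed

text \<open>Provides the puncture for \<open>S2_Jordan\<close>. If the two arcs covered the sphere,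
  deleting their common ends would leave two disjoint nonempty relatively closed pieces; but a
  sphere without two points is a plane without one point, hence connected.\<close>

lemma arc_pair_not_S2:
  assumes "arc c1" "arc c2" "path_image c1 \<inter> path_image c2 = {a, b}" "a \<noteq> b"
    "pathstart c1 = a" "pathfinish c1 = b" "pathstart c2 = a" "pathfinish c2 = b"
    "path_image c1 \<subseteq> S2" "path_image c2 \<subseteq> S2"
  shows "\<exists>q\<in>S2. q \<notin> path_image c1 \<union> path_image c2"
proof (rule ccontr)
  assume "\<not> ?thesis"
  then have eq: "S2 = path_image c1 \<union> path_image c2" using assms by blast
  have ab: "a \<in> S2" "b \<in> S2" using assms by blast+
  obtain h k where hk: "homeomorphism (S2 - {a}) (UNIV :: complex set) h k"
    using homeomorphism_punctured_S2[OF ab(1)] by blast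
  have "k ` (UNIV - {h b}) = S2 - {a, b}"
  proof -
    have "k ` UNIV = S2 - {a}" "inj k" "k (h b) = b"
      using hk ab assms(4) by (auto simp: homeomorphism_def intro: inj_on_inverseI)
    then show ?thesis by (metis Diff_insert2 image_empty image_insert image_set_diff)
  qed
  moreover have "continuous_on (UNIV - {h b}) k" using hk by (meson continuous_on_subset homeomorphism_def subset_UNIV)
  moreover have "connected (UNIV - {h b})" by (metis Compl_eq_Diff_UNIV DIM_complex connected_punctured_universe order_refl)
  ultimately have con: "connected (S2 - {a, b})" by (metis connected_continuous_image)
  let ?A = "path_image c1 - {a, b}" let ?B = "path_image c2 - {a, b}"
  have "closedin (top_of_set (S2 - {a, b})) ?A" "closedin (top_of_set (S2 - {a, b})) ?B"
  proof -
    have "?A = (S2 - {a, b}) \<inter> path_image c1" "?B = (S2 - {a, b}) \<inter> path_image c2" using eq by auto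
    moreover have "closed (path_image c1)" "closed (path_image c2)" using assms by (simp_all add: closed_arc_image)
    ultimately show "closedin (top_of_set (S2 - {a, b})) ?A" "closedin (top_of_set (S2 - {a, b})) ?B"
      by (simp_all add: closedin_closed_Int)
  qed
  moreover have "?A \<union> ?B = S2 - {a, b}" "?A \<inter> ?B = {}" using eq assms by auto
  moreover have "?A \<noteq> {}" "?B \<noteq> {}"
    using arc_inner_point[OF assms(1)] arc_inner_point[OF assms(2)] assms by auto
  ultimately show False using con unfolding connected_closedin_eq by metis
qed

lemma homeomorphism_arc:
  assumes hk: "homeomorphism (S2 - {q}) (UNIV :: complex set) h k" and "arc c" "path_image c \<subseteq> S2 - {q}"
  shows "arc (h \<circ> c)"
proof -
  have "continuous_on (path_image c) h" "inj_on h (path_image c)"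
    using assms by (metis homeomorphism_def continuous_on_subset inj_on_inverseI inj_on_subset)+
  then show ?thesis using assms(2) unfolding arc_def by (auto simp: path_continuous_image path_image_def intro: comp_inj_on)
qed

lemma homeomorphism_image_inverse:
  "homeomorphism S T h k \<Longrightarrow> X \<subseteq> S \<Longrightarrow> k ` h ` X = X"
  unfolding homeomorphism_def image_image by (auto simp: subset_iff image_iff)

lemma loop_of_arcs:
  fixes c1 c2 :: "real \<Rightarrow> 'a::real_normed_vector"
  assumes "arc c1" "arc c2" "path_image c1 \<inter> path_image c2 = {a, b}"
    "pathstart c1 = a" "pathfinish c1 = b" "pathstart c2 = a" "pathfinish c2 = b"
  shows "simple_path (c1 +++ reversepath c2)" "pathfinish (c1 +++ reversepath c2) = pathstart (c1 +++ reversepath c2)"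
    "path_image (c1 +++ reversepath c2) = path_image c1 \<union> path_image c2"
  using assms by (auto simp: simple_path_join_loop_eq arc_reversepath path_image_join)

text \<open>After a puncture off the curve the planar Jordan theorem applies. The inside pulls back
  by \<open>region_from_plane\<close>, which asks for a bounded set; the other region is the
  unbounded outside completed by the puncture and is treated by hand.\<close>

lemma S2_Jordan:
  assumes c: "arc c1" "arc c2" "path_image c1 \<inter> path_image c2 = {a, b}" "a \<noteq> b"
    "pathstart c1 = a" "pathfinish c1 = b" "pathstart c2 = a" "pathfinish c2 = b"
    "path_image c1 \<subseteq> S2" "path_image c2 \<subseteq> S2"
  defines "J \<equiv> path_image c1 \<union> path_image c2"
  shows "\<exists>R1 R2. region J R1 \<and> region J R2 \<and> R1 \<inter> R2 = {} \<and> S2 = R1 \<union> R2 \<union> J"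
proof -
  obtain q where q: "q \<in> S2" "q \<notin> J" using arc_pair_not_S2[OF c] by (auto simp: J_def)
  obtain h k where hk: "homeomorphism (S2 - {q}) (UNIV :: complex set) h k"
    using homeomorphism_punctured_S2[OF q(1)] by blast
  have JS: "J \<subseteq> S2 - {q}" using c q by (auto simp: J_def)
  have khJ: "k ` h ` J = J" using homeomorphism_image_inverse[OF hk JS] .
  have hk': "h (k z) = z" "k z \<in> S2 - {q}" for z using hk unfolding homeomorphism_def by blast+
  have kh': "k (h z) = z" if "z \<in> S2 - {q}" for z using hk that by (auto simp: homeomorphism_def)
  have arcs: "arc (h \<circ> c1)" "arc (h \<circ> c2)"
    using homeomorphism_arc[OF hk] c JS by (auto simp: J_def)
  have inj: "inj_on h (S2 - {q})" using hk by (metis homeomorphism_def inj_on_inverseI)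
  have "h ` path_image c1 \<inter> h ` path_image c2 = h ` {a, b}"
    using inj JS c(3) by (metis J_def inj_on_image_Int le_sup_iff)
  then have I: "path_image (h \<circ> c1) \<inter> path_image (h \<circ> c2) = {h a, h b}" by (simp add: path_image_compose)
  define l where "l = (h \<circ> c1) +++ reversepath (h \<circ> c2)"
  have l: "simple_path l" "pathfinish l = pathstart l" "path_image l = h ` J"
    using loop_of_arcs[OF arcs I] c by (simp_all add: l_def pathstart_compose pathfinish_compose path_image_compose J_def image_Un)
  let ?I = "inside (h ` J)" and ?O = "outside (h ` J)"
  note jo = Jordan_inside_outside[OF l(1,2), unfolded l(3)]
  have clI: "closure ?I = ?I \<union> h ` J" "closure ?O = ?O \<union> h ` J"
    using jo by (metis closure_Un_frontier)+
  have r1: "region J (k ` ?I)"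
    using region_from_plane[OF hk q(1), of ?I "h ` J"] jo clI khJ by simp
  define R2 where "R2 = S2 - closure (k ` ?I)"
  have cl1: "closure (k ` ?I) = k ` ?I \<union> J" using r1 by (simp add: region_def)
  have kI: "k ` ?I \<subseteq> S2" using region_sub[OF r1] by simp
  have R2eq: "R2 = insert q (k ` ?O)"
  proof -
    have "x \<in> insert q (k ` ?O)" if "x \<in> R2" for x
    proof (cases "x = q")
      case False
      then have x: "x \<in> S2 - {q}" using that by (simp add: R2_def)
      then have kx: "k (h x) = x" by (rule kh')
      then have "h x \<notin> ?I" "h x \<notin> h ` J" using that khJ unfolding R2_def cl1 by (metis DiffD2 UnI1 UnI2 image_eqI)+
      then have "h x \<in> ?O" using jo by blast
      then show ?thesis using kx by force
    qed simp
    moreover have "x \<in> R2" if "x \<in> insert q (k ` ?O)" for x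
    proof -
      have "q \<in> R2" using q hk' unfolding R2_def cl1 by blast
      moreover have "k z \<in> R2" if "z \<in> ?O" for z
      proof -
        have "k z \<notin> k ` ?I" using that jo hk' by (metis IntI empty_iff imageE)
        moreover have "k z \<notin> J" using that jo hk'(1) by (metis ComplD UnI2 image_eqI)
        ultimately show ?thesis using hk'(2)[of z] by (auto simp: R2_def cl1)
      qed
      ultimately show ?thesis using that by blast
    qed
    ultimately show ?thesis by blast
  qed
  have "closed (closure (k ` ?I))" by simp
  then have o2: "openin (top_of_set S2) R2" by (simp add: R2_def Diff_eq openin_open_Int open_Compl)
  \<comment> \<open>If \<open>q\<close> were not a limit point of the pulled back outside, the
    closure of that set would be compact in the punctured sphere and its image bounded, whereas the
    outside is unbounded.\<close>
  have qcl: "q \<in> closure (k ` ?O)"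
  proof (rule ccontr)
    assume nq: "q \<notin> closure (k ` ?O)"
    have "k ` ?O \<subseteq> S2" using hk' by blast
    then have "closure (k ` ?O) \<subseteq> S2 - {q}" using nq closure_minimal[of "k ` ?O" S2] by auto
    moreover have "compact (closure (k ` ?O))"
      using \<open>k ` ?O \<subseteq> S2\<close> bounded_subset[OF bounded_sphere] by (metis compact_closure)
    ultimately have "compact (h ` closure (k ` ?O))" using hk
      by (metis compact_continuous_image continuous_on_subset homeomorphism_def)
    moreover have "?O \<subseteq> h ` closure (k ` ?O)"
      using hk'(1) closure_subset[of "k ` ?O"] by (metis image_eqI image_subset_iff subsetI)
    ultimately have "bounded ?O" using bounded_subset compact_imp_bounded by blast
    then show False using jo by blast
  qed
  have kc: "continuous_on T k" for T using hk by (metis homeomorphism_def continuous_on_subset subset_UNIV)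
  have con2: "connected R2"
  proof (rule connected_intermediate_closure[of "k ` ?O"])
    show "connected (k ` ?O)" by (rule connected_continuous_image[OF kc]) (use jo in simp)
    show "k ` ?O \<subseteq> R2" by (auto simp: R2eq)
    show "R2 \<subseteq> closure (k ` ?O)" using qcl closure_subset[of "k ` ?O"] by (auto simp: R2eq)
  qed
  have "closure R2 = R2 \<union> J"
  proof
    have "closedin (top_of_set S2) (S2 - k ` ?I)" using r1 by (auto simp: region_def)
    then have "closed (S2 - k ` ?I)" using closedin_closed_trans closed_sphere by blast
    moreover have "R2 \<subseteq> S2 - k ` ?I" by (auto simp: R2_def cl1)
    ultimately have "closure R2 \<subseteq> S2 - k ` ?I" by (rule closure_minimal[rotated])
    then show "closure R2 \<subseteq> R2 \<union> J" by (auto simp: R2_def cl1)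
    have "k ` closure ?O \<subseteq> closure (k ` ?O)" by (rule image_closure_subset[OF kc]) (auto simp: closure_subset)
    then have "J \<subseteq> closure (k ` ?O)" using clI(2) khJ by (metis image_Un le_supE)
    also have "\<dots> \<subseteq> closure R2" by (rule closure_mono) (auto simp: R2eq)
    finally show "R2 \<union> J \<subseteq> closure R2" by (simp add: closure_subset)
  qed
  moreover have "R2 \<inter> J = {}" by (auto simp: R2_def cl1)
  moreover have "R2 \<noteq> {}" by (simp add: R2eq)
  ultimately have r2: "region J R2" using con2 o2 by (simp add: region_def)
  have "k ` ?I \<inter> R2 = {}" by (auto simp: R2_def cl1)
  moreover have "S2 = k ` ?I \<union> R2 \<union> J" using kI JS by (auto simp: R2_def cl1)
  ultimately show ?thesis using r1 r2 by blast
qed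

text \<open>The puncture is taken beyond the closed curve as seen from \<open>R\<close>. Then
  \<open>R\<close> becomes the inside of a planar closed curve, and the planar splitting of an
  inside by a crosscut applies.\<close>

lemma S2_theta:
  assumes arcs: "arc c1" "arc c2" "arc c" and ab: "a \<noteq> b"
    and ends: "pathstart c1 = a" "pathfinish c1 = b" "pathstart c2 = a" "pathfinish c2 = b" "pathstart c = a" "pathfinish c = b"
    and int: "path_image c1 \<inter> path_image c2 = {a, b}"
    and r: "region (path_image c1 \<union> path_image c2) R" and cR: "path_image c - {a, b} \<subseteq> R"
  shows "\<exists>R1 R2. region (path_image c1 \<union> path_image c) R1 \<and> region (path_image c2 \<union> path_image c) R2 \<and>
    R1 \<inter> R2 = {} \<and> R = R1 \<union> R2 \<union> (path_image c - {a, b})"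
proof -
  let ?J = "path_image c1 \<union> path_image c2"
  have JS: "?J \<subseteq> S2" "R \<subseteq> S2" using region_sub[OF r] by auto
  have RJ: "R \<inter> ?J = {}" "R \<noteq> {}" "connected R" using r by (auto simp: region_def)
  \<comment> \<open>Either \<open>R\<close> misses the first Jordan domain or it is contained in it
    and misses the second; any point of a missed domain serves.\<close>
  obtain q where q: "q \<in> S2" "q \<notin> R \<union> ?J"
  proof -
    obtain R1 R2 where R12: "region ?J R1" "region ?J R2" "R1 \<inter> R2 = {}" "S2 = R1 \<union> R2 \<union> ?J"
      using S2_Jordan[OF arcs(1,2) int ab ends(1-4)] JS by auto
    have ne: "R1 \<noteq> {}" "R2 \<noteq> {}" "R1 \<inter> ?J = {}" "R2 \<inter> ?J = {}" using R12 by (auto simp: region_def)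
    show ?thesis
    proof (cases "R \<inter> R1 = {}")
      case True
      obtain z where "z \<in> R1" using ne by blast
      then show ?thesis using that[of z] True ne(3) R12(4) by blast
    next
      case False
      then have "R \<subseteq> R1" using region_absorb[OF R12(1) RJ(3) JS(2) RJ(1)] by simp
      moreover obtain z where "z \<in> R2" using ne by blast
      ultimately show ?thesis using that[of z] R12(3) ne(4) R12(4) by blast
    qed
  qed
  obtain h k where hk: "homeomorphism (S2 - {q}) (UNIV :: complex set) h k"
    using homeomorphism_punctured_S2[OF q(1)] by blast
  have cc: "path_image c \<subseteq> R \<union> ?J" using cR int by blast
  have sub: "path_image c1 \<subseteq> S2 - {q}" "path_image c2 \<subseteq> S2 - {q}" "path_image c \<subseteq> S2 - {q}" "R \<subseteq> S2 - {q}"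
    using JS q cc by blast+
  have hk': "h (k z) = z" "k z \<in> S2 - {q}" for z using hk unfolding homeomorphism_def by blast+
  have khs: "k ` h ` X = X" if "X \<subseteq> S2 - {q}" for X using homeomorphism_image_inverse[OF hk that] .
  have inj: "inj_on h (S2 - {q})" using hk by (metis homeomorphism_def inj_on_inverseI)
  have harcs: "arc (h \<circ> c1)" "arc (h \<circ> c2)" "arc (h \<circ> c)" using homeomorphism_arc[OF hk] arcs sub by auto
  have i1: "path_image c1 \<inter> path_image c = {a, b}" "path_image c2 \<inter> path_image c = {a, b}"
    using cR RJ(1) ends pathstart_in_path_image[of c] pathfinish_in_path_image[of c]
      pathstart_in_path_image[of c1] pathfinish_in_path_image[of c1] pathstart_in_path_image[of c2] pathfinish_in_path_image[of c2]
    by auto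
  have ii: "path_image (h \<circ> c1) \<inter> path_image (h \<circ> c2) = {h a, h b}"
    "path_image (h \<circ> c1) \<inter> path_image (h \<circ> c) = {h a, h b}"
    "path_image (h \<circ> c2) \<inter> path_image (h \<circ> c) = {h a, h b}"
    using inj_on_image_Int[OF inj sub(1,2)] inj_on_image_Int[OF inj sub(1,3)] inj_on_image_Int[OF inj sub(2,3)] int i1
    by (simp_all add: path_image_compose)
  have e: "pathstart (h \<circ> c1) = h a" "pathfinish (h \<circ> c1) = h b" "pathstart (h \<circ> c2) = h a" "pathfinish (h \<circ> c2) = h b"
    "pathstart (h \<circ> c) = h a" "pathfinish (h \<circ> c) = h b"
    using ends by (simp_all add: pathstart_compose pathfinish_compose)
  let ?p1 = "path_image (h \<circ> c1)" and ?p2 = "path_image (h \<circ> c2)" and ?p = "path_image (h \<circ> c)"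
  note l12 = loop_of_arcs[OF harcs(1,2) ii(1) e(1-4)] and l1 = loop_of_arcs[OF harcs(1,3) ii(2) e(1,2,5,6)]
    and l2 = loop_of_arcs[OF harcs(2,3) ii(3) e(3-6)]
  note j12 = Jordan_inside_outside[OF l12(1,2), unfolded l12(3)] and j1 = Jordan_inside_outside[OF l1(1,2), unfolded l1(3)]
    and j2 = Jordan_inside_outside[OF l2(1,2), unfolded l2(3)]
  have hJ: "h ` ?J = ?p1 \<union> ?p2" by (simp add: image_Un path_image_compose)
  note hR = region_to_plane[OF hk r q(2), unfolded hJ]
  have absorb: "T \<subseteq> h ` R" if "connected T" "T \<inter> (?p1 \<union> ?p2) = {}" "T \<inter> h ` R \<noteq> {}" for T
  proof -
    have "openin (top_of_set T) (T \<inter> h ` R)" using hR(2) by (simp add: openin_open_Int)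
    moreover have "T \<inter> h ` R = T \<inter> closure (h ` R)" using that(2) hR(6) by auto
    then have "closedin (top_of_set T) (T \<inter> h ` R)" by (simp add: closedin_closed_Int)
    ultimately have "T \<inter> h ` R = T" using that(1,3) by (auto simp: connected_clopen)
    then show ?thesis by blast
  qed
  \<comment> \<open>The image of \<open>R\<close> is bounded, so it cannot contain the outside; as
    it absorbs every connected set that meets it off the curve, it misses the outside and equals the
    inside.\<close>
  have "inside (?p1 \<union> ?p2) = h ` R"
  proof -
    define P where "P = ?p1 \<union> ?p2"
    have jf: "connected (inside P)" "connected (outside P)" "\<not> bounded (outside P)" "outside P \<noteq> {}"
      "inside P \<union> outside P = - P"
      using j12 unfolding P_def[symmetric] by (simp_all only: simp_thms)
    note hR' = hR[folded P_def] and absorb' = absorb[folded P_def]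
    have 0: "h ` R \<subseteq> inside P \<union> outside P" using hR'(5) jf(5) by auto
    have d: "outside P \<inter> P = {}" "inside P \<inter> P = {}" using jf(5) by auto
    have "\<not> outside P \<subseteq> h ` R" using hR(4) jf(3) bounded_subset by blast
    then have "outside P \<inter> h ` R = {}" using absorb'[OF jf(2) d(1)] by blast
    then have 1: "h ` R \<subseteq> inside P" using 0 by blast
    then have "inside P \<subseteq> h ` R" using absorb'[OF jf(1) d(2)] hR(1) by blast
    then show ?thesis using 1 unfolding P_def by blast
  qed
  note hRI = this
  have "path_image c - {a, b} \<noteq> {}"
    using arc_inner_point[OF arcs(3)] ends by simp
  then have "?p \<inter> h ` R \<noteq> {}" using cR by (auto simp: path_image_compose)
  then have ne: "?p \<inter> inside (?p1 \<union> ?p2) \<noteq> {}" using hRI by simp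
  have hab: "h a \<noteq> h b" using e(1,2) harcs(1) arc_distinct_ends by metis
  note s = split_inside_simple_closed_curve[OF arc_imp_simple_path[OF harcs(1)] e(1,2) arc_imp_simple_path[OF harcs(2)] e(3,4)
      arc_imp_simple_path[OF harcs(3)] e(5,6) hab ii(1,2,3) ne]
  have s1: "inside (?p1 \<union> ?p) \<inter> inside (?p2 \<union> ?p) = {}" and
    s2: "inside (?p1 \<union> ?p) \<union> inside (?p2 \<union> ?p) \<union> (?p - {h a, h b}) = inside (?p1 \<union> ?p2)"
    using s by blast+
  let ?R1 = "k ` inside (?p1 \<union> ?p)" and ?R2 = "k ` inside (?p2 \<union> ?p)"
  have cl: "closure (inside (?p1 \<union> ?p)) = inside (?p1 \<union> ?p) \<union> (?p1 \<union> ?p)"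
    "closure (inside (?p2 \<union> ?p)) = inside (?p2 \<union> ?p) \<union> (?p2 \<union> ?p)"
    using j1 j2 by (metis closure_Un_frontier)+
  have kp: "k ` (?p1 \<union> ?p) = path_image c1 \<union> path_image c" "k ` (?p2 \<union> ?p) = path_image c2 \<union> path_image c"
    using khs sub by (simp_all add: image_Un path_image_compose)
  have r1: "region (path_image c1 \<union> path_image c) ?R1" and r2: "region (path_image c2 \<union> path_image c) ?R2"
    using region_from_plane[OF hk q(1), of "inside (?p1 \<union> ?p)" "?p1 \<union> ?p"] region_from_plane[OF hk q(1), of "inside (?p2 \<union> ?p)" "?p2 \<union> ?p"]
      j1 j2 cl kp by (simp_all)
  have injk: "inj k" using hk' by (metis injI)
  have "?R1 \<inter> ?R2 = {}" using s1 injk by (metis image_Int image_empty)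
  moreover have "R = ?R1 \<union> ?R2 \<union> (path_image c - {a, b})"
  proof -
    have "R = k ` h ` R" using khs sub by simp
    also have "\<dots> = ?R1 \<union> ?R2 \<union> k ` (?p - {h a, h b})" using s2 hRI by (metis image_Un)
    also have "k ` (?p - {h a, h b}) = k ` ?p - {k (h a), k (h b)}" using injk by (simp add: image_set_diff)
    also have "\<dots> = path_image c - {a, b}"
      using khs[OF sub(3)] hk sub(3) ends by (metis (no_types, lifting) homeomorphism_def path_image_compose pathfinish_in_path_image pathstart_in_path_image subsetD)
    finally show ?thesis .
  qed
  ultimately show ?thesis using r1 r2 by blast
qed

section \<open>Paths and cycles of a plane graph\<close>

fun les :: "'a list \<Rightarrow> 'a set set" where
  "les (u # v # l) = insert {u, v} (les (v # l))"
| "les _ = {}"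

lemma les_sub: "e \<in> les l \<Longrightarrow> e \<subseteq> set l"
  by (induction l rule: les.induct) auto

lemma les_append: "les (xs @ y # ys) = les (xs @ [y]) \<union> les (y # ys)"
proof (induction xs)
  case (Cons x xs)
  then show ?case by (cases xs) auto
qed simp

lemma les_rev: "les (rev l) = les l"
proof (induction l rule: les.induct)
  case (1 u v l)
  have "les (rev (u # v # l)) = les (rev l @ v # [u])" by simp
  also have "\<dots> = les (rev (v # l)) \<union> les [v, u]" using les_append[of "rev l" v "[u]"] by simp
  also have "\<dots> = les (u # v # l)" using 1 by (auto simp: insert_commute)
  finally show ?case .
qed auto

lemma les_ends:
  assumes "{x, y} \<in> les (x # A @ [y])" "distinct (x # A @ [y])"
  shows "A = []"
proof (cases A)
  case (Cons a A')
  have "{x, y} \<noteq> {x, a}" using assms Cons by (auto simp: doubleton_eq_iff)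
  then have "{x, y} \<in> les (a # A' @ [y])" using assms(1) Cons by auto
  then show ?thesis using les_sub assms(2) Cons by fastforce
qed simp

lemma les_nth: "Suc i < length l \<Longrightarrow> {l ! i, l ! Suc i} \<in> les l"
proof (induction l arbitrary: i rule: les.induct)
  case (1 u v l)
  then show ?case by (cases i) auto
qed auto

lemma les_conv: "les l = {{l ! i, l ! Suc i} | i. Suc i < length l}"
proof
  show "les l \<subseteq> {{l ! i, l ! Suc i} | i. Suc i < length l}"
  proof (induction l rule: les.induct)
    case (1 u v l)
    show ?case
    proof
      fix e assume "e \<in> les (u # v # l)"
      then consider "e = {u, v}" | "e \<in> les (v # l)" by auto
      then show "e \<in> {{(u # v # l) ! i, (u # v # l) ! Suc i} | i. Suc i < length (u # v # l)}"
      proof cases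
        case 1 then show ?thesis by (intro CollectI exI[of _ 0]) auto
      next
        case 2
        then obtain i where "e = {(v # l) ! i, (v # l) ! Suc i}" "Suc i < length (v # l)" using 1 by auto
        then show ?thesis by (intro CollectI exI[of _ "Suc i"]) auto
      qed
    qed
  qed auto
qed (use les_nth in blast)

definition padj :: "drawing \<Rightarrow> real^3 \<Rightarrow> real^3 \<Rightarrow> bool" where
  "padj P u v \<longleftrightarrow> (\<exists>e\<in>curves P. e \<inter> points P = {u, v})"

definition cv :: "drawing \<Rightarrow> (real^3) set \<Rightarrow> (real^3) set" where
  "cv P d = (THE e. e \<in> curves P \<and> e \<inter> points P = d)"

text \<open>The vertices are added separately so that a walk with a single vertex still contributes
  its point; on longer walks along edges they lie on the curves anyway.\<close>

definition pc :: "drawing \<Rightarrow> (real^3) list \<Rightarrow> (real^3) set" where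
  "pc P l = set l \<union> (\<Union>d\<in>les l. cv P d)"

definition pcyc :: "drawing \<Rightarrow> (real^3) list \<Rightarrow> (real^3) set" where
  "pcyc P L = pc P (L @ [hd L])"

definition cyc :: "drawing \<Rightarrow> (real^3) list \<Rightarrow> bool" where
  "cyc P L \<longleftrightarrow> 3 \<le> length L \<and> distinct L \<and> set L \<subseteq> points P \<and> successively (padj P) (L @ [hd L])"

lemma padj_sym: "padj P u v \<Longrightarrow> padj P v u"
  by (simp add: padj_def insert_commute)

lemma successively_rev_padj: "successively (padj P) (rev l) \<longleftrightarrow> successively (padj P) l"
  by (simp add: padj_def insert_commute)

lemma pc_append: "pc P (xs @ y # ys) = pc P (xs @ [y]) \<union> pc P (y # ys)"
  using les_append[of xs y ys] by (auto simp: pc_def)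

lemma pc_rev: "pc P (rev l) = pc P l"
  by (simp add: pc_def les_rev)

lemma pcyc_rotate1: "pcyc P (rotate1 L) = pcyc P L"
proof (cases L)
  case (Cons x xs)
  show ?thesis
  proof (cases xs)
    case Nil then show ?thesis using Cons by simp
  next
    case (Cons y ys)
    have "pcyc P (rotate1 L) = pc P ((y # ys) @ x # [y])" using Cons \<open>L = x # xs\<close> by (simp add: pcyc_def)
    also have "\<dots> = pc P (y # ys @ [x]) \<union> pc P [x, y]" using pc_append[of P "y # ys" x "[y]"] by simp
    also have "\<dots> = pc P ([x] @ y # ys @ [x])" using pc_append[of P "[x]" y "ys @ [x]"] by auto
    finally show ?thesis using Cons \<open>L = x # xs\<close> by (simp add: pcyc_def)
  qed
qed simp

lemma pcyc_rotate: "pcyc P (rotate n L) = pcyc P L"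
  by (induction n) (auto simp: pcyc_rotate1)

lemma pcyc_rev: "pcyc P (rev L) = pcyc P L"
proof (cases L rule: rev_cases)
  case (snoc ys y)
  then have "pcyc P (rev L) = pc P (rev (y # ys @ [y]))" by (simp add: pcyc_def)
  also have "\<dots> = pcyc P (y # ys)" unfolding pc_rev by (simp add: pcyc_def)
  also have "\<dots> = pcyc P (rotate1 (y # ys))" by (rule pcyc_rotate1[symmetric])
  finally show ?thesis using snoc by simp
qed simp

lemma cyc_rotate1: "cyc P L \<Longrightarrow> cyc P (rotate1 L)"
proof (cases L)
  case (Cons x xs)
  assume c: "cyc P L"
  then obtain y ys where xs: "xs = y # ys" using Cons by (cases xs) (auto simp: cyc_def)
  have "successively (padj P) (x # y # ys @ [x])" using c Cons xs by (simp add: cyc_def)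
  then have "successively (padj P) (y # ys @ [x])" "padj P x y" by auto
  then have "successively (padj P) ((y # ys @ [x]) @ [y])" by (subst successively_append_iff) auto
  then show ?thesis using c Cons xs by (auto simp: cyc_def)
qed simp

lemma cyc_rotate: "cyc P L \<Longrightarrow> cyc P (rotate n L)"
  by (induction n) (auto simp: cyc_rotate1)

lemma cyc_rev: "cyc P L \<Longrightarrow> cyc P (rev L)"
proof (cases L)
  case (Cons x xs)
  assume c: "cyc P L"
  have "successively (padj P) (rev (x # xs @ [x]))" using c Cons unfolding successively_rev_padj by (simp add: cyc_def)
  then have "cyc P (x # rev xs)" using c Cons by (auto simp: cyc_def)
  moreover have "rev L = rotate1 (x # rev xs)" using Cons by simp
  ultimately show ?thesis using cyc_rotate1 by metis
qed simp

section \<open>Arcs, cycles and discs traced in a plane graph\<close>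

context
  fixes P assumes plane: "plane_graph P"
begin

lemma padj_points: "padj P u v \<Longrightarrow> u \<in> points P \<and> v \<in> points P \<and> u \<noteq> v"
proof -
  assume "padj P u v"
  then obtain e where e: "e \<in> curves P" "e \<inter> points P = {u, v}" by (auto simp: padj_def)
  then obtain g where "arc g" "e \<inter> points P = {pathstart g, pathfinish g}" using plane by (auto simp: plane_graph_def)
  then show ?thesis using e arc_distinct_ends by (metis IntD2 doubleton_eq_iff insertCI)
qed

lemma cv_props:
  assumes "padj P u v" shows "cv P {u, v} \<in> curves P" "cv P {u, v} \<inter> points P = {u, v}"
proof -
  have "\<exists>!e. e \<in> curves P \<and> e \<inter> points P = {u, v}"
  proof -
    have "inj_on (\<lambda>e. e \<inter> points P) (curves P)" using plane by (simp add: plane_graph_def)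
    then show ?thesis using assms unfolding padj_def by (metis (mono_tags, lifting) inj_onD)
  qed
  from theI'[OF this] show "cv P {u, v} \<in> curves P" "cv P {u, v} \<inter> points P = {u, v}" by (auto simp: cv_def)
qed

lemma cv_eq: "e \<in> curves P \<Longrightarrow> e \<inter> points P = d \<Longrightarrow> cv P d = e"
  unfolding cv_def using plane by (intro the_equality) (auto simp: plane_graph_def inj_on_def)

lemma cv_arc:
  assumes "padj P u v"
  shows "\<exists>g. arc g \<and> path_image g = cv P {u, v} \<and> pathstart g = u \<and> pathfinish g = v"
proof -
  obtain g where g: "arc g" "path_image g = cv P {u, v}" "{u, v} = {pathstart g, pathfinish g}"
    using cv_props[OF assms] plane by (metis plane_graph_def)
  consider "pathstart g = u" "pathfinish g = v" | "pathstart g = v" "pathfinish g = u"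
    using g(3) by (auto simp: doubleton_eq_iff)
  then show ?thesis
  proof cases
    case 1 then show ?thesis using g by blast
  next
    case 2 then show ?thesis using g by (intro exI[of _ "reversepath g"]) (auto simp: arc_reversepath)
  qed
qed

lemma les_padj: "successively (padj P) l \<Longrightarrow> d \<in> les l \<Longrightarrow> \<exists>u v. d = {u, v} \<and> padj P u v"
  by (induction l rule: les.induct) auto

lemma les_cv: "successively (padj P) l \<Longrightarrow> d \<in> les l \<Longrightarrow> cv P d \<in> curves P \<and> cv P d \<inter> points P = d"
  using les_padj cv_props by metis

lemma pc_points: "successively (padj P) l \<Longrightarrow> set l \<subseteq> points P \<Longrightarrow> pc P l \<inter> points P = set l"
  using les_cv[of l] les_sub[of _ l] unfolding pc_def by blast

text \<open>Turns combinatorial into topological disjointness: two distinct curves meet only in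
  vertices, so walks without a common edge share no further points.\<close>

lemma pc_Int:
  assumes "successively (padj P) l" "successively (padj P) l'" "set l \<subseteq> points P" "set l' \<subseteq> points P"
    and "les l \<inter> les l' = {}"
  shows "pc P l \<inter> pc P l' = set l \<inter> set l'"
proof -
  have "z \<in> set l \<inter> set l'" if z: "z \<in> pc P l" "z \<in> pc P l'" for z
  proof (cases "z \<in> points P")
    case True
    then show ?thesis using z pc_points[OF assms(1,3)] pc_points[OF assms(2,4)] by blast
  next
    case False
    then obtain d d' where d: "d \<in> les l" "z \<in> cv P d" "d' \<in> les l'" "z \<in> cv P d'"
      using z assms(3,4) by (auto simp: pc_def)
    have "cv P d \<noteq> cv P d'" using les_cv[OF assms(1) d(1)] les_cv[OF assms(2) d(3)] assms(5) d by (metis disjoint_iff)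
    then have "z \<in> points P"
      using plane les_cv[OF assms(1) d(1)] les_cv[OF assms(2) d(3)] d unfolding plane_graph_def by blast
    then show ?thesis using False by simp
  qed
  then show ?thesis by (auto simp: pc_def)
qed

lemma pc_S2: "successively (padj P) l \<Longrightarrow> set l \<subseteq> points P \<Longrightarrow> pc P l \<subseteq> S2"
proof -
  assume l: "successively (padj P) l" "set l \<subseteq> points P"
  have "points P \<subseteq> S2" "\<And>e. e \<in> curves P \<Longrightarrow> e \<subseteq> S2" using plane by (auto simp: plane_graph_def)
  then show ?thesis using l les_cv[OF l(1)] unfolding pc_def by blast
qed

lemma pc_arc:
  assumes "distinct l" "2 \<le> length l" "successively (padj P) l" "set l \<subseteq> points P"
  shows "\<exists>g. arc g \<and> path_image g = pc P l \<and> pathstart g = hd l \<and> pathfinish g = last l"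
  using assms
proof (induction l rule: les.induct)
  case (1 u v l)
  have uv: "padj P u v" using 1 by simp
  obtain g0 where g0: "arc g0" "path_image g0 = cv P {u, v}" "pathstart g0 = u" "pathfinish g0 = v"
    using cv_arc[OF uv] by blast
  have cvi: "{u, v} \<subseteq> cv P {u, v}" using cv_props[OF uv] by blast
  show ?case
  proof (cases l)
    case Nil
    then show ?thesis using g0 cvi by (intro exI[of _ g0]) (auto simp: pc_def)
  next
    case (Cons w l')
    obtain g where g: "arc g" "path_image g = pc P (v # l)" "pathstart g = v" "pathfinish g = last (v # l)"
      using 1 Cons by auto
    have "cv P {u, v} \<union> {u, v} = pc P [u, v]" by (auto simp: pc_def)
    moreover have "les [u, v] \<inter> les (v # l) = {}" using les_sub[of "{u, v}" "v # l"] 1(2) by auto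
    ultimately have "(cv P {u, v} \<union> {u, v}) \<inter> pc P (v # l) = {v}"
      using pc_Int[of "[u, v]" "v # l"] 1 by auto
    then have "path_image g0 \<inter> path_image g \<subseteq> {pathstart g}" using g g0 by auto
    then have "arc (g0 +++ g)" using g0 g by (intro arc_join) auto
    moreover have "path_image (g0 +++ g) = pc P (u # v # l)"
      using g0 g cvi by (subst path_image_join) (auto simp: pc_def)
    ultimately show ?thesis using g0 g by (intro exI[of _ "g0 +++ g"]) auto
  qed
qed auto

lemma cyc_split:
  assumes "cyc P (x # A @ y # D)"
  shows "successively (padj P) (x # A @ [y])" "successively (padj P) (y # D @ [x])"
    "pcyc P (x # A @ y # D) = pc P (x # A @ [y]) \<union> pc P (y # D @ [x])"
    "pc P (x # A @ [y]) \<inter> pc P (y # D @ [x]) = {x, y}"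
proof -
  have s: "successively (padj P) ((x # A) @ y # D @ [x])" and d: "distinct (x # A @ y # D)" "3 \<le> length (x # A @ y # D)"
    and pts: "set (x # A @ y # D) \<subseteq> points P"
    using assms by (auto simp: cyc_def)
  have "(x # A) @ y # D @ [x] = (x # A @ [y]) @ D @ [x]" by simp
  then show s1: "successively (padj P) (x # A @ [y])" using s by (metis successively_append_iff)
  show s2: "successively (padj P) (y # D @ [x])" using s by (subst (asm) successively_append_iff) auto
  show "pcyc P (x # A @ y # D) = pc P (x # A @ [y]) \<union> pc P (y # D @ [x])"
    using pc_append[of P "x # A" y "D @ [x]"] by (simp add: pcyc_def)
  \<comment> \<open>A common edge can only join \<open>x\<close> and \<open>y\<close>, and then
    neither side has an inner vertex, against the length of a cycle.\<close>
  have "les (x # A @ [y]) \<inter> les (y # D @ [x]) = {}"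
  proof (rule ccontr)
    assume "les (x # A @ [y]) \<inter> les (y # D @ [x]) \<noteq> {}"
    then obtain e where e: "e \<in> les (x # A @ [y])" "e \<in> les (y # D @ [x])" by blast
    have "e \<subseteq> {x, y}" using les_sub[OF e(1)] les_sub[OF e(2)] d by auto
    moreover obtain u v where "e = {u, v}" "u \<noteq> v" using les_padj[OF s1 e(1)] padj_points by blast
    ultimately have exy: "e = {x, y}" by auto
    have "A = []" using les_ends[of x y A] e exy d by auto
    moreover have "D = []" using les_ends[of y x D] e exy d by (auto simp: insert_commute)
    ultimately show False using d by simp
  qed
  then show "pc P (x # A @ [y]) \<inter> pc P (y # D @ [x]) = {x, y}"
    using pc_Int[OF s1 s2] pts d by auto
qed

lemma cyc_region_points: "cyc P L \<Longrightarrow> pcyc P L \<inter> points P = set L"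
proof -
  assume c: "cyc P L"
  then have "L \<noteq> []" by (auto simp: cyc_def)
  then have "hd L \<in> set L" by simp
  then show ?thesis using pc_points[of "L @ [hd L]"] c unfolding pcyc_def cyc_def by (simp add: insert_absorb subset_iff)
qed

lemma ear_arc:
  assumes "distinct (x # Z @ [y])" "successively (padj P) (x # Z @ [y])" "set (x # Z @ [y]) \<subseteq> points P"
  shows "\<exists>g. arc g \<and> path_image g = pc P (x # Z @ [y]) \<and> pathstart g = x \<and> pathfinish g = y"
  using pc_arc[OF assms(1) _ assms(2,3)] by auto

lemma cyc_ear:
  assumes "successively (padj P) (x # A @ [y])" "successively (padj P) (x # Z @ [y])"
    "distinct (x # A @ y # Z)" "set (x # A @ y # Z) \<subseteq> points P" "A \<noteq> [] \<or> Z \<noteq> []"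
  shows "cyc P (x # A @ y # rev Z)" "pcyc P (x # A @ y # rev Z) = pc P (x # A @ [y]) \<union> pc P (x # Z @ [y])"
proof -
  have z: "successively (padj P) (y # rev Z @ [x])" using assms(2) successively_rev_padj[of P "x # Z @ [y]"] by simp
  have "successively (padj P) ((x # A @ [y]) @ rev Z @ [x])"
    using assms(1) z by (subst successively_append_iff) (auto simp: successively_Cons)
  then show "cyc P (x # A @ y # rev Z)" using assms by (cases A; cases Z) (auto simp: cyc_def)
  have "pc P (y # rev Z @ [x]) = pc P (x # Z @ [y])" using pc_rev[of P "x # Z @ [y]"] by simp
  then show "pcyc P (x # A @ y # rev Z) = pc P (x # A @ [y]) \<union> pc P (x # Z @ [y])"
    using pc_append[of P "x # A" y "rev Z @ [x]"] by (simp add: pcyc_def)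
qed

text \<open>\<open>S2_theta\<close> for a cycle and a path across its disc. Both halves are listed
  from \<open>x\<close> over \<open>y\<close> and back through \<open>rev Z\<close>, so the second
  runs against the old orientation. \<open>ear_step\<close> and \<open>discs_ear\<close> use
  literally the same lists, which keeps discs and faces in step.\<close>

lemma disc_split:
  assumes c: "cyc P (x # A @ y # D)" and r: "region (pcyc P (x # A @ y # D)) R"
    and Z: "distinct (x # Z @ [y])" "set Z \<inter> set (x # A @ y # D) = {}" "set Z \<subseteq> points P"
    "successively (padj P) (x # Z @ [y])" "pc P (x # Z @ [y]) - {x, y} \<subseteq> R"
  shows "cyc P (x # A @ y # rev Z)" "cyc P (x # rev D @ y # rev Z)"
    "\<exists>R1 R2. region (pcyc P (x # A @ y # rev Z)) R1 \<and> region (pcyc P (x # rev D @ y # rev Z)) R2 \<and>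
       R1 \<inter> R2 = {} \<and> R = R1 \<union> R2 \<union> (pc P (x # Z @ [y]) - {x, y})"
proof -
  note s = cyc_split[OF c]
  have d: "distinct (x # A @ y # D)" "set (x # A @ y # D) \<subseteq> points P" using c by (auto simp: cyc_def)
  obtain g where g: "arc g" "path_image g = pc P (x # Z @ [y])" "pathstart g = x" "pathfinish g = y"
    using ear_arc[OF Z(1,4)] Z d by auto
  obtain g1 where g1: "arc g1" "path_image g1 = pc P (x # A @ [y])" "pathstart g1 = x" "pathfinish g1 = y"
    using ear_arc[OF _ s(1)] d by auto
  obtain g2' where g2': "arc g2'" "path_image g2' = pc P (y # D @ [x])" "pathstart g2' = y" "pathfinish g2' = x"
    using ear_arc[OF _ s(2)] d by auto
  define g2 where "g2 = reversepath g2'"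
  have g2: "arc g2" "path_image g2 = pc P (y # D @ [x])" "pathstart g2 = x" "pathfinish g2 = y"
    using g2' by (auto simp: g2_def arc_reversepath)
  have gR: "pc P (x # Z @ [y]) - {x, y} \<noteq> {}" using arc_inner_point[OF g(1)] g by auto
  have RJ: "R \<inter> pcyc P (x # A @ y # D) = {}" using r by (simp add: region_def)
  \<comment> \<open>Otherwise the crossing path would be the boundary edge itself, whereas its inner
    points lie in \<open>R\<close> and hence off the boundary.\<close>
  have AZ: "A \<noteq> [] \<or> Z \<noteq> []"
  proof (rule ccontr)
    assume "\<not> ?thesis"
    then have "pc P (x # Z @ [y]) = pc P (x # A @ [y])" by simp
    then show False using gR Z(5) RJ s(3) by blast
  qed
  have DZ: "rev D \<noteq> [] \<or> Z \<noteq> []"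
  proof (rule ccontr)
    assume "\<not> ?thesis"
    then have "pc P (x # Z @ [y]) = pc P (y # D @ [x])" using pc_rev[of P "[x, y]"] by simp
    then show False using gR Z(5) RJ s(3) by blast
  qed
  have sD: "successively (padj P) (x # rev D @ [y])" using s(2) successively_rev_padj[of P "y # D @ [x]"] by simp
  have pD: "pc P (x # rev D @ [y]) = pc P (y # D @ [x])" using pc_rev[of P "y # D @ [x]"] by simp
  note e1 = cyc_ear[OF s(1) Z(4) _ _ AZ] and e2 = cyc_ear[OF sD Z(4) _ _ DZ]
  show c1: "cyc P (x # A @ y # rev Z)" using e1(1) d Z by auto
  show c2: "cyc P (x # rev D @ y # rev Z)" using e2(1) d Z by auto
  have p1: "pcyc P (x # A @ y # rev Z) = path_image g1 \<union> path_image g" using e1(2) d Z g g1 by auto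
  have p2: "pcyc P (x # rev D @ y # rev Z) = path_image g2 \<union> path_image g" using e2(2) d Z g g2 pD by auto
  have "region (path_image g1 \<union> path_image g2) R" using r s(3) g1 g2 by simp
  moreover have "path_image g1 \<inter> path_image g2 = {x, y}" using s(4) g1 g2 by simp
  moreover have "x \<noteq> y" using d by auto
  ultimately have "\<exists>R1 R2. region (path_image g1 \<union> path_image g) R1 \<and> region (path_image g2 \<union> path_image g) R2 \<and>
    R1 \<inter> R2 = {} \<and> R = R1 \<union> R2 \<union> (path_image g - {x, y})"
    using S2_theta[of g1 g2 g x y R] g g1 g2 Z(5) by auto
  then show "\<exists>R1 R2. region (pcyc P (x # A @ y # rev Z)) R1 \<and> region (pcyc P (x # rev D @ y # rev Z)) R2 \<and>
       R1 \<inter> R2 = {} \<and> R = R1 \<union> R2 \<union> (pc P (x # Z @ [y]) - {x, y})"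
    unfolding p1 p2 g(2)[symmetric] .
qed

text \<open>A single edge bounds no disc. The first ear closes it to a cycle, and both sides of this
  cycle become discs with the same boundary list.\<close>

lemma disc_initial:
  assumes "padj P x y" "distinct (x # Z @ [y])" "Z \<noteq> []" "set Z \<subseteq> points P" "successively (padj P) (x # Z @ [y])"
  shows "cyc P (x # y # rev Z)"
    "\<exists>R1 R2. region (pcyc P (x # y # rev Z)) R1 \<and> region (pcyc P (x # y # rev Z)) R2 \<and>
       R1 \<inter> R2 = {} \<and> S2 = R1 \<union> R2 \<union> pcyc P (x # y # rev Z)"
    "pcyc P (x # y # rev Z) = pc P [x, y] \<union> pc P (x # Z @ [y])"
proof -
  have xy: "x \<in> points P" "y \<in> points P" "x \<noteq> y" using padj_points[OF assms(1)] by auto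
  have s: "successively (padj P) (x # [] @ [y])" using assms(1) by simp
  have e: "cyc P (x # [] @ y # rev Z)" "pcyc P (x # [] @ y # rev Z) = pc P (x # [] @ [y]) \<union> pc P (x # Z @ [y])"
    using cyc_ear[OF s assms(5)] assms xy by auto
  then show "cyc P (x # y # rev Z)" "pcyc P (x # y # rev Z) = pc P [x, y] \<union> pc P (x # Z @ [y])" by auto
  have c': "cyc P (x # [] @ y # rev Z)" using e by simp
  note cs = cyc_split[OF c']
  obtain g where g: "arc g" "path_image g = pc P (x # Z @ [y])" "pathstart g = x" "pathfinish g = y"
    using ear_arc[OF assms(2,5)] assms xy by auto
  obtain g1 where g1: "arc g1" "path_image g1 = pc P [x, y]" "pathstart g1 = x" "pathfinish g1 = y"
    using ear_arc[of x "[]" y] assms xy by auto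
  have "pc P (y # rev Z @ [x]) = pc P (x # Z @ [y])" using pc_rev[of P "x # Z @ [y]"] by simp
  then have "path_image g1 \<inter> path_image g = {x, y}" using cs(4) g g1 by simp
  moreover have "path_image g1 \<subseteq> S2" "path_image g \<subseteq> S2"
    using pc_S2[OF s] pc_S2[OF assms(5)] g g1 assms xy by auto
  ultimately show "\<exists>R1 R2. region (pcyc P (x # y # rev Z)) R1 \<and> region (pcyc P (x # y # rev Z)) R2 \<and>
       R1 \<inter> R2 = {} \<and> S2 = R1 \<union> R2 \<union> pcyc P (x # y # rev Z)"
    using S2_Jordan[of g1 g x y] g g1 xy e(2) by auto
qed

end

section \<open>One stellar step\<close>

lemma faces_props:
  assumes "F \<in> faces P"
  shows "F \<subseteq> S2" "F \<inter> points P = {}" "\<And>e. e \<in> curves P \<Longrightarrow> F \<inter> e = {}" "connected F" "F \<noteq> {}"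
proof -
  have "F \<subseteq> S2 - (points P \<union> \<Union>(curves P))" using assms unfolding faces_def by (rule in_components_subset)
  then show "F \<subseteq> S2" "F \<inter> points P = {}" "\<And>e. e \<in> curves P \<Longrightarrow> F \<inter> e = {}" by blast+
  show "connected F" "F \<noteq> {}" using assms unfolding faces_def by (auto simp: in_components_connected in_components_nonempty)
qed

lemma faces_disjoint: "F \<in> faces P \<Longrightarrow> F' \<in> faces P \<Longrightarrow> F \<noteq> F' \<Longrightarrow> F \<inter> F' = {}"
  unfolding faces_def using components_nonoverlap by blast

text \<open>By the last condition new vertices avoid old curves, so old edges keep their ends and
  adjacency is inherited.\<close>

definition extends :: "drawing \<Rightarrow> drawing \<Rightarrow> bool" where
  "extends P Q \<longleftrightarrow> points P \<subseteq> points Q \<and> curves P \<subseteq> curves Q \<and> (\<forall>e\<in>curves P. e \<inter> points Q = e \<inter> points P)"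

lemma extends_trans: "extends P Q \<Longrightarrow> extends Q R \<Longrightarrow> extends P R"
  unfolding extends_def by (metis (no_types, lifting) subset_trans subsetD)

text \<open>\<open>stellar_step\<close> hides centres and spokes behind an existential quantifier.
  \<open>star\<close>, \<open>star_points\<close> and \<open>star_curves\<close> are its parts with
  these witnesses as parameters, so that lemmas can speak about fixed ones.\<close>

definition star :: "drawing \<Rightarrow> ((real^3) set \<Rightarrow> real^3) \<Rightarrow> ((real^3) set \<Rightarrow> real^3 \<Rightarrow> real \<Rightarrow> real^3) \<Rightarrow> bool" where
  "star P c g \<longleftrightarrow> (\<forall>F\<in>faces P. c F \<in> F) \<and>
        (\<forall>F\<in>faces P. \<forall>u\<in>boundary_vertices P F.
           arc (g F u) \<and> pathstart (g F u) = c F \<and> pathfinish (g F u) = u \<and>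
           path_image (g F u) - {u} \<subseteq> F) \<and>
        (\<forall>F\<in>faces P. \<forall>u\<in>boundary_vertices P F. \<forall>w\<in>boundary_vertices P F.
           u \<noteq> w \<longrightarrow> path_image (g F u) \<inter> path_image (g F w) = {c F})"

definition star_points :: "nat \<Rightarrow> drawing \<Rightarrow> ((real^3) set \<Rightarrow> real^3) \<Rightarrow> ((real^3) set \<Rightarrow> real^3 \<Rightarrow> real \<Rightarrow> real^3) \<Rightarrow> (real^3) set" where
  "star_points n P c g = points P \<union> c ` faces P \<union>
          {g F u (real i / real (n + 1)) | F u i.
             F \<in> faces P \<and> u \<in> boundary_vertices P F \<and> 1 \<le> i \<and> i \<le> n}"

definition star_curves :: "nat \<Rightarrow> drawing \<Rightarrow> ((real^3) set \<Rightarrow> real^3 \<Rightarrow> real \<Rightarrow> real^3) \<Rightarrow> (real^3) set set" where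
  "star_curves n P g = curves P \<union>
          {g F u ` {real i / real (n + 1) .. real (i + 1) / real (n + 1)} | F u i.
             F \<in> faces P \<and> u \<in> boundary_vertices P F \<and> i \<le> n}"

lemma stellar_step_alt:
  "stellar_step n P Q \<longleftrightarrow> (\<exists>c g. star P c g \<and> points Q = star_points n P c g \<and> curves Q = star_curves n P g)"
  unfolding stellar_step_def star_def star_points_def star_curves_def by (simp only: conj_assoc)

context
  fixes P Q :: drawing and c g n
  assumes plane: "plane_graph P" and star: "star P c g"
    and Q: "points Q = star_points n P c g" "curves Q = star_curves n P g" and n: "1 \<le> n"
begin

lemma centre_in: "F \<in> faces P \<Longrightarrow> c F \<in> F"
  using star by (simp add: star_def)

lemma bv_points: "u \<in> boundary_vertices P F \<Longrightarrow> u \<in> points P"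
  by (simp add: boundary_vertices_def)

lemma spoke:
  assumes "F \<in> faces P" "u \<in> boundary_vertices P F"
  shows "arc (g F u)" "g F u 0 = c F" "g F u 1 = u" "path_image (g F u) - {u} \<subseteq> F" "inj_on (g F u) {0..1}"
  using star assms unfolding star_def pathstart_def pathfinish_def arc_def by blast+

lemma spoke_in:
  assumes "F \<in> faces P" "u \<in> boundary_vertices P F" "0 \<le> t" "t < 1"
  shows "g F u t \<in> F"
proof -
  have "g F u t \<in> path_image (g F u)" using assms by (simp add: path_image_def)
  moreover have "g F u t \<noteq> u" using inj_onD[OF spoke(5)[OF assms(1,2)], of t 1] spoke(3)[OF assms(1,2)] assms by auto
  ultimately show ?thesis using spoke(4)[OF assms(1,2)] by blast
qed

text \<open>Face, rim vertex and parameter act as coordinates of the new points. They are unique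
  except at the centre, which all spokes of a face share, and at parameter 1, where the point is an
  old vertex that several faces may share; hence \<open>t < 1\<close>.\<close>

lemma spoke_key:
  assumes F: "F \<in> faces P" "u \<in> boundary_vertices P F" "F' \<in> faces P" "u' \<in> boundary_vertices P F'"
    and t: "0 \<le> t" "t < 1" "0 \<le> t'" "t' \<le> 1" "g F u t = g F' u' t'"
  shows "F = F' \<and> t = t' \<and> (u = u' \<or> t = 0)"
proof -
  have z: "g F u t \<in> F" using spoke_in F t by blast
  have "t' \<noteq> 1"
  proof
    assume "t' = 1"
    then have "g F u t \<in> points P" using t spoke(3)[OF F(3,4)] bv_points[OF F(4)] by simp
    then show False using z faces_props(2)[OF F(1)] by blast
  qed
  then have t': "t' < 1" using t by simp
  then have "g F u t \<in> F'" using spoke_in[OF F(3,4)] t by simp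
  then have FF: "F = F'" using z faces_disjoint[OF F(1,3)] by blast
  show ?thesis
  proof (cases "u = u'")
    case True
    then show ?thesis using FF inj_onD[OF spoke(5)[OF F(1,2)], of t t'] t by auto
  next
    case False
    have "g F u t \<in> path_image (g F u)" unfolding path_image_def using t by (intro imageI) simp
    moreover have "g F u' t' \<in> path_image (g F u')" unfolding path_image_def using t by (intro imageI) simp
    moreover have "g F u t = g F u' t'" using t FF by simp
    ultimately have "g F u t \<in> path_image (g F u) \<inter> path_image (g F u')" by simp
    then have "g F u t = c F" using star F FF False unfolding star_def by blast
    then have "g F u t = g F u 0" "g F u' t' = g F u' 0" using spoke(2) F FF t(5) by auto
    then have "t = 0" "t' = 0"
      using inj_onD[OF spoke(5)[OF F(1,2)], of t 0] inj_onD[OF spoke(5)[OF F(3,4)], of t' 0] t t' FF by auto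
    then show ?thesis using FF by simp
  qed
qed

lemma step_points: "F \<in> faces P \<Longrightarrow> c F \<in> points Q" "points P \<subseteq> points Q"
  "F \<in> faces P \<Longrightarrow> u \<in> boundary_vertices P F \<Longrightarrow> i \<le> n + 1 \<Longrightarrow> g F u (real i / real (n + 1)) \<in> points Q"
proof -
  show "F \<in> faces P \<Longrightarrow> c F \<in> points Q" "points P \<subseteq> points Q" by (auto simp: Q star_points_def)
  then show "g F u (real i / real (n + 1)) \<in> points Q" if F: "F \<in> faces P" "u \<in> boundary_vertices P F" "i \<le> n + 1"
  proof -
    consider "i = 0" | "i = n + 1" | "1 \<le> i" "i \<le> n" using F by linarith
    then show ?thesis
    proof cases
      case 1 then show ?thesis using spoke(2)[OF F(1,2)] \<open>F \<in> faces P \<Longrightarrow> c F \<in> points Q\<close> F by simp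
    next
      case 2 then show ?thesis using spoke(3)[OF F(1,2)] bv_points[OF F(2)] \<open>points P \<subseteq> points Q\<close> by auto
    next
      case 3 then show ?thesis unfolding Q star_points_def using F by blast
    qed
  qed
qed

lemma step_points_cases:
  assumes "z \<in> points Q"
  obtains "z \<in> points P" | F where "F \<in> faces P" "z = c F"
  | F u i where "F \<in> faces P" "u \<in> boundary_vertices P F" "1 \<le> i" "i \<le> n" "z = g F u (real i / real (n + 1))"
  using assms unfolding Q star_points_def by blast

lemma step_new_in_faces: "z \<in> points Q \<Longrightarrow> z \<notin> points P \<Longrightarrow> \<exists>F\<in>faces P. z \<in> F"
proof (erule step_points_cases)
  fix F u i assume "F \<in> faces P" "u \<in> boundary_vertices P F" "1 \<le> i" "i \<le> n" "z = g F u (real i / real (n + 1))"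
  then show "\<exists>F\<in>faces P. z \<in> F" using spoke_in[of F u "real i / real (n + 1)"] by auto
qed (use centre_in in auto)

lemma step_extends: "extends P Q"
proof -
  have "e \<inter> points Q = e \<inter> points P" if "e \<in> curves P" for e
    using step_new_in_faces faces_props(3) that step_points(2) by blast
  moreover have "curves P \<subseteq> curves Q" by (auto simp: Q star_curves_def)
  ultimately show ?thesis using step_points(2) by (simp add: extends_def)
qed

lemma piece_points:
  assumes F: "F \<in> faces P" "u \<in> boundary_vertices P F" and i: "i \<le> n"
  shows "g F u ` {real i / real (n + 1) .. real (i + 1) / real (n + 1)} \<inter> points Q =
    {g F u (real i / real (n + 1)), g F u (real (i + 1) / real (n + 1))}"
proof -
  let ?N = "real (n + 1)"
  have A: "z \<in> {g F u (real i / ?N), g F u (real (i + 1) / ?N)}"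
    if z: "z = g F u t" "real i / ?N \<le> t" "t \<le> real (i + 1) / ?N" "z \<in> points Q" for z t
  proof (cases "t < 1")
    case False
    have "real (i + 1) / ?N \<le> 1" using i by simp
    then have "t = real (i + 1) / ?N" using False z by linarith
    then show ?thesis using z by simp
  next
    case True
    have t0: "0 \<le> t" using z(2) by (meson divide_nonneg_nonneg of_nat_0_le_iff order_trans)
    have zF: "z \<in> F" using spoke_in[OF F t0 True] z by simp
    from z(4) show ?thesis
    proof (rule step_points_cases)
      assume "z \<in> points P" then show ?thesis using zF faces_props(2)[OF F(1)] by blast
    next
      fix F' assume F': "F' \<in> faces P" "z = c F'"
      then have "F = F'" using zF centre_in faces_disjoint[OF F(1)] by blast
      then have "g F u t = g F u 0" using F' z spoke(2)[OF F] by simp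
      then have "t = 0" using inj_onD[OF spoke(5)[OF F], of t 0] True t0 by simp
      then have "i = 0" using z(2) by (simp add: divide_le_0_iff)
      then show ?thesis using z \<open>t = 0\<close> by simp
    next
      fix F' u' j assume F': "F' \<in> faces P" "u' \<in> boundary_vertices P F'" "1 \<le> j" "j \<le> n" "z = g F' u' (real j / ?N)"
      then have "t = real j / ?N" using spoke_key[OF F F'(1,2) t0 True, of "real j / ?N"] z by (simp add: divide_le_eq)
      then have "real i \<le> real j" "real j \<le> real (i + 1)" using z by (simp_all add: divide_le_cancel)
      then have "j = i \<or> j = i + 1" by linarith
      then show ?thesis using z \<open>t = real j / ?N\<close> by auto
    qed
  qed
  have "{g F u (real i / ?N), g F u (real (i + 1) / ?N)} \<subseteq> g F u ` {real i / ?N .. real (i + 1) / ?N} \<inter> points Q"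
  proof -
    have "real i / ?N \<le> real (i + 1) / ?N" by (intro divide_right_mono) auto
    then have "real i / ?N \<in> {real i / ?N .. real (i + 1) / ?N}" "real (i + 1) / ?N \<in> {real i / ?N .. real (i + 1) / ?N}" by simp_all
    then show ?thesis using step_points(3)[OF F, of i] step_points(3)[OF F, of "i + 1"] i by simp
  qed
  moreover have "g F u ` {real i / ?N .. real (i + 1) / ?N} \<inter> points Q \<subseteq> {g F u (real i / ?N), g F u (real (i + 1) / ?N)}"
    by (rule subsetI, elim IntE imageE) (rule A, auto)
  ultimately show ?thesis by (rule antisym[rotated])
qed

lemma piece_arc:
  assumes F: "F \<in> faces P" "u \<in> boundary_vertices P F" and i: "i \<le> n"
  shows "\<exists>h. arc h \<and> path_image h = g F u ` {real i / real (n + 1) .. real (i + 1) / real (n + 1)} \<and>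
    pathstart h = g F u (real i / real (n + 1)) \<and> pathfinish h = g F u (real (i + 1) / real (n + 1))"
proof -
  let ?a = "real i / real (n + 1)" and ?b = "real (i + 1) / real (n + 1)"
  have ab: "0 \<le> ?a" "?a < ?b" "?b \<le> 1" using i by (auto simp: divide_strict_right_mono)
  then have "arc (subpath ?a ?b (g F u))" using arc_subpath_arc[OF spoke(1)[OF F], of ?a ?b] by auto
  moreover have "path_image (subpath ?a ?b (g F u)) = g F u ` {?a..?b}" using ab by (simp add: path_image_subpath)
  ultimately show ?thesis by (intro exI[of _ "subpath ?a ?b (g F u)"]) (simp add: pathstart_subpath pathfinish_subpath)
qed

lemma piece_sub: "F \<in> faces P \<Longrightarrow> u \<in> boundary_vertices P F \<Longrightarrow> i \<le> n \<Longrightarrow>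
    z \<in> g F u ` {real i / real (n + 1) .. real (i + 1) / real (n + 1)} \<Longrightarrow>
    \<exists>t. z = g F u t \<and> 0 \<le> t \<and> t \<le> 1 \<and> real i / real (n + 1) \<le> t \<and> t \<le> real (i + 1) / real (n + 1)"
proof -
  assume a: "i \<le> n" "z \<in> g F u ` {real i / real (n + 1) .. real (i + 1) / real (n + 1)}"
  then obtain t where t: "z = g F u t" "real i / real (n + 1) \<le> t" "t \<le> real (i + 1) / real (n + 1)" by auto
  moreover have "real (i + 1) / real (n + 1) \<le> 1" using a by simp
  moreover have "0 \<le> real i / real (n + 1)" by simp
  ultimately show ?thesis by (metis order_trans)
qed

text \<open>By \<open>spoke_key\<close> a common point of two pieces is an old vertex, a centre, or
  lies on two consecutive pieces of one spoke and then at their common end.\<close>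

lemma piece_piece:
  assumes F: "F \<in> faces P" "u \<in> boundary_vertices P F" "i \<le> n" "F' \<in> faces P" "u' \<in> boundary_vertices P F'" "i' \<le> n"
    and ne: "\<not> (F = F' \<and> u = u' \<and> i = i')"
    and z: "z \<in> g F u ` {real i / real (n + 1) .. real (i + 1) / real (n + 1)}"
      "z \<in> g F' u' ` {real i' / real (n + 1) .. real (i' + 1) / real (n + 1)}"
  shows "z \<in> points Q"
proof -
  let ?N = "real (n + 1)"
  obtain t where t: "z = g F u t" "0 \<le> t" "t \<le> 1" "real i / ?N \<le> t" "t \<le> real (i + 1) / ?N" using piece_sub[OF F(1-3) z(1)] by blast
  obtain t' where t': "z = g F' u' t'" "0 \<le> t'" "t' \<le> 1" "real i' / ?N \<le> t'" "t' \<le> real (i' + 1) / ?N"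
    using piece_sub[OF F(4-6) z(2)] by blast
  show ?thesis
  proof (cases "t = 1")
    case True then show ?thesis using t spoke(3)[OF F(1,2)] bv_points[OF F(2)] step_points(2) by auto
  next
    case False
    then have k: "F = F'" "t = t'" "u = u' \<or> t = 0" using spoke_key[OF F(1,2,4,5) t(2) _ t'(2,3)] t t' by auto
    show ?thesis
    proof (cases "t = 0")
      case True then show ?thesis using t spoke(2)[OF F(1,2)] step_points(1)[OF F(1)] by simp
    next
      case False
      then have "i \<noteq> i'" using k ne by auto
      moreover have "real i \<le> real (i' + 1)" "real i' \<le> real (i + 1)"
      proof -
        have "real i / ?N \<le> real (i' + 1) / ?N" "real i' / ?N \<le> real (i + 1) / ?N" using t t' k by linarith+
        then show "real i \<le> real (i' + 1)" "real i' \<le> real (i + 1)" by (simp_all add: divide_le_cancel)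
      qed
      ultimately have "i = i' + 1 \<or> i' = i + 1" by linarith
      then have "t = real i / ?N \<or> t = real i' / ?N"
      proof
        assume "i = i' + 1" then show ?thesis using t(4) t'(5) k(2) by (intro disjI1 antisym) simp_all
      next
        assume "i' = i + 1" then show ?thesis using t(5) t'(4) k(2) by (intro disjI2 antisym) simp_all
      qed
      then show ?thesis using step_points(3)[OF F(1,2), of i] step_points(3)[OF F(4,5), of i'] F t(1) t'(1) k(2) by auto
    qed
  qed
qed

lemma step_plane: "plane_graph Q"
proof -
  let ?N = "real (n + 1)"
  let ?K = "\<lambda>F u i. g F u ` {real i / ?N .. real (i + 1) / ?N}"
  have ext: "extends P Q" by (rule step_extends)
  have new: "e \<in> curves P \<or> (\<exists>F u i. F \<in> faces P \<and> u \<in> boundary_vertices P F \<and> i \<le> n \<and> e = ?K F u i)" if "e \<in> curves Q" for e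
    using that unfolding Q star_curves_def by blast
  have Psub: "points P \<subseteq> S2" "\<And>e. e \<in> curves P \<Longrightarrow> e \<subseteq> S2" using plane by (auto simp: plane_graph_def)
  have 1: "points Q \<subseteq> S2" using step_new_in_faces faces_props(1) Psub(1) by blast
  have KS: "?K F u i \<subseteq> insert u F" if F: "F \<in> faces P" "u \<in> boundary_vertices P F" "i \<le> n" for F u i
  proof
    fix z assume "z \<in> ?K F u i"
    from piece_sub[OF F this] obtain t where "z = g F u t" "0 \<le> t" "t \<le> 1" by blast
    then show "z \<in> insert u F" using spoke(3)[OF F(1,2)] spoke_in[OF F(1,2), of t] by (cases "t = 1") auto
  qed
  have 2: "e \<subseteq> S2 \<and> (\<exists>g. arc g \<and> path_image g = e \<and> e \<inter> points Q = {pathstart g, pathfinish g})" if "e \<in> curves Q" for e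
    using new[OF that]
  proof
    assume e: "e \<in> curves P"
    have "\<forall>e\<in>curves P. e \<subseteq> S2 \<and> (\<exists>g. arc g \<and> path_image g = e \<and> e \<inter> points P = {pathstart g, pathfinish g})"
      using plane by (simp add: plane_graph_def)
    moreover have "e \<inter> points Q = e \<inter> points P" using ext e by (simp add: extends_def)
    ultimately show ?thesis using e by simp
  next
    assume "\<exists>F u i. F \<in> faces P \<and> u \<in> boundary_vertices P F \<and> i \<le> n \<and> e = ?K F u i"
    then obtain F u i where F: "F \<in> faces P" "u \<in> boundary_vertices P F" "i \<le> n" "e = ?K F u i" by blast
    have "insert u F \<subseteq> S2" using faces_props(1)[OF F(1)] bv_points[OF F(2)] Psub(1) by blast
    then have "e \<subseteq> S2" using KS[OF F(1-3)] F(4) by (metis subset_trans)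
    then show ?thesis using piece_arc[OF F(1-3)] piece_points[OF F(1-3)] F(4) by metis
  qed
  have 3: "e \<inter> f \<subseteq> points Q" if ef: "e \<in> curves Q" "f \<in> curves Q" "e \<noteq> f" for e f
  proof -
    have on: "e \<inter> f \<subseteq> points Q" if e: "e \<in> curves P" and f: "F \<in> faces P" "u \<in> boundary_vertices P F" "i \<le> n" "f = ?K F u i" for e f F u i
    proof -
      have "e \<inter> f \<subseteq> {u}" using KS[OF f(1-3)] f(4) faces_props(3)[OF f(1) e] by blast
      then show ?thesis using bv_points[OF f(2)] step_points(2) by blast
    qed
    consider "e \<in> curves P" "f \<in> curves P" | "e \<in> curves P" "\<exists>F u i. F \<in> faces P \<and> u \<in> boundary_vertices P F \<and> i \<le> n \<and> f = ?K F u i"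
      | "f \<in> curves P" "\<exists>F u i. F \<in> faces P \<and> u \<in> boundary_vertices P F \<and> i \<le> n \<and> e = ?K F u i"
      | "\<exists>F u i. F \<in> faces P \<and> u \<in> boundary_vertices P F \<and> i \<le> n \<and> e = ?K F u i" "\<exists>F u i. F \<in> faces P \<and> u \<in> boundary_vertices P F \<and> i \<le> n \<and> f = ?K F u i"
      using new[OF ef(1)] new[OF ef(2)] by blast
    then show ?thesis
    proof cases
      case 1 then show ?thesis using plane ef(3) step_points(2) unfolding plane_graph_def by blast
    next
      case 2 then show ?thesis using on by blast
    next
      case 3 then show ?thesis using on by blast
    next
      case 4
      then obtain F u i F' u' i' where F: "F \<in> faces P" "u \<in> boundary_vertices P F" "i \<le> n" "e = ?K F u i"
        "F' \<in> faces P" "u' \<in> boundary_vertices P F'" "i' \<le> n" "f = ?K F' u' i'" by blast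
      have "\<not> (F = F' \<and> u = u' \<and> i = i')" using F ef(3) by blast
      then show ?thesis using piece_piece[OF F(1-3) F(5-7)] F(4,8) by blast
    qed
  qed
  \<comment> \<open>Two edges must not share both ends. An end with parameter below 1 determines the
    face and the position on the spoke, and also the spoke unless it is the centre.\<close>
  have 4: "e = f" if ef: "e \<in> curves Q" "f \<in> curves Q" "e \<inter> points Q = f \<inter> points Q" for e f
  proof -
    have on: False if e: "e \<in> curves P" and f: "F \<in> faces P" "u \<in> boundary_vertices P F" "i \<le> n" "f = ?K F u i"
      and eq: "e \<inter> points Q = f \<inter> points Q" for e f F u i
    proof -
      have "g F u (real i / ?N) \<in> e" using piece_points[OF f(1-3)] f(4) eq by blast
      moreover have "g F u (real i / ?N) \<in> F" using spoke_in[OF f(1,2), of "real i / ?N"] f(3) by simp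
      ultimately show False using faces_props(3)[OF f(1) e] by blast
    qed
    consider "e \<in> curves P" "f \<in> curves P" | "e \<in> curves P" "\<exists>F u i. F \<in> faces P \<and> u \<in> boundary_vertices P F \<and> i \<le> n \<and> f = ?K F u i"
      | "f \<in> curves P" "\<exists>F u i. F \<in> faces P \<and> u \<in> boundary_vertices P F \<and> i \<le> n \<and> e = ?K F u i"
      | "\<exists>F u i. F \<in> faces P \<and> u \<in> boundary_vertices P F \<and> i \<le> n \<and> e = ?K F u i" "\<exists>F u i. F \<in> faces P \<and> u \<in> boundary_vertices P F \<and> i \<le> n \<and> f = ?K F u i"
      using new[OF ef(1)] new[OF ef(2)] by blast
    then show ?thesis
    proof cases
      case 1
      then have "e \<inter> points P = f \<inter> points P" using ef(3) ext by (auto simp: extends_def)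
      moreover have "inj_on (\<lambda>e. e \<inter> points P) (curves P)" using plane by (simp add: plane_graph_def)
      ultimately show ?thesis using 1 by (auto dest: inj_onD)
    next
      case 2 then show ?thesis using on ef(3) by blast
    next
      case 3 then show ?thesis using on ef(3) by (metis (no_types, lifting))
    next
      case 4
      then obtain F u i F' u' i' where F: "F \<in> faces P" "u \<in> boundary_vertices P F" "i \<le> n" "e = ?K F u i"
        "F' \<in> faces P" "u' \<in> boundary_vertices P F'" "i' \<le> n" "f = ?K F' u' i'" by blast
      have pts: "{g F u (real i / ?N), g F u (real (i + 1) / ?N)} = {g F' u' (real i' / ?N), g F' u' (real (i' + 1) / ?N)}"
        using ef(3) piece_points[OF F(1-3)] piece_points[OF F(5-7)] F(4,8) by simp
      have pos: "0 < ?N" by simp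
      have key: "\<exists>j'\<in>{i', i' + 1}. F = F' \<and> real j = real j' \<and> (u = u' \<or> j = 0)" if j: "j \<in> {i, i + 1}" "j \<le> n" for j
      proof -
        have "g F u (real j / ?N) \<in> {g F' u' (real i' / ?N), g F' u' (real (i' + 1) / ?N)}" using pts j(1) by blast
        then obtain j' where j': "j' \<in> {i', i' + 1}" "g F u (real j / ?N) = g F' u' (real j' / ?N)" by blast
        have b: "0 \<le> real j / ?N" "real j / ?N < 1" "0 \<le> real j' / ?N" "real j' / ?N \<le> 1" using j j' F by auto
        have a: "F = F' \<and> real j / ?N = real j' / ?N \<and> (u = u' \<or> real j / ?N = 0)"
          by (rule spoke_key[OF F(1,2,5,6) b j'(2)])
        have "real j = real j'" using a pos by (metis divide_cancel_right less_irrefl)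
        moreover have "u = u' \<or> j = 0" using a pos by (metis divide_eq_0_iff less_irrefl of_nat_eq_0_iff)
        ultimately have "F = F' \<and> real j = real j' \<and> (u = u' \<or> j = 0)" using a by blast
        then show ?thesis using j'(1) by blast
      qed
      have FF: "F = F'" using key[of i] F(3) by blast
      \<comment> \<open>If the spokes differed, the first end would be the centre. As
        \<open>n\<close> is positive, the second end is then an inner vertex of the spoke and
        determines the spoke after all.\<close>
      have uu: "u = u'"
      proof (rule ccontr)
        assume "u \<noteq> u'"
        then have "i = 0" using key[of i] F(3) by auto
        then have "i + 1 \<le> n" using n by simp
        then show False using key[of "i + 1"] \<open>u \<noteq> u'\<close> by auto
      qed
      have "i' \<le> i" using key[of i] F(3) by auto
      have "i = i'"
      proof (rule ccontr)
        assume "i \<noteq> i'"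
        then have i: "i = i' + 1" using key[of i] F(3) by auto
        have "g F' u' (real i' / ?N) \<in> {g F u (real i / ?N), g F u (real (i + 1) / ?N)}" using pts by blast
        moreover have "real i' / ?N < 1" "real i / ?N \<le> 1" "real (i + 1) / ?N \<le> 1" using F by auto
        ultimately have "real i' / ?N = real i / ?N \<or> real i' / ?N = real (i + 1) / ?N"
          using spoke_key[OF F(5,6,1,2), of "real i' / ?N" "real i / ?N"] spoke_key[OF F(5,6,1,2), of "real i' / ?N" "real (i + 1) / ?N"] by auto
        then show False using i pos by (auto simp: divide_cancel_right)
      qed
      then show ?thesis using F FF uu by simp
    qed
  qed
  show ?thesis unfolding plane_graph_def
  proof (intro conjI)
    show "inj_on (\<lambda>e. e \<inter> points Q) (curves Q)" by (rule inj_onI) (rule 4)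
    show "\<forall>e\<in>curves Q. e \<subseteq> S2 \<and> (\<exists>g. arc g \<and> path_image g = e \<and> e \<inter> points Q = {pathstart g, pathfinish g})"
      using 2 by (rule ballI)
    show "\<forall>e\<in>curves Q. \<forall>f\<in>curves Q. e \<noteq> f \<longrightarrow> e \<inter> f \<subseteq> points Q" using 3 by (intro ballI impI)
  qed (rule 1)
qed

end

section \<open>Linkages in stellar faces\<close>

definition conn :: "('v \<Rightarrow> 'v \<Rightarrow> bool) \<Rightarrow> 'v set \<Rightarrow> bool" where
  "conn adj A \<longleftrightarrow> A \<noteq> {} \<and> (\<forall>x\<in>A. \<forall>y\<in>A. (x, y) \<in> {(u, v). u \<in> A \<and> v \<in> A \<and> adj u v}\<^sup>*)"

lemma conn_reach_mono:
  assumes "(x, y) \<in> {(u, v). u \<in> A \<and> v \<in> A \<and> adj u v}\<^sup>*" "A \<subseteq> B"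
  shows "(x, y) \<in> {(u, v). u \<in> B \<and> v \<in> B \<and> adj u v}\<^sup>*"
  by (rule rev_subsetD[OF assms(1)], rule rtrancl_mono) (use assms(2) in auto)

lemma conn_reach: "conn adj A \<Longrightarrow> x \<in> A \<Longrightarrow> y \<in> A \<Longrightarrow> A \<subseteq> B \<Longrightarrow>
    (x, y) \<in> {(u, v). u \<in> B \<and> v \<in> B \<and> adj u v}\<^sup>*"
  unfolding conn_def using conn_reach_mono[of x y A adj B] by blast

lemma conn_singleton: "conn adj {x}"
  by (simp add: conn_def)

lemma conn_Un_adj:
  assumes A: "conn adj A" and B: "conn adj B" and ab: "a \<in> A" "b \<in> B"
    and adj: "adj a b" "adj b a"
  shows "conn adj (A \<union> B)"
proof -
  let ?R = "{(u, v). u \<in> A \<union> B \<and> v \<in> A \<union> B \<and> adj u v}"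
  have AA: "(x, y) \<in> ?R\<^sup>*" if "x \<in> A" "y \<in> A" for x y
    using conn_reach[OF A that] by blast
  have BB: "(x, y) \<in> ?R\<^sup>*" if "x \<in> B" "y \<in> B" for x y
    using conn_reach[OF B that] by blast
  have e: "(a, b) \<in> ?R\<^sup>*" "(b, a) \<in> ?R\<^sup>*"
    using ab adj by (auto intro!: r_into_rtrancl)
  have "(x, y) \<in> ?R\<^sup>*" if "x \<in> A" "y \<in> B" for x y
    using AA[OF that(1) ab(1)] e(1) BB[OF ab(2) that(2)] by (meson rtrancl_trans)
  moreover have "(x, y) \<in> ?R\<^sup>*" if "x \<in> B" "y \<in> A" for x y
    using BB[OF that(1) ab(2)] e(2) AA[OF ab(1) that(2)] by (meson rtrancl_trans)
  moreover have "A \<union> B \<noteq> {}" using ab by blast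
  ultimately show ?thesis unfolding conn_def using AA BB by blast
qed

lemma conn_Un_Int:
  assumes A: "conn adj A" and B: "conn adj B" and "A \<inter> B \<noteq> {}"
  shows "conn adj (A \<union> B)"
proof -
  let ?R = "{(u, v). u \<in> A \<union> B \<and> v \<in> A \<union> B \<and> adj u v}"
  obtain a where a: "a \<in> A" "a \<in> B" using assms(3) by blast
  have AA: "(x, y) \<in> ?R\<^sup>*" if "x \<in> A" "y \<in> A" for x y
    using conn_reach[OF A that] by blast
  have BB: "(x, y) \<in> ?R\<^sup>*" if "x \<in> B" "y \<in> B" for x y
    using conn_reach[OF B that] by blast
  have "(x, a) \<in> ?R\<^sup>*" "(a, x) \<in> ?R\<^sup>*" if "x \<in> A \<union> B" for x
    using that AA a BB by blast+
  then have "(x, y) \<in> ?R\<^sup>*" if "x \<in> A \<union> B" "y \<in> A \<union> B" for x y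
    using that by (meson rtrancl_trans)
  moreover have "A \<union> B \<noteq> {}" using a by blast
  ultimately show ?thesis unfolding conn_def by blast
qed

lemma conn_Union_chain:
  fixes i j :: nat
  assumes "i \<le> j" "\<And>s. i \<le> s \<Longrightarrow> s \<le> j \<Longrightarrow> conn adj (Y s)"
    and "\<And>s. i \<le> s \<Longrightarrow> s < j \<Longrightarrow> Y s \<inter> Y (Suc s) \<noteq> {}"
  shows "conn adj (\<Union>s\<in>{i..j}. Y s)"
  using assms
proof (induction j rule: dec_induct)
  case base
  then show ?case by simp
next
  case (step j)
  have "conn adj (\<Union>s\<in>{i..j}. Y s)" using step by simp
  moreover have "conn adj (Y (Suc j))" using step by simp
  moreover have "(\<Union>s\<in>{i..j}. Y s) \<inter> Y (Suc j) \<noteq> {}"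
    using step.prems(2)[of j] step.hyps by fastforce
  ultimately have "conn adj ((\<Union>s\<in>{i..j}. Y s) \<union> Y (Suc j))" by (rule conn_Un_Int)
  moreover have "(\<Union>s\<in>{i..Suc j}. Y s) = (\<Union>s\<in>{i..j}. Y s) \<union> Y (Suc j)"
    using step.hyps by (subst atLeastAtMostSuc_conv) auto
  ultimately show ?case by simp
qed

lemma conn_walk:
  fixes i j :: nat
  assumes "i \<le> j" "\<And>s. i \<le> s \<Longrightarrow> s < j \<Longrightarrow> adj (f s) (f (Suc s))"
    and "\<And>u v. adj u v \<Longrightarrow> adj v u"
  shows "conn adj (f ` {i..j})"
  using assms
proof (induction j rule: dec_induct)
  case base
  then show ?case by (simp add: conn_singleton)
next
  case (step j)
  have "conn adj (f ` {i..j} \<union> {f (Suc j)})"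
    by (rule conn_Un_adj[OF _ conn_singleton, of _ _ "f j" "f (Suc j)"]) (use step in auto)
  moreover have "f ` {i..Suc j} = f ` {i..j} \<union> {f (Suc j)}"
    using step.hyps by (auto simp: le_Suc_eq)
  ultimately show ?case by simp
qed

section \<open>Subsequences and list positions\<close>

lemma subseq_positions:
  assumes "subseq xs ys"
  shows "\<exists>p. (\<forall>i<length xs. p i < length ys \<and> ys ! p i = xs ! i) \<and>
    (\<forall>i j. i < j \<longrightarrow> j < length xs \<longrightarrow> p i < (p j :: nat))"
  using assms
proof (induction rule: list_emb.induct)
  case (list_emb_Nil ys)
  then show ?case by simp
next
  case (list_emb_Cons xs ys y)
  then obtain p where p: "\<And>i. i < length xs \<Longrightarrow> p i < length ys \<and> ys ! p i = xs ! i"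
    "\<And>i j. i < j \<Longrightarrow> j < length xs \<Longrightarrow> p i < p j" by blast
  show ?case by (rule exI[of _ "\<lambda>i. Suc (p i)"]) (use p in auto)
next
  case (list_emb_Cons2 x y xs ys)
  then obtain p where p: "\<And>i. i < length xs \<Longrightarrow> p i < length ys \<and> ys ! p i = xs ! i"
    "\<And>i j. i < j \<Longrightarrow> j < length xs \<Longrightarrow> p i < p j" by blast
  show ?case
    by (rule exI[of _ "\<lambda>i. case i of 0 \<Rightarrow> 0 | Suc j \<Rightarrow> Suc (p j)"])
       (use p list_emb_Cons2 in \<open>auto simp: nth_Cons' less_Suc_eq_0_disj split: nat.splits\<close>)
qed

lemma subseq_ConsE:
  assumes "subseq (x # xs) ys"
  obtains us vs where "ys = us @ x # vs" "subseq xs vs"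
  using assms list_emb_ConsD[of "(=)" x xs ys] by blast

lemma subseq_snocE:
  assumes "subseq (xs @ [x]) ys"
  obtains us vs where "ys = us @ x # vs" "subseq xs us"
proof -
  obtain us vs where 1: "ys = us @ vs" "subseq xs us" "subseq [x] vs"
    using list_emb_appendD[OF assms] by blast
  obtain v1 v2 where "vs = v1 @ x # v2" using subseq_ConsE[OF 1(3)] by metis
  moreover have "subseq xs (us @ v1)" using 1(2) by (rule subseq_rev_drop_many)
  ultimately show ?thesis using that[of "us @ v1" v2] 1(1) by simp
qed

lemma subseq_rev: "subseq xs ys \<Longrightarrow> subseq (rev xs) (rev ys)"
  by (induction rule: list_emb.induct) (auto intro: subseq_rev_drop_many list_emb_append_mono)

declare upt_Suc [simp del]

lemma upt_split: "i \<le> j \<Longrightarrow> j \<le> k \<Longrightarrow> [i..<k] = [i..<j] @ [j..<k]"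
  using upt_add_eq_append[of i j "k - j"] by simp

lemma distinct_index:
  assumes "distinct L" shows "\<exists>ix. \<forall>i<length L. ix (L ! i) = (i::nat)"
proof -
  have "\<forall>i<length L. the_inv_into {..<length L} (\<lambda>i. L ! i) (L ! i) = i"
    using assms by (intro allI impI the_inv_into_f_f) (auto simp: inj_on_def nth_eq_iff_index_eq)
  then show ?thesis by blast
qed

text \<open>Boundary cycle of the new face between two neighbouring spokes: from the common centre
  out along \<open>f\<close>, over the rim edge, and back along \<open>g\<close> down to depth 1.
  Position \<open>d\<close> is depth \<open>d\<close> on \<open>f\<close>, and position
  \<open>2 * n + 5 - d\<close> is depth \<open>d\<close> on \<open>g\<close>; the index arithmetic
  below is of this form.\<close>

definition sector :: "nat \<Rightarrow> (nat \<Rightarrow> 'v) \<Rightarrow> (nat \<Rightarrow> 'v) \<Rightarrow> 'v list" where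
  "sector n f g = map f [0..<n + 3] @ map g (rev [1..<n + 3])"

lemma length_sector [simp]: "length (sector n f g) = 2 * n + 5"
  by (simp add: sector_def)

lemma sector_nth_left: "d \<le> n + 2 \<Longrightarrow> sector n f g ! d = f d"
  by (simp add: sector_def nth_append del: upt_Suc)

lemma sector_nth_right: "1 \<le> d \<Longrightarrow> d \<le> n + 2 \<Longrightarrow> sector n f g ! (2 * n + 5 - d) = g d"
  by (simp add: sector_def nth_append rev_map rev_nth del: upt_Suc)
     (auto simp: rev_nth algebra_simps intro!: arg_cong[of _ _ g])

text \<open>Reversal moves the centre from the front to the end of the list, and a rotation by the
  length minus one brings it back.\<close>

lemma sector_swap:
  assumes "f 0 = g 0"
  shows "sector n g f = rotate (2 * n + 4) (rev (sector n f g))"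
proof -
  have 1: "[0..<n + 3] = 0 # [1..<n + 3]" by (simp add: upt_conv_Cons)
  have "rev (sector n f g) = (map g [1..<n + 3] @ map f (rev [1..<n + 3])) @ [f 0]"
    unfolding sector_def 1 by (simp add: rev_map del: upt_Suc)
  moreover have "2 * n + 4 = length (map g [1..<n + 3] @ map f (rev [1..<n + 3]))" by simp
  ultimately have "rotate (2 * n + 4) (rev (sector n f g)) = [f 0] @ map g [1..<n + 3] @ map f (rev [1..<n + 3])"
    by (metis rotate_append)
  also have "\<dots> = sector n g f" unfolding sector_def 1 using assms by (simp del: upt_Suc)
  finally show ?thesis by simp
qed

text \<open>Level \<open>n + 1\<close> spokes carry \<open>n + 1\<close> subdividing vertices: \<open>sp t 0\<close> is the centre of the
  face, \<open>sp t (n + 2)\<close> its \<open>t\<close>-th boundary vertex. Spoke \<open>length C\<close> repeats spoke \<open>0\<close>.\<close>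

definition fan :: "('v \<Rightarrow> 'v \<Rightarrow> bool) \<Rightarrow> (nat \<Rightarrow> 'v list \<Rightarrow> 'v set \<Rightarrow> bool) \<Rightarrow> nat \<Rightarrow> 'v list \<Rightarrow> 'v set \<Rightarrow>
    (nat \<Rightarrow> nat \<Rightarrow> 'v) \<Rightarrow> (nat \<Rightarrow> 'v set) \<Rightarrow> bool" where
  "fan adj face n C I sp J \<longleftrightarrow>
     3 \<le> length C \<and> distinct C \<and> set C \<inter> I = {} \<and>
     (\<forall>t\<le>length C. sp t 0 = sp 0 0) \<and> (\<forall>d. sp (length C) d = sp 0 d) \<and>
     sp 0 0 \<in> I \<and> (\<forall>t<length C. sp t (n + 2) = C ! t) \<and>
     (\<forall>t<length C. \<forall>d\<in>{1..n + 1}. sp t d \<in> I \<and> sp t d \<noteq> sp 0 0) \<and>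
     (\<forall>t<length C. \<forall>t'<length C. \<forall>d\<in>{1..n + 1}. \<forall>d'\<in>{1..n + 1}.
        sp t d = sp t' d' \<longrightarrow> t = t' \<and> d = d') \<and>
     (\<forall>t\<le>length C. \<forall>d\<le>n + 1. adj (sp t d) (sp t (Suc d))) \<and>
     (\<forall>t<length C. face (n + 1) (sector n (sp t) (sp (Suc t))) (J t) \<and> J t \<subseteq> I) \<and>
     (\<forall>t<length C. \<forall>t'<length C. t \<noteq> t' \<longrightarrow> J t \<inter> J t' = {}) \<and>
     (\<forall>t<length C. \<forall>t'\<le>length C. \<forall>d\<le>n + 1. sp t' d \<notin> J t)"

text \<open>The interface between topology and combinatorics. A face is known only by its level, its
  boundary cycle up to rotation and reflection, and the set of vertices inside it. The single
  structural fact is that it splits into a fan of faces of the next level.\<close>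

locale stellar_faces =
  fixes adj :: "'v \<Rightarrow> 'v \<Rightarrow> bool" and face :: "nat \<Rightarrow> 'v list \<Rightarrow> 'v set \<Rightarrow> bool"
  assumes adj_sym: "adj u v \<Longrightarrow> adj v u"
    and face_rotate1: "face n C I \<Longrightarrow> face n (rotate1 C) I"
    and face_rev: "face n C I \<Longrightarrow> face n (rev C) I"
    and face_fan: "face n C I \<Longrightarrow> \<exists>sp J. fan adj face n C I sp J"
begin

lemma face_rotate: "face n C I \<Longrightarrow> face n (rotate r C) I"
  by (induction r) (auto simp: face_rotate1)

lemma face_facts: "face n C I \<Longrightarrow> distinct C \<and> 3 \<le> length C \<and> set C \<inter> I = {}"
  using face_fan[of n C I] by (auto simp: fan_def)

context
  fixes n C I sp J
  assumes fan: "fan adj face n C I sp J"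
begin

lemmas fan_len = fan[unfolded fan_def, THEN conjunct1, rule_format]
lemmas fan_distinct = fan[unfolded fan_def, THEN conjunct2, THEN conjunct1, rule_format]
lemmas fan_disj = fan[unfolded fan_def, THEN conjunct2, THEN conjunct2, THEN conjunct1, rule_format]
lemmas fan_centre = fan[unfolded fan_def, THEN conjunct2, THEN conjunct2, THEN conjunct2, THEN conjunct1, rule_format]
lemmas fan_wrap = fan[unfolded fan_def, THEN conjunct2, THEN conjunct2, THEN conjunct2, THEN conjunct2, THEN conjunct1, rule_format]
lemmas fan_centre_in = fan[unfolded fan_def, THEN conjunct2, THEN conjunct2, THEN conjunct2, THEN conjunct2, THEN conjunct2, THEN conjunct1, rule_format]
lemmas fan_tip = fan[unfolded fan_def, THEN conjunct2, THEN conjunct2, THEN conjunct2, THEN conjunct2, THEN conjunct2, THEN conjunct2, THEN conjunct1, rule_format]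
lemmas fan_inner = fan[unfolded fan_def, THEN conjunct2, THEN conjunct2, THEN conjunct2, THEN conjunct2, THEN conjunct2, THEN conjunct2, THEN conjunct2, THEN conjunct1, rule_format]
lemmas fan_inner_inj = fan[unfolded fan_def, THEN conjunct2, THEN conjunct2, THEN conjunct2, THEN conjunct2, THEN conjunct2, THEN conjunct2, THEN conjunct2, THEN conjunct2, THEN conjunct1, rule_format]
lemmas fan_adj = fan[unfolded fan_def, THEN conjunct2, THEN conjunct2, THEN conjunct2, THEN conjunct2, THEN conjunct2, THEN conjunct2, THEN conjunct2, THEN conjunct2, THEN conjunct2, THEN conjunct1, rule_format]
lemmas fan_face = fan[unfolded fan_def, THEN conjunct2, THEN conjunct2, THEN conjunct2, THEN conjunct2, THEN conjunct2, THEN conjunct2, THEN conjunct2, THEN conjunct2, THEN conjunct2, THEN conjunct2, THEN conjunct1, rule_format, THEN conjunct1]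
lemmas fan_J_sub = fan[unfolded fan_def, THEN conjunct2, THEN conjunct2, THEN conjunct2, THEN conjunct2, THEN conjunct2, THEN conjunct2, THEN conjunct2, THEN conjunct2, THEN conjunct2, THEN conjunct2, THEN conjunct1, rule_format, THEN conjunct2]
lemmas fan_J_disj = fan[unfolded fan_def, THEN conjunct2, THEN conjunct2, THEN conjunct2, THEN conjunct2, THEN conjunct2, THEN conjunct2, THEN conjunct2, THEN conjunct2, THEN conjunct2, THEN conjunct2, THEN conjunct2, THEN conjunct1, rule_format]
lemmas fan_inner_J = fan[unfolded fan_def, THEN conjunct2, THEN conjunct2, THEN conjunct2, THEN conjunct2, THEN conjunct2, THEN conjunct2, THEN conjunct2, THEN conjunct2, THEN conjunct2, THEN conjunct2, THEN conjunct2, THEN conjunct2, rule_format]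

lemma fan_in: "t \<le> length C \<Longrightarrow> d \<le> n + 1 \<Longrightarrow> sp t d \<in> I"
proof -
  assume a: "t \<le> length C" "d \<le> n + 1"
  have "sp t d \<in> I" if "t < length C" "d \<noteq> 0" for t
    using fan_inner[of t d] that a(2) by auto
  moreover have "sp t 0 \<in> I" using fan_centre[OF a(1)] fan_centre_in by simp
  ultimately show "sp t d \<in> I" using a fan_len fan_wrap
    by (metis le_neq_implies_less less_le_trans zero_less_numeral)
qed

lemma fan_tip': "t \<le> length C \<Longrightarrow> sp t (n + 2) = C ! (t mod length C)"
proof (cases "t = length C")
  case True
  have "0 < length C" using fan_len by linarith
  then show ?thesis using fan_tip[of 0] fan_wrap[of "n + 2"] True by simp
next
  case False
  assume "t \<le> length C"
  then show ?thesis using False fan_tip[of t] by simp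
qed

lemma fan_tip_notin: "t \<le> length C \<Longrightarrow> sp t (n + 2) \<notin> I"
proof -
  assume "t \<le> length C"
  have "C ! (t mod length C) \<in> set C" using fan_len by (intro nth_mem) (auto intro: mod_less_divisor)
  then show ?thesis using fan_disj fan_tip'[OF \<open>t \<le> length C\<close>] by auto
qed

lemma fan_notin_J: "t < length C \<Longrightarrow> t' \<le> length C \<Longrightarrow> d \<le> n + 2 \<Longrightarrow> sp t' d \<notin> J t"
proof (cases "d = n + 2")
  case True
  assume "t < length C" "t' \<le> length C"
  then show ?thesis using True fan_tip_notin fan_J_sub by blast
next
  case False
  assume "t < length C" "t' \<le> length C" "d \<le> n + 2"
  moreover have "d \<le> n + 1" using False \<open>d \<le> n + 2\<close> by simp
  ultimately show ?thesis using fan_inner_J by blast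
qed

lemma fan_inj0:
  assumes "t < length C" "t' < length C" "1 \<le> d" "d \<le> n + 2" "1 \<le> d'" "d' \<le> n + 2" "sp t d = sp t' d'"
  shows "t = t' \<and> d = d'"
proof -
  have *: "sp t d \<noteq> sp t' (n + 2)" if "t < length C" "t' < length C" "d \<le> n + 1" for t t' d
    using fan_in[of t d] fan_tip_notin[of t'] that by force
  consider "d = n + 2" "d' = n + 2" | "d = n + 2" "d' \<le> n + 1" | "d \<le> n + 1" "d' = n + 2" | "d \<le> n + 1" "d' \<le> n + 1"
    using assms by linarith
  then show ?thesis
  proof cases
    case 1
    then have "C ! t = C ! t'" using assms fan_tip by simp
    moreover have "distinct C" by (rule fan_distinct)
    ultimately show ?thesis using assms 1 nth_eq_iff_index_eq by blast
  next
    case 2 then show ?thesis using *[of t' t d'] assms by simp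
  next
    case 3 then show ?thesis using *[of t t' d] assms by simp
  next
    case 4 then show ?thesis using fan_inner_inj[of t t' d d'] assms by auto
  qed
qed

text \<open>Counts the spokes from 1 to \<open>length C\<close>, where spoke \<open>length C\<close>
  stands for spoke 0. A spiral that ends next to sector 0 needs this numbering, since it may start
  on the last spoke.\<close>

lemma fan_inj:
  assumes "1 \<le> t" "t \<le> length C" "1 \<le> t'" "t' \<le> length C" "1 \<le> d" "d \<le> n + 2" "1 \<le> d'" "d' \<le> n + 2"
    and "sp t d = sp t' d'"
  shows "t = t' \<and> d = d'"
proof -
  let ?r = "\<lambda>t. if t = length C then 0 else t"
  have "sp (?r t) d = sp (?r t') d'" using assms fan_wrap by auto
  then have "?r t = ?r t' \<and> d = d'"
    by (intro fan_inj0) (use assms fan_len in auto)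
  then show ?thesis using assms by (auto split: if_splits)
qed

lemma fan_centre_neq: "t \<le> length C \<Longrightarrow> 1 \<le> d \<Longrightarrow> d \<le> n + 2 \<Longrightarrow> sp t d \<noteq> sp 0 0"
proof -
  assume a: "t \<le> length C" "1 \<le> d" "d \<le> n + 2"
  show ?thesis
  proof (cases "d = n + 2")
    case True then show ?thesis using fan_tip_notin[OF a(1)] fan_centre_in by auto
  next
    case False
    have "sp t d \<noteq> sp 0 0" if "t < length C" for t
      using fan_inner[of t d] that a False by auto
    then show ?thesis using a fan_wrap fan_len
      by (metis le_neq_implies_less less_le_trans zero_less_numeral)
  qed
qed

text \<open>The mirror image of a fan: spoke 0 stays, spoke \<open>t\<close> is exchanged with spoke
  \<open>length C - t\<close>, and sector \<open>t\<close> with sector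
  \<open>length C - 1 - t\<close>. It lets \<open>ear_step\<close> treat the second side of an ear
  by the argument for the first.\<close>

lemma fan_reverse:
  "fan adj face n (hd C # rev (tl C)) I (\<lambda>t. sp (length C - t)) (\<lambda>t. J (length C - 1 - t))"
proof -
  let ?k = "length C"
  let ?C = "hd C # rev (tl C)"
  have C: "C \<noteq> []" using fan_len by auto
  have len: "length ?C = ?k" using C by simp
  have nthC: "?C ! t = C ! ((?k - t) mod ?k)" if "t < ?k" for t
  proof (cases "t = 0")
    case True then show ?thesis using C by (simp add: hd_conv_nth)
  next
    case False
    then have "rev (tl C) ! (t - 1) = tl C ! (?k - 1 - Suc (t - 1))"
      using that by (subst rev_nth) auto
    also have "\<dots> = C ! (?k - t)" using False that by (subst nth_tl) (auto simp: Suc_diff_Suc)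
    finally show ?thesis using False that by (simp add: nth_Cons')
  qed
  have fc: "face (n + 1) (sector n (sp (?k - t)) (sp (?k - Suc t))) (J (?k - 1 - t))" if "t < ?k" for t
  proof -
    let ?s = "?k - Suc t"
    have s: "?s < ?k" "Suc ?s = ?k - t" "?k - 1 - t = ?s" using that by auto
    have "sector n (sp (?k - t)) (sp ?s) = rotate (2 * n + 4) (rev (sector n (sp ?s) (sp (?k - t))))"
      by (rule sector_swap) (metis diff_le_self fan_centre)
    then show ?thesis using fan_face[OF s(1)] s face_rotate face_rev by metis
  qed
  have 4: "distinct ?C" using fan_distinct C by (cases C) auto
  have 5: "set ?C \<inter> I = {}" using fan_disj C by (cases C) auto
  have 6: "t = t' \<and> d = d'" if "t < ?k" "t' < ?k" "d \<in> {1..n + 1}" "d' \<in> {1..n + 1}"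
    "sp (?k - t) d = sp (?k - t') d'" for t t' d d'
  proof -
    have "?k - t = ?k - t' \<and> d = d'" by (rule fan_inj) (use that in auto)
    then show ?thesis using that by linarith
  qed
  have 7: "sp (?k - t) d \<in> I \<and> sp (?k - t) d \<noteq> sp (?k - 0) 0" if "t < ?k" "d \<in> {1..n + 1}" for t d
    using fan_in[of "?k - t" d] fan_centre_neq[of "?k - t" d] fan_centre[of "?k"] that by simp
  have 8: "J (?k - 1 - t) \<inter> J (?k - 1 - t') = {}" if "t < ?k" "t' < ?k" "t \<noteq> t'" for t t'
    by (rule fan_J_disj) (use that in auto)
  show ?thesis
    unfolding fan_def len
  proof (intro conjI allI impI ballI)
    show "3 \<le> ?k" by (rule fan_len)
    show "distinct ?C" "set ?C \<inter> I = {}" by (fact 4 5)+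
    show "sp (?k - t) 0 = sp (?k - 0) 0" for t using fan_centre[of "?k - t"] fan_centre[of "?k"] by simp
    show "sp (?k - ?k) d = sp (?k - 0) d" for d using fan_wrap by simp
    show "sp (?k - 0) 0 \<in> I" using fan_centre[of "?k"] fan_centre_in by simp
    show "sp (?k - t) (n + 2) = ?C ! t" if "t < ?k" for t
      using nthC[OF that] fan_tip'[of "?k - t"] by simp
    show "sp (?k - t) d \<in> I" "sp (?k - t) d \<noteq> sp (?k - 0) 0" if "t < ?k" "d \<in> {1..n + 1}" for t d
      using 7[OF that] by auto
    show "t = t'" "d = d'" if "t < ?k" "t' < ?k" "d \<in> {1..n + 1}" "d' \<in> {1..n + 1}"
      "sp (?k - t) d = sp (?k - t') d'" for t t' d d'
      using 6[OF that] by auto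
    show "adj (sp (?k - t) d) (sp (?k - t) (Suc d))" if "d \<le> n + 1" for t d
      using fan_adj[of "?k - t" d] that by simp
    show "face (n + 1) (sector n (sp (?k - t)) (sp (?k - Suc t))) (J (?k - 1 - t))" if "t < ?k" for t
      by (rule fc[OF that])
    show "J (?k - 1 - t) \<subseteq> I" if "t < ?k" for t using fan_J_sub that by simp
    show "J (?k - 1 - t) \<inter> J (?k - 1 - t') = {}" if "t < ?k" "t' < ?k" "t \<noteq> t'" for t t'
      by (rule 8[OF that])
    show "sp (?k - t') d \<notin> J (?k - 1 - t)" if "t < ?k" "d \<le> n + 1" for t t' d
      using fan_notin_J[of "?k - 1 - t" "?k - t'" d] that by auto
  qed
qed

end

text \<open>Nested pairs of rim vertices are joined by disjoint connected sets. The outermost pair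
  is joined through the centre along its own two spokes. Every other set \<open>i\<close> crosses
  the spokes strictly between its ends at depth \<open>i\<close>; between two neighbouring spokes
  this is again a nested problem, in a sector of the next level and with fewer pairs, since the
  outermost one is gone. The indices range over the inner depths of a spoke.\<close>

lemma parallel_linkage:
  assumes "finite S" "face n C I" "S \<subseteq> {1..n + 1}"
    and "\<And>i. i \<in> S \<Longrightarrow> a i < b i \<and> b i < length C"
    and "\<And>i j. i \<in> S \<Longrightarrow> j \<in> S \<Longrightarrow> i < j \<Longrightarrow> a i < a j \<and> b j < b i"
  shows "\<exists>X. (\<forall>i\<in>S. conn adj (X i) \<and> C ! a i \<in> X i \<and> C ! b i \<in> X i \<and> X i \<subseteq> I \<union> {C ! a i, C ! b i}) \<and>
    (\<forall>i\<in>S. \<forall>j\<in>S. i \<noteq> j \<longrightarrow> X i \<inter> X j = {})"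
  using assms
proof (induction "card S" arbitrary: S n C I a b rule: less_induct)
  case (less S n C I a b)
  show ?case
  proof (cases "S = {}")
    case True then show ?thesis by simp
  next
  case False
  obtain sp J where fan: "fan adj face n C I sp J" using face_fan[OF less.prems(2)] by blast
  note f = fan_notin_J[OF fan] fan_inj0[OF fan] fan_centre_neq[OF fan]
  define m where "m = Min S"
  define S' where "S' = S - {m}"
  have m: "m \<in> S" using False less.prems(1) by (simp add: m_def)
  have m_less: "m < i" if "i \<in> S'" for i
  proof -
    have "m \<le> i" "m \<noteq> i" using that less.prems(1) by (auto simp: S'_def m_def)
    then show ?thesis by simp
  qed
  have S': "card S' < card S" "finite S'" "S' \<subseteq> S"
    using card_Diff1_less[OF less.prems(1) m] less.prems(1) by (auto simp: S'_def)
  have depth: "1 \<le> i" "i \<le> n + 1" if "i \<in> S" for i using less.prems(3) that by auto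
  have ab: "a i < b i" "b i < length C" if "i \<in> S" for i using less.prems(4) that by auto
  have mono: "a i < a j" "b j < b i" if "i \<in> S" "j \<in> S" "i < j" for i j
    using less.prems(5) that by auto
  \<comment> \<open>\<open>A s\<close> are the connections that pass sector \<open>s\<close>. They
    enter it at depth \<open>en\<close> on spoke \<open>s\<close> and leave it at depth
    \<open>ex\<close> on the next spoke: the rim depth \<open>n + 2\<close> where the connection
    starts or ends, its own depth elsewhere.\<close>
  define A where "A s = {i \<in> S'. a i \<le> s \<and> s < b i}" for s
  define en where "en s i = (if a i = s then n + 2 else i)" for s i
  define ex where "ex s i = (if b i = Suc s then n + 2 else i)" for s i
  have rng: "1 \<le> en s i" "en s i \<le> n + 2" "1 \<le> ex s i" "ex s i \<le> n + 2" if "i \<in> S" for s i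
    using depth[OF that] by (auto simp: en_def ex_def)
  have "\<exists>Y. (\<forall>i\<in>A s. conn adj (Y i) \<and> sp s (en s i) \<in> Y i \<and> sp (Suc s) (ex s i) \<in> Y i \<and>
        Y i \<subseteq> J s \<union> {sp s (en s i), sp (Suc s) (ex s i)}) \<and>
      (\<forall>i\<in>A s. \<forall>j\<in>A s. i \<noteq> j \<longrightarrow> Y i \<inter> Y j = {})" if s: "s < length C" for s
  proof -
    let ?Q = "sector n (sp s) (sp (Suc s))"
    have AS: "i \<in> S" "a i \<le> s" "s < b i" "b i < length C" if "i \<in> A s" for i
      using that S' ab by (auto simp: A_def)
    have fin: "finite (A s)" using S' by (auto simp: A_def)
    have cA: "card (A s) < card S" using S' card_mono[of S' "A s"] by (fastforce simp: A_def)
    have sub: "A s \<subseteq> {1..n + 1 + 1}" using AS depth by fastforce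
    have q: "?Q ! en s i = sp s (en s i)" "?Q ! (2 * n + 5 - ex s i) = sp (Suc s) (ex s i)" if "i \<in> A s" for i
      using sector_nth_left sector_nth_right rng[OF AS(1)[OF that]] by metis+
    have ord: "en s i < 2 * n + 5 - ex s i \<and> 2 * n + 5 - ex s i < length ?Q" if "i \<in> A s" for i
      using rng[OF AS(1)[OF that], of s] by simp
    have mon: "en s i < en s j \<and> 2 * n + 5 - ex s j < 2 * n + 5 - ex s i"
      if "i \<in> A s" "j \<in> A s" "i < j" for i j
      using mono[OF AS(1)[OF that(1)] AS(1)[OF that(2)] that(3)] AS(2,3)[OF that(1)] AS(2,3)[OF that(2)]
        depth[OF AS(1)[OF that(1)]] depth[OF AS(1)[OF that(2)]] that(3)
      unfolding en_def ex_def by auto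
    have "\<exists>X. (\<forall>i\<in>A s. conn adj (X i) \<and> ?Q ! en s i \<in> X i \<and> ?Q ! (2 * n + 5 - ex s i) \<in> X i \<and>
            X i \<subseteq> J s \<union> {?Q ! en s i, ?Q ! (2 * n + 5 - ex s i)}) \<and>
        (\<forall>i\<in>A s. \<forall>j\<in>A s. i \<noteq> j \<longrightarrow> X i \<inter> X j = {})"
      by (rule less.hyps[OF cA fin fan_face[OF fan s] sub ord mon])
    then obtain Y where "(\<forall>i\<in>A s. conn adj (Y i) \<and> ?Q ! en s i \<in> Y i \<and> ?Q ! (2 * n + 5 - ex s i) \<in> Y i \<and>
            Y i \<subseteq> J s \<union> {?Q ! en s i, ?Q ! (2 * n + 5 - ex s i)})"
        "(\<forall>i\<in>A s. \<forall>j\<in>A s. i \<noteq> j \<longrightarrow> Y i \<inter> Y j = {})" by blast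
    then show ?thesis using q by (intro exI[of _ Y]) simp
  qed
  then obtain Y where Y: "\<And>s i. s < length C \<Longrightarrow> i \<in> A s \<Longrightarrow> conn adj (Y s i) \<and> sp s (en s i) \<in> Y s i \<and>
        sp (Suc s) (ex s i) \<in> Y s i \<and> Y s i \<subseteq> J s \<union> {sp s (en s i), sp (Suc s) (ex s i)}"
      "\<And>s i j. s < length C \<Longrightarrow> i \<in> A s \<Longrightarrow> j \<in> A s \<Longrightarrow> i \<noteq> j \<Longrightarrow> Y s i \<inter> Y s j = {}"
    by metis
  define X where "X i = (if i = m then sp (a m) ` {0..n + 2} \<union> sp (b m) ` {0..n + 2}
     else (\<Union>s\<in>{a i..b i - 1}. Y s i))" for i
  have inA: "i \<in> A s" "s < length C" "Suc s < length C" if "i \<in> S'" "s \<in> {a i..b i - 1}" for i s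
    using that S' ab[of i] by (auto simp: A_def)
  have lt: "a i < length C" "b i < length C" if "i \<in> S" for i using ab[OF that] by auto
  \<comment> \<open>The spoke vertices touched by connection \<open>i\<close>. Sector interiors are
    disjoint from each other and from all spokes, so disjointness reduces to the induction
    hypothesis within one sector and to disjointness of these sets.\<close>
  define Pt where "Pt i = {sp t e | t e. ((t = a i \<or> t = b i) \<and> e = n + 2) \<or> (a i < t \<and> t < b i \<and> e = i)}" for i
  have Ysub: "Y s i \<subseteq> J s \<union> Pt i" if "i \<in> S'" "s \<in> {a i..b i - 1}" for i s
  proof -
    have i: "i \<in> S" using that S' by auto
    have "sp s (en s i) \<in> Pt i"
    proof (cases "a i = s")
      case False
      then show ?thesis using that ab[OF i] unfolding Pt_def en_def by (intro CollectI exI[of _ s] exI[of _ i]) auto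
    qed (auto simp: en_def Pt_def)
    moreover have "sp (Suc s) (ex s i) \<in> Pt i"
    proof (cases "b i = Suc s")
      case False
      then show ?thesis using that ab[OF i] unfolding Pt_def ex_def by (intro CollectI exI[of _ "Suc s"] exI[of _ i]) auto
    next
      case True
      then show ?thesis unfolding Pt_def ex_def by (intro CollectI exI[of _ "Suc s"] exI[of _ "n + 2"]) auto
    qed
    ultimately show ?thesis using Y(1)[OF inA(2)[OF that] inA(1)[OF that]] by blast
  qed
  have tip: "C ! t = sp t (n + 2)" if "t < length C" for t using fan_tip[OF fan that] by simp
  have PtE: "\<exists>t e. x = sp t e \<and> 1 \<le> e \<and> e \<le> n + 2 \<and> t < length C \<and> a i \<le> t \<and> t \<le> b i \<and>
      (((t = a i \<or> t = b i) \<and> e = n + 2) \<or> (a i < t \<and> t < b i \<and> e = i))" if "x \<in> Pt i" "i \<in> S" for x i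
    using that depth[OF that(2)] ab[OF that(2)] unfolding Pt_def by fastforce
  have PtJ: "Pt i \<inter> J s = {}" if "i \<in> S" "s < length C" for i s
    using PtE[OF _ that(1)] f(1)[OF that(2)] by fastforce
  have PtPt: "Pt i \<inter> Pt j = {}" if ij: "i \<in> S" "j \<in> S" "i < j" for i j
  proof (rule ccontr)
    assume "Pt i \<inter> Pt j \<noteq> {}"
    then obtain x where x: "x \<in> Pt i" "x \<in> Pt j" by blast
    obtain t e where 1: "x = sp t e" "1 \<le> e" "e \<le> n + 2" "t < length C"
      "((t = a i \<or> t = b i) \<and> e = n + 2) \<or> (a i < t \<and> t < b i \<and> e = i)"
      using PtE[OF x(1) ij(1)] by blast
    obtain t' e' where 2: "x = sp t' e'" "1 \<le> e'" "e' \<le> n + 2" "t' < length C" "a j \<le> t'" "t' \<le> b j"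
      "((t' = a j \<or> t' = b j) \<and> e' = n + 2) \<or> (a j < t' \<and> t' < b j \<and> e' = j)"
      using PtE[OF x(2) ij(2)] by blast
    note * = 1 2
    have "t = t'" "e = e'" using f(2)[of t t' e e'] 1 2 by auto
    then show False using * mono[OF ij] depth[OF ij(1)] depth[OF ij(2)] ij(3) ab[OF ij(1)] by auto
  qed
  have XmPt: "X m \<inter> Pt i = {}" if "i \<in> S'" for i
  proof (rule ccontr)
    assume "X m \<inter> Pt i \<noteq> {}"
    then obtain x where x: "x \<in> X m" "x \<in> Pt i" by blast
    have i: "i \<in> S" using that S' by auto
    obtain t e where te: "x = sp t e" "1 \<le> e" "e \<le> n + 2" "t < length C" "a i \<le> t" "t \<le> b i"
      using PtE[OF x(2) i] by blast
    obtain t' e' where te': "x = sp t' e'" "e' \<le> n + 2" "t' = a m \<or> t' = b m" using x(1) by (auto simp: X_def)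
    have t': "t' < length C" using te'(3) lt[OF m] by auto
    have "e' \<noteq> 0"
    proof
      assume "e' = 0"
      then have "sp t e = sp 0 0" using te te' fan_centre[OF fan, of t'] t' by simp
      then show False using f(3)[of t e] te by simp
    qed
    then have "t = t'" using f(2)[of t t' e e'] te te' t' by auto
    then show False using mono[OF m i m_less[OF that]] te te' by auto
  qed
  have XmJ: "X m \<inter> J s = {}" if "s < length C" for s
    using f(1)[OF that] lt[OF m] by (auto simp: X_def less_imp_le)
  have Xsub: "X i \<subseteq> (\<Union>s\<in>{a i..b i - 1}. J s) \<union> Pt i" if "i \<in> S'" for i
  proof -
    have "X i = (\<Union>s\<in>{a i..b i - 1}. Y s i)" using that by (auto simp: X_def S'_def)
    then show ?thesis using Ysub[OF that] by blast
  qed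
  have XmX: "X m \<inter> X i = {}" if "i \<in> S'" for i
    using XmPt[OF that] XmJ Xsub[OF that] inA(2)[OF that] by blast
  have XX: "X i \<inter> X j = {}" if "i \<in> S'" "j \<in> S'" "i < j" for i j
  proof -
    have ij: "i \<in> S" "j \<in> S" "i \<noteq> m" "j \<noteq> m" using that S' by (auto simp: S'_def)
    have "Y s i \<inter> Y s' j = {}" if s: "s \<in> {a i..b i - 1}" and s': "s' \<in> {a j..b j - 1}" for s s'
    proof (cases "s = s'")
      case True
      then show ?thesis using Y(2)[of s i j] inA[OF \<open>i \<in> S'\<close> s] inA[OF \<open>j \<in> S'\<close> s'] \<open>i < j\<close> by auto
    next
      case False
      have "J s \<inter> J s' = {}" using fan_J_disj[OF fan] False inA(2)[OF \<open>i \<in> S'\<close> s] inA(2)[OF \<open>j \<in> S'\<close> s'] by blast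
      then show ?thesis
        using Ysub[OF \<open>i \<in> S'\<close> s] Ysub[OF \<open>j \<in> S'\<close> s'] PtPt[OF ij(1,2) \<open>i < j\<close>]
          PtJ[OF ij(1) inA(2)[OF \<open>j \<in> S'\<close> s']] PtJ[OF ij(2) inA(2)[OF \<open>i \<in> S'\<close> s]] by blast
    qed
    moreover have "X i = (\<Union>s\<in>{a i..b i - 1}. Y s i)" "X j = (\<Union>s\<in>{a j..b j - 1}. Y s j)"
      using ij by (auto simp: X_def)
    ultimately show ?thesis by blast
  qed
  have "X i \<inter> X j = {}" if ij: "i \<in> S" "j \<in> S" "i \<noteq> j" for i j
  proof -
    consider "i = m" "j \<in> S'" | "j = m" "i \<in> S'" | "i \<in> S'" "j \<in> S'" "i < j" | "i \<in> S'" "j \<in> S'" "j < i"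
      using ij unfolding S'_def by (metis DiffI linorder_neqE_nat singletonD)
    then show ?thesis using XmX XX by cases blast+
  qed
  moreover have "conn adj (X i) \<and> C ! a i \<in> X i \<and> C ! b i \<in> X i \<and> X i \<subseteq> I \<union> {C ! a i, C ! b i}" if "i \<in> S" for i
  proof (cases "i = m")
    case True
    have lm: "a m \<le> length C" "b m \<le> length C" using lt[OF m] by auto
    have w: "conn adj (sp t ` {0..n + 2})" if "t \<le> length C" for t
      by (rule conn_walk) (use fan_adj[OF fan that] adj_sym in auto)
    have "sp (a m) 0 = sp (b m) 0" using fan_centre[OF fan lm(1)] fan_centre[OF fan lm(2)] by simp
    then have "sp (a m) ` {0..n + 2} \<inter> sp (b m) ` {0..n + 2} \<noteq> {}"
      by (metis IntI atLeastAtMost_iff empty_iff image_eqI le0)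
    then have "conn adj (X m)" using conn_Un_Int[OF w[OF lm(1)] w[OF lm(2)]] by (simp add: X_def)
    moreover have "C ! a m \<in> X m" "C ! b m \<in> X m" using tip lt[OF m] by (auto simp: X_def)
    moreover have "X m \<subseteq> I \<union> {C ! a m, C ! b m}"
    proof
      fix x assume "x \<in> X m"
      then obtain t e where te: "x = sp t e" "e \<le> n + 2" "t = a m \<or> t = b m" by (auto simp: X_def)
      then show "x \<in> I \<union> {C ! a m, C ! b m}"
        using tip[of t] lt[OF m] fan_in[OF fan, of t e] lm by (cases "e = n + 2") auto
    qed
    ultimately show ?thesis using True by simp
  next
    case False
    then have i: "i \<in> S'" using that by (simp add: S'_def)
    have Xi: "X i = (\<Union>s\<in>{a i..b i - 1}. Y s i)" using False by (simp add: X_def)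
    have "conn adj (X i)" unfolding Xi
    proof (rule conn_Union_chain)
      show "a i \<le> b i - 1" using ab[OF that] by simp
      show "conn adj (Y s i)" if "a i \<le> s" "s \<le> b i - 1" for s
        using Y(1)[OF inA(2,1)[OF i]] that by auto
      show "Y s i \<inter> Y (Suc s) i \<noteq> {}" if s: "a i \<le> s" "s < b i - 1" for s
      proof -
        have "sp (Suc s) (ex s i) \<in> Y s i" using Y(1)[OF inA(2,1)[OF i, of s]] s by auto
        moreover have "sp (Suc s) (en (Suc s) i) \<in> Y (Suc s) i"
          using Y(1)[OF inA(2,1)[OF i, of "Suc s"]] s by auto
        moreover have "ex s i = en (Suc s) i" using s by (auto simp: ex_def en_def)
        ultimately show ?thesis by auto
      qed
    qed
    moreover have "C ! a i \<in> X i"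
    proof -
      have "sp (a i) (en (a i) i) \<in> Y (a i) i" using Y(1)[OF inA(2,1)[OF i, of "a i"]] ab[OF that] by auto
      then show ?thesis using tip[OF lt(1)[OF that]] ab[OF that] by (auto simp: Xi en_def)
    qed
    moreover have "C ! b i \<in> X i"
    proof -
      have "sp (Suc (b i - 1)) (ex (b i - 1) i) \<in> Y (b i - 1) i"
        using Y(1)[OF inA(2,1)[OF i, of "b i - 1"]] ab[OF that] by auto
      moreover have "Suc (b i - 1) = b i" using ab[OF that] by simp
      ultimately have "C ! b i \<in> Y (b i - 1) i" using tip[OF lt(2)[OF that]] by (auto simp: ex_def)
      then show ?thesis using ab[OF that] unfolding Xi by (intro UN_I[of "b i - 1"]) auto
    qed
    moreover have "X i \<subseteq> I \<union> {C ! a i, C ! b i}"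
    proof -
      have "Pt i \<subseteq> I \<union> {C ! a i, C ! b i}"
      proof
        fix x assume "x \<in> Pt i"
        then show "x \<in> I \<union> {C ! a i, C ! b i}"
          using PtE[OF _ that, of x] tip fan_in[OF fan] depth[OF that] by (metis UnCI insertCI less_imp_le)
      qed
      moreover have "J s \<subseteq> I" if "s \<in> {a i..b i - 1}" for s using fan_J_sub[OF fan inA(2)[OF i that]] .
      ultimately show ?thesis using Xsub[OF i] by blast
    qed
    ultimately show ?thesis by simp
  qed
  ultimately show ?thesis by (intro exI[of _ X]) blast
  qed
qed

text \<open>Set \<open>j\<close> runs inwards along spoke \<open>t j\<close> to depth
  \<open>j\<close> and then crosses all lower spokes at this depth down to spoke 1. A start further
  away gets a smaller depth and so passes closer to the centre than the sets that join later. The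
  last inclusion records that only the sectors 1 to \<open>q - 1\<close> are entered; sector 0 and
  those from \<open>q\<close> on stay empty.\<close>

lemma spiral:
  assumes fan: "fan adj face n C I sp J" and q: "q \<le> length C"
    and M: "finite M" "M \<subseteq> {1..n + 1}"
    and t: "\<And>j. j \<in> M \<Longrightarrow> 1 \<le> t j \<and> t j \<le> q"
    and mono: "\<And>i j. i \<in> M \<Longrightarrow> j \<in> M \<Longrightarrow> i < j \<Longrightarrow> t j < t i"
  shows "\<exists>X. (\<forall>j\<in>M. conn adj (X j) \<and> sp (t j) (n + 2) \<in> X j \<and> sp 1 j \<in> X j \<and>
      X j \<subseteq> insert (sp (t j) (n + 2)) I \<and>
      X j \<subseteq> {sp s d | s d. 1 \<le> s \<and> s \<le> q \<and> 1 \<le> d \<and> d \<le> n + 2} \<union> (\<Union>s\<in>{1..<q}. J s)) \<and>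
    (\<forall>i\<in>M. \<forall>j\<in>M. i \<noteq> j \<longrightarrow> X i \<inter> X j = {})"
proof -
  have dep: "1 \<le> j" "j \<le> n + 1" if "j \<in> M" for j using M that by auto
  define A where "A s = {j \<in> M. s < t j}" for s
  have "\<exists>Y. (\<forall>j\<in>A s. conn adj (Y j) \<and> sp s j \<in> Y j \<and> sp (Suc s) j \<in> Y j \<and>
        Y j \<subseteq> J s \<union> {sp s j, sp (Suc s) j}) \<and>
      (\<forall>i\<in>A s. \<forall>j\<in>A s. i \<noteq> j \<longrightarrow> Y i \<inter> Y j = {})" if s: "s < length C" for s
  proof -
    let ?Q = "sector n (sp s) (sp (Suc s))"
    have e: "?Q ! j = sp s j" "?Q ! (2 * n + 5 - j) = sp (Suc s) j" if "j \<in> A s" for j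
      using that dep[of j] sector_nth_left[of j n] sector_nth_right[of j n] by (auto simp: A_def)
    have "\<exists>Y. (\<forall>j\<in>A s. conn adj (Y j) \<and> ?Q ! j \<in> Y j \<and> ?Q ! (2 * n + 5 - j) \<in> Y j \<and>
        Y j \<subseteq> J s \<union> {?Q ! j, ?Q ! (2 * n + 5 - j)}) \<and>
      (\<forall>i\<in>A s. \<forall>j\<in>A s. i \<noteq> j \<longrightarrow> Y i \<inter> Y j = {})"
    proof (rule parallel_linkage[OF _ fan_face[OF fan s]])
      show "finite (A s)" "A s \<subseteq> {1..n + 1 + 1}" using M by (auto simp: A_def)
      show "j < 2 * n + 5 - j \<and> 2 * n + 5 - j < length ?Q" if "j \<in> A s" for j
        using that dep[of j] by (auto simp: A_def)
      show "i < j \<and> 2 * n + 5 - j < 2 * n + 5 - i" if "i \<in> A s" "j \<in> A s" "i < j" for i j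
        using that dep[of i] dep[of j] by (auto simp: A_def)
    qed
    then obtain Y where "\<forall>j\<in>A s. conn adj (Y j) \<and> ?Q ! j \<in> Y j \<and> ?Q ! (2 * n + 5 - j) \<in> Y j \<and>
        Y j \<subseteq> J s \<union> {?Q ! j, ?Q ! (2 * n + 5 - j)}"
      "\<forall>i\<in>A s. \<forall>j\<in>A s. i \<noteq> j \<longrightarrow> Y i \<inter> Y j = {}" by blast
    then show ?thesis using e by (intro exI[of _ Y]) simp
  qed
  then obtain Y where Y: "\<And>s j. s < length C \<Longrightarrow> j \<in> A s \<Longrightarrow> conn adj (Y s j) \<and> sp s j \<in> Y s j \<and>
        sp (Suc s) j \<in> Y s j \<and> Y s j \<subseteq> J s \<union> {sp s j, sp (Suc s) j}"
      "\<And>s i j. s < length C \<Longrightarrow> i \<in> A s \<Longrightarrow> j \<in> A s \<Longrightarrow> i \<noteq> j \<Longrightarrow> Y s i \<inter> Y s j = {}"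
    by metis
  define X where "X j = sp (t j) ` {j..n + 2} \<union> (\<Union>s\<in>{1..<t j}. Y s j)" for j
  \<comment> \<open>The part of the inward stretch and of the crossing points that lies on spokes;
    as in \<open>parallel_linkage\<close>, disjointness is checked on these vertices and sector by
    sector.\<close>
  define Q where "Q j = {sp s e | s e. 1 \<le> s \<and> s \<le> t j \<and> j \<le> e \<and> e \<le> n + 2 \<and> (s = t j \<or> e = j)}" for j
  have sA: "j \<in> A s" "s < length C" if "j \<in> M" "s \<in> {1..<t j}" for j s
    using that t[of j] q by (auto simp: A_def)
  have Ysub: "Y s j \<subseteq> J s \<union> Q j" if "j \<in> M" "s \<in> {1..<t j}" for j s
  proof -
    have "sp s j \<in> Q j" "sp (Suc s) j \<in> Q j"
      using that dep[of j] unfolding Q_def by fastforce+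
    then show ?thesis using Y(1)[OF sA(2)[OF that] sA(1)[OF that]] by blast
  qed
  have spQ: "sp (t j) ` {j..n + 2} \<subseteq> Q j" if "j \<in> M" for j
  proof -
    have "sp (t j) e \<in> Q j" if "j \<le> e" "e \<le> n + 2" for e
      using t[OF \<open>j \<in> M\<close>] that unfolding Q_def by (intro CollectI exI[of _ "t j"] exI[of _ e]) simp
    then show ?thesis by (auto simp del: One_nat_def)
  qed
  have XQ: "X j \<subseteq> (\<Union>s\<in>{1..<t j}. J s) \<union> Q j" if "j \<in> M" for j
  proof -
    have "sp (t j) ` {j..n + 2} \<subseteq> Q j" using spQ[OF that] .
    then show ?thesis using Ysub[OF that] unfolding X_def by blast
  qed
  have QQ: "Q i \<inter> Q j = {}" if "i \<in> M" "j \<in> M" "i < j" for i j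
  proof -
    have False if x: "x \<in> Q i" "x \<in> Q j" for x
    proof -
      obtain s e where 1: "x = sp s e" "1 \<le> s" "s \<le> t i" "i \<le> e" "e \<le> n + 2" "s = t i \<or> e = i"
        using x(1) by (auto simp: Q_def)
      obtain s' e' where 2: "x = sp s' e'" "1 \<le> s'" "s' \<le> t j" "j \<le> e'" "e' \<le> n + 2" "s' = t j \<or> e' = j"
        using x(2) by (auto simp: Q_def)
      have "s = s' \<and> e = e'"
        by (rule fan_inj[OF fan]) (use 1 2 t[OF \<open>i \<in> M\<close>] t[OF \<open>j \<in> M\<close>] q dep(1)[OF \<open>i \<in> M\<close>] dep(1)[OF \<open>j \<in> M\<close>] in auto)
      then show False using 1 2 mono[OF \<open>i \<in> M\<close> \<open>j \<in> M\<close> \<open>i < j\<close>] \<open>i < j\<close> by auto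
    qed
    then show ?thesis by blast
  qed
  have QJ: "Q j \<inter> J s = {}" if "j \<in> M" "s < length C" for j s
    using fan_notin_J[OF fan that(2)] t[OF that(1)] q unfolding Q_def by fastforce
  have YY: "Y s i \<inter> Y s' j = {}" if ij: "i \<in> M" "j \<in> M" "i < j" and s: "s \<in> {1..<t i}" "s' \<in> {1..<t j}" for i j s s'
  proof (cases "s = s'")
    case True
    then show ?thesis using Y(2)[of s i j] sA[OF ij(1) s(1)] sA[OF ij(2) s(2)] ij by auto
  next
    case False
    have "J s \<inter> J s' = {}" using fan_J_disj[OF fan] False sA(2)[OF ij(1) s(1)] sA(2)[OF ij(2) s(2)] by blast
    then show ?thesis using Ysub[OF ij(1) s(1)] Ysub[OF ij(2) s(2)] QQ[OF ij]
      QJ[OF ij(1) sA(2)[OF ij(2) s(2)]] QJ[OF ij(2) sA(2)[OF ij(1) s(1)]] by blast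
  qed
  have XX: "X i \<inter> X j = {}" if ij: "i \<in> M" "j \<in> M" "i < j" for i j
  proof -
    note 1 = spQ[OF ij(1)] spQ[OF ij(2)]
    have 2: "Q i \<inter> Y s j = {}" if "s \<in> {1..<t j}" for s
      using Ysub[OF ij(2) that] QJ[OF ij(1) sA(2)[OF ij(2) that]] QQ[OF ij] by blast
    have 3: "Q j \<inter> Y s i = {}" if "s \<in> {1..<t i}" for s
      using Ysub[OF ij(1) that] QJ[OF ij(2) sA(2)[OF ij(1) that]] QQ[OF ij] by blast
    have 4: "sp (t i) ` {i..n + 2} \<inter> sp (t j) ` {j..n + 2} = {}" using 1 QQ[OF ij] by blast
    have 5: "sp (t i) ` {i..n + 2} \<inter> (\<Union>s\<in>{1..<t j}. Y s j) = {}" using 1(1) 2 by blast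
    have 6: "(\<Union>s\<in>{1..<t i}. Y s i) \<inter> sp (t j) ` {j..n + 2} = {}" using 1(2) 3 by blast
    have 7: "(\<Union>s\<in>{1..<t i}. Y s i) \<inter> (\<Union>s\<in>{1..<t j}. Y s j) = {}" using YY[OF ij] by blast
    show ?thesis unfolding X_def using 4 5 6 7 by blast
  qed
  have "conn adj (X j) \<and> sp (t j) (n + 2) \<in> X j \<and> sp 1 j \<in> X j" if j: "j \<in> M" for j
  proof -
    have tj: "1 \<le> t j" "t j \<le> length C" using t[OF j] q by auto
    have w: "conn adj (sp (t j) ` {j..n + 2})"
      by (rule conn_walk) (use fan_adj[OF fan tj(2)] adj_sym dep[OF j] in auto)
    show ?thesis
    proof (cases "t j = 1")
      case True
      then show ?thesis using w dep[OF j] by (auto simp: X_def)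
    next
      case False
      then have set: "{1..<t j} = {1..t j - 1}" using tj by auto
      have "conn adj (\<Union>s\<in>{1..t j - 1}. Y s j)"
      proof (rule conn_Union_chain)
        show "1 \<le> t j - 1" using False tj by simp
        show "conn adj (Y s j)" if "1 \<le> s" "s \<le> t j - 1" for s
          using Y(1)[OF sA(2,1)[OF j, of s]] that False tj by auto
        show "Y s j \<inter> Y (Suc s) j \<noteq> {}" if "1 \<le> s" "s < t j - 1" for s
        proof -
          have "sp (Suc s) j \<in> Y s j" using Y(1)[OF sA(2,1)[OF j, of s]] that by auto
          moreover have "sp (Suc s) j \<in> Y (Suc s) j" using Y(1)[OF sA(2,1)[OF j, of "Suc s"]] that by auto
          ultimately show ?thesis by blast
        qed
      qed
      moreover have "sp (t j) j \<in> Y (t j - 1) j"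
      proof -
        have "t j - 1 \<in> {1..<t j}" "Suc (t j - 1) = t j" using False tj by auto
        then show ?thesis using Y(1)[OF sA(2,1)[OF j, of "t j - 1"]] by metis
      qed
      then have "sp (t j) ` {j..n + 2} \<inter> (\<Union>s\<in>{1..t j - 1}. Y s j) \<noteq> {}"
      proof -
        have "sp (t j) j \<in> sp (t j) ` {j..n + 2}" using dep[OF j] by (intro imageI) auto
        moreover have "t j - 1 \<in> {1..t j - 1}" using False tj by auto
        ultimately show ?thesis using \<open>sp (t j) j \<in> Y (t j - 1) j\<close> by blast
      qed
      ultimately have "conn adj (X j)" unfolding X_def set using w by (metis conn_Un_Int)
      moreover have "sp 1 j \<in> Y 1 j" using Y(1)[OF sA(2,1)[OF j, of 1]] False tj by auto
      then have "sp 1 j \<in> X j" using False tj by (auto simp: X_def)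
      ultimately show ?thesis using dep[OF j] by (auto simp: X_def)
    qed
  qed
  moreover have "X j \<subseteq> {sp s d | s d. 1 \<le> s \<and> s \<le> q \<and> 1 \<le> d \<and> d \<le> n + 2} \<union> (\<Union>s\<in>{1..<q}. J s)" if j: "j \<in> M" for j
  proof -
    have "Q j \<subseteq> {sp s d | s d. 1 \<le> s \<and> s \<le> q \<and> 1 \<le> d \<and> d \<le> n + 2}"
    proof
      fix x assume "x \<in> Q j"
      then obtain s e where "x = sp s e" "1 \<le> s" "s \<le> t j" "j \<le> e" "e \<le> n + 2" by (auto simp: Q_def)
      then show "x \<in> {sp s d | s d. 1 \<le> s \<and> s \<le> q \<and> 1 \<le> d \<and> d \<le> n + 2}"
        using t[OF j] dep[OF j] by (intro CollectI exI[of _ s] exI[of _ e]) auto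
    qed
    moreover have "(\<Union>s\<in>{1..<t j}. J s) \<subseteq> (\<Union>s\<in>{1..<q}. J s)" using t[OF j] by (intro UN_mono) auto
    ultimately show ?thesis by (intro order_trans[OF XQ[OF j]] Un_least le_supI2 le_supI1)
  qed
  moreover have "X j \<subseteq> insert (sp (t j) (n + 2)) I" if j: "j \<in> M" for j
  proof -
    have "sp s e \<in> insert (sp (t j) (n + 2)) I" if "1 \<le> s" "s \<le> t j" "e \<le> n + 2" "s = t j \<or> e = j" for s e
      using that t[OF j] q dep[OF j] fan_in[OF fan, of s e] by (cases "e = n + 2") auto
    then have "Q j \<subseteq> insert (sp (t j) (n + 2)) I" by (auto simp: Q_def)
    moreover have "J s \<subseteq> I" if "s \<in> {1..<t j}" for s using fan_J_sub[OF fan sA(2)[OF j that]] .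
    ultimately show ?thesis using XQ[OF j] by blast
  qed
  moreover have "X i \<inter> X j = {}" if "i \<in> M" "j \<in> M" "i \<noteq> j" for i j
    using XX[of i j] XX[of j i] that by (cases "i < j") auto
  ultimately show ?thesis by (intro exI[of _ X]) blast
qed

text \<open>A spiral with depths assigned in reverse: the first label arrives at depth
  \<open>length A\<close>, the last one at depth 1. The boundary of sector 0 runs inwards along
  spoke 1, so it meets the labels in their original order.\<close>

lemma gather:
  fixes m :: "'h \<Rightarrow> 'v"
  assumes fan: "fan adj face n C I sp J" and q: "q \<le> length C"
    and A: "distinct A" "length A \<le> n + 1"
    and sub: "subseq (map m A) (map (\<lambda>t. sp t (n + 2)) [1..<Suc q])"
  shows "\<exists>X m'. (\<forall>a\<in>set A. conn adj (X a) \<and> m a \<in> X a \<and> m' a \<in> X a \<and> X a \<subseteq> insert (m a) I \<and>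
      X a \<subseteq> {sp s d | s d. 1 \<le> s \<and> s \<le> q \<and> 1 \<le> d \<and> d \<le> n + 2} \<union> (\<Union>s\<in>{1..<q}. J s)) \<and>
    (\<forall>a\<in>set A. \<forall>b\<in>set A. a \<noteq> b \<longrightarrow> X a \<inter> X b = {}) \<and>
    map m' A = map (sp 1) (rev [1..<Suc (length A)])"
proof -
  let ?r = "length A"
  obtain p where p: "\<And>i. i < ?r \<Longrightarrow> p i < q \<and> sp (Suc (p i)) (n + 2) = m (A ! i)"
    and pm: "\<And>i j. i < j \<Longrightarrow> j < ?r \<Longrightarrow> p i < p j"
  proof -
    from subseq_positions[OF sub] obtain p where
      a: "\<forall>i<length (map m A). p i < length (map (\<lambda>t. sp t (n + 2)) [1..<Suc q]) \<and>
         map (\<lambda>t. sp t (n + 2)) [1..<Suc q] ! p i = map m A ! i"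
      and b: "\<forall>i j. i < j \<longrightarrow> j < length (map m A) \<longrightarrow> p i < p j" by blast
    have "p i < q \<and> sp (Suc (p i)) (n + 2) = m (A ! i)" if "i < ?r" for i
      using a that by (auto simp del: upt_Suc)
    moreover have "p i < p j" if "i < j" "j < ?r" for i j using b that by simp
    ultimately show ?thesis by (rule that)
  qed
  obtain ix where ix: "\<And>i. i < ?r \<Longrightarrow> ix (A ! i) = i" using distinct_index[OF A(1)] by blast
  \<comment> \<open>Depth \<open>j\<close> belongs to the label with index \<open>?r - j\<close>.
    Positions in the list count from 0, spokes from 1.\<close>
  define t where "t j = Suc (p (?r - j))" for j
  have "\<exists>X. (\<forall>j\<in>{1..?r}. conn adj (X j) \<and> sp (t j) (n + 2) \<in> X j \<and> sp 1 j \<in> X j \<and>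
      X j \<subseteq> insert (sp (t j) (n + 2)) I \<and>
      X j \<subseteq> {sp s d | s d. 1 \<le> s \<and> s \<le> q \<and> 1 \<le> d \<and> d \<le> n + 2} \<union> (\<Union>s\<in>{1..<q}. J s)) \<and>
    (\<forall>i\<in>{1..?r}. \<forall>j\<in>{1..?r}. i \<noteq> j \<longrightarrow> X i \<inter> X j = {})"
  proof (rule spiral[OF fan q])
    show "finite {1..?r}" "{1..?r} \<subseteq> {1..n + 1}" using A by auto
    show "1 \<le> t j \<and> t j \<le> q" if "j \<in> {1..?r}" for j using p[of "?r - j"] that by (auto simp: t_def Suc_le_eq)
    show "t j < t i" if "i \<in> {1..?r}" "j \<in> {1..?r}" "i < j" for i j
      using pm[of "?r - j" "?r - i"] that by (auto simp: t_def)
  qed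
  then obtain X where X00: "(\<forall>j\<in>{1..?r}. conn adj (X j) \<and> sp (t j) (n + 2) \<in> X j \<and> sp 1 j \<in> X j \<and>
      X j \<subseteq> insert (sp (t j) (n + 2)) I \<and>
      X j \<subseteq> {sp s d | s d. 1 \<le> s \<and> s \<le> q \<and> 1 \<le> d \<and> d \<le> n + 2} \<union> (\<Union>s\<in>{1..<q}. J s)) \<and>
      (\<forall>i\<in>{1..?r}. \<forall>j\<in>{1..?r}. i \<noteq> j \<longrightarrow> X i \<inter> X j = {})" ..
  note X = bspec[OF X00[THEN conjunct1]] and XX0 = X00[THEN conjunct2]
  have D: "?r - ix a \<in> {1..?r} \<and> a = A ! ix a \<and> ix a < ?r \<and> sp (t (?r - ix a)) (n + 2) = m a" if a: "a \<in> set A" for a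
  proof -
    obtain i where i: "i < ?r" "a = A ! i" using a by (metis in_set_conv_nth)
    then have "ix a = i" using ix by simp
    moreover have "t (?r - i) = Suc (p i)" using i by (simp add: t_def)
    ultimately show ?thesis using i p[OF i(1)] by simp
  qed
  show ?thesis
  proof (intro exI[of _ "\<lambda>a. X (?r - ix a)"] exI[of _ "\<lambda>a. sp 1 (?r - ix a)"] conjI ballI impI)
    fix a assume a: "a \<in> set A"
    note j = D[OF a]
    note Xa = X[OF j[THEN conjunct1]]
    have ma: "sp (t (?r - ix a)) (n + 2) = m a" using j by simp
    show "conn adj (X (?r - ix a))" by (rule Xa[THEN conjunct1])
    show "m a \<in> X (?r - ix a)" using Xa[THEN conjunct2, THEN conjunct1] unfolding ma .
    show "sp 1 (?r - ix a) \<in> X (?r - ix a)" by (rule Xa[THEN conjunct2, THEN conjunct2, THEN conjunct1])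
    show "X (?r - ix a) \<subseteq> insert (m a) I"
      using Xa[THEN conjunct2, THEN conjunct2, THEN conjunct2, THEN conjunct1] unfolding ma .
    show "X (?r - ix a) \<subseteq> {sp s d | s d. 1 \<le> s \<and> s \<le> q \<and> 1 \<le> d \<and> d \<le> n + 2} \<union> (\<Union>s\<in>{1..<q}. J s)"
      by (rule Xa[THEN conjunct2, THEN conjunct2, THEN conjunct2, THEN conjunct2])
  next
    fix a b assume ab: "a \<in> set A" "b \<in> set A" "a \<noteq> b"
    then have "?r - ix a \<noteq> ?r - ix b" using D[OF ab(1)] D[OF ab(2)] by (metis diff_diff_cancel less_imp_le)
    then show "X (?r - ix a) \<inter> X (?r - ix b) = {}" using D[OF ab(1)] D[OF ab(2)] XX0 by blast
  next
    show "map (\<lambda>a. sp 1 (?r - ix a)) A = map (sp 1) (rev [1..<Suc ?r])"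
      by (rule nth_equalityI) (use ix in \<open>auto simp: rev_nth Suc_diff_Suc simp del: upt_Suc\<close>)
  qed
qed

text \<open>One side of an ear that runs along spoke 0 from the rim to the centre. The labels before
  spoke \<open>b\<close> gather on spoke 1; sector 0 then meets, in cyclic order, the rim end of
  spoke 0, these labels, the centre, and the ear vertices on spoke 0.\<close>

lemma half_ear:
  fixes m :: "'h \<Rightarrow> 'v"
  assumes fan: "fan adj face n C I sp J" and b: "1 \<le> b" "b < length C"
    and A: "distinct A" "length A \<le> n + 1" and l: "l \<le> n + 1"
    and sub: "subseq (map m A) (map (\<lambda>t. sp t (n + 2)) [1..<b])"
  shows "\<exists>X m' C'. (\<forall>a\<in>set A. conn adj (X a) \<and> m a \<in> X a \<and> m' a \<in> X a \<and> X a \<subseteq> insert (m a) I \<and>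
      X a \<subseteq> {sp s d | s d. 1 \<le> s \<and> s < b \<and> 1 \<le> d \<and> d \<le> n + 2} \<union> (\<Union>s\<in>{1..<b}. J s)) \<and>
    (\<forall>a\<in>set A. \<forall>a'\<in>set A. a \<noteq> a' \<longrightarrow> X a \<inter> X a' = {}) \<and>
    face (n + 1) C' (J 0) \<and>
    subseq (sp 0 (n + 2) # map m' A @ sp 0 0 # map (sp 0) [1..<Suc l]) C'"
proof -
  have q: "Suc (b - 1) = b" "b - 1 \<le> length C" using b by auto
  obtain X m' where X: "\<forall>a\<in>set A. conn adj (X a) \<and> m a \<in> X a \<and> m' a \<in> X a \<and> X a \<subseteq> insert (m a) I \<and>
      X a \<subseteq> {sp s d | s d. 1 \<le> s \<and> s \<le> b - 1 \<and> 1 \<le> d \<and> d \<le> n + 2} \<union> (\<Union>s\<in>{1..<b - 1}. J s)"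
    "\<forall>a\<in>set A. \<forall>a'\<in>set A. a \<noteq> a' \<longrightarrow> X a \<inter> X a' = {}"
    "map m' A = map (sp 1) (rev [1..<Suc (length A)])"
    using gather[OF fan q(2) A, of m] sub unfolding q(1) by blast
  have "{sp s d | s d. 1 \<le> s \<and> s \<le> b - 1 \<and> 1 \<le> d \<and> d \<le> n + 2} \<subseteq> {sp s d | s d. 1 \<le> s \<and> s < b \<and> 1 \<le> d \<and> d \<le> n + 2}"
    using q by fastforce
  moreover have "(\<Union>s\<in>{1..<b - 1}. J s) \<subseteq> (\<Union>s\<in>{1..<b}. J s)" by (intro UN_mono) auto
  ultimately have X1: "\<forall>a\<in>set A. conn adj (X a) \<and> m a \<in> X a \<and> m' a \<in> X a \<and> X a \<subseteq> insert (m a) I \<and>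
      X a \<subseteq> {sp s d | s d. 1 \<le> s \<and> s < b \<and> 1 \<le> d \<and> d \<le> n + 2} \<union> (\<Union>s\<in>{1..<b}. J s)"
    using X(1) by (meson subset_trans Un_mono)
  \<comment> \<open>Sector 0, rotated so that it begins with the rim end of spoke 0.\<close>
  let ?C = "sp 0 (n + 2) # map (sp 1) (rev [1..<n + 3]) @ map (sp 0) [0..<n + 2]"
  have "sector n (sp 0) (sp 1) = map (sp 0) [0..<n + 2] @ (sp 0 (n + 2) # map (sp 1) (rev [1..<n + 3]))"
    by (simp add: sector_def numeral_3_eq_3 upt_Suc)
  then have "rotate (length (map (sp 0) [0..<n + 2])) (sector n (sp 0) (sp 1)) = ?C"
    using rotate_append by (metis append_Cons)
  moreover have "0 < length C" using b by linarith
  ultimately have "face (n + 1) ?C (J 0)" using face_rotate[OF fan_face[OF fan, of 0]] by (metis One_nat_def)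
  moreover have "subseq (sp 0 (n + 2) # map m' A @ sp 0 0 # map (sp 0) [1..<Suc l]) ?C"
  proof -
    have "[1..<n + 3] = [1..<Suc (length A)] @ [Suc (length A)..<n + 3]"
      using A by (intro upt_split) auto
    then have "map (sp 1) (rev [1..<n + 3]) = map (sp 1) (rev [Suc (length A)..<n + 3]) @ map m' A"
      unfolding X(3) by (metis map_append rev_append)
    then have 1: "subseq (map m' A) (map (sp 1) (rev [1..<n + 3]))" by (simp add: list_emb_append2)
    have "[0..<n + 2] = 0 # [1..<Suc l] @ [Suc l..<n + 2]"
      using l upt_split[of 1 "Suc l" "n + 2"] by (simp add: upt_conv_Cons del: upt_Suc)
    then have "map (sp 0) [0..<n + 2] = (sp 0 0 # map (sp 0) [1..<Suc l]) @ map (sp 0) [Suc l..<n + 2]" by simp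
    then have 2: "subseq (sp 0 0 # map (sp 0) [1..<Suc l]) (map (sp 0) [0..<n + 2])"
      by (metis list_emb_append2 subseq_rev_drop_many subseq_order.order_refl)
    show ?thesis using list_emb_append_mono[OF 1 2] by auto
  qed
  ultimately show ?thesis using X1 X(2) by blast
qed

text \<open>Gathering all labels on spoke 1 moves the configuration into sector 0, one level deeper.
  The centre represents no label there and becomes a gap at the end of the rotated cycle. If the old
  cycle had such a gap already, the spiral does not use the last spoke: the sector behind the spoke
  of the last label stays empty and touches that label, which makes it a spare face.\<close>

lemma wait_step:
  fixes m :: "'h \<Rightarrow> 'v"
  assumes face: "face n C I" and L: "distinct L" "length L \<le> n + 1" "L \<noteq> []"
    and sub: "subseq (map m L) C"
  shows "\<exists>C' I' m' X. face (n + 1) C' I' \<and> I' \<subseteq> I \<and> subseq (map m' L) (butlast C') \<and>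
    (\<forall>x\<in>set L. conn adj (X x) \<and> m x \<in> X x \<and> m' x \<in> X x \<and> X x \<subseteq> insert (m x) I \<and> X x \<inter> I' = {}) \<and>
    (\<forall>x\<in>set L. \<forall>y\<in>set L. x \<noteq> y \<longrightarrow> X x \<inter> X y = {}) \<and>
    (subseq (map m L) (butlast C) \<longrightarrow>
      (\<exists>C'' I''. face (n + 1) C'' I'' \<and> I'' \<subseteq> I \<and> I'' \<inter> I' = {} \<and> m (last L) \<in> set C'' \<and>
         (\<forall>x\<in>set L. X x \<inter> I'' = {})))"
proof -
  let ?k = "length C"
  \<comment> \<open>Shifted so that spoke \<open>i + 1\<close> ends in \<open>C ! i\<close>. The
    last entry of \<open>C\<close>, the possible gap, then sits on spoke 0, which is the same as
    spoke \<open>?k\<close>.\<close>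
  define Cr where "Cr = last C # butlast C"
  have Cne: "C \<noteq> []" and k: "3 \<le> ?k" using face_facts[OF face] by auto
  have "Cr = rotate (length (butlast C)) C"
    using rotate_append[of "butlast C" "[last C]"] Cne by (simp add: Cr_def)
  then obtain sp J where fan: "fan adj face n Cr I sp J" using face_fan[OF face_rotate[OF face]] by metis
  have len: "length Cr = ?k" using Cne by (simp add: Cr_def)
  have tips: "map (\<lambda>t. sp t (n + 2)) [1..<Suc ?k] = C"
  proof (rule nth_equalityI)
    fix i assume "i < length (map (\<lambda>t. sp t (n + 2)) [1..<Suc ?k])"
    then have i: "i < ?k" by (simp del: upt_Suc)
    have "sp (Suc i) (n + 2) = Cr ! (Suc i mod ?k)" using fan_tip'[OF fan, of "Suc i"] i len by simp
    also have "\<dots> = C ! i"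
    proof (cases "Suc i = ?k")
      case True
      then have "i = ?k - 1" by simp
      then show ?thesis using True last_conv_nth[OF Cne] by (simp add: Cr_def)
    next
      case False
      then show ?thesis using i by (simp add: Cr_def nth_butlast)
    qed
    finally show "map (\<lambda>t. sp t (n + 2)) [1..<Suc ?k] ! i = C ! i" using i by (simp del: upt_Suc)
  qed (simp del: upt_Suc)
  \<comment> \<open>Using the shorter list whenever it suffices keeps \<open>q\<close> below
    \<open>?k\<close>, so that there is a sector \<open>q\<close> to be set aside.\<close>
  define C0 where "C0 = (if subseq (map m L) (butlast C) then butlast C else C)"
  have C0: "subseq (map m L) C0" using sub by (simp add: C0_def)
  have C0p: "\<exists>e. C = C0 @ e" by (cases "subseq (map m L) (butlast C)") (use Cne append_butlast_last_id[of C] in \<open>auto simp: C0_def simp del: append_butlast_last_id intro: exI[of _ "[last C]"]\<close>)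
  obtain us vs where uv: "C0 = us @ m (last L) # vs" "subseq (map m (butlast L)) us"
    using subseq_snocE[of "map m (butlast L)" "m (last L)" C0] C0 L(3) by (metis append_butlast_last_id list.simps(8,9) map_append)
  define q where "q = Suc (length us)"
  obtain e where e: "C = C0 @ e" using C0p by blast
  have qk: "q \<le> ?k" using e uv by (simp add: q_def)
  have tq: "map (\<lambda>t. sp t (n + 2)) [1..<Suc q] = us @ [m (last L)]"
  proof -
    have "map (\<lambda>t. sp t (n + 2)) [1..<Suc q] = take q (map (\<lambda>t. sp t (n + 2)) [1..<Suc ?k])"
      using qk by (simp add: take_map)
    also have "\<dots> = take q C" by (simp only: tips)
    also have "\<dots> = us @ [m (last L)]" unfolding e uv(1) q_def by simp
    finally show ?thesis .
  qed
  have "subseq (map m L) (us @ [m (last L)])"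
    using list_emb_append_mono[OF uv(2), of "[m (last L)]" "[m (last L)]"] L(3)
    by (metis append_butlast_last_id list.simps(8,9) map_append subseq_order.order_refl)
  then have "subseq (map m L) (map (\<lambda>t. sp t (n + 2)) [1..<Suc q])" by (simp only: tq)
  from gather[OF fan, unfolded len, OF qk L(1,2) this] obtain X m' where
    X0: "(\<forall>a\<in>set L. conn adj (X a) \<and> m a \<in> X a \<and> m' a \<in> X a \<and> X a \<subseteq> insert (m a) I \<and>
      X a \<subseteq> {sp s d | s d. 1 \<le> s \<and> s \<le> q \<and> 1 \<le> d \<and> d \<le> n + 2} \<union> (\<Union>s\<in>{1..<q}. J s)) \<and>
    (\<forall>a\<in>set L. \<forall>b\<in>set L. a \<noteq> b \<longrightarrow> X a \<inter> X b = {}) \<and>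
    map m' L = map (sp 1) (rev [1..<Suc (length L)])" by (elim exE)
  note X = X0[THEN conjunct1] X0[THEN conjunct2, THEN conjunct1] X0[THEN conjunct2, THEN conjunct2]
  have k0: "0 < ?k" using k by linarith
  have XJ: "X a \<inter> J s = {}" if "a \<in> set L" "s < ?k" "s = 0 \<or> q \<le> s" for a s
  proof -
    have "J s \<inter> J s' = {}" if "s' \<in> {1..<q}" for s'
      using fan_J_disj[OF fan, unfolded len, of s s'] that \<open>s < ?k\<close> \<open>s = 0 \<or> q \<le> s\<close> qk by auto
    moreover have "sp s' d \<notin> J s" if "s' \<le> q" "d \<le> n + 2" for s' d
      using fan_notin_J[OF fan, unfolded len, of s s' d] that qk \<open>s < ?k\<close> by simp
    ultimately show ?thesis using X(1) that(1) by blast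
  qed
  \<comment> \<open>A sector starts with the centre; \<open>rotate1\<close> moves it to the end, so
    that the labels lie in \<open>butlast\<close>.\<close>
  let ?C' = "rotate1 (sector n (sp 0) (sp 1))"
  have bl: "butlast ?C' = map (sp 0) [1..<n + 3] @ map (sp 1) (rev [1..<n + 3])"
    by (simp add: sector_def upt_conv_Cons butlast_append del: upt_Suc)
  have 1: "face (n + 1) ?C' (J 0)" using face_rotate1[OF fan_face[OF fan, unfolded len, OF k0]] by simp
  have 2: "J 0 \<subseteq> I" using fan_J_sub[OF fan, unfolded len, OF k0] .
  have 3: "subseq (map m' L) (butlast ?C')"
  proof -
    have "[1..<n + 3] = [1..<Suc (length L)] @ [Suc (length L)..<n + 3]"
      using L(2) by (intro upt_split) auto
    then have "map (sp 1) (rev [1..<n + 3]) = map (sp 1) (rev [Suc (length L)..<n + 3]) @ map m' L"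
      unfolding X(3) by (metis map_append rev_append)
    then show ?thesis unfolding bl by (simp add: list_emb_append2)
  qed
  have 4: "\<exists>C'' I''. face (n + 1) C'' I'' \<and> I'' \<subseteq> I \<and> I'' \<inter> J 0 = {} \<and> m (last L) \<in> set C'' \<and>
         (\<forall>x\<in>set L. X x \<inter> I'' = {})" if "subseq (map m L) (butlast C)"
  proof -
    have "C0 = butlast C" using that by (simp add: C0_def)
    then have "q \<le> length (butlast C)" using uv(1) by (metis q_def add_Suc_right le_add1 length_Cons length_append add_Suc)
    then have qk': "q < ?k" using k by simp
    let ?S = "sector n (sp q) (sp (Suc q))"
    have "sp q (n + 2) = m (last L)"
    proof -
      have "map (\<lambda>t. sp t (n + 2)) [1..<Suc q] ! length us = m (last L)" unfolding tq by simp
      then show ?thesis by (simp add: q_def del: upt_Suc)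
    qed
    then have "?S ! (n + 2) = m (last L)" by (simp add: sector_nth_left)
    then have "m (last L) \<in> set ?S" using nth_mem[of "n + 2" ?S] by simp
    moreover have "J q \<inter> J 0 = {}" using fan_J_disj[OF fan, unfolded len, OF qk' k0] by (simp add: q_def)
    ultimately show ?thesis using fan_face[OF fan, unfolded len, OF qk'] fan_J_sub[OF fan, unfolded len, OF qk'] XJ[OF _ qk'] by blast
  qed
  have 5: "\<forall>x\<in>set L. X x \<inter> J 0 = {}" using XJ[OF _ k0] by blast
  show ?thesis
    by (rule exI[of _ ?C'], rule exI[of _ "J 0"], rule exI[of _ m'], rule exI[of _ X])
       (use 1 2 3 4 5 X in blast)
qed

text \<open>The ear is laid along the spoke of \<open>x\<close>: the new vertices take the depths
  from \<open>length Z\<close> down to 1, \<open>x\<close> keeps the outer rest of the spoke, and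
  \<open>y\<close> takes the whole of its own spoke together with the centre. The labels of the two
  sides spiral towards the spoke of \<open>x\<close> from opposite directions, so the two sectors
  next to it see the two halves of the split disc.\<close>

lemma ear_step:
  fixes m :: "'h \<Rightarrow> 'v"
  assumes face: "face n C I" and dist: "distinct (x # A @ y # D @ Z)"
    and len: "length A \<le> n + 1" "length D \<le> n + 1" "length Z \<le> n + 1"
    and sub: "subseq (map m (x # A @ y # D)) C"
  shows "\<exists>C1 I1 m1 C2 I2 m2 X. face (n + 1) C1 I1 \<and> face (n + 1) C2 I2 \<and> I1 \<subseteq> I \<and> I2 \<subseteq> I \<and> I1 \<inter> I2 = {} \<and>
    subseq (map m1 (x # A @ y # rev Z)) C1 \<and> subseq (map m2 (x # rev D @ y # rev Z)) C2 \<and>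
    (\<forall>u\<in>set (x # A @ y # rev Z). m1 u \<in> X u) \<and> (\<forall>u\<in>set (x # rev D @ y # rev Z). m2 u \<in> X u) \<and>
    (\<forall>u\<in>set (x # A @ y # D). conn adj (X u) \<and> m u \<in> X u \<and> X u \<subseteq> insert (m u) I) \<and>
    (\<forall>u\<in>set Z. conn adj (X u) \<and> X u \<subseteq> I) \<and>
    (\<forall>u\<in>set (x # A @ y # D @ Z). X u \<inter> (I1 \<union> I2) = {}) \<and>
    (\<forall>u\<in>set (x # A @ y # D @ Z). \<forall>v\<in>set (x # A @ y # D @ Z). u \<noteq> v \<longrightarrow> X u \<inter> X v = {}) \<and>
    (\<forall>i\<le>length Z. \<exists>a\<in>X ((x # Z @ [y]) ! i). \<exists>b\<in>X ((x # Z @ [y]) ! Suc i). adj a b)"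
proof -
  let ?l = "length Z"
  obtain C1 C2 where C12: "C = C1 @ m x # C2" "subseq (map m (A @ y # D)) C2"
    using sub subseq_ConsE[of "m x" "map m (A @ y # D)" C] by auto
  have "subseq (map m A @ (m y # map m D)) (C2 @ C1)" using C12(2) by (simp add: subseq_rev_drop_many)
  then obtain E F where EF: "C2 @ C1 = E @ F" "subseq (map m A) E" "subseq (m y # map m D) F"
    using list_emb_appendD by blast
  obtain F1 CD where F1: "F = F1 @ m y # CD" "subseq (map m D) CD" using subseq_ConsE[OF EF(3)] by blast
  define CA where "CA = E @ F1"
  define Cr where "Cr = m x # CA @ m y # CD"
  have CA: "subseq (map m A) CA" using EF(2) by (simp add: CA_def subseq_rev_drop_many)
  have "Cr = rotate (length C1) C" using C12(1) EF(1) F1(1) rotate_append[of C1 "m x # C2"] by (simp add: Cr_def CA_def)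
  then obtain sp J where fan: "fan adj face n Cr I sp J" using face_fan[OF face_rotate[OF face]] by metis
  define k where "k = length Cr"
  define b where "b = Suc (length CA)"
  have k: "k = b + Suc (length CD)" by (simp add: k_def b_def Cr_def)
  have k3: "3 \<le> k" using fan_len[OF fan] by (simp add: k_def)
  have b: "1 \<le> b" "b < k" by (auto simp: k b_def)
  have tip: "sp t (n + 2) = Cr ! t" if "t < k" for t using fan_tip[OF fan] that by (simp add: k_def)
  have tipsA: "map (\<lambda>t. sp t (n + 2)) [1..<b] = CA"
    by (rule nth_equalityI) (use tip in \<open>auto simp: b_def k Cr_def nth_append simp del: upt_Suc\<close>)
  obtain XA mA C1' where XA: "\<forall>a\<in>set A. conn adj (XA a) \<and> m a \<in> XA a \<and> mA a \<in> XA a \<and> XA a \<subseteq> insert (m a) I \<and>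
      XA a \<subseteq> {sp s d | s d. 1 \<le> s \<and> s < b \<and> 1 \<le> d \<and> d \<le> n + 2} \<union> (\<Union>s\<in>{1..<b}. J s)"
    and XAd: "\<forall>a\<in>set A. \<forall>a'\<in>set A. a \<noteq> a' \<longrightarrow> XA a \<inter> XA a' = {}"
    and C1': "face (n + 1) C1' (J 0)" "subseq (sp 0 (n + 2) # map mA A @ sp 0 0 # map (sp 0) [1..<Suc ?l]) C1'"
    using half_ear[OF fan b(1), folded k_def, OF b(2) _ len(1,3), of m] dist CA unfolding tipsA by auto
  \<comment> \<open>The side of \<open>D\<close> is treated in the mirrored fan, where its labels
    follow directly after \<open>x\<close>; \<open>b'\<close> is the position of \<open>y\<close>
    there.\<close>
  have Cre: "hd Cr # rev (tl Cr) = m x # rev CD @ m y # rev CA" by (simp add: Cr_def)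
  define sp' where "sp' = (\<lambda>t. sp (k - t))"
  define J' where "J' = (\<lambda>t. J (k - 1 - t))"
  have fan': "fan adj face n (m x # rev CD @ m y # rev CA) I sp' J'"
    using fan_reverse[OF fan] unfolding Cre sp'_def J'_def k_def .
  define b' where "b' = Suc (length CD)"
  have lenr: "length (m x # rev CD @ m y # rev CA) = k" by (simp add: k b_def)
  have b': "1 \<le> b'" "b' < k" "k - b' = b" by (auto simp: k b'_def b_def)
  have tipsD: "map (\<lambda>t. sp' t (n + 2)) [1..<b'] = rev CD"
  proof (rule nth_equalityI)
    fix i assume "i < length (map (\<lambda>t. sp' t (n + 2)) [1..<b'])"
    then have i: "i < length CD" by (simp add: b'_def)
    then have "sp' (Suc i) (n + 2) = (m x # rev CD @ m y # rev CA) ! Suc i"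
      using fan_tip[OF fan', unfolded lenr, of "Suc i"] b' by (simp add: b'_def)
    then show "map (\<lambda>t. sp' t (n + 2)) [1..<b'] ! i = rev CD ! i"
      using i by (simp add: b'_def nth_append del: upt_Suc)
  qed (simp add: b'_def)
  have CDr: "subseq (map m (rev D)) (rev CD)" using subseq_rev[OF F1(2)] by (simp add: rev_map)
  obtain XD mD C2' where XD0: "\<forall>a\<in>set (rev D). conn adj (XD a) \<and> m a \<in> XD a \<and> mD a \<in> XD a \<and> XD a \<subseteq> insert (m a) I \<and>
      XD a \<subseteq> {sp' s d | s d. 1 \<le> s \<and> s < b' \<and> 1 \<le> d \<and> d \<le> n + 2} \<union> (\<Union>s\<in>{1..<b'}. J' s)"
    and XDd: "\<forall>a\<in>set (rev D). \<forall>a'\<in>set (rev D). a \<noteq> a' \<longrightarrow> XD a \<inter> XD a' = {}"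
    and C2': "face (n + 1) C2' (J' 0)" "subseq (sp' 0 (n + 2) # map mD (rev D) @ sp' 0 0 # map (sp' 0) [1..<Suc ?l]) C2'"
    using half_ear[OF fan' b'(1), unfolded lenr, OF b'(2), of "rev D" ?l m] dist len CDr unfolding tipsD by auto
  have sp'0: "sp' 0 = sp 0" using fan_wrap[OF fan] by (auto simp: sp'_def k_def)
  have J'0: "J' 0 = J (k - 1)" by (simp add: J'_def)
  \<comment> \<open>Four zones: the spoke of \<open>x\<close> without the centre, the spoke of
    \<open>y\<close> with it, and what lies between them on either side apart from sectors 0 and
    \<open>k - 1\<close>. Branch sets in different zones are disjoint for this reason alone.\<close>
  define UA where "UA = {sp s d | s d. 1 \<le> s \<and> s < b \<and> 1 \<le> d \<and> d \<le> n + 2} \<union> (\<Union>s\<in>{1..<b}. J s)"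
  define UD where "UD = {sp s d | s d. b < s \<and> s < k \<and> 1 \<le> d \<and> d \<le> n + 2} \<union> (\<Union>s\<in>{b..<k - 1}. J s)"
  have XD: "XD a \<subseteq> UD" if "a \<in> set D" for a
  proof -
    have "{sp' s d | s d. 1 \<le> s \<and> s < b' \<and> 1 \<le> d \<and> d \<le> n + 2} \<subseteq> UD"
    proof
      fix z assume "z \<in> {sp' s d | s d. 1 \<le> s \<and> s < b' \<and> 1 \<le> d \<and> d \<le> n + 2}"
      then obtain s d where "z = sp (k - s) d" "1 \<le> s" "s < b'" "1 \<le> d" "d \<le> n + 2" by (auto simp: sp'_def)
      then show "z \<in> UD" unfolding UD_def using b' by (intro UnI1 CollectI exI[of _ "k - s"] exI[of _ d]) auto
    qed
    moreover have "(\<Union>s\<in>{1..<b'}. J' s) \<subseteq> UD"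
    proof
      fix z assume "z \<in> (\<Union>s\<in>{1..<b'}. J' s)"
      then obtain s where "z \<in> J (k - 1 - s)" "1 \<le> s" "s < b'" by (auto simp: J'_def)
      then show "z \<in> UD" unfolding UD_def using b' by (intro UnI2 UN_I[of "k - 1 - s"]) auto
    qed
    moreover have "XD a \<subseteq> {sp' s d | s d. 1 \<le> s \<and> s < b' \<and> 1 \<le> d \<and> d \<le> n + 2} \<union> (\<Union>s\<in>{1..<b'}. J' s)"
      using XD0 that by simp
    ultimately show ?thesis by (meson order_trans Un_least)
  qed
  have XA': "XA a \<subseteq> UA" if "a \<in> set A" for a using XA that by (simp add: UA_def)
  define Ux where "Ux = {sp 0 d | d. 1 \<le> d \<and> d \<le> n + 2}"
  define Uy where "Uy = {sp b d | d. d \<le> n + 2}"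
  have inj: "s = s' \<and> d = d'" if "sp s d = sp s' d'" "s < k" "s' < k" "1 \<le> d" "d \<le> n + 2" "1 \<le> d'" "d' \<le> n + 2" for s s' d d'
    using fan_inj0[OF fan, folded k_def, of s s' d d'] that by blast
  have nJ: "sp s d \<notin> J s'" if "s < k" "d \<le> n + 2" "s' < k" for s s' d
    using fan_notin_J[OF fan, folded k_def, of s' s d] that by simp
  have JJ: "J s \<inter> J s' = {}" if "s < k" "s' < k" "s \<noteq> s'" for s s'
    using fan_J_disj[OF fan, folded k_def] that by blast
  have cn: "sp s d \<noteq> sp s' 0" if "s < k" "s' < k" "1 \<le> d" "d \<le> n + 2" for s s' d
    using fan_centre_neq[OF fan, folded k_def, of s d] fan_centre[OF fan, folded k_def, of s'] that by simp
  have d1: "UA \<inter> UD = {}"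
  proof -
    have "sp s d \<notin> UD" if "s < b" "1 \<le> d" "d \<le> n + 2" for s d
      using that b inj[of s d] nJ[of s d] unfolding UD_def by force
    moreover have "J s \<inter> UD = {}" if "s < b" for s
    proof -
      have "sp s' d \<notin> J s" if "b < s'" "s' < k" "d \<le> n + 2" for s' d using that nJ[of s' d s] b \<open>s < b\<close> by simp
      moreover have "J s \<inter> J s' = {}" if "s' \<in> {b..<k - 1}" for s' using JJ[of s s'] that b \<open>s < b\<close> by (simp add: less_diff_conv)
      ultimately show ?thesis unfolding UD_def by blast
    qed
    ultimately show ?thesis unfolding UA_def by force
  qed
  have d2: "Ux \<inter> (UA \<union> UD \<union> Uy) = {}"
  proof -
    have "sp 0 d \<notin> UA \<union> UD \<union> Uy" if "1 \<le> d" "d \<le> n + 2" for d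
    proof
      assume "sp 0 d \<in> UA \<union> UD \<union> Uy"
      then consider s d' where "sp 0 d = sp s d'" "0 < s" "s < k" "1 \<le> d'" "d' \<le> n + 2" | s where "sp 0 d \<in> J s" "s < k" | d' where "sp 0 d = sp b d'" "d' \<le> n + 2"
        using b unfolding UA_def UD_def Uy_def by fastforce
      then show False
      proof cases
        case 1 then show ?thesis using inj[of 0 d s d'] that b by simp
      next
        case 2 then show ?thesis using nJ[of 0 d s] that b by simp
      next
        case 3 then show ?thesis using inj[of 0 d b d'] cn[of 0 b d] that b by (cases "d' = 0") auto
      qed
    qed
    then show ?thesis unfolding Ux_def by blast
  qed
  have d3: "Uy \<inter> (UA \<union> UD) = {}"
  proof -
    have "sp b d \<notin> UA \<union> UD" if "d \<le> n + 2" for d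
    proof
      assume "sp b d \<in> UA \<union> UD"
      then consider s d' where "sp b d = sp s d'" "b \<noteq> s" "s < k" "1 \<le> d'" "d' \<le> n + 2" | s where "sp b d \<in> J s" "s < k"
        using b unfolding UA_def UD_def by fastforce
      then show False
      proof cases
        case 1 then show ?thesis using inj[of b d s d'] cn[of s b d'] that b by (cases "d = 0") auto
      next
        case 2 then show ?thesis using nJ[of b d s] that b by simp
      qed
    qed
    then show ?thesis unfolding Uy_def by blast
  qed
  have d4: "(UA \<union> UD \<union> Ux \<union> Uy) \<inter> (J 0 \<union> J (k - 1)) = {}"
  proof -
    have "z \<notin> J r" if z: "z \<in> UA \<union> UD \<union> Ux \<union> Uy" and r: "r = 0 \<or> r = k - 1" for z r
    proof -
      have r': "r < k" using r b by auto
      from z consider s d' where "z = sp s d'" "s < k" "d' \<le> n + 2" | s where "z \<in> J s" "s < k" "s \<noteq> 0" "s \<noteq> k - 1"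
        using b unfolding UA_def UD_def Ux_def Uy_def by fastforce
      then show ?thesis using nJ[OF _ _ r'] JJ[OF r'] r by cases blast+
    qed
    then show ?thesis by blast
  qed
  obtain ix where ix: "\<And>i. i < ?l \<Longrightarrow> ix (Z ! i) = i" using distinct_index[of Z] dist by auto
  \<comment> \<open>Depth \<open>?l - i\<close> for \<open>Z ! i\<close> makes the ear leave
    \<open>x\<close> at depth \<open>?l + 1\<close> and arrive in the centre, which belongs to
    \<open>y\<close>.\<close>
  define X where "X u = (if u = x then sp 0 ` {Suc ?l..n + 2} else if u = y then sp b ` {0..n + 2}
     else if u \<in> set A then XA u else if u \<in> set D then XD u else {sp 0 (?l - ix u)})" for u
  have Xx: "X x = sp 0 ` {Suc ?l..n + 2}" and Xy: "X y = sp b ` {0..n + 2}" using dist by (auto simp: X_def)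
  have XA2: "X u = XA u" if "u \<in> set A" for u using dist that by (auto simp: X_def)
  have XD2: "X u = XD u" if "u \<in> set D" for u using dist that by (auto simp: X_def)
  have XZ: "X (Z ! i) = {sp 0 (?l - i)}" if "i < ?l" for i
    using dist that ix[OF that] nth_mem[OF that] by (auto simp: X_def)
  have XZ2: "\<exists>i<?l. u = Z ! i \<and> X u = {sp 0 (?l - i)}" if "u \<in> set Z" for u
    using that XZ by (metis in_set_conv_nth)
  have Ux: "X x \<subseteq> Ux" using len by (auto simp: Xx Ux_def)
  have Uy: "X y \<subseteq> Uy" by (auto simp: Xy Uy_def)
  have UA: "X u \<subseteq> UA" if "u \<in> set A" for u using XA' XA2 that by simp
  have UD: "X u \<subseteq> UD" if "u \<in> set D" for u using XD XD2 that by simp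
  have UZ: "X u \<subseteq> Ux" if "u \<in> set Z" for u
  proof -
    obtain i where i: "i < ?l" "X u = {sp 0 (?l - i)}" using XZ2[OF \<open>u \<in> set Z\<close>] by blast
    have "sp 0 (?l - i) \<in> Ux" unfolding Ux_def
      by (intro CollectI exI[of _ "?l - i"] conjI refl) (use i(1) len in arith)+
    then show ?thesis using i by simp
  qed
  have xZ: "X x \<inter> X u = {}" if "u \<in> set Z" for u
  proof -
    obtain i where i: "i < ?l" "X u = {sp 0 (?l - i)}" using XZ2[OF \<open>u \<in> set Z\<close>] by blast
    have "sp 0 (?l - i) \<noteq> sp 0 d" if "d \<in> {Suc ?l..n + 2}" for d
    proof
      assume "sp 0 (?l - i) = sp 0 d"
      moreover have "1 \<le> ?l - i" "?l - i \<le> n + 2" "1 \<le> d" "d \<le> n + 2" "0 < k" "?l - i < d"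
        using i(1) that len b by auto
      ultimately show False using inj[of 0 "?l - i" 0 d] by auto
    qed
    then have "sp 0 (?l - i) \<notin> X x" unfolding Xx by blast
    then show ?thesis using i by simp
  qed
  have ZZ: "X u \<inter> X v = {}" if uv: "u \<in> set Z" "v \<in> set Z" "u \<noteq> v" for u v
  proof -
    obtain i where i: "i < ?l" "u = Z ! i" "X u = {sp 0 (?l - i)}" using XZ2[OF uv(1)] by blast
    obtain j where j: "j < ?l" "v = Z ! j" "X v = {sp 0 (?l - j)}" using XZ2[OF uv(2)] by blast
    have "i \<noteq> j" using i j uv(3) by auto
    then have ne: "?l - i \<noteq> ?l - j" using i(1) j(1) by linarith
    have "sp 0 (?l - i) \<noteq> sp 0 (?l - j)"
    proof
      assume "sp 0 (?l - i) = sp 0 (?l - j)"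
      then have "?l - i = ?l - j" using inj[of 0 "?l - i" 0 "?l - j"] i(1) j(1) len b by simp
      then show False using ne by simp
    qed
    then show ?thesis using i j by simp
  qed
  have AA: "X u \<inter> X v = {}" if "u \<in> set A" "v \<in> set A" "u \<noteq> v" for u v
    using XAd XA2[OF that(1)] XA2[OF that(2)] that by simp
  have DD: "X u \<inter> X v = {}" if "u \<in> set D" "v \<in> set D" "u \<noteq> v" for u v
    using XDd XD2[OF that(1)] XD2[OF that(2)] that by simp
  have disj: "X u \<inter> X v = {}" if uv: "u \<in> set (x # A @ y # D @ Z)" "v \<in> set (x # A @ y # D @ Z)" "u \<noteq> v" for u v
  proof -
    have cl: "u = x \<or> u = y \<or> u \<in> set A \<or> u \<in> set D \<or> u \<in> set Z" "v = x \<or> v = y \<or> v \<in> set A \<or> v \<in> set D \<or> v \<in> set Z"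
      using uv by auto
    have D: "X p \<inter> X q = {}" if "X p \<subseteq> P" "X q \<subseteq> Q" "P \<inter> Q = {}" for p q P Q using that by blast
    have e: "Ux \<inter> Uy = {}" "Ux \<inter> UA = {}" "Ux \<inter> UD = {}" "Uy \<inter> UA = {}" "Uy \<inter> UD = {}" using d2 d3 by blast+
    have "X x \<inter> X y = {}" by (rule D[OF Ux Uy e(1)])
    moreover have "X x \<inter> X p = {}" "X y \<inter> X p = {}" if "p \<in> set A" for p
      using D[OF Ux UA[OF that] e(2)] D[OF Uy UA[OF that] e(4)] by auto
    moreover have "X x \<inter> X p = {}" "X y \<inter> X p = {}" if "p \<in> set D" for p
      using D[OF Ux UD[OF that] e(3)] D[OF Uy UD[OF that] e(5)] by auto
    moreover have "X p \<inter> X y = {}" "\<And>q. q \<in> set A \<Longrightarrow> X p \<inter> X q = {}" "\<And>q. q \<in> set D \<Longrightarrow> X p \<inter> X q = {}" if "p \<in> set Z" for p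
      using D[OF UZ[OF that] Uy e(1)] D[OF UZ[OF that] UA e(2)] D[OF UZ[OF that] UD e(3)] by auto
    moreover have "X p \<inter> X q = {}" if "p \<in> set A" "q \<in> set D" for p q
      using D[OF UA[OF that(1)] UD[OF that(2)] d1] .
    ultimately show ?thesis
      using cl uv(3) xZ ZZ[of u v] AA[of u v] DD[of u v]
      by (elim disjE; metis Int_commute)
  qed
  have walk: "conn adj (sp t ` {i..j})" if "i \<le> j" "j \<le> n + 2" "t \<le> k" for t i j
    by (rule conn_walk[OF that(1)]) (use fan_adj[OF fan, folded k_def, OF that(3)] that adj_sym in auto)
  have mx: "m x = sp 0 (n + 2)" using tip[of 0] b by (simp add: Cr_def)
  have my: "m y = sp b (n + 2)" using tip[of b] b by (simp add: Cr_def b_def nth_append)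
  have inI: "sp t d \<in> I" if "t < k" "d \<le> n + 1" for t d using fan_in[OF fan, of t d] that by (simp add: k_def)
  have subI: "sp t ` {i..n + 2} \<subseteq> insert (sp t (n + 2)) I" if "t < k" for t i
  proof
    fix z assume "z \<in> sp t ` {i..n + 2}"
    then obtain d where "z = sp t d" "d \<le> n + 2" by auto
    then show "z \<in> insert (sp t (n + 2)) I" using inI[OF that, of d] by (cases "d = n + 2") auto
  qed
  have c5: "conn adj (X u) \<and> m u \<in> X u \<and> X u \<subseteq> insert (m u) I" if u: "u \<in> set (x # A @ y # D)" for u
  proof -
    have "conn adj (X x)" "conn adj (X y)" using walk[of "Suc ?l" "n + 2" 0] walk[of 0 "n + 2" b] len b by (auto simp: Xx Xy)
    moreover have "m x \<in> X x" "m y \<in> X y" using len by (auto simp: Xx Xy mx my)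
    moreover have "X x \<subseteq> insert (m x) I" "X y \<subseteq> insert (m y) I" using subI[of 0] subI[of b] b unfolding Xx Xy mx my by auto
    moreover have "conn adj (X u) \<and> m u \<in> X u \<and> X u \<subseteq> insert (m u) I" if "u \<in> set A"
      using bspec[OF XA that] unfolding XA2[OF that] by blast
    moreover have "conn adj (X u) \<and> m u \<in> X u \<and> X u \<subseteq> insert (m u) I" if "u \<in> set D"
      using bspec[OF XD0, of u] that unfolding XD2[OF that] by simp
    ultimately show ?thesis using u by auto
  qed
  have c6: "conn adj (X u) \<and> X u \<subseteq> I" if u: "u \<in> set Z" for u
  proof -
    obtain i where i: "i < ?l" "X u = {sp 0 (?l - i)}" using XZ2[OF u] by blast
    then show ?thesis using inI[of 0 "?l - i"] len b by (simp add: conn_singleton)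
  qed
  have c7: "X u \<inter> (J 0 \<union> J (k - 1)) = {}" if u: "u \<in> set (x # A @ y # D @ Z)" for u
  proof -
    have "X u \<subseteq> UA \<union> UD \<union> Ux \<union> Uy" using u Ux Uy UA[of u] UD[of u] UZ[of u] by auto
    then show ?thesis using d4 by blast
  qed
  have c8: "\<exists>a\<in>X ((x # Z @ [y]) ! i). \<exists>b\<in>X ((x # Z @ [y]) ! Suc i). adj a b" if i: "i \<le> ?l" for i
  proof -
    have 1: "sp 0 (Suc (?l - i)) \<in> X ((x # Z @ [y]) ! i)"
    proof (cases i)
      case 0 then show ?thesis using len by (simp add: Xx)
    next
      case (Suc j)
      then have "Suc (?l - i) = ?l - j" using i by simp
      then show ?thesis using Suc i XZ[of j] by (simp add: nth_append)
    qed
    have 2: "sp 0 (?l - i) \<in> X ((x # Z @ [y]) ! Suc i)"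
    proof (cases "i = ?l")
      case True
      then have "sp 0 (?l - i) = sp b 0" using fan_centre[OF fan, of b] b by (simp add: k_def)
      then show ?thesis using True by (simp add: Xy)
    next
      case False
      then show ?thesis using i XZ[of i] by (simp add: nth_append)
    qed
    have "adj (sp 0 (Suc (?l - i))) (sp 0 (?l - i))"
      using adj_sym[OF fan_adj[OF fan, of 0 "?l - i"]] len by simp
    then show ?thesis using 1 2 by blast
  qed
  define m1 where "m1 u = (if u = x then sp 0 (n + 2) else if u = y then sp 0 0 else if u \<in> set A then mA u else sp 0 (?l - ix u))" for u
  define m2 where "m2 u = (if u = x then sp 0 (n + 2) else if u = y then sp 0 0 else if u \<in> set D then mD u else sp 0 (?l - ix u))" for u
  have mZ: "map f (rev Z) = map (sp 0) [1..<Suc ?l]" if "\<And>i. i < ?l \<Longrightarrow> f (Z ! i) = sp 0 (?l - i)" for f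
    by (rule nth_equalityI) (use that in \<open>auto simp: rev_nth simp del: upt_Suc\<close>)
  have "map m1 A = map mA A" "map m2 (rev D) = map mD (rev D)" using dist by (auto simp: m1_def m2_def)
  moreover have "map m1 (rev Z) = map (sp 0) [1..<Suc ?l]" "map m2 (rev Z) = map (sp 0) [1..<Suc ?l]"
    by (rule mZ; use dist ix nth_mem[of _ Z] in \<open>fastforce simp: m1_def m2_def\<close>)+
  moreover have "m1 x = sp 0 (n + 2)" "m2 x = sp 0 (n + 2)" "m1 y = sp 0 0" "m2 y = sp 0 0"
    using dist by (auto simp: m1_def m2_def)
  ultimately have s1: "subseq (map m1 (x # A @ y # rev Z)) C1'" and s2: "subseq (map m2 (x # rev D @ y # rev Z)) C2'"
    using C1'(2) C2'(2) unfolding sp'0 by (simp_all only: list.map map_append)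
  have sp00: "sp 0 0 \<in> X y" using fan_centre[OF fan, of b] b by (force simp: Xy k_def)
  have sp0n: "sp 0 (n + 2) \<in> X x" using len by (auto simp: Xx)
  have mi: "sp 0 (?l - ix u) \<in> X u" if u: "u \<in> set Z" for u
  proof -
    obtain i where "i < ?l" "u = Z ! i" using u by (metis in_set_conv_nth)
    then show ?thesis using ix XZ by simp
  qed
  have m1X: "m1 u \<in> X u" if u: "u \<in> set (x # A @ y # rev Z)" for u
    using u dist sp00 sp0n mi[of u] XA XA2[of u] by (auto simp: m1_def)
  have m2X: "m2 u \<in> X u" if u: "u \<in> set (x # rev D @ y # rev Z)" for u
    using u dist sp00 sp0n mi[of u] XD0 XD2[of u] by (auto simp: m2_def)
  have JI: "J 0 \<subseteq> I" "J (k - 1) \<subseteq> I" using fan_J_sub[OF fan, folded k_def] b by auto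
  have J2: "J 0 \<inter> J (k - 1) = {}" using JJ[of 0 "k - 1"] k3 by simp
  show ?thesis
  proof (rule exI[of _ C1'], rule exI[of _ "J 0"], rule exI[of _ m1], rule exI[of _ C2'], rule exI[of _ "J (k - 1)"],
      rule exI[of _ m2], rule exI[of _ X], intro conjI)
    show "face (n + 1) C1' (J 0)" "face (n + 1) C2' (J (k - 1))" using C1' C2' J'0 by auto
    show "J 0 \<subseteq> I" "J (k - 1) \<subseteq> I" "J 0 \<inter> J (k - 1) = {}" by (fact JI J2)+
    show "subseq (map m1 (x # A @ y # rev Z)) C1'" "subseq (map m2 (x # rev D @ y # rev Z)) C2'" by (fact s1 s2)+
  qed (intro ballI allI impI, (rule m1X m2X c5 c6 c7 c8 disj; assumption))+
qed

end

section \<open>Faces after a stellar step\<close>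

lemma arc_end_closure:
  fixes g :: "real \<Rightarrow> 'a::metric_space"
  assumes "arc g" shows "pathfinish g \<in> closure (path_image g - {pathstart g, pathfinish g})"
proof -
  have c: "continuous_on {0..1} g" "inj_on g {0..1}" using assms by (auto simp: arc_def path_def)
  have cl: "closure {0<..<1::real} = {0..1}" by simp
  have "g ` closure {0<..<1} \<subseteq> closure (g ` {0<..<1})"
    by (rule image_closure_subset) (use c cl in \<open>auto simp: closure_subset\<close>)
  then have "g 1 \<in> closure (g ` {0<..<1})" using cl by auto
  moreover have "g t \<in> path_image g - {pathstart g, pathfinish g}" if t: "0 < t" "t < 1" for t
    using inj_onD[OF c(2), of t 0] inj_onD[OF c(2), of t 1] t by (auto simp: path_image_def pathstart_def pathfinish_def)
  then have "g ` {0<..<1} \<subseteq> path_image g - {pathstart g, pathfinish g}" by auto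
  ultimately show ?thesis unfolding pathfinish_def by (meson closure_mono subsetD)
qed

lemma Int_singletonD: "A \<inter> B = {w} \<Longrightarrow> z \<in> A \<Longrightarrow> z \<in> B \<Longrightarrow> z = w"
  by blast

lemma Int_doubletonD: "A \<inter> B = {v, w} \<Longrightarrow> z \<in> A \<Longrightarrow> z \<in> B \<Longrightarrow> z = v \<or> z = w"
  by blast

text \<open>The spokes are arbitrary arcs, so the sectors are obtained topologically: the spokes are
  drawn one after another, and each cuts one sector off the remaining region by
  \<open>S2_theta\<close>.\<close>

lemma fan_regions:
  assumes plane: "plane_graph Q" and cyc: "cyc Q L" and reg: "region (pcyc Q L) R" and k: "k = length L"
    and G: "\<And>t. t < k \<Longrightarrow> arc (G t) \<and> pathstart (G t) = c \<and> pathfinish (G t) = L ! t \<and> path_image (G t) - {L ! t} \<subseteq> R"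
    and Gk: "G k = G 0"
    and GG: "\<And>t s. t < k \<Longrightarrow> s < k \<Longrightarrow> t \<noteq> s \<Longrightarrow> path_image (G t) \<inter> path_image (G s) = {c}"
  shows "\<exists>Rg. (\<forall>t<k. region (path_image (G t) \<union> pc Q [L ! t, (L @ [hd L]) ! Suc t] \<union> path_image (G (Suc t))) (Rg t)) \<and>
    (\<forall>t<k. \<forall>s<k. t \<noteq> s \<longrightarrow> Rg t \<inter> Rg s = {}) \<and> (\<forall>t<k. \<forall>s<k. Rg t \<inter> path_image (G s) = {}) \<and>
    R = (\<Union>t<k. Rg t) \<union> (\<Union>t<k. path_image (G t) - {L ! t})"
proof -
  define W where "W t = (L @ [hd L]) ! t" for t
  define tail where "tail r = drop r L @ [hd L]" for r
  define g where "g t = path_image (G t)" for t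
  have k3: "3 \<le> k" and dist: "distinct L" and pts: "set L \<subseteq> points Q" and suc: "successively (padj Q) (L @ [hd L])"
    using cyc k by (auto simp: cyc_def)
  have Lne: "L \<noteq> []" using k3 k by auto
  have WL: "W t = L ! t" if "t < k" for t using that k by (simp add: W_def nth_append)
  have W0: "W 0 = hd L" "W k = hd L" using Lne k by (auto simp: W_def nth_append hd_conv_nth)
  have Wpts: "W t \<in> points Q" if "t \<le> k" for t
  proof -
    have "W t \<in> set (L @ [hd L])" unfolding W_def using that k by (intro nth_mem) simp
    then show ?thesis using pts Lne by auto
  qed
  have tailC: "tail r = W r # tail (Suc r)" if "r < k" for r
    using that k unfolding tail_def W_def by (simp add: Cons_nth_drop_Suc[symmetric] nth_append)
  have tailk: "tail k = [W k]" using k W0 by (simp add: tail_def)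
  have hdtail: "\<exists>l. tail r = W r # l" if "r \<le> k" for r
    using tailC[of r] tailk that by (cases "r = k") auto
  have sucT: "successively (padj Q) (tail r)" for r
  proof -
    have "L @ [hd L] = take r L @ tail r" by (simp add: tail_def)
    then show ?thesis using suc by (metis successively_append_iff)
  qed
  have ptT: "set (tail r) \<subseteq> points Q" for r using pts Lne set_drop_subset[of r L] by (auto simp: tail_def)
  have Wadj: "padj Q (W t) (W (Suc t))" if t: "t < k" for t
  proof -
    obtain l where "tail (Suc t) = W (Suc t) # l" using hdtail[of "Suc t"] t by auto
    then show ?thesis using sucT[of t] tailC[OF t] by simp
  qed
  define E where "E t = pc Q [W t, W (Suc t)]" for t
  have pcT: "pc Q (tail r) = E r \<union> pc Q (tail (Suc r))" if r: "r < k" for r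
  proof -
    obtain l where l: "tail (Suc r) = W (Suc r) # l" using hdtail[of "Suc r"] r by auto
    then show ?thesis using pc_append[of Q "[W r]" "W (Suc r)" l] tailC[OF r] by (simp add: E_def)
  qed
  have inT: "set (tail r) = {W s | s. r \<le> s \<and> s \<le> k}" if r: "r \<le> k" for r
  proof -
    have "set (tail r) = set (drop r (L @ [hd L]))" using r k by (simp add: tail_def)
    also have "\<dots> = {(L @ [hd L]) ! s | s. r \<le> s \<and> s < length (L @ [hd L])}"
    proof -
      have "set (drop r l) = {l ! s | s. r \<le> s \<and> s < length l}" for l :: "(real^3) list"
      proof -
        have "set (drop r l) = {drop r l ! i | i. i < length l - r}" by (simp add: set_conv_nth)
        also have "\<dots> = {l ! s | s. r \<le> s \<and> s < length l}"
        proof (intro antisym subsetI; elim CollectE exE conjE)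
          fix x i assume "x = drop r l ! i" "i < length l - r"
          then show "x \<in> {l ! s | s. r \<le> s \<and> s < length l}" by (intro CollectI exI[of _ "r + i"]) auto
        next
          fix x s assume "x = l ! s" "r \<le> s" "s < length l"
          then show "x \<in> {drop r l ! i | i. i < length l - r}" by (intro CollectI exI[of _ "s - r"]) auto
        qed
        finally show ?thesis .
      qed
      then show ?thesis .
    qed
    finally show ?thesis using k by (auto simp: W_def less_Suc_eq_le)
  qed
  have Winj: "W s \<noteq> W t" if "s < t" "t \<le> k" "s \<noteq> 0 \<or> t \<noteq> k" for s t
  proof (cases "t = k")
    case True
    then have "s < k" "s \<noteq> 0" using that by auto
    then show ?thesis using True WL[of s] W0 hd_conv_nth[OF Lne] Lne k nth_eq_iff_index_eq[OF dist, of s 0] by auto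
  next
    case False
    then show ?thesis using WL[of s] WL[of t] that dist k nth_eq_iff_index_eq[OF dist, of s t] by auto
  qed
  have distT: "distinct (tail r)" if "1 \<le> r" "r \<le> k" for r
  proof -
    have "hd L \<notin> set (drop r L)"
    proof
      assume "hd L \<in> set (drop r L)"
      then obtain i where "i < length (drop r L)" "drop r L ! i = hd L" by (metis in_set_conv_nth)
      then have "r + i < k" "W (r + i) = W 0" using k W0 WL[of "r + i"] by auto
      then show False using Winj[of 0 "r + i"] that by auto
    qed
    then show ?thesis using dist by (simp add: tail_def)
  qed
  have Epts: "E t \<inter> points Q = {W t, W (Suc t)}" if "t < k" for t
    using pc_points[OF plane, of "[W t, W (Suc t)]"] Wadj[OF that] Wpts[of t] Wpts[of "Suc t"] that by (auto simp: E_def)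
  have pcTp: "pc Q (tail r) \<inter> points Q = set (tail r)" for r using pc_points[OF plane sucT ptT] .
  have J: "pcyc Q L = pc Q (tail 0)" by (simp add: pcyc_def tail_def)
  have tailJ: "pc Q (tail r) \<subseteq> pcyc Q L" if "r \<le> k" for r
    using that
  proof (induction r)
    case (Suc r) then show ?case using pcT[of r] by auto
  qed (simp add: J)
  have EJ: "E t \<subseteq> pcyc Q L" if "t < k" for t using pcT[OF that] tailJ[of t] that by auto
  have RJ: "R \<inter> pcyc Q L = {}" using reg by (simp add: region_def)
  have gJ: "g t \<inter> pcyc Q L = {W t}" if "t < k" for t
  proof -
    have "W t \<in> g t" using G[OF that] WL[OF that] pathfinish_in_path_image[of "G t"] by (simp add: g_def)
    moreover have "W t \<in> pcyc Q L" using WL[OF that] that k by (auto simp: pcyc_def pc_def)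
    moreover have "g t - {W t} \<subseteq> R" using G[OF that] WL[OF that] by (simp add: g_def)
    ultimately show ?thesis using RJ by blast
  qed
  have gR: "g t - {W t} \<subseteq> R" if "t < k" for t using G[OF that] WL[OF that] by (simp add: g_def)
  have cg: "c \<in> g t" if "t < k" for t using G[OF that] pathstart_in_path_image[of "G t"] by (simp add: g_def)
  have cR: "c \<in> R" using gR[of 0] cg[of 0] G[of 0] arc_distinct_ends[of "G 0"] k3 WL[of 0] by auto
  have gg: "g t \<inter> g s = {c}" if "t < k" "s < k" "t \<noteq> s" for t s using GG[OF that] by (simp add: g_def)
  have earc: "\<exists>e. arc e \<and> path_image e = E t \<and> pathstart e = W t \<and> pathfinish e = W (Suc t)" if "t < k" for t
    using pc_arc[OF plane, of "[W t, W (Suc t)]"] Wadj[OF that] padj_points[OF plane Wadj[OF that]] by (auto simp: E_def)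
  have tarc: "\<exists>e. arc e \<and> path_image e = pc Q (tail r) \<and> pathstart e = W r \<and> pathfinish e = W k" if "1 \<le> r" "r < k" for r
  proof -
    have "length (tail r) \<ge> 2" using that k by (simp add: tail_def)
    moreover have "hd (tail r) = W r" "last (tail r) = W k" using tailC[of r] that W0 by (auto simp: tail_def)
    ultimately show ?thesis using pc_arc[OF plane distT _ sucT ptT, of r] that by auto
  qed
  \<comment> \<open>State after \<open>r\<close> cuts: \<open>Rg t\<close> with \<open>t < r\<close>
    are finished sectors, and \<open>M\<close> is the rest, bounded by spokes \<open>r\<close> and 0
    and by the part of the cycle from \<open>W r\<close> on to its closing vertex.\<close>
  define S where "S r Rg M \<longleftrightarrow> (\<forall>t<r. region (g t \<union> E t \<union> g (Suc t)) (Rg t)) \<and>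
      region (g r \<union> g 0 \<union> pc Q (tail r)) M \<and> (\<forall>t<r. \<forall>s<r. t \<noteq> s \<longrightarrow> Rg t \<inter> Rg s = {}) \<and> (\<forall>t<r. Rg t \<inter> M = {}) \<and>
      (\<forall>t<r. \<forall>s\<le>r. Rg t \<inter> g s = {}) \<and> (\<forall>s\<le>r. M \<inter> g s = {}) \<and>
      R = (\<Union>t<r. Rg t) \<union> M \<union> (\<Union>t\<le>r. g t - {W t})" for r Rg M
  have base: "\<exists>Rg M. S 1 Rg M"
  proof -
    obtain e where e: "arc e" "path_image e = E 0" "pathstart e = W 0" "pathfinish e = W 1" using earc[of 0] k3 by auto
    obtain f' where f': "arc f'" "path_image f' = pc Q (tail 1)" "pathstart f' = W 1" "pathfinish f' = W 0"
      using tarc[of 1] k3 W0 by auto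
    define f where "f = reversepath f'"
    have f: "arc f" "path_image f = pc Q (tail 1)" "pathstart f = W 0" "pathfinish f = W 1" using f' by (auto simp: f_def arc_reversepath)
    \<comment> \<open>A single spoke ends inside \<open>R\<close> and separates nothing; spokes 0
      and 1 together form the first crosscut.\<close>
    define h where "h = reversepath (G 0) +++ G 1"
    have G0: "arc (G 0)" "pathstart (G 0) = c" "pathfinish (G 0) = W 0" and G1: "arc (G 1)" "pathstart (G 1) = c" "pathfinish (G 1) = W 1"
      using G[of 0] G[of 1] WL[of 0] WL[of 1] k3 by auto
    have "path_image (reversepath (G 0)) \<inter> path_image (G 1) \<subseteq> {pathstart (G 1)}" using gg[of 0 1] k3 G1 by (auto simp: g_def)
    then have h: "arc h" "path_image h = g 0 \<union> g 1" "pathstart h = W 0" "pathfinish h = W 1"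
      using G0 G1 by (auto simp: h_def g_def arc_reversepath path_image_join intro!: arc_join)
    have W01: "W 0 \<noteq> W 1" using Winj[of 0 1] k3 by auto
    have EF: "pcyc Q L = E 0 \<union> pc Q (tail 1)" using J pcT[of 0] k3 by simp
    have Eint: "E 0 \<inter> pc Q (tail 1) = {W 0, W 1}"
    proof -
      have L: "L = W 0 # [] @ W 1 # drop 2 L"
        using Cons_nth_drop_Suc[of 0 L] Cons_nth_drop_Suc[of 1 L] WL[of 0] WL[of 1] k3 k Lne by (simp add: numeral_2_eq_2)
      have "W 1 # drop 2 L @ [W 0] = tail 1" using tailC[of 1] k3 W0 by (simp add: tail_def numeral_2_eq_2)
      then show ?thesis using cyc_split(4)[OF plane, of "W 0" "[]" "W 1" "drop 2 L"] cyc L by (simp add: E_def)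
    qed
    have "path_image h - {W 0, W 1} \<subseteq> R" using h(2) gR[of 0] gR[of 1] k3 by auto
    then have "\<exists>R1 R2. region (path_image e \<union> path_image h) R1 \<and> region (path_image f \<union> path_image h) R2 \<and>
        R1 \<inter> R2 = {} \<and> R = R1 \<union> R2 \<union> (path_image h - {W 0, W 1})"
      by (intro S2_theta[OF e(1) f(1) h(1) W01 e(3,4) f(3,4) h(3,4)]) (use reg EF Eint e f in auto)
    then obtain R1 R2 where R12: "region (E 0 \<union> path_image h) R1" "region (pc Q (tail 1) \<union> path_image h) R2" "R1 \<inter> R2 = {}"
      "R = R1 \<union> R2 \<union> (path_image h - {W 0, W 1})"
      unfolding e(2) f(2) by blast
    have "S 1 (\<lambda>_. R1) R2"
    proof -
      have "g 0 \<union> E 0 \<union> g (Suc 0) = E 0 \<union> path_image h" "g 1 \<union> g 0 \<union> pc Q (tail 1) = pc Q (tail 1) \<union> path_image h" using h by auto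
      moreover have "R1 \<inter> path_image h = {}" "R2 \<inter> path_image h = {}"
        using R12(1,2) unfolding region_def by (simp_all add: Int_Un_distrib)
      moreover have "path_image h - {W 0, W 1} = (\<Union>t\<le>1. g t - {W t})"
      proof -
        have "g 0 \<inter> pcyc Q L = {W 0}" "g 1 \<inter> pcyc Q L = {W 1}" using gJ[of 0] gJ[of 1] k3 by simp_all
        moreover have "{W 0, W 1} \<subseteq> pcyc Q L" using EF Eint by blast
        ultimately have "W 1 \<notin> g 0" "W 0 \<notin> g 1" using W01 by (metis Int_singletonD insert_subset)+
        then show ?thesis unfolding h(2) by (auto simp: le_Suc_eq)
      qed
      ultimately have e': "region (g 0 \<union> E 0 \<union> g (Suc 0)) R1" "region (g 1 \<union> g 0 \<union> pc Q (tail 1)) R2"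
        "R1 \<inter> g 0 = {}" "R1 \<inter> g 1 = {}" "R2 \<inter> g 0 = {}" "R2 \<inter> g 1 = {}" "R = R1 \<union> R2 \<union> (\<Union>t\<le>1. g t - {W t})"
        using R12 h(2) by (simp_all only: Int_Un_distrib Un_empty)
      show ?thesis unfolding S_def
      proof (intro conjI allI impI)
        show "region (g t \<union> E t \<union> g (Suc t)) R1" if "t < 1" for t using that e'(1) by simp
        show "region (g 1 \<union> g 0 \<union> pc Q (tail 1)) R2" by (rule e'(2))
        show "R1 \<inter> R1 = {}" if "t < 1" "s < 1" "t \<noteq> s" for t s :: nat using that by simp
        show "R1 \<inter> R2 = {}" by (rule R12(3))
        show "R1 \<inter> g s = {}" "R2 \<inter> g s = {}" if "s \<le> 1" for s
          using that e'(3-6) by (cases s; simp)+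
        show "R = (\<Union>t<(1::nat). R1) \<union> R2 \<union> (\<Union>t\<le>1. g t - {W t})"
        proof -
          have "(\<Union>t<(1::nat). R1) = R1" by auto
          then show ?thesis using e'(7) by (simp only:)
        qed
      qed
    qed
    then show ?thesis by blast
  qed
  have step: "\<exists>Rg M. S (Suc r) Rg M" if r: "1 \<le> r" "Suc r < k" and S: "S r Rg M" for r Rg M
  proof -
    have rk: "r < k" using r by simp
    obtain e where e: "arc e" "path_image e = E r" "pathstart e = W r" "pathfinish e = W (Suc r)" using earc[OF rk] by auto
    obtain f where f: "arc f" "path_image f = pc Q (tail (Suc r))" "pathstart f = W (Suc r)" "pathfinish f = W 0"
      using tarc[of "Suc r"] r W0 by auto
    have Gs: "arc (G t)" "pathstart (G t) = c" "pathfinish (G t) = W t" if "t < k" for t using G[OF that] WL[OF that] by auto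
    have k0: "0 < k" using r by simp
    have Er: "E r \<inter> pc Q (tail (Suc r)) = {W (Suc r)}"
    proof -
      have "W r \<notin> set (tail (Suc r))" using distT[of r] tailC[OF rk] r by auto
      then have "les [W r, W (Suc r)] \<inter> les (tail (Suc r)) = {}" using les_sub[of "{W r, W (Suc r)}"] by auto
      then have "E r \<inter> pc Q (tail (Suc r)) = {W r, W (Suc r)} \<inter> set (tail (Suc r))"
        using pc_Int[OF plane _ sucT _ ptT, of "[W r, W (Suc r)]" "Suc r"] Wadj[OF rk] Wpts[of r] Wpts[of "Suc r"] r by (simp add: E_def)
      moreover have "W (Suc r) \<in> set (tail (Suc r))" using tailC[of "Suc r"] r by simp
      ultimately show ?thesis using \<open>W r \<notin> set (tail (Suc r))\<close> by auto
    qed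
    \<comment> \<open>The boundary of \<open>M\<close> is cut at the two ends of the next spoke, the
      centre and \<open>W (Suc r)\<close>, to match the shape of \<open>S2_theta\<close>.\<close>
    define c1 where "c1 = G r +++ e"
    define c2 where "c2 = G 0 +++ reversepath f"
    have grE: "g r \<inter> E r = {W r}" using gJ[OF rk] EJ[OF rk] Epts[OF rk] by blast
    have g0T: "g 0 \<inter> pc Q (tail (Suc r)) = {W 0}"
    proof -
      have "W 0 \<in> set (tail (Suc r))" using W0 by (simp add: tail_def)
      then have "W 0 \<in> pc Q (tail (Suc r))" by (simp add: pc_def)
      then show ?thesis using gJ[OF k0] tailJ[of "Suc r"] r by auto
    qed
    have c1: "arc c1" "path_image c1 = g r \<union> E r" "pathstart c1 = c" "pathfinish c1 = W (Suc r)"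
      using Gs[OF rk] e grE by (auto simp: c1_def g_def path_image_join intro!: arc_join)
    have c2: "arc c2" "path_image c2 = g 0 \<union> pc Q (tail (Suc r))" "pathstart c2 = c" "pathfinish c2 = W (Suc r)"
      using Gs[OF k0] f g0T by (auto simp: c2_def g_def path_image_join arc_reversepath intro!: arc_join)
    have int: "path_image c1 \<inter> path_image c2 = {c, W (Suc r)}"
    proof -
      have 1: "g r \<inter> g 0 = {c}" using gg[OF rk k0] r by auto
      have "W r \<notin> pc Q (tail (Suc r))" using distT[of r] tailC[OF rk] r pcTp[of "Suc r"] Wpts[of r] by auto
      moreover have "pc Q (tail (Suc r)) \<subseteq> pcyc Q L" using tailJ[of "Suc r"] r by simp
      ultimately have 2: "g r \<inter> pc Q (tail (Suc r)) = {}" using Int_singletonD[OF gJ[OF rk]] by fastforce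
      have "W 0 \<notin> E r" using Epts[OF rk] Wpts[of 0] Winj[of 0 r] Winj[of 0 "Suc r"] r by auto
      then have 3: "E r \<inter> g 0 = {}" using Int_singletonD[OF gJ[OF k0]] EJ[OF rk] by fastforce
      show ?thesis unfolding c1(2) c2(2) using 1 2 3 Er by blast
    qed
    have bM: "path_image c1 \<union> path_image c2 = g r \<union> g 0 \<union> pc Q (tail r)" unfolding c1(2) c2(2) pcT[OF rk] by blast
    have regM: "region (path_image c1 \<union> path_image c2) M" using S bM by (simp add: S_def)
    have cW: "c \<noteq> W (Suc r)" using cR RJ WL[OF r(2)] r k by (auto simp: pcyc_def pc_def)
    let ?T = "g (Suc r) - {c, W (Suc r)}"
    have Gn: "arc (G (Suc r))" "pathstart (G (Suc r)) = c" "pathfinish (G (Suc r)) = W (Suc r)" using Gs r by auto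
    have conT: "connected ?T" using connected_simple_path_endless[of "G (Suc r)"] Gn by (simp add: g_def arc_imp_simple_path)
    have TR: "?T \<subseteq> R" using gR[OF r(2)] by blast
    have Tg: "?T \<inter> g t = {}" if "t \<le> r" for t using gg[of "Suc r" t] that r by auto
    have "R \<subseteq> (\<Union>t<r. Rg t) \<union> M \<union> (\<Union>t\<le>r. g t)" using S unfolding S_def by (elim conjE) blast
    have Tsub: "?T \<subseteq> (\<Union>t<r. Rg t) \<union> M"
    proof -
      show ?thesis
      proof
        fix z assume z: "z \<in> ?T"
        then have "z \<in> R" using TR by blast
        then have "z \<in> (\<Union>t<r. Rg t) \<union> M \<union> (\<Union>t\<le>r. g t)" using \<open>R \<subseteq> _\<close> by blast
        moreover have "z \<notin> (\<Union>t\<le>r. g t)" using Tg z by blast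
        ultimately show "z \<in> (\<Union>t<r. Rg t) \<union> M" by blast
      qed
    qed
    have TS: "?T \<subseteq> S2" using TR region_sub(1)[OF reg] by blast
    have TJ: "?T \<inter> pcyc Q L = {}" using TR RJ by blast
    \<comment> \<open>If the next spoke ran inside a finished sector, its rim end would lie in the
      closure of that sector; but \<open>W (Suc r)\<close> is neither in the sector nor on its
      boundary.\<close>
    have noRg: "?T \<inter> Rg t = {}" if t: "t < r" for t
    proof (rule ccontr)
      assume ne: "?T \<inter> Rg t \<noteq> {}"
      have rg: "region (g t \<union> E t \<union> g (Suc t)) (Rg t)" using S t by (simp add: S_def)
      have "?T \<inter> (g t \<union> E t \<union> g (Suc t)) = {}" using Tg[of t] Tg[of "Suc t"] TJ EJ[of t] t rk by auto
      then have "?T \<subseteq> Rg t" using region_absorb[OF rg conT TS] ne by blast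
      then have "closure ?T \<subseteq> closure (Rg t)" by (rule closure_mono)
      moreover have "W (Suc r) \<in> closure ?T" using arc_end_closure[OF Gn(1)] Gn by (simp add: g_def)
      ultimately have W: "W (Suc r) \<in> Rg t \<union> (g t \<union> E t \<union> g (Suc t))" using rg by (auto simp: region_def)
      have wJ: "W (Suc r) \<in> pcyc Q L" using WL[OF r(2)] r k by (auto simp: pcyc_def pc_def)
      moreover have "Rg t \<subseteq> R" using S t by (auto simp: S_def)
      ultimately have "W (Suc r) \<notin> Rg t" using RJ by blast
      moreover have "W (Suc r) \<notin> g t" "W (Suc r) \<notin> g (Suc t)"
      proof -
        have "g t \<inter> pcyc Q L = {W t}" "g (Suc t) \<inter> pcyc Q L = {W (Suc t)}" "W t \<noteq> W (Suc r)" "W (Suc t) \<noteq> W (Suc r)"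
          using gJ[of t] gJ[of "Suc t"] Winj[of t "Suc r"] Winj[of "Suc t" "Suc r"] t r by simp_all
        then show "W (Suc r) \<notin> g t" "W (Suc r) \<notin> g (Suc t)" using wJ Int_singletonD by metis+
      qed
      moreover have "W (Suc r) \<notin> E t"
      proof -
        have "E t \<inter> points Q = {W t, W (Suc t)}" "W (Suc r) \<in> points Q" "W t \<noteq> W (Suc r)" "W (Suc t) \<noteq> W (Suc r)"
          using Epts[of t] Wpts[of "Suc r"] Winj[of t "Suc r"] Winj[of "Suc t" "Suc r"] t r by simp_all
        then show ?thesis using Int_doubletonD by metis
      qed
      ultimately show False using W by blast
    qed
    then have TM: "?T \<subseteq> M" using Tsub by blast
    obtain R1 R2 where R12: "region (path_image c1 \<union> path_image (G (Suc r))) R1" "region (path_image c2 \<union> path_image (G (Suc r))) R2"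
      "R1 \<inter> R2 = {}" "M = R1 \<union> R2 \<union> (path_image (G (Suc r)) - {c, W (Suc r)})"
      using S2_theta[OF c1(1) c2(1) Gn(1) cW c1(3,4) c2(3,4) Gn(2,3) int regM] TM by (auto simp: g_def)
    define Rg' where "Rg' t = (if t = r then R1 else Rg t)" for t
    have Rgr: "Rg' t = Rg t" if "t < r" for t using that by (simp add: Rg'_def)
    have Mfull: "M = R1 \<union> R2 \<union> ?T" using R12 by (simp add: g_def)
    have d: "\<And>t s. t < r \<Longrightarrow> s < r \<Longrightarrow> t \<noteq> s \<Longrightarrow> Rg t \<inter> Rg s = {}" "\<And>t. t < r \<Longrightarrow> Rg t \<inter> M = {}"
      "\<And>t s. t < r \<Longrightarrow> s \<le> r \<Longrightarrow> Rg t \<inter> g s = {}" "\<And>s. s \<le> r \<Longrightarrow> M \<inter> g s = {}"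
      "R = (\<Union>t<r. Rg t) \<union> M \<union> (\<Union>t\<le>r. g t - {W t})" using S by (auto simp: S_def)
    have gn: "g (Suc r) = ?T \<union> {c, W (Suc r)}" using cg[OF r(2)] gJ[OF r(2)] by blast
    have R1g: "R1 \<inter> g (Suc r) = {}" "R2 \<inter> g (Suc r) = {}" using R12(1,2) by (auto simp: region_def g_def)
    have "S (Suc r) Rg' R2"
      unfolding S_def
    proof (intro conjI allI impI)
      fix t assume t: "t < Suc r"
      show "region (g t \<union> E t \<union> g (Suc t)) (Rg' t)"
      proof (cases "t = r")
        case True then show ?thesis using R12(1) c1(2) by (simp add: Rg'_def g_def Un_assoc Un_commute)
      next
        case False then show ?thesis using S t by (simp add: Rg'_def S_def)
      qed
    next
      show "region (g (Suc r) \<union> g 0 \<union> pc Q (tail (Suc r))) R2"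
        using R12(2) c2(2) by (simp add: g_def Un_assoc Un_commute Un_left_commute)
    next
      fix t s assume ts: "t < Suc r" "s < Suc r" "t \<noteq> s"
      have "R1 \<subseteq> M" using Mfull by blast
      then have "Rg t \<inter> R1 = {}" if "t < r" for t using d(2)[OF that] by blast
      then show "Rg' t \<inter> Rg' s = {}" using ts d(1)[of t s] unfolding Rg'_def less_Suc_eq by (metis Int_commute)
    next
      fix t assume t: "t < Suc r"
      have "R2 \<subseteq> M" using Mfull by blast
      then have "Rg t \<inter> R2 = {}" if "t < r" for t using d(2)[OF that] by blast
      then show "Rg' t \<inter> R2 = {}" using t R12(3) unfolding Rg'_def less_Suc_eq by metis
    next
      fix t s assume ts: "t < Suc r" "s \<le> Suc r"
      have RM: "R1 \<subseteq> M" using Mfull by blast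
      have "Rg t \<inter> g (Suc r) = {}" if "t < r"
      proof -
        have "c \<notin> Rg t" using d(3)[OF that, of 0] cg[OF k0] by auto
        moreover have "W (Suc r) \<notin> Rg t"
        proof -
          have "Rg t \<subseteq> R" using d(5) that by blast
          moreover have "W (Suc r) \<in> pcyc Q L" using WL[OF r(2)] r k by (auto simp: pcyc_def pc_def)
          ultimately show ?thesis using RJ by blast
        qed
        ultimately show ?thesis using gn noRg[OF that] by blast
      qed
      then show "Rg' t \<inter> g s = {}" using ts d(3)[of t s] d(4)[of s] RM R1g by (cases "t = r"; cases "s = Suc r") (auto simp: Rg'_def)
    next
      fix s assume s: "s \<le> Suc r"
      have "R2 \<subseteq> M" using Mfull by blast
      then show "R2 \<inter> g s = {}" using s d(4)[of s] R1g by (cases "s = Suc r") auto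
    next
      have "(\<Union>t<Suc r. Rg' t) = (\<Union>t<r. Rg t) \<union> R1" by (auto simp: Rg'_def less_Suc_eq split: if_splits)
      moreover have "(\<Union>t\<le>Suc r. g t - {W t}) = (\<Union>t\<le>r. g t - {W t}) \<union> (g (Suc r) - {W (Suc r)})" by (auto simp: le_Suc_eq)
      moreover have "g (Suc r) - {W (Suc r)} = insert c ?T" using gn cW by blast
      moreover have "c \<in> (\<Union>t\<le>r. g t - {W t})" using cg[OF k0] cR RJ gJ[OF k0] by auto
      ultimately show "R = (\<Union>t<Suc r. Rg' t) \<union> R2 \<union> (\<Union>t\<le>Suc r. g t - {W t})"
        using d(5) Mfull by (simp only:) blast
    qed
    then show ?thesis by blast
  qed
  have "\<exists>Rg M. S r Rg M" if "1 \<le> r" "r < k" for r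
    using that
  proof (induction r rule: nat_induct_at_least)
    case base show ?case by (rule \<open>\<exists>Rg M. S 1 Rg M\<close>)
  next
    case (Suc r) then show ?case using step[of r] by auto
  qed
  moreover have "1 \<le> k - 1" "k - 1 < k" using k3 by auto
  ultimately obtain Rg M where S: "S (k - 1) Rg M" by blast
  obtain k' where k': "k = Suc k'" using k3 by (cases k) auto
  have S': "S k' Rg M" using S k' by simp
  \<comment> \<open>After the last spoke the rest is bounded by the last spoke, one rim edge and
    spoke 0, so it is itself the last sector.\<close>
  define Rf where "Rf t = (if t = k' then M else Rg t)" for t
  have gk: "g k = g 0" using Gk by (simp add: g_def)
  have tk: "pc Q (tail k') = E k'" using pcT[of k'] k' tailk by (auto simp: pc_def E_def)
  have 1: "region (g t \<union> E t \<union> g (Suc t)) (Rf t)" if "t < k" for t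
  proof (cases "t = k'")
    case True
    have "region (g k' \<union> g 0 \<union> E k') M" using S' tk by (simp add: S_def)
    moreover have "g k' \<union> g 0 \<union> E k' = g t \<union> E t \<union> g (Suc t)" using True gk k' by auto
    ultimately show ?thesis using True by (simp add: Rf_def)
  next
    case False then show ?thesis using S' that k' by (simp add: Rf_def S_def)
  qed
  have 2: "Rf t \<inter> Rf s = {}" if "t < k" "s < k" "t \<noteq> s" for t s
    using S' that k' unfolding S_def Rf_def by (auto simp: Int_commute)
  have 3: "Rf t \<inter> g s = {}" if "t < k" "s < k" for t s
    using S' that k' unfolding S_def Rf_def by (auto simp: less_Suc_eq_le)
  have 4: "R = (\<Union>t<k. Rf t) \<union> (\<Union>t<k. g t - {W t})"
  proof -
    have "(\<Union>t<k. Rf t) = (\<Union>t<k'. Rg t) \<union> M" by (auto simp: Rf_def k' less_Suc_eq split: if_splits)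
    moreover have "{..<k} = {..k'}" using k' by auto
    ultimately show ?thesis using S' unfolding S_def by simp
  qed
  have "(\<Union>t<k. g t - {W t}) = (\<Union>t<k. g t - {L ! t})" using WL by simp
  then show ?thesis using 1 2 3 4 WL unfolding E_def g_def W_def[symmetric]
    by (intro exI[of _ Rf]) simp
qed

lemma boundary_vertices_region:
  assumes plane: "plane_graph P" and "cyc P L" "region (pcyc P L) F"
  shows "boundary_vertices P F = set L"
proof -
  have FS: "F \<subseteq> S2" and JS: "pcyc P L \<subseteq> S2" using region_sub[OF assms(3)] by auto
  have cl: "closure F = F \<union> pcyc P L" "F \<inter> pcyc P L = {}" "openin (top_of_set S2) F" using assms(3) by (auto simp: region_def)
  have "top_of_set S2 interior_of F = F" using cl(3) by (simp add: interior_of_openin)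
  moreover have "top_of_set S2 closure_of F = S2 \<inter> closure F"
    using FS by (simp add: closure_of_subtopology inf.absorb2)
  ultimately have "top_of_set S2 frontier_of F = pcyc P L" using cl FS JS by (auto simp: frontier_of_def)
  then show ?thesis using cyc_region_points[OF plane assms(2)] by (auto simp: boundary_vertices_def)
qed

lemma successively_mono': "successively A l \<Longrightarrow> (\<And>x y. A x y \<Longrightarrow> B x y) \<Longrightarrow> successively B l"
  by (induction l rule: induct_list012) auto

lemma extends_padj: "extends P Q \<Longrightarrow> padj P u v \<Longrightarrow> padj Q u v"
  unfolding extends_def padj_def by (metis subsetD)

context
  fixes P Q assumes P: "plane_graph P" and Q: "plane_graph Q" and ext: "extends P Q"
begin

lemma extends_cv: "padj P u v \<Longrightarrow> cv Q {u, v} = cv P {u, v}"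
  using cv_props[OF P] ext unfolding extends_def by (intro cv_eq[OF Q]) auto

lemma extends_pc: "successively (padj P) l \<Longrightarrow> pc Q l = pc P l"
  using les_padj[OF P, of l] extends_cv unfolding pc_def by (metis (no_types, lifting) SUP_cong)

lemma extends_cyc: "cyc P L \<Longrightarrow> cyc Q L" "cyc P L \<Longrightarrow> pcyc Q L = pcyc P L"
  using ext successively_mono'[of "padj P" _ "padj Q"] extends_padj[OF ext] extends_pc[of "L @ [hd L]"]
  unfolding cyc_def pcyc_def extends_def by auto

end

abbreviation drawn :: "drawing \<Rightarrow> (real^3) set" where
  "drawn P \<equiv> points P \<union> \<Union>(curves P)"

text \<open>By \<open>region_absorb\<close> no connected set can grow beyond a region without
  meeting its drawn boundary, which is the maximality required of a component.\<close>

lemma region_face: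
  assumes "region J R" "J \<subseteq> drawn Q" "R \<inter> drawn Q = {}"
  shows "R \<in> faces Q"
proof -
  have "R \<subseteq> S2 - drawn Q" using region_sub[OF assms(1)] assms(3) by blast
  moreover have "d = R" if "R \<subseteq> d" "d \<subseteq> S2 - drawn Q" "connected d" for d
  proof -
    have "d \<subseteq> S2" "d \<inter> J = {}" "R \<noteq> {}" using that(2) assms(1,2) by (auto simp: region_def)
    moreover have "d \<inter> R \<noteq> {}" using that(1) \<open>R \<noteq> {}\<close> by blast
    ultimately have "d \<subseteq> R" using region_absorb[OF assms(1) that(3)] by blast
    then show ?thesis using that(1) by simp
  qed
  moreover have "R \<noteq> {}" "connected R" using assms(1) by (auto simp: region_def)
  ultimately show ?thesis unfolding faces_def in_components_maximal by blast
qed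

lemma Union_faces: "\<Union>(faces P) = S2 - drawn P"
  by (simp add: faces_def)

text \<open>Invariant of the finite stages. Since each face is bounded by a cycle, its boundary
  vertices have a cyclic order, as \<open>fan\<close> requires; finiteness yields a countable limit
  and leaves room for a generic choice of centres.\<close>

definition good :: "drawing \<Rightarrow> bool" where
  "good P \<longleftrightarrow> plane_graph P \<and> finite (points P) \<and> finite (faces P) \<and>
     (\<forall>F\<in>faces P. \<exists>L. cyc P L \<and> region (pcyc P L) F)"

lemma les_map_upt: "les (map f [0..<Suc m]) = {{f d, f (Suc d)} | d. d < m}"
proof -
  have "(e = {map f [0..<Suc m] ! i, map f [0..<Suc m] ! Suc i} \<and> Suc i < length (map f [0..<Suc m])) \<longleftrightarrow>
      (e = {f i, f (Suc i)} \<and> i < m)" for e i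
    by (cases "i < m") (simp_all add: nth_map_upt)
  then show ?thesis unfolding les_conv by simp
qed

context
  fixes P Q :: drawing and c g m
  assumes goodP: "good P" and star: "star P c g"
    and Q: "points Q = star_points (Suc m) P c g" "curves Q = star_curves (Suc m) P g"
begin

lemma planeP: "plane_graph P" using goodP by (simp add: good_def)

lemma planeQ: "plane_graph Q" using step_plane[OF planeP star Q] by simp

lemma extQ: "extends P Q" using step_extends[OF planeP star Q] by simp

context
  fixes F L
  assumes F: "F \<in> faces P" and L: "cyc P L" "region (pcyc P L) F"
begin

text \<open>With the first vertex repeated, index \<open>length L\<close> denotes spoke 0 again,
  which matches the wrap-around in \<open>fan\<close>.\<close>

definition rim :: "nat \<Rightarrow> real^3" where "rim t = (L @ [hd L]) ! t"
definition sp :: "nat \<Rightarrow> nat \<Rightarrow> real^3" where "sp t d = g F (rim t) (real d / real (m + 2))"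

lemma rim_bv: "t \<le> length L \<Longrightarrow> rim t \<in> boundary_vertices P F"
proof -
  assume "t \<le> length L"
  then have "rim t \<in> set (L @ [hd L])" unfolding rim_def by (intro nth_mem) simp
  moreover have "L \<noteq> []" using L by (auto simp: cyc_def)
  then have "hd L \<in> set L" by simp
  ultimately show ?thesis unfolding boundary_vertices_region[OF planeP L] by auto
qed

lemma rim_nth: "t < length L \<Longrightarrow> rim t = L ! t" "rim (length L) = rim 0"
  using L by (auto simp: rim_def nth_append cyc_def hd_conv_nth)

lemma rim_inj: "t < length L \<Longrightarrow> rim t \<noteq> rim (Suc t)"
proof -
  assume t: "t < length L"
  have d: "distinct L" "3 \<le> length L" using L by (auto simp: cyc_def)
  show ?thesis
  proof (cases "Suc t = length L")
    case True
    then have "t \<noteq> 0" using d by auto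
    then show ?thesis using True t rim_nth(1)[OF t] rim_nth(1)[of 0] rim_nth(2) d nth_eq_iff_index_eq[OF d(1), of t 0] by force
  next
    case False then show ?thesis using t rim_nth(1)[of t] rim_nth(1)[of "Suc t"] d nth_eq_iff_index_eq[OF d(1), of t "Suc t"] by auto
  qed
qed

lemmas spk = spoke[OF planeP star Q _ F rim_bv, simplified] spoke_in[OF planeP star Q _ F rim_bv, simplified]

lemma sp_ends: "t \<le> length L \<Longrightarrow> sp t 0 = c F" "t \<le> length L \<Longrightarrow> sp t (m + 2) = rim t"
  using spk(2,3) by (auto simp: sp_def)

lemma sp_in: "t \<le> length L \<Longrightarrow> d \<le> m + 1 \<Longrightarrow> sp t d \<in> F"
  using spk(6)[of t "real d / real (m + 2)"] by (simp add: sp_def)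

lemma sp_eq: "t \<le> length L \<Longrightarrow> t' \<le> length L \<Longrightarrow> d \<le> m + 1 \<Longrightarrow> d' \<le> m + 2 \<Longrightarrow> sp t d = sp t' d' \<Longrightarrow>
   d = d' \<and> (rim t = rim t' \<or> d = 0)"
proof -
  assume a: "t \<le> length L" "t' \<le> length L" "d \<le> m + 1" "d' \<le> m + 2" "sp t d = sp t' d'"
  have "F = F \<and> real d / real (m + 2) = real d' / real (m + 2) \<and> (rim t = rim t' \<or> real d / real (m + 2) = 0)"
    by (rule spoke_key[OF planeP star Q _ F rim_bv[OF a(1)] F rim_bv[OF a(2)]]) (use a in \<open>auto simp: sp_def\<close>)
  then show ?thesis by (auto simp: divide_eq_0_iff)
qed

lemma sp_points: "t \<le> length L \<Longrightarrow> d \<le> m + 2 \<Longrightarrow> sp t d \<in> points Q"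
  using step_points(3)[OF planeP star Q _ F rim_bv, of t d] by (simp add: sp_def)

lemma sp_piece:
  assumes t: "t \<le> length L" and d: "d \<le> m + 1"
  defines "K \<equiv> g F (rim t) ` {real d / real (m + 2) .. real (d + 1) / real (m + 2)}"
  shows "padj Q (sp t d) (sp t (Suc d))" "cv Q {sp t d, sp t (Suc d)} = K" "K \<in> curves Q"
proof -
  show K: "K \<in> curves Q" unfolding Q star_curves_def K_def using F rim_bv[OF t] d by fastforce
  have "K \<inter> points Q = {sp t d, sp t (Suc d)}"
    using piece_points[OF planeP star Q _ F rim_bv[OF t], of d] d by (simp add: K_def sp_def)
  then show "padj Q (sp t d) (sp t (Suc d))" "cv Q {sp t d, sp t (Suc d)} = K"
    using K cv_eq[OF planeQ K] by (auto simp: padj_def)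
qed

text \<open>The pieces of a subdivided spoke cover it, so the walk along its vertices traces the
  same point set as the original arc.\<close>

lemma unit_cover: "{0..1::real} = (\<Union>d<m + 2. {real d / real (m + 2) .. real (d + 1) / real (m + 2)})"
proof -
  have "x \<in> (\<Union>d<m + 2. {real d / real (m + 2) .. real (d + 1) / real (m + 2)})" if x: "0 \<le> x" "x \<le> 1" for x :: real
  proof (cases "x = 1")
    case True
    then have "x \<in> {real (m + 1) / real (m + 2) .. real (m + 1 + 1) / real (m + 2)}" by simp
    then show ?thesis by (intro UN_I[of "m + 1"]) simp_all
  next
    case False
    let ?N = "real (m + 2)"
    define d where "d = nat \<lfloor>x * ?N\<rfloor>"
    have xN: "0 \<le> x * ?N" "x * ?N < ?N" using x False by auto
    have d: "real d \<le> x * ?N" "x * ?N \<le> real d + 1" using xN unfolding d_def by (simp_all add: of_nat_nat)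
    then have "d < m + 2" using xN by linarith
    moreover have "real d / ?N \<le> x" "x \<le> real (d + 1) / ?N" using d by (simp_all add: field_simps)
    ultimately show ?thesis by auto
  qed
  moreover have "x \<in> {0..1}" if "d < m + 2" "x \<in> {real d / real (m + 2) .. real (d + 1) / real (m + 2)}" for x d
  proof -
    have "0 \<le> real d / real (m + 2)" "real (d + 1) / real (m + 2) \<le> 1" using that by auto
    then show ?thesis using that(2) unfolding atLeastAtMost_iff by linarith
  qed
  ultimately show ?thesis by (intro antisym subsetI) (simp only: atLeastAtMost_iff, blast)
qed

lemma spoke_list:
  assumes t: "t \<le> length L"
  shows "successively (padj Q) (map (sp t) [0..<m + 3])" "set (map (sp t) [0..<m + 3]) \<subseteq> points Q"
    "distinct (map (sp t) [0..<m + 3])" "pc Q (map (sp t) [0..<m + 3]) = path_image (g F (rim t))"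
proof -
  show "successively (padj Q) (map (sp t) [0..<m + 3])"
    unfolding successively_conv_nth using sp_piece(1)[OF t] by auto
  show pts: "set (map (sp t) [0..<m + 3]) \<subseteq> points Q" using sp_points[OF t] by auto
  have "inj_on (sp t) {0..<m + 3}"
  proof (rule inj_onI)
    fix d d' assume a: "d \<in> {0..<m + 3}" "d' \<in> {0..<m + 3}" "sp t d = sp t d'"
    show "d = d'"
    proof (cases "d = m + 2")
      case True
      then show ?thesis using a sp_eq[OF t t, of d' d] by (cases "d' = m + 2") auto
    next
      case False then show ?thesis using a sp_eq[OF t t, of d d'] by auto
    qed
  qed
  then show "distinct (map (sp t) [0..<m + 3])" by (simp add: distinct_map)
  have le: "les (map (sp t) [0..<m + 3]) = {{sp t d, sp t (Suc d)} | d. d < m + 2}"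
    using les_map_upt[of "sp t" "m + 2"] by (simp add: numeral_3_eq_3)
  have "(\<Union>x\<in>les (map (sp t) [0..<m + 3]). cv Q x) = (\<Union>d<m + 2. cv Q {sp t d, sp t (Suc d)})"
    unfolding le by auto
  also have "\<dots> = (\<Union>d<m + 2. g F (rim t) ` {real d / real (m + 2) .. real (d + 1) / real (m + 2)})"
    using sp_piece(2)[OF t] by auto
  also have "\<dots> = path_image (g F (rim t))" unfolding path_image_def unit_cover by blast
  finally have 1: "(\<Union>x\<in>les (map (sp t) [0..<m + 3]). cv Q x) = path_image (g F (rim t))" .
  have "sp t d \<in> path_image (g F (rim t))" if "d \<le> m + 2" for d
    using that unfolding sp_def path_image_def by (intro imageI) auto
  then show "pc Q (map (sp t) [0..<m + 3]) = path_image (g F (rim t))"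
    unfolding pc_def 1 by auto
qed

lemma rim_adj: "t < length L \<Longrightarrow> padj P (rim t) (rim (Suc t))"
proof -
  assume t: "t < length L"
  have "successively (padj P) (L @ [hd L])" using L by (simp add: cyc_def)
  then show ?thesis unfolding successively_conv_nth rim_def using t by simp
qed

text \<open>Two paths lead from the centre to \<open>rim (Suc t)\<close>: spoke \<open>t\<close>
  followed by the rim edge, and spoke \<open>t + 1\<close>. They share only their ends, so
  \<open>cyc_ear\<close> closes them to a cycle.\<close>

lemma child_cyc:
  assumes t: "t < length L"
  shows "cyc Q (sector m (sp t) (sp (Suc t)))"
    "pcyc Q (sector m (sp t) (sp (Suc t))) =
      path_image (g F (rim t)) \<union> pc Q [rim t, rim (Suc t)] \<union> path_image (g F (rim (Suc t)))"
proof -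
  define A where "A = map (sp t) [1..<m + 3]"
  define Z where "Z = map (sp (Suc t)) [1..<m + 2]"
  have t': "t \<le> length L" "Suc t \<le> length L" using t by auto
  have xA: "c F # A = map (sp t) [0..<m + 3]" using sp_ends(1)[OF t'(1)] by (simp add: A_def upt_conv_Cons)
  have xZ: "c F # Z @ [rim (Suc t)] = map (sp (Suc t)) [0..<m + 3]"
  proof -
    have "[0..<m + 3] = 0 # [1..<m + 2] @ [m + 2]"
    proof -
      have "[0..<m + 3] = 0 # [1..<Suc (m + 2)]" using upt_conv_Cons[of 0 "m + 3"] by (simp add: numeral_3_eq_3)
      also have "[1..<Suc (m + 2)] = [1..<m + 2] @ [m + 2]" by (rule upt_Suc_append) simp
      finally show ?thesis .
    qed
    then show ?thesis using sp_ends[OF t'(2)] by (simp add: Z_def)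
  qed
  have sec: "sector m (sp t) (sp (Suc t)) = c F # A @ rim (Suc t) # rev Z"
  proof -
    have "rev [1..<m + 3] = (m + 2) # rev [1..<m + 2]" by (simp add: numeral_3_eq_3 upt_Suc_append)
    then show ?thesis unfolding sector_def xA[symmetric] using sp_ends(2)[OF t'(2)] by (simp add: Z_def rev_map)
  qed
  have Aend: "A = map (sp t) [1..<m + 2] @ [rim t]"
    using sp_ends(2)[OF t'(1)] by (simp add: A_def numeral_3_eq_3 upt_Suc_append)
  have adj: "padj Q (rim t) (rim (Suc t))" using extends_padj[OF extQ rim_adj[OF t]] .
  have s1: "successively (padj Q) (c F # A @ [rim (Suc t)])"
    using spoke_list(1)[OF t'(1)] adj unfolding xA[symmetric] append_Cons[symmetric]
    by (subst successively_append_iff) (simp add: Aend)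
  have s2: "successively (padj Q) (c F # Z @ [rim (Suc t)])" unfolding xZ by (rule spoke_list(1)[OF t'(2)])
  have dd: "distinct (c F # A @ rim (Suc t) # Z)"
  proof -
    have 1: "distinct (c F # A)" "distinct (c F # Z @ [rim (Suc t)])"
      unfolding xA xZ using spoke_list(3) t' by auto
    have "sp t d \<noteq> sp (Suc t) d'" if d: "1 \<le> d" "d \<le> m + 2" "1 \<le> d'" "d' \<le> m + 2" for d d'
    proof
      assume eq: "sp t d = sp (Suc t) d'"
      have ne: "rim t \<noteq> rim (Suc t)" by (rule rim_inj[OF t])
      show False
      proof (cases "d = m + 2")
        case True
        then show False using eq d ne sp_ends(2) t' sp_eq[of "Suc t" t d' d] by (cases "d' = m + 2") auto
      next
        case False
        then show False using eq d ne t' sp_eq[of t "Suc t" d d'] by auto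
      qed
    qed
    then have "set A \<inter> set (Z @ [rim (Suc t)]) = {}"
      using sp_ends(2)[OF t'(2)] unfolding A_def Z_def by fastforce
    then show ?thesis using 1 by auto
  qed
  have pp: "set (c F # A @ rim (Suc t) # Z) \<subseteq> points Q"
    using spoke_list(2)[OF t'(1)] spoke_list(2)[OF t'(2)] unfolding xA[symmetric] xZ[symmetric] by auto
  have "A \<noteq> [] \<or> Z \<noteq> []" by (simp add: Aend)
  note e = cyc_ear[OF planeQ s1 s2 dd pp this]
  show "cyc Q (sector m (sp t) (sp (Suc t)))" unfolding sec by (rule e(1))
  have "pc Q (c F # A @ [rim (Suc t)]) = path_image (g F (rim t)) \<union> pc Q [rim t, rim (Suc t)]"
  proof -
    have "pc Q (c F # A @ [rim (Suc t)]) = pc Q ((c F # map (sp t) [1..<m + 2]) @ rim t # [rim (Suc t)])" by (simp add: Aend)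
    also have "\<dots> = pc Q (c F # A) \<union> pc Q [rim t, rim (Suc t)]"
      using pc_append[of Q "c F # map (sp t) [1..<m + 2]" "rim t" "[rim (Suc t)]"] by (simp add: Aend)
    finally show ?thesis unfolding xA using spoke_list(4)[OF t'(1)] by simp
  qed
  then show "pcyc Q (sector m (sp t) (sp (Suc t))) =
      path_image (g F (rim t)) \<union> pc Q [rim t, rim (Suc t)] \<union> path_image (g F (rim (Suc t)))"
    unfolding sec e(2) xZ spoke_list(4)[OF t'(2)] by simp
qed

text \<open>Inside a face the new drawing consists of the spokes of this very face. So the regions
  between its spokes contain no drawn point and are faces.\<close>

lemma drawn_in_face:
  assumes "z \<in> drawn Q" "z \<in> F" shows "\<exists>t<length L. z \<in> path_image (g F (L ! t))"
proof -
  have bv: "boundary_vertices P F = set L" by (rule boundary_vertices_region[OF planeP L])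
  have Lne: "0 < length L" using L by (auto simp: cyc_def)
  have "\<exists>u\<in>set L. z \<in> path_image (g F u)"
  proof -
    have nP: "z \<notin> drawn P" using faces_props[OF F] assms(2) by blast
    have cF: "\<exists>u\<in>set L. c F \<in> path_image (g F u)"
    proof -
      have "c F \<in> path_image (g F (L ! 0))" using spk(1,2)[of 0] rim_nth(1)[OF Lne] by (metis pathstart_def pathstart_in_path_image le0)
      then show ?thesis using Lne nth_mem by blast
    qed
    have pt: ?thesis if F': "F' \<in> faces P" "u \<in> boundary_vertices P F'" "z = g F' u s" "0 \<le> s" "s \<le> 1" for F' u s
    proof -
      have "z \<in> path_image (g F' u)" unfolding path_image_def F'(3) using F' by (intro imageI) simp
      then have "z = u \<or> z \<in> F'" using spoke(4)[OF planeP star Q _ F'(1,2)] by auto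
      moreover have "z \<noteq> u" using nP F'(2) by (auto simp: boundary_vertices_def)
      ultimately have "F' = F" using faces_disjoint[OF F'(1) F] assms(2) by blast
      then show ?thesis using F'(2) \<open>z \<in> path_image (g F' u)\<close> bv by auto
    qed
    from assms(1) show ?thesis
    proof
      assume "z \<in> points Q"
      then show ?thesis
      proof (rule step_points_cases[OF planeP star Q, simplified])
        assume "z \<in> points P" then show ?thesis using nP by blast
      next
        fix F' assume "F' \<in> faces P" "z = c F'"
        then have "z \<in> F'" using centre_in[OF planeP star Q] by simp
        then have "F' = F" using faces_disjoint[OF \<open>F' \<in> faces P\<close> F] assms(2) by blast
        then show ?thesis using cF \<open>z = c F'\<close> by simp
      next
        fix F' u i assume "F' \<in> faces P" "u \<in> boundary_vertices P F'" "Suc 0 \<le> i" "i \<le> Suc m" "z = g F' u (real i / (2 + real m))"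
        then show ?thesis using pt[of F' u "real i / (2 + real m)"] by (simp add: divide_le_eq)
      qed
    next
      assume "z \<in> \<Union>(curves Q)"
      then obtain e where e: "e \<in> curves Q" "z \<in> e" by blast
      then have "e \<notin> curves P" using nP by blast
      then obtain F' u i where i: "F' \<in> faces P" "u \<in> boundary_vertices P F'" "i \<le> Suc m"
        "e = g F' u ` {real i / real (Suc m + 1) .. real (i + 1) / real (Suc m + 1)}"
        using e unfolding Q star_curves_def by blast
      obtain s where "z = g F' u s" "0 \<le> s" "s \<le> 1" using piece_sub[OF planeP star Q _ i(1-3)] e(2) i(4) by auto
      then show ?thesis using pt i by blast
    qed
  qed
  then show ?thesis by (metis in_set_conv_nth)
qed

lemma fan_faces:
  "\<exists>Rg. (\<forall>t<length L. Rg t \<in> faces Q \<and> cyc Q (sector m (sp t) (sp (Suc t))) \<and>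
        region (pcyc Q (sector m (sp t) (sp (Suc t)))) (Rg t) \<and> Rg t \<subseteq> F) \<and>
     (\<forall>t<length L. \<forall>s<length L. t \<noteq> s \<longrightarrow> Rg t \<inter> Rg s = {}) \<and>
     F \<subseteq> (\<Union>t<length L. Rg t) \<union> drawn Q"
proof -
  let ?k = "length L"
  define G where "G t = g F (rim t)" for t
  have cycQ: "cyc Q L" "pcyc Q L = pcyc P L" using extends_cyc[OF planeP planeQ extQ L(1)] by auto
  have bv: "boundary_vertices P F = set L" by (rule boundary_vertices_region[OF planeP L])
  have d: "distinct L" using L by (simp add: cyc_def)
  have "\<exists>Rg. (\<forall>t<?k. region (path_image (G t) \<union> pc Q [L ! t, (L @ [hd L]) ! Suc t] \<union> path_image (G (Suc t))) (Rg t)) \<and>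
    (\<forall>t<?k. \<forall>s<?k. t \<noteq> s \<longrightarrow> Rg t \<inter> Rg s = {}) \<and> (\<forall>t<?k. \<forall>s<?k. Rg t \<inter> path_image (G s) = {}) \<and>
    F = (\<Union>t<?k. Rg t) \<union> (\<Union>t<?k. path_image (G t) - {L ! t})"
  proof (rule fan_regions[OF planeQ cycQ(1) _ refl, of F G "c F"])
    show "region (pcyc Q L) F" using L cycQ by simp
    show "arc (G t) \<and> pathstart (G t) = c F \<and> pathfinish (G t) = L ! t \<and> path_image (G t) - {L ! t} \<subseteq> F" if "t < ?k" for t
      using spk(1-4)[of t] rim_nth(1)[OF that] that by (simp add: G_def pathstart_def pathfinish_def)
    show "G ?k = G 0" using rim_nth(2) by (simp add: G_def)
    show "path_image (G t) \<inter> path_image (G s) = {c F}" if "t < ?k" "s < ?k" "t \<noteq> s" for t s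
    proof -
      have "L ! t \<noteq> L ! s" using that d nth_eq_iff_index_eq by blast
      moreover have "L ! t \<in> boundary_vertices P F" "L ! s \<in> boundary_vertices P F" using that bv by auto
      ultimately show ?thesis using star F unfolding star_def G_def rim_nth(1)[OF that(1)] rim_nth(1)[OF that(2)] by blast
    qed
  qed
  then obtain Rg where Rg: "\<And>t. t < ?k \<Longrightarrow> region (path_image (G t) \<union> pc Q [L ! t, (L @ [hd L]) ! Suc t] \<union> path_image (G (Suc t))) (Rg t)"
    "\<And>t s. t < ?k \<Longrightarrow> s < ?k \<Longrightarrow> t \<noteq> s \<Longrightarrow> Rg t \<inter> Rg s = {}" "\<And>t s. t < ?k \<Longrightarrow> s < ?k \<Longrightarrow> Rg t \<inter> path_image (G s) = {}"
    "F = (\<Union>t<?k. Rg t) \<union> (\<Union>t<?k. path_image (G t) - {L ! t})" by blast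
  have reg: "region (pcyc Q (sector m (sp t) (sp (Suc t)))) (Rg t)" if "t < ?k" for t
    using Rg(1)[OF that] child_cyc(2)[OF that] rim_nth(1)[OF that] by (simp add: G_def rim_def)
  have pid: "path_image (g F (rim t)) \<subseteq> drawn Q" if "t \<le> ?k" for t
  proof -
    have "path_image (g F (rim t)) = (\<Union>d<m + 2. g F (rim t) ` {real d / real (m + 2) .. real (d + 1) / real (m + 2)})"
      unfolding path_image_def unit_cover by blast
    also have "\<dots> \<subseteq> drawn Q"
    proof (rule UN_least)
      fix d assume "d \<in> {..<m + 2}"
      then have "g F (rim t) ` {real d / real (m + 2) .. real (d + 1) / real (m + 2)} \<in> curves Q" using sp_piece(3)[OF that, of d] by simp
      then show "g F (rim t) ` {real d / real (m + 2) .. real (d + 1) / real (m + 2)} \<subseteq> drawn Q" by blast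
    qed
    finally show ?thesis .
  qed
  have sub: "Rg t \<subseteq> F" if "t < ?k" for t using Rg(4) that by blast
  have dis: "Rg t \<inter> drawn Q = {}" if t: "t < ?k" for t
  proof (rule ccontr)
    assume "Rg t \<inter> drawn Q \<noteq> {}"
    then obtain z where z: "z \<in> Rg t" "z \<in> drawn Q" by blast
    then obtain s where "s < ?k" "z \<in> path_image (g F (L ! s))" using drawn_in_face sub[OF t] by blast
    then show False using Rg(3)[OF t, of s] z rim_nth(1)[of s] by (auto simp: G_def)
  qed
  have fc: "Rg t \<in> faces Q" if t: "t < ?k" for t
  proof (rule region_face[OF reg[OF t] _ dis[OF t]])
    have "pc Q [rim t, rim (Suc t)] \<subseteq> drawn Q"
    proof -
      have a: "padj Q (rim t) (rim (Suc t))" using extends_padj[OF extQ rim_adj[OF t]] .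
      then have "cv Q {rim t, rim (Suc t)} \<in> curves Q" "rim t \<in> points Q" "rim (Suc t) \<in> points Q"
        using cv_props[OF planeQ a] padj_points[OF planeQ a] by auto
      then show ?thesis by (auto simp: pc_def)
    qed
    then show "pcyc Q (sector m (sp t) (sp (Suc t))) \<subseteq> drawn Q"
      unfolding child_cyc(2)[OF t] using pid[of t] pid[of "Suc t"] t by auto
  qed
  have "F \<subseteq> (\<Union>t<?k. Rg t) \<union> drawn Q"
  proof -
    have "path_image (G t) \<subseteq> drawn Q" if "t < ?k" for t using pid[of t] that by (simp add: G_def)
    then show ?thesis using Rg(4) by blast
  qed
  then show ?thesis using fc child_cyc(1) reg sub Rg(2) by (intro exI[of _ Rg]) simp
qed

end

lemma step_good: "good Q"
proof -
  have fP: "finite (faces P)" "finite (points P)" "\<And>F. F \<in> faces P \<Longrightarrow> \<exists>L. cyc P L \<and> region (pcyc P L) F"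
    using goodP by (auto simp: good_def)
  define Lf where "Lf F = (SOME L. cyc P L \<and> region (pcyc P L) F)" for F
  have Lf: "cyc P (Lf F)" "region (pcyc P (Lf F)) F" if "F \<in> faces P" for F
    using someI_ex[OF fP(3)[OF that]] by (auto simp: Lf_def)
  have "\<exists>Rg. \<forall>F\<in>faces P. (\<forall>t<length (Lf F). Rg F t \<in> faces Q \<and> (\<exists>L. cyc Q L \<and> region (pcyc Q L) (Rg F t))) \<and>
     F \<subseteq> (\<Union>t<length (Lf F). Rg F t) \<union> drawn Q"
  proof (rule bchoice, rule ballI)
    fix F assume F: "F \<in> faces P"
    show "\<exists>R. (\<forall>t<length (Lf F). R t \<in> faces Q \<and> (\<exists>L. cyc Q L \<and> region (pcyc Q L) (R t))) \<and> F \<subseteq> (\<Union>t<length (Lf F). R t) \<union> drawn Q"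
    proof -
      from fan_faces[OF F Lf[OF F]] obtain R where R: "\<forall>t<length (Lf F). R t \<in> faces Q \<and>
          cyc Q (sector m (sp F (Lf F) t) (sp F (Lf F) (Suc t))) \<and>
          region (pcyc Q (sector m (sp F (Lf F) t) (sp F (Lf F) (Suc t)))) (R t) \<and> R t \<subseteq> F"
        "F \<subseteq> (\<Union>t<length (Lf F). R t) \<union> drawn Q" by (elim exE conjE) (rule that)
      have "\<forall>t<length (Lf F). R t \<in> faces Q \<and> (\<exists>L. cyc Q L \<and> region (pcyc Q L) (R t))" using R(1) by blast
      then show ?thesis using R(2) by blast
    qed
  qed
  then obtain Rg where Rg0: "\<forall>F\<in>faces P. (\<forall>t<length (Lf F). Rg F t \<in> faces Q \<and> (\<exists>L. cyc Q L \<and> region (pcyc Q L) (Rg F t))) \<and>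
     F \<subseteq> (\<Union>t<length (Lf F). Rg F t) \<union> drawn Q" ..
  have Rg: "\<And>F t. F \<in> faces P \<Longrightarrow> t < length (Lf F) \<Longrightarrow> Rg F t \<in> faces Q \<and> (\<exists>L. cyc Q L \<and> region (pcyc Q L) (Rg F t))"
    "\<And>F. F \<in> faces P \<Longrightarrow> F \<subseteq> (\<Union>t<length (Lf F). Rg F t) \<union> drawn Q" using Rg0 by simp_all
  \<comment> \<open>A point of a new face lies in an old face and off the drawing, hence in some
    sector; faces that meet are equal, so the sectors are all the new faces.\<close>
  have cover: "\<exists>F\<in>faces P. \<exists>t<length (Lf F). C = Rg F t" if C: "C \<in> faces Q" for C
  proof -
    obtain z where z: "z \<in> C" using faces_props(5)[OF C] by blast
    then have "z \<in> S2 - drawn Q" using C Union_faces[of Q] by blast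
    moreover have "drawn P \<subseteq> drawn Q" using extQ by (auto simp: extends_def)
    ultimately have "z \<in> \<Union>(faces P)" "z \<notin> drawn Q" using Union_faces[of P] by auto
    then obtain F where F: "F \<in> faces P" "z \<in> F" by blast
    then obtain t where t: "t < length (Lf F)" "z \<in> Rg F t" using Rg(2)[OF F(1)] \<open>z \<notin> drawn Q\<close> by blast
    then have "C = Rg F t" using faces_disjoint[OF C, of "Rg F t"] Rg(1)[OF F(1) t(1)] z by blast
    then show ?thesis using F t by blast
  qed
  have "faces Q \<subseteq> (\<Union>F\<in>faces P. Rg F ` {..<length (Lf F)})" using cover by fastforce
  then have fin: "finite (faces Q)" by (rule finite_subset) (use fP in auto)
  have "points Q \<subseteq> points P \<union> c ` faces P \<union>
      (\<lambda>(F, u, i). g F u (real i / real (Suc m + 1))) ` (SIGMA F:faces P. boundary_vertices P F \<times> {1..Suc m})"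
  proof -
    have "{g F u (real i / real (Suc m + 1)) | F u i. F \<in> faces P \<and> u \<in> boundary_vertices P F \<and> 1 \<le> i \<and> i \<le> Suc m} \<subseteq>
      (\<lambda>(F, u, i). g F u (real i / real (Suc m + 1))) ` (SIGMA F:faces P. boundary_vertices P F \<times> {1..Suc m})"
      (is "_ \<subseteq> ?R")
    proof
      fix z assume "z \<in> {g F u (real i / real (Suc m + 1)) | F u i. F \<in> faces P \<and> u \<in> boundary_vertices P F \<and> 1 \<le> i \<and> i \<le> Suc m}"
      then obtain F u i where "z = g F u (real i / real (Suc m + 1))" "F \<in> faces P" "u \<in> boundary_vertices P F" "1 \<le> i" "i \<le> Suc m" by blast
      then show "z \<in> ?R" by (intro image_eqI[of _ _ "(F, u, i)"]) auto
    qed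
    then show ?thesis unfolding Q star_points_def by blast
  qed
  moreover have "finite (boundary_vertices P F)" for F using fP by (simp add: boundary_vertices_def)
  then have "finite (points P \<union> c ` faces P \<union>
      (\<lambda>(F, u, i). g F u (real i / real (Suc m + 1))) ` (SIGMA F:faces P. boundary_vertices P F \<times> {1..Suc m}))" using fP by simp
  ultimately have "finite (points Q)" by (rule finite_subset)
  then show ?thesis unfolding good_def using planeQ fin cover Rg(1) by metis
qed

end

lemma triangle_good:
  assumes "embedded_triangle P" shows "good P" "faces P \<noteq> {}"
proof -
  obtain x y z where plane: "plane_graph P" and xyz: "x \<noteq> y" "y \<noteq> z" "x \<noteq> z"
    and ag: "abstract_graph P = \<lparr>verts = {x, y, z}, edges = {{x, y}, {y, z}, {x, z}}\<rparr>"
    using assms by (auto simp: embedded_triangle_def)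
  have pe: "points P = {x, y, z} \<and> (\<lambda>e. e \<inter> points P) ` curves P = {{x, y}, {y, z}, {x, z}}"
    using ag[unfolded abstract_graph_def sgraph.ext_inject] by (elim conjE) (rule conjI)
  note pts = pe[THEN conjunct1] and ed = pe[THEN conjunct2]
  have adj: "padj P x y" "padj P y z" "padj P x z"
  proof -
    have *: "padj P u v" if "{u, v} \<in> (\<lambda>e. e \<inter> points P) ` curves P" for u v using that by (auto simp: padj_def)
    show "padj P x y" "padj P y z" "padj P x z" by (rule *, simp only: ed, simp)+
  qed
  have adj': "padj P z y" using padj_sym[OF adj(2)] .
  let ?L = "[x, y, z]"
  \<comment> \<open>The triangle is treated as the edge from \<open>x\<close> to \<open>y\<close>
    with an ear through \<open>z\<close>; this gives its two faces.\<close>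
  have "distinct (x # [z] @ [y])" "successively (padj P) (x # [z] @ [y])" "set [z] \<subseteq> points P" using xyz adj adj' pts by auto
  note di = disc_initial[OF plane adj(1) this(1) _ this(3,2), simplified]
  have cycL: "cyc P ?L" using di(1) by simp
  obtain R1 R2 where R: "region (pcyc P ?L) R1" "region (pcyc P ?L) R2" "R1 \<inter> R2 = {}" "S2 = R1 \<union> R2 \<union> pcyc P ?L"
    using di(2) by auto
  have dr: "drawn P = pcyc P ?L"
  proof
    have "cv P {x, y} \<in> curves P" "cv P {y, z} \<in> curves P" "cv P {x, z} \<in> curves P" using cv_props(1)[OF plane] adj by auto
    then show "pcyc P ?L \<subseteq> drawn P" using pts by (auto simp: pcyc_def pc_def insert_commute)
    have "e = cv P {x, y} \<or> e = cv P {y, z} \<or> e = cv P {x, z}" if "e \<in> curves P" for e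
    proof -
      have "e \<inter> points P \<in> (\<lambda>e. e \<inter> points P) ` curves P" using that by (rule imageI)
      then have "e \<inter> points P \<in> {{x, y}, {y, z}, {x, z}}" unfolding ed .
      then show ?thesis using cv_eq[OF plane that refl] by (metis insertE singletonD)
    qed
    then show "drawn P \<subseteq> pcyc P ?L" using pts by (auto simp: pcyc_def pc_def insert_commute)
  qed
  have dis: "R1 \<inter> pcyc P ?L = {}" "R2 \<inter> pcyc P ?L = {}" using R by (auto simp: region_def)
  have f12: "R1 \<in> faces P" "R2 \<in> faces P" using region_face[OF R(1)] region_face[OF R(2)] dr dis by auto
  have "C = R1 \<or> C = R2" if C: "C \<in> faces P" for C
  proof -
    obtain z where z: "z \<in> C" using faces_props(5)[OF C] by blast
    then have "z \<in> S2 - drawn P" using C Union_faces[of P] by blast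
    then have "z \<in> R1 \<or> z \<in> R2" using R(4) dr by blast
    then show ?thesis using faces_disjoint[OF C] f12 z by blast
  qed
  then have fe: "faces P = {R1, R2}" using f12 by blast
  then show "faces P \<noteq> {}" by simp
  show "good P" unfolding good_def fe using plane pts cycL R by auto
qed

section \<open>The limit drawing\<close>

lemma extends_refl: "extends P P"
  by (simp add: extends_def)

context
  fixes \<G> assumes seq: "stellar_sequence \<G>"
begin

lemma seq_step: "\<exists>c g. star (\<G> n) c g \<and> points (\<G> (Suc n)) = star_points (Suc n) (\<G> n) c g \<and>
    curves (\<G> (Suc n)) = star_curves (Suc n) (\<G> n) g"
proof -
  have "stellar_step (Suc n) (\<G> n) (\<G> (Suc n))"
    using seq unfolding stellar_sequence_def by (metis diff_Suc_1 zero_less_Suc)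
  then show ?thesis unfolding stellar_step_alt .
qed

lemma seq_good: "good (\<G> n)"
proof (induction n)
  case 0
  then show ?case using seq triangle_good(1) by (simp add: stellar_sequence_def)
next
  case (Suc n)
  then show ?case using seq_step[of n] step_good by blast
qed

lemma seq_plane: "plane_graph (\<G> n)"
  using seq_good by (simp add: good_def)

lemma seq_extends: "n \<le> m \<Longrightarrow> extends (\<G> n) (\<G> m)"
proof (induction m rule: dec_induct)
  case base show ?case by (rule extends_refl)
next
  case (step m)
  obtain c g where "star (\<G> m) c g" "points (\<G> (Suc m)) = star_points (Suc m) (\<G> m) c g"
    "curves (\<G> (Suc m)) = star_curves (Suc m) (\<G> m) g" using seq_step by blast
  from extQ[OF seq_good this] show ?case using step extends_trans by blast
qed

lemma extends_union: "extends (\<G> n) (union_drawing \<G>)"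
proof -
  have "e \<inter> points (\<G> m) \<subseteq> points (\<G> n)" if "e \<in> curves (\<G> n)" for e m
  proof (cases "n \<le> m")
    case True then show ?thesis using seq_extends[OF True] that by (auto simp: extends_def)
  next
    case False then show ?thesis using seq_extends[of m n] by (auto simp: extends_def)
  qed
  then show ?thesis by (auto simp: extends_def union_drawing_def)
qed

lemma union_points: "points (union_drawing \<G>) = (\<Union>n. points (\<G> n))" "curves (union_drawing \<G>) = (\<Union>n. curves (\<G> n))"
  by (auto simp: union_drawing_def)

text \<open>Each clause concerns at most two curves. These lie in a common stage, and later stages
  put no further vertices on them.\<close>

lemma union_plane: "plane_graph (union_drawing \<G>)"
proof -
  let ?U = "union_drawing \<G>"
  have pl: "points (\<G> n) \<subseteq> S2" "\<forall>e\<in>curves (\<G> n). e \<subseteq> S2 \<and> (\<exists>g. arc g \<and> path_image g = e \<and> e \<inter> points (\<G> n) = {pathstart g, pathfinish g})"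
    "\<forall>e\<in>curves (\<G> n). \<forall>f\<in>curves (\<G> n). e \<noteq> f \<longrightarrow> e \<inter> f \<subseteq> points (\<G> n)" "inj_on (\<lambda>e. e \<inter> points (\<G> n)) (curves (\<G> n))" for n
    using seq_plane[of n] by (simp_all add: plane_graph_def)
  have eqp: "e \<inter> points ?U = e \<inter> points (\<G> n)" if "e \<in> curves (\<G> n)" for e n
    using extends_union[of n] that by (auto simp: extends_def)
  have two: "\<exists>n. e \<in> curves (\<G> n) \<and> f \<in> curves (\<G> n)" if ef: "e \<in> curves ?U" "f \<in> curves ?U" for e f
  proof -
    obtain n m where "e \<in> curves (\<G> n)" "f \<in> curves (\<G> m)" using ef by (auto simp: union_points)
    then have "e \<in> curves (\<G> (max n m))" "f \<in> curves (\<G> (max n m))"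
      using seq_extends[of n "max n m"] seq_extends[of m "max n m"] by (auto simp: extends_def)
    then show ?thesis by blast
  qed
  show ?thesis unfolding plane_graph_def
  proof (intro conjI ballI impI)
    show "points ?U \<subseteq> S2" using pl(1) by (auto simp: union_points)
  next
    fix e assume "e \<in> curves ?U"
    then obtain n where n: "e \<in> curves (\<G> n)" by (auto simp: union_points)
    show "e \<subseteq> S2" using pl(2)[of n] n by blast
    show "\<exists>g. arc g \<and> path_image g = e \<and> e \<inter> points ?U = {pathstart g, pathfinish g}" using pl(2)[of n] n eqp[OF n] by simp
  next
    fix e f assume "e \<in> curves ?U" "f \<in> curves ?U" "e \<noteq> f"
    then obtain n where n: "e \<in> curves (\<G> n)" "f \<in> curves (\<G> n)" using two by blast
    then have "e \<inter> f \<subseteq> points (\<G> n)" using pl(3)[of n] \<open>e \<noteq> f\<close> by blast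
    then show "e \<inter> f \<subseteq> points ?U" by (auto simp: union_points)
  next
    show "inj_on (\<lambda>e. e \<inter> points ?U) (curves ?U)"
    proof (rule inj_onI)
      fix e f assume ef: "e \<in> curves ?U" "f \<in> curves ?U" "e \<inter> points ?U = f \<inter> points ?U"
      obtain n where n: "e \<in> curves (\<G> n)" "f \<in> curves (\<G> n)" using two[OF ef(1,2)] by blast
      then have "e \<inter> points (\<G> n) = f \<inter> points (\<G> n)" using ef(3) eqp by simp
      then show "e = f" using inj_onD[OF pl(4)] n by blast
    qed
  qed
qed

lemma union_countable: "countable (points (union_drawing \<G>))"
proof -
  have "finite (points (\<G> n))" for n using seq_good[of n] by (simp add: good_def)
  then show ?thesis unfolding union_points by (intro countable_UN) (auto intro: countable_finite)
qed

text \<open>\<open>I\<close> collects the vertices of all later stages in the face, so disjoint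
  faces own disjoint vertex sets of the limit graph.\<close>

definition gface :: "nat \<Rightarrow> (real^3) list \<Rightarrow> (real^3) set \<Rightarrow> bool" where
  "gface n C I \<longleftrightarrow> (\<exists>F\<in>faces (\<G> n). cyc (\<G> n) C \<and> region (pcyc (\<G> n) C) F \<and> I = points (union_drawing \<G>) \<inter> F)"

text \<open>The step from stage \<open>n\<close> to stage \<open>Suc n\<close> puts
  \<open>n + 1\<close> subdividing vertices on each spoke; with the centre at depth 0 the rim is at
  depth \<open>n + 2\<close>.\<close>

lemma gface_fan:
  assumes "gface n C I"
  shows "\<exists>s J. fan (padj (union_drawing \<G>)) gface n C I s J"
proof -
  let ?U = "union_drawing \<G>" and ?Q = "\<G> (Suc n)"
  obtain F where F: "F \<in> faces (\<G> n)" and L: "cyc (\<G> n) C" "region (pcyc (\<G> n) C) F" and I: "I = points ?U \<inter> F"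
    using assms by (auto simp: gface_def)
  obtain c g where star: "star (\<G> n) c g" and Q: "points ?Q = star_points (Suc n) (\<G> n) c g"
    "curves ?Q = star_curves (Suc n) (\<G> n) g" using seq_step[of n] by blast
  note A = seq_good[of n] star Q
  note B = A F L
  let ?k = "length C" and ?s = "sp g n F C"
  obtain Rg where Rg: "\<forall>t<?k. Rg t \<in> faces ?Q \<and> cyc ?Q (sector n (?s t) (?s (Suc t))) \<and>
        region (pcyc ?Q (sector n (?s t) (?s (Suc t)))) (Rg t) \<and> Rg t \<subseteq> F"
     "\<forall>t<?k. \<forall>s<?k. t \<noteq> s \<longrightarrow> Rg t \<inter> Rg s = {}"
    using fan_faces[OF B] by (elim exE conjE) (rule that)
  have QU: "points ?Q \<subseteq> points ?U" by (auto simp: union_points)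
  have k3: "3 \<le> ?k" and dist: "distinct C" and Cp: "set C \<subseteq> points (\<G> n)" using L by (auto simp: cyc_def)
  have k0: "0 < ?k" using k3 by linarith
  have rim: "rim C t = C ! t" if "t < ?k" for t using rim_nth(1)[OF B that] .
  have sin: "?s t d \<in> I" if "t \<le> ?k" "d \<le> n + 1" for t d
    using sp_in[OF B that] sp_points[OF B that(1), of d] that QU I by auto
  define J where "J t = points ?U \<inter> Rg t" for t
  have "fan (padj ?U) gface n C I ?s J"
    unfolding fan_def
  proof (intro conjI allI impI ballI)
    show "3 \<le> ?k" "distinct C" by (fact k3 dist)+
    show "set C \<inter> I = {}" using Cp faces_props(2)[OF F] I by blast
    show "?s t 0 = ?s 0 0" if "t \<le> ?k" for t using sp_ends(1)[OF B that] sp_ends(1)[OF B, of 0] by simp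
    show "?s ?k d = ?s 0 d" for d by (simp add: sp_def[OF B] rim_nth(2)[OF B])
    show "?s 0 0 \<in> I" using sin by simp
    show "?s t (n + 2) = C ! t" if "t < ?k" for t using sp_ends(2)[OF B, of t] rim[OF that] that by simp
    show "?s t d \<in> I" if "t < ?k" "d \<in> {1..n + 1}" for t d using sin that by simp
    show "?s t d \<noteq> ?s 0 0" if "t < ?k" "d \<in> {1..n + 1}" for t d
      using sp_eq[OF B, of t 0 d 0] that by auto
    show "t = t'" "d = d'" if a: "t < ?k" "t' < ?k" "d \<in> {1..n + 1}" "d' \<in> {1..n + 1}" "?s t d = ?s t' d'" for t t' d d'
    proof -
      have "d = d' \<and> (rim C t = rim C t' \<or> d = 0)" using sp_eq[OF B, of t t' d d'] a by auto
      then have e: "d = d'" "C ! t = C ! t'" using a rim by auto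
      then show "d = d'" "t = t'" using nth_eq_iff_index_eq[OF dist a(1,2)] by auto
    qed
    show "padj ?U (?s t d) (?s t (Suc d))" if "t \<le> ?k" "d \<le> n + 1" for t d
      using extends_padj[OF extends_union sp_piece(1)[OF B that]] .
    show "gface (n + 1) (sector n (?s t) (?s (Suc t))) (J t)" if "t < ?k" for t
      using Rg(1) that unfolding gface_def J_def by auto
    show "J t \<subseteq> I" if "t < ?k" for t using Rg(1) that I by (auto simp: J_def)
    show "J t \<inter> J t' = {}" if "t < ?k" "t' < ?k" "t \<noteq> t'" for t t' using Rg(2) that by (auto simp: J_def)
    show "?s t' d \<notin> J t" if "t < ?k" "t' \<le> ?k" "d \<le> n + 1" for t t' d
    proof -
      have "Rg t \<in> faces ?Q" using Rg(1) that by blast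
      then have "Rg t \<inter> points ?Q = {}" by (rule faces_props(2))
      moreover have "?s t' d \<in> points ?Q" using sp_points[OF B, of t' d] that by simp
      ultimately show ?thesis by (auto simp: J_def)
    qed
  qed
  then show ?thesis by blast
qed

lemma gface_stellar: "stellar_faces (padj (union_drawing \<G>)) gface"
proof
  show "padj (union_drawing \<G>) v u" if "padj (union_drawing \<G>) u v" for u v using padj_sym[OF that] .
  show "gface n (rotate1 C) I" if "gface n C I" for n C I
    using that cyc_rotate1 pcyc_rotate1 unfolding gface_def by metis
  show "gface n (rev C) I" if "gface n C I" for n C I
    using that cyc_rev pcyc_rev unfolding gface_def by metis
  show "\<exists>sp J. fan (padj (union_drawing \<G>)) gface n C I sp J" if "gface n C I" for n C I
    using gface_fan[OF that] .
qed

lemma gface_exists: "\<exists>C I. gface 0 C I \<and> I \<subseteq> points (union_drawing \<G>)"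
proof -
  have "faces (\<G> 0) \<noteq> {}" using seq triangle_good(2) by (simp add: stellar_sequence_def)
  then obtain F where F: "F \<in> faces (\<G> 0)" by blast
  then obtain L where "cyc (\<G> 0) L" "region (pcyc (\<G> 0) L) F" using seq_good[of 0] by (auto simp: good_def)
  then show ?thesis using F unfolding gface_def by blast
qed

end

section \<open>Boards: branch sets and hosts\<close>

text \<open>A face of level \<open>lev\<close> with boundary cycle \<open>rimc\<close> and inner vertices \<open>inn\<close>, whose boundary meets
  the branch sets of the vertices \<open>lab\<close> in this cyclic order.\<close>

datatype ('v, 'h, 't) host = Host (lev: nat) (rimc: "'v list") (inn: "'v set") (lab: "'h list") (tag: 't)

context stellar_faces
begin

text \<open>\<open>m\<close> selects for each label a vertex of its branch set on the boundary. The
  bound on the number of labels is the number of inner depths on a spoke of the next level, which is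
  the capacity of \<open>gather\<close>.\<close>

definition hosting :: "('h \<Rightarrow> 'v set) \<Rightarrow> ('v, 'h, 't) host \<Rightarrow> bool" where
  "hosting B h \<longleftrightarrow> face (lev h) (rimc h) (inn h) \<and> distinct (lab h) \<and> length (lab h) \<le> lev h + 1 \<and>
     (\<exists>m. subseq (map m (lab h)) (rimc h) \<and> (\<forall>x\<in>set (lab h). m x \<in> B x))"

text \<open>The interiors of the hosts are reserved ground, disjoint from each other and from all
  branch sets, so work inside one host cannot disturb anything else.\<close>

definition board :: "'v set \<Rightarrow> 'h set \<Rightarrow> ('h \<Rightarrow> 'v set) \<Rightarrow> ('v, 'h, 't) host set \<Rightarrow> bool" where
  "board W V B H \<longleftrightarrow>
     (\<forall>x\<in>V. conn adj (B x) \<and> B x \<subseteq> W) \<and> (\<forall>x\<in>V. \<forall>y\<in>V. x \<noteq> y \<longrightarrow> B x \<inter> B y = {}) \<and>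
     (\<forall>h\<in>H. hosting B h \<and> set (lab h) \<subseteq> V \<and> inn h \<subseteq> W \<and> (\<forall>x\<in>V. inn h \<inter> B x = {})) \<and>
     (\<forall>h\<in>H. \<forall>h'\<in>H. h \<noteq> h' \<longrightarrow> inn h \<inter> inn h' = {})"

lemma inn_nonempty: "hosting B h \<Longrightarrow> inn h \<noteq> {}"
  using face_fan fan_centre_in unfolding hosting_def by blast

lemma hosting_mono: "hosting B h \<Longrightarrow> (\<And>x. x \<in> set (lab h) \<Longrightarrow> B x \<subseteq> B' x) \<Longrightarrow> hosting B' h"
  unfolding hosting_def by blast

lemma board_branch: "board W V B H \<Longrightarrow> x \<in> V \<Longrightarrow> conn adj (B x) \<and> B x \<subseteq> W"
  by (simp add: board_def)

lemma board_branch_disj: "board W V B H \<Longrightarrow> x \<in> V \<Longrightarrow> y \<in> V \<Longrightarrow> x \<noteq> y \<Longrightarrow> B x \<inter> B y = {}"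
  by (simp add: board_def)

lemma board_host: "board W V B H \<Longrightarrow> h \<in> H \<Longrightarrow> hosting B h \<and> set (lab h) \<subseteq> V \<and> inn h \<subseteq> W"
  by (simp add: board_def)

lemma board_host_branch: "board W V B H \<Longrightarrow> h \<in> H \<Longrightarrow> x \<in> V \<Longrightarrow> inn h \<inter> B x = {}"
  by (simp add: board_def)

lemma board_host_disj: "board W V B H \<Longrightarrow> h \<in> H \<Longrightarrow> h' \<in> H \<Longrightarrow> h \<noteq> h' \<Longrightarrow> inn h \<inter> inn h' = {}"
  by (simp add: board_def)

lemma boardI:
  assumes "\<And>x. x \<in> V \<Longrightarrow> conn adj (B x) \<and> B x \<subseteq> W" "\<And>x y. x \<in> V \<Longrightarrow> y \<in> V \<Longrightarrow> x \<noteq> y \<Longrightarrow> B x \<inter> B y = {}"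
    "\<And>h. h \<in> H \<Longrightarrow> hosting B h \<and> set (lab h) \<subseteq> V \<and> inn h \<subseteq> W" "\<And>h x. h \<in> H \<Longrightarrow> x \<in> V \<Longrightarrow> inn h \<inter> B x = {}"
    "\<And>h h'. h \<in> H \<Longrightarrow> h' \<in> H \<Longrightarrow> h \<noteq> h' \<Longrightarrow> inn h \<inter> inn h' = {}"
  shows "board W V B H"
  using assms by (simp add: board_def)

text \<open>Common core of the operations that descend into a host \<open>h\<close>: it is replaced
  by hosts inside it, the branch sets on its boundary receive connected pieces that meet them and
  otherwise lie inside \<open>h\<close>, and new branch sets \<open>N\<close> are placed inside
  \<open>h\<close>. Everything added lies on ground reserved for \<open>h\<close>, so the other
  hosts and branch sets are not affected.\<close>

lemma board_update:
  assumes b: "board W V B (insert h H)" and hH: "h \<notin> H" and N: "N \<inter> V = {}"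
    and X0: "\<forall>x\<in>set (lab h). conn adj (X x) \<and> X x \<inter> B x \<noteq> {} \<and> X x \<subseteq> B x \<union> inn h"
    and XN0: "\<forall>z\<in>N. conn adj (X z) \<and> X z \<subseteq> inn h"
    and XX0: "\<forall>x\<in>set (lab h) \<union> N. \<forall>y\<in>set (lab h) \<union> N. x \<noteq> y \<longrightarrow> X x \<inter> X y = {}"
    and Hn0: "\<forall>h'\<in>Hn. hosting X h' \<and> set (lab h') \<subseteq> set (lab h) \<union> N \<and> inn h' \<subseteq> inn h \<and>
      (\<forall>u\<in>set (lab h) \<union> N. X u \<inter> inn h' = {})"
    and Hd0: "\<forall>h'\<in>Hn. \<forall>h''\<in>Hn. h' \<noteq> h'' \<longrightarrow> inn h' \<inter> inn h'' = {}"
  defines "B' \<equiv> \<lambda>x. (if x \<in> set (lab h) then B x \<union> X x else if x \<in> N then X x else B x)"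
  shows "board W (V \<union> N) B' (Hn \<union> H)" "Hn \<inter> H = {}" "\<And>x. x \<in> V \<Longrightarrow> B x \<subseteq> B' x" "\<And>x. x \<in> set (lab h) \<union> N \<Longrightarrow> X x \<subseteq> B' x"
proof -
  note X = bspec[OF X0] and XN = bspec[OF XN0] and Hn = bspec[OF Hn0]
  have XX: "X x \<inter> X y = {}" if "x \<in> set (lab h) \<union> N" "y \<in> set (lab h) \<union> N" "x \<noteq> y" for x y using XX0 that by simp
  have Hd: "inn g \<inter> inn g' = {}" if "g \<in> Hn" "g' \<in> Hn" "g \<noteq> g'" for g g' using Hd0 that by simp
  have b1: "conn adj (B x)" "B x \<subseteq> W" if "x \<in> V" for x using board_branch[OF b that] by auto
  note b2 = board_branch_disj[OF b]
  let ?H = "insert h H"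
  have h: "h \<in> ?H" by simp
  have b3: "hosting B g" "set (lab g) \<subseteq> V" "inn g \<subseteq> W" if "g \<in> ?H" for g using board_host[OF b that] by auto
  note b4 = board_host_branch[OF b] and b5 = board_host_disj[OF b]
  \<comment> \<open>A new host that was also an old one would have an interior both contained in
    \<open>inn h\<close> and disjoint from it; but interiors contain the centre of a fan.\<close>
  show "Hn \<inter> H = {}"
  proof (rule ccontr)
    assume "Hn \<inter> H \<noteq> {}"
    then obtain g where g: "g \<in> Hn" "g \<in> H" by blast
    then have "inn g \<subseteq> inn h" "g \<noteq> h" using Hn hH by auto
    then have "inn g = {}" using b5[of g h] g by auto
    then show False using inn_nonempty b3(1)[of g] g by blast
  qed
  have labV: "set (lab h) \<subseteq> V" using b3(2)[OF h] .
  have B'l: "B' x = B x \<union> X x" if "x \<in> set (lab h)" for x using that by (simp add: B'_def)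
  have B'n: "B' x = X x" if "x \<in> N" for x using that N labV by (auto simp: B'_def)
  have B'o: "B' x = B x" if "x \<in> V" "x \<notin> set (lab h)" for x using that N by (auto simp: B'_def)
  show mono: "B x \<subseteq> B' x" if "x \<in> V" for x using that B'l B'o by (cases "x \<in> set (lab h)") auto
  show "X x \<subseteq> B' x" if "x \<in> set (lab h) \<union> N" for x using that B'l B'n by auto
  have sub: "B' x \<subseteq> B x \<union> inn h" if "x \<in> V" for x
    using that X[of x] B'l[of x] B'o[of x] by (cases "x \<in> set (lab h)") auto
  have subn: "B' x \<subseteq> inn h" if "x \<in> N" for x using that XN[of x] B'n[of x] by auto
  have c1: "conn adj (B' x) \<and> B' x \<subseteq> W" if x: "x \<in> V \<union> N" for x
  proof (cases "x \<in> N")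
    case True then show ?thesis using XN[OF True] B'n[OF True] b3(3)[OF h] by auto
  next
    case False
    then have xV: "x \<in> V" using x by simp
    have "conn adj (B' x)"
    proof (cases "x \<in> set (lab h)")
      case True then show ?thesis using X[OF True] B'l[OF True] conn_Un_Int[OF b1(1)[OF xV], of "X x"] by (simp add: Int_commute)
    next
      case False then show ?thesis using B'o[OF xV False] b1(1)[OF xV] by simp
    qed
    then show ?thesis using sub[OF xV] b1(2)[OF xV] b3(3)[OF h] by blast
  qed
  have lV: "B' x \<inter> B' y = {}" if x: "x \<in> V" and y: "y \<in> V" "x \<noteq> y" for x y
  proof (cases "x \<in> set (lab h) \<and> y \<in> set (lab h)")
    case True
    have "X x \<inter> X y = {}" using XX[of x y] True y by simp
    moreover have "X x \<inter> B y = {}" "B x \<inter> X y = {}"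
      using X[of x] X[of y] True b2[OF x y] b4[OF h x] b4[OF h y(1)] by blast+
    ultimately show ?thesis using B'l[of x] B'l[of y] True b2[OF x y] by blast
  next
    case False
    then show ?thesis using B'o[OF x] B'o[OF y(1)] sub[OF x] sub[OF y(1)] b2[OF x y] b4[OF h x] b4[OF h y(1)] by blast
  qed
  have lN: "B' x \<inter> B' z = {}" if x: "x \<in> V" and z: "z \<in> N" for x z
  proof (cases "x \<in> set (lab h)")
    case True
    have "X x \<inter> X z = {}" using XX[of x z] True z N x by auto
    then show ?thesis using B'l[OF True] B'n[OF z] XN[OF z] b4[OF h x] by blast
  next
    case False then show ?thesis using B'o[OF x False] B'n[OF z] XN[OF z] b4[OF h x] by blast
  qed
  have c2: "B' x \<inter> B' y = {}" if xy: "x \<in> V \<union> N" "y \<in> V \<union> N" "x \<noteq> y" for x y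
  proof -
    consider "x \<in> V" "y \<in> V" | "x \<in> V" "y \<in> N" | "x \<in> N" "y \<in> V" | "x \<in> N" "y \<in> N" using xy by blast
    then show ?thesis
    proof cases
      case 1 then show ?thesis using lV xy by blast
    next
      case 2 then show ?thesis using lN by blast
    next
      case 3 then show ?thesis using lN[of y x] by blast
    next
      case 4 then show ?thesis using XX[of x y] xy B'n by simp
    qed
  qed
  have c3: "hosting B' g \<and> set (lab g) \<subseteq> V \<union> N \<and> inn g \<subseteq> W \<and> (\<forall>x\<in>V \<union> N. inn g \<inter> B' x = {})"
    if g: "g \<in> Hn \<union> H" for g
  proof (cases "g \<in> Hn")
    case True
    note H = Hn[OF True]
    have "hosting B' g"
      by (rule hosting_mono[of X]) (use H B'l B'n in auto)
    moreover have "inn g \<inter> B' x = {}" if x: "x \<in> V \<union> N" for x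
    proof (cases "x \<in> set (lab h) \<union> N")
      case True
      have "X x \<inter> inn g = {}" using H True by blast
      then show ?thesis using True B'l[of x] B'n[of x] b4[OF h, of x] H labV by blast
    next
      case False
      then show ?thesis using x B'o[of x] b4[OF h, of x] H by blast
    qed
    ultimately show ?thesis using H labV b3(3)[OF h] by blast
  next
    case False
    then have gH: "g \<in> ?H" "g \<noteq> h" using g hH by auto
    have "hosting B' g" by (rule hosting_mono[OF b3(1)[OF gH(1)]]) (use mono b3(2)[OF gH(1)] in blast)
    moreover have "inn g \<inter> B' x = {}" if x: "x \<in> V \<union> N" for x
      using x sub[of x] subn[of x] b4[OF gH(1), of x] b5[OF gH(1) h gH(2)] by blast
    ultimately show ?thesis using b3(2,3)[OF gH(1)] by blast
  qed
  have c4: "inn g \<inter> inn g' = {}" if g: "g \<in> Hn \<union> H" "g' \<in> Hn \<union> H" "g \<noteq> g'" for g g'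
  proof -
    have x: "inn g \<inter> inn g' = {}" if "g \<in> Hn" "g' \<in> H" for g g'
    proof -
      have "inn g' \<inter> inn h = {}" using b5[of g' h] that(2) hH by auto
      then show ?thesis using Hn[OF that(1)] by blast
    qed
    consider "g \<in> Hn" "g' \<in> Hn" | "g \<in> Hn" "g' \<in> H" | "g \<in> H" "g' \<in> Hn" | "g \<in> H" "g' \<in> H" using g by blast
    then show ?thesis
    proof cases
      case 1 then show ?thesis using Hd g by blast
    next
      case 2 then show ?thesis using x by blast
    next
      case 3 then show ?thesis using x[of g' g] by blast
    next
      case 4 then show ?thesis using b5[of g g'] g by blast
    qed
  qed
  show "board W (V \<union> N) B' (Hn \<union> H)" unfolding board_def
  proof (intro conjI)
    show "\<forall>x\<in>V \<union> N. conn adj (B' x) \<and> B' x \<subseteq> W" using c1 by (rule ballI)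
    show "\<forall>x\<in>V \<union> N. \<forall>y\<in>V \<union> N. x \<noteq> y \<longrightarrow> B' x \<inter> B' y = {}" using c2 by (intro ballI impI)
    show "\<forall>g\<in>Hn \<union> H. hosting B' g \<and> set (lab g) \<subseteq> V \<union> N \<and> inn g \<subseteq> W \<and> (\<forall>x\<in>V \<union> N. inn g \<inter> B' x = {})" using c3 by (rule ballI)
    show "\<forall>g\<in>Hn \<union> H. \<forall>g'\<in>Hn \<union> H. g \<noteq> g' \<longrightarrow> inn g \<inter> inn g' = {}" using c4 by (intro ballI impI)
  qed
qed

section \<open>Elementary operations on a board\<close>

lemma host_rotate:
  assumes "hosting B h"
  shows "\<exists>C. hosting B (Host (lev h) C (inn h) (rotate r (lab h)) t)"
proof (induction r)
  case 0
  then show ?case using assms unfolding hosting_def by (intro exI[of _ "rimc h"]) auto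
next
  case (Suc r)
  then obtain C m where C: "face (lev h) C (inn h)" "distinct (rotate r (lab h))" "length (lab h) \<le> lev h + 1"
    "subseq (map m (rotate r (lab h))) C" "\<forall>x\<in>set (lab h). m x \<in> B x" by (auto simp: hosting_def)
  show ?case
  proof (cases "rotate r (lab h)")
    case Nil
    then show ?thesis using C unfolding hosting_def by (intro exI[of _ C]) (auto intro!: exI[of _ m])
  next
    case (Cons x xs)
    obtain us vs where uv: "C = us @ m x # vs" "subseq (map m xs) vs" using C(4) Cons by (auto elim: subseq_ConsE)
    have "subseq (map m (xs @ [x])) (vs @ us @ [m x])"
      using list_emb_append_mono[OF uv(2), of "[m x]" "us @ [m x]"] by (simp add: list_emb_append2)
    moreover have "vs @ us @ [m x] = rotate (length (us @ [m x])) C" using uv(1) rotate_append[of "us @ [m x]" vs] by simp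
    moreover have "rotate (Suc r) (lab h) = xs @ [x]" using Cons by simp
    ultimately have "subseq (map m (rotate (Suc r) (lab h))) (vs @ us @ [m x])" "face (lev h) (vs @ us @ [m x]) (inn h)"
      using face_rotate[OF C(1)] by metis+
    moreover have "distinct (rotate (Suc r) (lab h))" using C(2) by (simp only: distinct_rotate)
    ultimately show ?thesis using C(3,5) unfolding hosting_def
      by (intro exI[of _ "vs @ us @ [m x]"]) (simp del: rotate_Suc, intro exI[of _ m], simp del: rotate_Suc)
  qed
qed

lemma rotate_back: "\<exists>r'. rotate r' (rotate r L) = L"
proof (cases "L = []")
  case False
  let ?n = "length L"
  have "rotate (?n - r mod ?n) (rotate r L) = rotate ((?n - r mod ?n + r) mod ?n) L"
    by (metis rotate_rotate rotate_conv_mod)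
  also have "(?n - r mod ?n + r) mod ?n = 0"
  proof -
    have "(?n - r mod ?n + r) mod ?n = (?n - r mod ?n + r mod ?n) mod ?n" by (simp add: mod_add_right_eq)
    also have "?n - r mod ?n + r mod ?n = ?n" using False by (simp add: less_imp_le)
    finally show ?thesis by simp
  qed
  finally show ?thesis by auto
qed simp

lemma op_rotate:
  assumes b: "board W V B (insert h H)" and hH: "h \<notin> H"
  shows "\<exists>h'. board W V B (insert h' H) \<and> h' \<notin> H \<and> lab h' = rotate r (lab h) \<and> tag h' = t \<and> lev h' = lev h"
proof -
  have hb: "hosting B h" "set (lab h) \<subseteq> V" "inn h \<subseteq> W" using board_host[OF b, of h] by auto
  have hx: "inn h \<inter> B x = {}" if "x \<in> V" for x using board_host_branch[OF b _ that, of h] by simp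
  have dis: "inn h \<inter> inn g = {}" if "g \<in> H" for g using board_host_disj[OF b, of h g] hH that by auto
  obtain C where C: "hosting B (Host (lev h) C (inn h) (rotate r (lab h)) t)"
    using host_rotate[OF hb(1), of r t] by (elim exE) (rule that)
  define h' where "h' = Host (lev h) C (inn h) (rotate r (lab h)) t"
  have h': "hosting B h' \<and> set (lab h') \<subseteq> V \<and> inn h' \<subseteq> W" "inn h' = inn h" using C hb by (simp_all add: h'_def)
  have "h' \<notin> H" using dis[of h'] inn_nonempty[OF hb(1)] by (auto simp: h'_def)
  moreover have "board W V B (insert h' H)"
  proof (rule boardI)
    show "conn adj (B x) \<and> B x \<subseteq> W" if "x \<in> V" for x by (rule board_branch[OF b that])
    show "B x \<inter> B y = {}" if "x \<in> V" "y \<in> V" "x \<noteq> y" for x y by (rule board_branch_disj[OF b that])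
    show "hosting B g \<and> set (lab g) \<subseteq> V \<and> inn g \<subseteq> W" if "g \<in> insert h' H" for g
      using that h' board_host[OF b, of g] by auto
    show "inn g \<inter> B x = {}" if "g \<in> insert h' H" "x \<in> V" for g x
      using that h'(2) hx[OF that(2)] board_host_branch[OF b _ that(2), of g] by (cases "g = h'") simp_all
    show "inn g \<inter> inn g' = {}" if g: "g \<in> insert h' H" "g' \<in> insert h' H" "g \<noteq> g'" for g g'
    proof -
      have h'd: "inn h' \<inter> inn g = {}" if "g \<in> H" for g using dis[OF that] h'(2) by simp
      consider "g = h'" "g' \<in> H" | "g' = h'" "g \<in> H" | "g \<in> H" "g' \<in> H" using g by blast
      then show ?thesis
      proof cases
        case 1 then show ?thesis using h'd by blast
      next
        case 2 then show ?thesis using h'd[of g] by blast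
      next
        case 3 then show ?thesis using board_host_disj[OF b, of g g'] g(3) by blast
      qed
    qed
  qed
  ultimately show ?thesis by (intro exI[of _ h']) (simp add: h'_def)
qed

text \<open>Each wait raises the level, hence the capacity, and always leaves a gap. A gap left
  earlier is traded for a spare host of the last label; for this the representatives
  \<open>m\<close> must be chosen to respect the gap whenever there is one.\<close>

lemma op_wait:
  assumes b: "board W V B (insert h H)" and hH: "h \<notin> H" and ne: "lab h \<noteq> []"
  shows "\<exists>B' h'. board W V B' (insert h' H) \<and> h' \<notin> H \<and> lab h' = lab h \<and> tag h' = tag h \<and> lev h' = lev h + 1 \<and>
    (\<forall>x\<in>V. B x \<subseteq> B' x) \<and> (\<exists>m. subseq (map m (lab h')) (butlast (rimc h')) \<and> (\<forall>x\<in>set (lab h'). m x \<in> B' x)) \<and>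
    ((\<exists>m. subseq (map m (lab h)) (butlast (rimc h)) \<and> (\<forall>x\<in>set (lab h). m x \<in> B x)) \<longrightarrow>
      (\<exists>h''. board W V B' (insert h' (insert h'' H)) \<and> h'' \<notin> H \<and> lab h'' = [last (lab h)] \<and> tag h'' = t \<and> h' \<noteq> h''))"
proof -
  let ?L = "lab h" and ?n = "lev h"
  let ?gap = "\<exists>m. subseq (map m ?L) (butlast (rimc h)) \<and> (\<forall>x\<in>set ?L. m x \<in> B x)"
  have hb0: "hosting B h" and labV: "set ?L \<subseteq> V" using board_host[OF b, of h] by auto
  have hb: "face ?n (rimc h) (inn h)" "distinct ?L" "length ?L \<le> ?n + 1"
    and ex: "\<exists>m. subseq (map m ?L) (rimc h) \<and> (\<forall>x\<in>set ?L. m x \<in> B x)"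
    using hb0 by (simp_all add: hosting_def)
  obtain m where m: "subseq (map m ?L) (rimc h)" "\<forall>x\<in>set ?L. m x \<in> B x" "?gap \<Longrightarrow> subseq (map m ?L) (butlast (rimc h))"
  proof (cases ?gap)
    case True
    then obtain m where a: "subseq (map m ?L) (butlast (rimc h))" "\<forall>x\<in>set ?L. m x \<in> B x" by blast
    have "rimc h \<noteq> []" using face_facts[OF hb(1)] by auto
    then have "subseq (butlast (rimc h)) (rimc h)" by (metis append_butlast_last_id subseq_rev_drop_many subseq_order.order_refl)
    then have "subseq (map m ?L) (rimc h)" using a(1) subseq_order.order_trans by blast
    then show ?thesis using that a by blast
  next
    case False then show ?thesis using that ex by blast
  qed
  obtain C' I' m' X where w: "face (?n + 1) C' I'" "I' \<subseteq> inn h" "subseq (map m' ?L) (butlast C')"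
    "\<forall>x\<in>set ?L. conn adj (X x) \<and> m x \<in> X x \<and> m' x \<in> X x \<and> X x \<subseteq> insert (m x) (inn h) \<and> X x \<inter> I' = {}"
    "\<forall>x\<in>set ?L. \<forall>y\<in>set ?L. x \<noteq> y \<longrightarrow> X x \<inter> X y = {}"
    "subseq (map m ?L) (butlast (rimc h)) \<longrightarrow> (\<exists>C'' I''. face (?n + 1) C'' I'' \<and> I'' \<subseteq> inn h \<and> I'' \<inter> I' = {} \<and> m (last ?L) \<in> set C'' \<and>
         (\<forall>x\<in>set ?L. X x \<inter> I'' = {}))"
    using wait_step[OF hb ne m(1)] by (elim exE conjE) (rule that)
  define h' where "h' = Host (?n + 1) C' I' ?L (tag h)"
  define B' where "B' = (\<lambda>x. if x \<in> set ?L then B x \<union> X x else if x \<in> {} then X x else B x)"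
  have C'ne: "C' \<noteq> []" using face_facts[OF w(1)] by auto
  have subC: "subseq (map m' ?L) C'"
    using w(3) C'ne by (metis append_butlast_last_id subseq_rev_drop_many)
  have m'X: "\<forall>x\<in>set ?L. m' x \<in> X x" using w(4) by blast
  have host': "hosting X h'" unfolding hosting_def h'_def using w(1) hb(2,3) subC m'X by auto
  have X1: "\<forall>x\<in>set ?L. conn adj (X x) \<and> X x \<inter> B x \<noteq> {} \<and> X x \<subseteq> B x \<union> inn h"
    using w(4) m(2) by blast
  have XX: "\<forall>x\<in>set ?L \<union> {}. \<forall>y\<in>set ?L \<union> {}. x \<noteq> y \<longrightarrow> X x \<inter> X y = {}" using w(5) by simp
  have H1: "hosting X h' \<and> set (lab h') \<subseteq> set ?L \<union> {} \<and> inn h' \<subseteq> inn h \<and> (\<forall>u\<in>set ?L \<union> {}. X u \<inter> inn h' = {})"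
    using host' w(2,4) by (simp add: h'_def)
  have e: "{} \<inter> V = {}" "\<forall>z\<in>{}. conn adj (X z) \<and> X z \<subseteq> inn h" by simp_all
  note up = board_update[OF b hH e(1) X1 e(2) XX, folded B'_def]
  have H1': "\<forall>g\<in>{h'}. hosting X g \<and> set (lab g) \<subseteq> set ?L \<union> {} \<and> inn g \<subseteq> inn h \<and> (\<forall>u\<in>set ?L \<union> {}. X u \<inter> inn g = {})"
    "\<forall>g\<in>{h'}. \<forall>g'\<in>{h'}. g \<noteq> g' \<longrightarrow> inn g \<inter> inn g' = {}" using H1 by simp_all
  note u1 = up(1)[OF H1'] and u2 = up(2)[OF H1']
  have u3: "B x \<subseteq> B' x" for x by (auto simp: B'_def)
  have u4: "X x \<subseteq> B' x" if "x \<in> set ?L" for x using that by (simp add: B'_def)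
  have g': "\<exists>m. subseq (map m (lab h')) (butlast (rimc h')) \<and> (\<forall>x\<in>set (lab h'). m x \<in> B' x)"
    by (rule exI[of _ m']) (use w(3) m'X u4 in \<open>auto simp: h'_def\<close>)
  have sp: "\<exists>h''. board W V B' (insert h' (insert h'' H)) \<and> h'' \<notin> H \<and> lab h'' = [last ?L] \<and> tag h'' = t \<and> h' \<noteq> h''" if gap: ?gap
  proof -
    obtain C'' I'' where c: "face (?n + 1) C'' I''" "I'' \<subseteq> inn h" "I'' \<inter> I' = {}" "m (last ?L) \<in> set C''" "\<forall>x\<in>set ?L. X x \<inter> I'' = {}"
      using w(6) m(3)[OF gap] by blast
    define h'' where "h'' = Host (?n + 1) C'' I'' [last ?L] t"
    have lL: "last ?L \<in> set ?L" using ne by simp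
    have "m (last ?L) \<in> X (last ?L)" using w(4) lL by blast
    then have host'': "hosting X h''"
      unfolding hosting_def h''_def using c(1,4) by (auto intro!: exI[of _ m] simp: subseq_singleton_left)
    have ne': "h' \<noteq> h''" using c(3) inn_nonempty[OF host''] by (auto simp: h'_def h''_def)
    have H2: "\<forall>g\<in>{h', h''}. hosting X g \<and> set (lab g) \<subseteq> set ?L \<union> {} \<and> inn g \<subseteq> inn h \<and> (\<forall>u\<in>set ?L \<union> {}. X u \<inter> inn g = {})"
    proof -
      have "hosting X h'' \<and> set (lab h'') \<subseteq> set ?L \<union> {} \<and> inn h'' \<subseteq> inn h \<and> (\<forall>u\<in>set ?L \<union> {}. X u \<inter> inn h'' = {})"
        using host'' c lL by (simp add: h''_def)
      then show ?thesis using H1 by (intro ballI) (elim insertE emptyE; blast)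
    qed
    have H3: "\<forall>g\<in>{h', h''}. \<forall>g'\<in>{h', h''}. g \<noteq> g' \<longrightarrow> inn g \<inter> inn g' = {}"
      using c(3) by (auto simp: h'_def h''_def)
    have "board W (V \<union> {}) B' ({h', h''} \<union> H)" "{h', h''} \<inter> H = {}" using up(1,2)[OF H2 H3] by blast+
    then show ?thesis using ne' by (intro exI[of _ h'']) (simp add: h''_def)
  qed
  show ?thesis
    by (rule exI[of _ B'], rule exI[of _ h']) (use u1 u2 u3 g' sp in \<open>simp add: h'_def\<close>)
qed

text \<open>With \<open>y\<close> rotated to the end, one wait creates a gap and a second one trades
  it for a spare host of \<open>y\<close>; the rotation is undone afterwards.\<close>

lemma op_split:
  assumes b: "board W V B (insert h H)" and hH: "h \<notin> H" and y: "y \<in> set (lab h)"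
  shows "\<exists>B' h' h''. board W V B' (insert h' (insert h'' H)) \<and> h' \<notin> insert h'' H \<and> h'' \<notin> H \<and> lab h' = lab h \<and> tag h' = tag h \<and>
    lab h'' = [y] \<and> tag h'' = t \<and> (\<forall>x\<in>V. B x \<subseteq> B' x)"
proof -
  obtain us vs where uv: "lab h = us @ y # vs" using y by (meson split_list)
  define r where "r = length (us @ [y])"
  have rl: "rotate r (lab h) = vs @ us @ [y]" using rotate_append[of "us @ [y]" vs] uv by (simp add: r_def)
  obtain h1 where h1: "board W V B (insert h1 H)" "h1 \<notin> H" "lab h1 = rotate r (lab h)" "tag h1 = tag h"
    using op_rotate[OF b hH] by metis
  have l1: "last (lab h1) = y" "lab h1 \<noteq> []" using h1 rl by auto
  obtain B2 h2 where h2: "board W V B2 (insert h2 H)" "h2 \<notin> H" "lab h2 = lab h1" "tag h2 = tag h1" "\<forall>x\<in>V. B x \<subseteq> B2 x"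
    "\<exists>m. subseq (map m (lab h2)) (butlast (rimc h2)) \<and> (\<forall>x\<in>set (lab h2). m x \<in> B2 x)"
    using op_wait[OF h1(1,2) l1(2), of t] by (elim exE conjE) (rule that, assumption+, rule exI, rule conjI, assumption+)
  have l2: "lab h2 \<noteq> []" "last (lab h2) = y" using h2 l1 by auto
  obtain B3 h3 where h3: "lab h3 = lab h2" "tag h3 = tag h2" "\<forall>x\<in>V. B2 x \<subseteq> B3 x" "h3 \<notin> H"
    and h3': "(\<exists>m. subseq (map m (lab h2)) (butlast (rimc h2)) \<and> (\<forall>x\<in>set (lab h2). m x \<in> B2 x)) \<longrightarrow>
      (\<exists>h''. board W V B3 (insert h3 (insert h'' H)) \<and> h'' \<notin> H \<and> lab h'' = [last (lab h2)] \<and> tag h'' = t \<and> h3 \<noteq> h'')"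
    using op_wait[OF h2(1,2) l2(1), of t] by (elim exE conjE) (rule that)
  obtain h4 where h4: "board W V B3 (insert h3 (insert h4 H))" "h4 \<notin> H" "lab h4 = [y]" "tag h4 = t" "h3 \<noteq> h4"
    using h3' h2(6) l2(2) by metis
  obtain r' where r': "rotate r' (rotate r (lab h)) = lab h" using rotate_back by blast
  have n3: "h3 \<notin> insert h4 H" using h3(4) h4(5) by simp
  obtain h5 where h5: "board W V B3 (insert h5 (insert h4 H))" "h5 \<notin> insert h4 H" "lab h5 = rotate r' (lab h3)" "tag h5 = tag h"
    using op_rotate[OF h4(1) n3] by metis
  have "lab h5 = lab h" using h5(3) h3(1) h2(3) h1(3) r' by simp
  then show ?thesis using h5 h4 h3(3) h2(5)
    by (intro exI[of _ B3] exI[of _ h5] exI[of _ h4]) (simp, blast)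
qed

text \<open>Without labels no branch set has to follow, so two sectors of one fan serve as the new
  hosts.\<close>

lemma op_split_free:
  assumes b: "board W V B (insert h H)" and hH: "h \<notin> H" and y: "lab h = []"
  shows "\<exists>h' h''. board W V B (insert h' (insert h'' H)) \<and> h' \<notin> insert h'' H \<and> h'' \<notin> H \<and> lab h' = [] \<and> lab h'' = [] \<and> tag h' = t \<and> tag h'' = t"
proof -
  have hb0: "hosting B h" using board_host[OF b, of h] by auto
  have "face (lev h) (rimc h) (inn h)" using hb0 by (simp add: hosting_def)
  from face_fan[OF this] obtain sp J where fan: "fan adj face (lev h) (rimc h) (inn h) sp J" by blast
  have k: "0 < length (rimc h)" "1 < length (rimc h)" using fan_len[OF fan] by linarith+
  define h' where "h' = Host (lev h + 1) (sector (lev h) (sp 0) (sp (Suc 0))) (J 0) (lab h) t"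
  define h'' where "h'' = Host (lev h + 1) (sector (lev h) (sp 1) (sp (Suc 1))) (J 1) (lab h) t"
  have ho: "hosting B h'" "hosting B h''"
    using fan_face[OF fan k(1)] fan_face[OF fan k(2)] y by (auto simp: hosting_def h'_def h''_def)
  have J: "J 0 \<subseteq> inn h" "J 1 \<subseteq> inn h" "J 0 \<inter> J 1 = {}" using fan_J_sub[OF fan] fan_J_disj[OF fan k] k by auto
  have H2: "\<forall>g\<in>{h', h''}. hosting B g \<and> set (lab g) \<subseteq> set (lab h) \<union> {} \<and> inn g \<subseteq> inn h \<and> (\<forall>u\<in>set (lab h) \<union> {}. B u \<inter> inn g = {})"
    using ho J y by (auto simp: h'_def h''_def)
  have H3: "\<forall>g\<in>{h', h''}. \<forall>g'\<in>{h', h''}. g \<noteq> g' \<longrightarrow> inn g \<inter> inn g' = {}"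
    using J by (auto simp: h'_def h''_def)
  have e: "{} \<inter> V = {}" "\<forall>z\<in>{}. conn adj (B z) \<and> B z \<subseteq> inn h"
    "\<forall>x\<in>set (lab h). conn adj (B x) \<and> B x \<inter> B x \<noteq> {} \<and> B x \<subseteq> B x \<union> inn h"
    "\<forall>x\<in>set (lab h) \<union> {}. \<forall>y\<in>set (lab h) \<union> {}. x \<noteq> y \<longrightarrow> B x \<inter> B y = {}" using y by simp_all
  note up = board_update[OF b hH e(1,3,2,4) H2 H3]
  have "board W V B (insert h' (insert h'' H))" "h' \<notin> H \<and> h'' \<notin> H" using up(1,2) y by auto
  moreover have "h' \<noteq> h''" using J(3) inn_nonempty[OF ho(1)] by (auto simp: h'_def h''_def)
  ultimately show ?thesis using y by (intro exI[of _ h'] exI[of _ h'']) (simp add: h'_def h''_def)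
qed

text \<open>The new branch set is the centre of the face alone, and sector 0 has it on its
  boundary.\<close>

lemma op_start:
  fixes v :: 'h
  assumes b: "board W V B (insert h H)" and hH: "h \<notin> H" and y: "lab h = []" and v: "v \<notin> V"
  shows "\<exists>B' h'. board W (insert v V) B' (insert h' H) \<and> h' \<notin> H \<and> lab h' = [v] \<and> tag h' = t \<and> (\<forall>x\<in>V. B x \<subseteq> B' x)"
proof -
  have hb0: "hosting B h" using board_host[OF b, of h] by auto
  have "face (lev h) (rimc h) (inn h)" using hb0 by (simp add: hosting_def)
  from face_fan[OF this] obtain sp J where fan: "fan adj face (lev h) (rimc h) (inn h) sp J" by blast
  have k: "0 < length (rimc h)" using fan_len[OF fan] by linarith
  define X where "X = (\<lambda>x::'h. {sp 0 0})"
  define h' where "h' = Host (lev h + 1) (sector (lev h) (sp 0) (sp (Suc 0))) (J 0) [v] t"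
  have "sp 0 0 \<in> set (sector (lev h) (sp 0) (sp (Suc 0)))"
    using sector_nth_left[of 0 "lev h" "sp 0" "sp (Suc 0)"] nth_mem[of 0 "sector (lev h) (sp 0) (sp (Suc 0))"] by simp
  then have ho: "hosting X h'" using fan_face[OF fan k]
    unfolding hosting_def h'_def X_def by (auto simp: subseq_singleton_left intro!: exI[of _ "\<lambda>_. sp 0 0"])
  have H2: "\<forall>g\<in>{h'}. hosting X g \<and> set (lab g) \<subseteq> set (lab h) \<union> {v} \<and> inn g \<subseteq> inn h \<and> (\<forall>u\<in>set (lab h) \<union> {v}. X u \<inter> inn g = {})"
    using ho fan_J_sub[OF fan k] fan_notin_J[OF fan k, of 0 0] by (auto simp: h'_def X_def)
  have H3: "\<forall>g\<in>{h'}. \<forall>g'\<in>{h'}. g \<noteq> g' \<longrightarrow> inn g \<inter> inn g' = {}" by simp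
  have N: "{v} \<inter> V = {}" using v by simp
  have XN: "\<forall>z\<in>{v}. conn adj (X z) \<and> X z \<subseteq> inn h" using fan_centre_in[OF fan] by (simp add: X_def conn_singleton)
  have XX: "\<forall>x\<in>set (lab h) \<union> {v}. \<forall>y\<in>set (lab h) \<union> {v}. x \<noteq> y \<longrightarrow> X x \<inter> X y = {}" using y by simp
  have X1: "\<forall>x\<in>set (lab h). conn adj (X x) \<and> X x \<inter> B x \<noteq> {} \<and> X x \<subseteq> B x \<union> inn h" using y by simp
  note up = board_update[OF b hH N X1 XN XX H2 H3]
  define B' where "B' = (\<lambda>u. if u \<in> set (lab h) then B u \<union> X u else if u \<in> {v} then X u else B u)"
  have "board W (insert v V) B' (insert h' H)" "h' \<notin> H"
    using up(1,2) unfolding B'_def[symmetric] by auto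
  moreover have "\<forall>x\<in>V. B x \<subseteq> B' x" using v by (auto simp: B'_def)
  ultimately show ?thesis by (intro exI[of _ B'] exI[of _ h']) (simp add: h'_def)
qed

text \<open>The centre becomes \<open>v\<close>, and \<open>x\<close> grows along its spoke to the
  neighbour of the centre; sector 0 then meets both.\<close>

lemma op_pendant:
  assumes b: "board W V B (insert h H)" and hH: "h \<notin> H" and y: "lab h = [x]" and v: "v \<notin> V"
  shows "\<exists>B' h'. board W (insert v V) B' (insert h' H) \<and> h' \<notin> H \<and> lab h' = [x, v] \<and> tag h' = t \<and> (\<forall>x\<in>V. B x \<subseteq> B' x) \<and>
    (\<exists>a\<in>B' x. \<exists>b\<in>B' v. adj a b)"
proof -
  let ?n = "lev h"
  have hb0: "hosting B h" "set (lab h) \<subseteq> V" using board_host[OF b, of h] by auto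
  obtain m where m: "face ?n (rimc h) (inn h)" "subseq [m x] (rimc h)" "m x \<in> B x" using hb0 y by (auto simp: hosting_def)
  obtain us vs where uv: "rimc h = us @ m x # vs" using m(2) by (auto elim: subseq_ConsE)
  define C where "C = m x # vs @ us"
  have "C = rotate (length us) (rimc h)" using uv rotate_append[of us "m x # vs"] by (simp add: C_def)
  then have "face ?n C (inn h)" using face_rotate[OF m(1)] by simp
  from face_fan[OF this] obtain sp J where fan: "fan adj face ?n C (inn h) sp J" by blast
  have k: "0 < length C" using fan_len[OF fan] by linarith
  have tip: "sp 0 (?n + 2) = m x" using fan_tip[OF fan k] by (simp add: C_def)
  have xv: "x \<in> V" "x \<noteq> v" using hb0 y v by auto
  define X where "X = (\<lambda>u. if u = x then sp 0 ` {1..?n + 2} else {sp 0 0})"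
  have Xx: "X x = sp 0 ` {1..?n + 2}" and Xv: "X v = {sp 0 0}" using xv by (auto simp: X_def)
  \<comment> \<open>Rotation by \<open>?n + 2\<close> brings the rim end of spoke 0 to the front, so
    that \<open>x\<close> precedes \<open>v\<close> in the label list.\<close>
  define Q where "Q = rotate (?n + 2) (sector ?n (sp 0) (sp (Suc 0)))"
  define h' where "h' = Host (?n + 1) Q (J 0) [x, v] t"
  have Q: "Q = sp 0 (?n + 2) # map (sp (Suc 0)) (rev [1..<?n + 3]) @ sp 0 0 # map (sp 0) [1..<?n + 2]"
  proof -
    have "[0..<?n + 3] = (0 # [1..<?n + 2]) @ [?n + 2]"
      using upt_Suc_append[of 0 "?n + 2"] upt_conv_Cons[of 0 "?n + 2"] by (simp add: numeral_3_eq_3)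
    then have "sector ?n (sp 0) (sp (Suc 0)) = (sp 0 0 # map (sp 0) [1..<?n + 2]) @ (sp 0 (?n + 2) # map (sp (Suc 0)) (rev [1..<?n + 3]))"
      by (simp add: sector_def)
    then show ?thesis unfolding Q_def using rotate_append[of "sp 0 0 # map (sp 0) [1..<?n + 2]"] by simp
  qed
  have ho: "hosting X h'"
  proof -
    have "face (?n + 1) Q (J 0)" unfolding Q_def by (rule face_rotate[OF fan_face[OF fan k]])
    moreover have "subseq [sp 0 (?n + 2), sp 0 0] Q" unfolding Q
      by (simp add: subseq_singleton_left)
    ultimately show ?thesis unfolding hosting_def h'_def using xv
      by (auto simp: Xx Xv intro!: exI[of _ "\<lambda>u. if u = x then sp 0 (?n + 2) else sp 0 0"])
  qed
  have JI: "J 0 \<subseteq> inn h" using fan_J_sub[OF fan k] .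
  have nJ: "sp 0 d \<notin> J 0" if "d \<le> ?n + 2" for d using fan_notin_J[OF fan k, of 0 d] that by simp
  have H2: "\<forall>g\<in>{h'}. hosting X g \<and> set (lab g) \<subseteq> set (lab h) \<union> {v} \<and> inn g \<subseteq> inn h \<and> (\<forall>u\<in>set (lab h) \<union> {v}. X u \<inter> inn g = {})"
    using ho JI nJ y xv by (auto simp: h'_def Xx Xv)
  have H3: "\<forall>g\<in>{h'}. \<forall>g'\<in>{h'}. g \<noteq> g' \<longrightarrow> inn g \<inter> inn g' = {}" by simp
  have N: "{v} \<inter> V = {}" using v by simp
  have XN: "\<forall>z\<in>{v}. conn adj (X z) \<and> X z \<subseteq> inn h" using fan_centre_in[OF fan] by (simp add: Xv conn_singleton)
  have cx: "sp 0 0 \<notin> X x" using fan_centre_neq[OF fan, of 0] by (auto simp: Xx) (metis le0)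
  have XX: "\<forall>p\<in>set (lab h) \<union> {v}. \<forall>q\<in>set (lab h) \<union> {v}. p \<noteq> q \<longrightarrow> X p \<inter> X q = {}"
    using y cx Xv by auto
  have X1: "\<forall>p\<in>set (lab h). conn adj (X p) \<and> X p \<inter> B p \<noteq> {} \<and> X p \<subseteq> B p \<union> inn h"
  proof
    fix p assume "p \<in> set (lab h)"
    then have p: "p = x" using y by simp
    have "conn adj (X x)" unfolding Xx by (rule conn_walk) (use fan_adj[OF fan, of 0] adj_sym in auto)
    moreover have "sp 0 (?n + 2) \<in> X x" unfolding Xx by (intro imageI) simp
    then have "m x \<in> X x" using tip by simp
    moreover have "X x \<subseteq> B x \<union> inn h"
    proof
      fix z assume "z \<in> X x"
      then obtain d where "z = sp 0 d" "d \<le> ?n + 2" by (auto simp: Xx)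
      then show "z \<in> B x \<union> inn h" using fan_in[OF fan, of 0 d] tip m(3) by (cases "d = ?n + 2") auto
    qed
    ultimately show "conn adj (X p) \<and> X p \<inter> B p \<noteq> {} \<and> X p \<subseteq> B p \<union> inn h" using m(3) p by blast
  qed
  note up = board_update[OF b hH N X1 XN XX H2 H3]
  define B' where "B' = (\<lambda>u. if u \<in> set (lab h) then B u \<union> X u else if u \<in> {v} then X u else B u)"
  have u1: "board W (insert v V) B' (insert h' H)" "h' \<notin> H"
    using up(1,2) unfolding B'_def[symmetric] by auto
  have u3: "\<forall>x\<in>V. B x \<subseteq> B' x" using v by (auto simp: B'_def)
  have "sp 0 1 \<in> B' x" "sp 0 0 \<in> B' v" using y xv by (auto simp: B'_def Xx Xv)
  moreover have "adj (sp 0 1) (sp 0 0)" using adj_sym[OF fan_adj[OF fan, of 0 0]] by simp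
  ultimately have "\<exists>a\<in>B' x. \<exists>b\<in>B' v. adj a b" by blast
  then show ?thesis using u1 u3 by (intro exI[of _ B'] exI[of _ h']) (simp add: h'_def)
qed

lemma op_ear0:
  assumes b: "board W V B (insert h H)" and hH: "h \<notin> H" and L: "lab h = x # A @ y # D"
    and Z: "distinct Z" "set Z \<inter> V = {}" and len: "length (lab h) + length Z \<le> lev h + 1"
  shows "\<exists>B' h1 h2. board W (V \<union> set Z) B' (insert h1 (insert h2 H)) \<and> h1 \<notin> insert h2 H \<and> h2 \<notin> H \<and>
    lab h1 = x # A @ y # rev Z \<and> tag h1 = t1 \<and> lab h2 = x # rev D @ y # rev Z \<and> tag h2 = t2 \<and> (\<forall>x\<in>V. B x \<subseteq> B' x) \<and>
    (\<forall>i\<le>length Z. \<exists>a\<in>B' ((x # Z @ [y]) ! i). \<exists>b\<in>B' ((x # Z @ [y]) ! Suc i). adj a b)"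
proof -
  let ?n = "lev h"
  have hb0: "hosting B h" and labV: "set (lab h) \<subseteq> V" using board_host[OF b, of h] by auto
  obtain m where m: "face ?n (rimc h) (inn h)" "distinct (lab h)" "subseq (map m (x # A @ y # D)) (rimc h)" "\<forall>u\<in>set (lab h). m u \<in> B u"
    using hb0 L by (auto simp: hosting_def)
  have dist: "distinct (x # A @ y # D @ Z)" using m(2) Z labV L by auto
  have l: "length A \<le> ?n + 1" "length D \<le> ?n + 1" "length Z \<le> ?n + 1" using len L by auto
  obtain C1 I1 m1 C2 I2 m2 X where e: "face (?n + 1) C1 I1" "face (?n + 1) C2 I2" "I1 \<subseteq> inn h" "I2 \<subseteq> inn h" "I1 \<inter> I2 = {}"
    "subseq (map m1 (x # A @ y # rev Z)) C1" "subseq (map m2 (x # rev D @ y # rev Z)) C2"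
    "\<forall>u\<in>set (x # A @ y # rev Z). m1 u \<in> X u" "\<forall>u\<in>set (x # rev D @ y # rev Z). m2 u \<in> X u"
    "\<forall>u\<in>set (x # A @ y # D). conn adj (X u) \<and> m u \<in> X u \<and> X u \<subseteq> insert (m u) (inn h)"
    "\<forall>u\<in>set Z. conn adj (X u) \<and> X u \<subseteq> inn h" "\<forall>u\<in>set (x # A @ y # D @ Z). X u \<inter> (I1 \<union> I2) = {}"
    "\<forall>u\<in>set (x # A @ y # D @ Z). \<forall>v\<in>set (x # A @ y # D @ Z). u \<noteq> v \<longrightarrow> X u \<inter> X v = {}"
    "\<forall>i\<le>length Z. \<exists>a\<in>X ((x # Z @ [y]) ! i). \<exists>b\<in>X ((x # Z @ [y]) ! Suc i). adj a b"
    using ear_step[OF m(1) dist l m(3)] by (elim exE conjE) (rule that)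
  define h1 where "h1 = Host (?n + 1) C1 I1 (x # A @ y # rev Z) t1"
  define h2 where "h2 = Host (?n + 1) C2 I2 (x # rev D @ y # rev Z) t2"
  have ho1: "hosting X h1"
    unfolding hosting_def h1_def host.sel using e(1,6,8) dist len L by (intro conjI exI[of _ m1]) auto
  have ho2: "hosting X h2"
    unfolding hosting_def h2_def host.sel using e(2,7,9) dist len L by (intro conjI exI[of _ m2]) auto
  have sets: "set (x # A @ y # D @ Z) = set (lab h) \<union> set Z" using L by auto
  have H2: "\<forall>g\<in>{h1, h2}. hosting X g \<and> set (lab g) \<subseteq> set (lab h) \<union> set Z \<and> inn g \<subseteq> inn h \<and> (\<forall>u\<in>set (lab h) \<union> set Z. X u \<inter> inn g = {})"
  proof -
    have x: "X u \<inter> I1 = {}" "X u \<inter> I2 = {}" if "u \<in> set (lab h) \<union> set Z" for u using e(12) that unfolding sets by blast+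
    have "set (lab h1) \<subseteq> set (lab h) \<union> set Z" "set (lab h2) \<subseteq> set (lab h) \<union> set Z" using L by (auto simp: h1_def h2_def)
    moreover have "inn h1 = I1" "inn h2 = I2" by (simp_all add: h1_def h2_def)
    ultimately show ?thesis using ho1 ho2 e(3,4) x by auto
  qed
  have H3: "\<forall>g\<in>{h1, h2}. \<forall>g'\<in>{h1, h2}. g \<noteq> g' \<longrightarrow> inn g \<inter> inn g' = {}"
    using e(5) by (auto simp: h1_def h2_def)
  have X1: "\<forall>p\<in>set (lab h). conn adj (X p) \<and> X p \<inter> B p \<noteq> {} \<and> X p \<subseteq> B p \<union> inn h"
  proof
    fix p assume p: "p \<in> set (lab h)"
    have "p \<in> set (x # A @ y # D)" using p L by simp
    then have "conn adj (X p)" "m p \<in> X p" "X p \<subseteq> insert (m p) (inn h)" using e(10) by blast+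
    then show "conn adj (X p) \<and> X p \<inter> B p \<noteq> {} \<and> X p \<subseteq> B p \<union> inn h" using m(4) p by blast
  qed
  note up = board_update[OF b hH Z(2) X1 e(11) e(13)[unfolded sets] H2 H3]
  define B' where "B' = (\<lambda>u. if u \<in> set (lab h) then B u \<union> X u else if u \<in> set Z then X u else B u)"
  have u1: "board W (V \<union> set Z) B' ({h1, h2} \<union> H)" "{h1, h2} \<inter> H = {}" "\<forall>x\<in>V. B x \<subseteq> B' x"
    "\<forall>x\<in>set (lab h) \<union> set Z. X x \<subseteq> B' x"
  proof -
    show "board W (V \<union> set Z) B' ({h1, h2} \<union> H)" using up(1) unfolding B'_def[symmetric] .
    show "{h1, h2} \<inter> H = {}" by (rule up(2))
    show "\<forall>x\<in>V. B x \<subseteq> B' x" using Z(2) by (auto simp: B'_def)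
    show "\<forall>x\<in>set (lab h) \<union> set Z. X x \<subseteq> B' x" using Z(2) labV by (auto simp: B'_def)
  qed
  have "h1 \<noteq> h2" using e(5) inn_nonempty[OF ho1] by (auto simp: h1_def h2_def)
  moreover have "\<forall>i\<le>length Z. \<exists>a\<in>B' ((x # Z @ [y]) ! i). \<exists>b\<in>B' ((x # Z @ [y]) ! Suc i). adj a b"
  proof (intro allI impI)
    fix i assume i: "i \<le> length Z"
    have "(x # Z @ [y]) ! i \<in> set (x # Z @ [y])" "(x # Z @ [y]) ! Suc i \<in> set (x # Z @ [y])" using i by (intro nth_mem; simp)+
    then have "(x # Z @ [y]) ! i \<in> set (lab h) \<union> set Z" "(x # Z @ [y]) ! Suc i \<in> set (lab h) \<union> set Z" using L by auto
    then show "\<exists>a\<in>B' ((x # Z @ [y]) ! i). \<exists>b\<in>B' ((x # Z @ [y]) ! Suc i). adj a b" using e(14) i u1(4) by blast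
  qed
  ultimately show ?thesis using u1(1-3)
    by (intro exI[of _ B'] exI[of _ h1] exI[of _ h2]) (simp add: h1_def h2_def)
qed

lemma op_wait_until:
  assumes b: "board W V B (insert h H)" and hH: "h \<notin> H" and ne: "lab h \<noteq> []"
  shows "\<exists>B' h'. board W V B' (insert h' H) \<and> h' \<notin> H \<and> lab h' = lab h \<and> lev h' = lev h + k \<and> (\<forall>x\<in>V. B x \<subseteq> B' x)"
proof (induction k)
  case 0
  then show ?case using b hH by (intro exI[of _ B] exI[of _ h]) simp
next
  case (Suc k)
  then obtain B' h' where a: "board W V B' (insert h' H)" "h' \<notin> H" "lab h' = lab h" "lev h' = lev h + k" "\<forall>x\<in>V. B x \<subseteq> B' x"
    by blast
  have "lab h' \<noteq> []" using a(3) ne by simp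
  from op_wait[OF a(1,2) this, of "tag h'"] obtain B2 h2 where c: "board W V B2 (insert h2 H)" "h2 \<notin> H" "lab h2 = lab h'" "lev h2 = lev h' + 1" "\<forall>x\<in>V. B' x \<subseteq> B2 x"
    by (elim exE conjE) (rule that)
  then show ?case using a by (intro exI[of _ B2] exI[of _ h2]) (simp, blast)
qed

text \<open>Waiting as many levels as there are labels and new vertices makes room for the ear and
  for the longer label lists of the two resulting hosts.\<close>

lemma op_ear:
  assumes b: "board W V B (insert h H)" and hH: "h \<notin> H" and L: "rotate r (lab h) = x # A @ y # D"
    and Z: "distinct Z" "set Z \<inter> V = {}"
  shows "\<exists>B' h1 h2. board W (V \<union> set Z) B' (insert h1 (insert h2 H)) \<and> h1 \<notin> insert h2 H \<and> h2 \<notin> H \<and>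
    lab h1 = x # A @ y # rev Z \<and> tag h1 = t1 \<and> lab h2 = x # rev D @ y # rev Z \<and> tag h2 = t2 \<and> (\<forall>x\<in>V. B x \<subseteq> B' x) \<and>
    (\<forall>i\<le>length Z. \<exists>a\<in>B' ((x # Z @ [y]) ! i). \<exists>b\<in>B' ((x # Z @ [y]) ! Suc i). adj a b)"
proof -
  obtain h1 where h1: "board W V B (insert h1 H)" "h1 \<notin> H" "lab h1 = rotate r (lab h)" using op_rotate[OF b hH] by metis
  have ne: "lab h1 \<noteq> []" using h1 L by simp
  obtain B2 h2 where h2: "board W V B2 (insert h2 H)" "h2 \<notin> H" "lab h2 = lab h1" "lev h2 = lev h1 + (length (lab h1) + length Z)" "\<forall>x\<in>V. B x \<subseteq> B2 x"
    using op_wait_until[OF h1(1,2) ne] by blast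
  have L2: "lab h2 = x # A @ y # D" using h2 h1 L by simp
  have len: "length (lab h2) + length Z \<le> lev h2 + 1" using h2 by simp
  from op_ear0[OF h2(1,2) L2 Z len, of t1 t2] obtain B' g1 g2 where
    "board W (V \<union> set Z) B' (insert g1 (insert g2 H))" "g1 \<notin> insert g2 H" "g2 \<notin> H"
    "lab g1 = x # A @ y # rev Z" "tag g1 = t1" "lab g2 = x # rev D @ y # rev Z" "tag g2 = t2" "\<forall>x\<in>V. B2 x \<subseteq> B' x"
    "\<forall>i\<le>length Z. \<exists>a\<in>B' ((x # Z @ [y]) ! i). \<exists>b\<in>B' ((x # Z @ [y]) ! Suc i). adj a b"
    by (elim exE conjE) (rule that)
  then show ?thesis using h2(5) by (intro exI[of _ B'] exI[of _ g1] exI[of _ g2]) (simp, blast)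
qed

text \<open>Each clause of \<open>board\<close> concerns finitely many vertices at a time and is
  decided at a finite stage. A host can be kept only if it is never replaced again, hence the
  increasing family \<open>S\<close>. \<open>B'\<close> skips the stages at which \<open>x\<close>
  is not yet placed, because \<open>B j x\<close> is arbitrary there.\<close>

lemma board_limit:
  assumes b: "\<And>j::nat. board W (V j) (B j) (H j)" and V: "\<And>j. V j \<subseteq> V (Suc j)"
    and B: "\<And>j x. x \<in> V j \<Longrightarrow> B j x \<subseteq> B (Suc j) x" and S: "\<And>j. S j \<subseteq> H j" "\<And>j. S j \<subseteq> S (Suc j)"
  defines "B' \<equiv> \<lambda>x. \<Union>j\<in>{j. x \<in> V j}. B j x"
  shows "board W (\<Union>j. V j) B' (\<Union>j. S j)" "\<And>j x. x \<in> V j \<Longrightarrow> B j x \<subseteq> B' x"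
proof -
  have Vm: "V i \<subseteq> V j" if "i \<le> j" for i j using lift_Suc_mono_le[of V, OF V that] .
  have Sm: "S i \<subseteq> S j" if "i \<le> j" for i j using lift_Suc_mono_le[of S, OF S(2) that] .
  have Bm: "B i x \<subseteq> B j x" if "i \<le> j" "x \<in> V i" for i j x
    using that
  proof (induction j rule: dec_induct)
    case (step j)
    then show ?case using B[of x j] Vm[of i j] by auto
  qed simp
  show sub: "B j x \<subseteq> B' x" if "x \<in> V j" for j x using that by (auto simp: B'_def)
  have mem: "\<exists>k\<ge>j. z \<in> B k x \<and> x \<in> V k" if zx: "z \<in> B' x" "x \<in> V j" for z x j
  proof -
    obtain i where i: "x \<in> V i" "z \<in> B i x" using zx by (auto simp: B'_def)
    then have "z \<in> B (max i j) x" "x \<in> V (max i j)" using Bm[of i "max i j" x] Vm[of i "max i j"] by auto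
    then show ?thesis using max.cobounded2 by blast
  qed
  show "board W (\<Union>j. V j) B' (\<Union>j. S j)"
  proof (rule boardI)
    fix x assume "x \<in> (\<Union>j. V j)"
    then obtain j where j: "x \<in> V j" by blast
    have "B' x \<noteq> {}" using sub[OF j] board_branch[OF b j] by (auto simp: conn_def)
    moreover have "(p, q) \<in> {(u, v). u \<in> B' x \<and> v \<in> B' x \<and> adj u v}\<^sup>*" if pq: "p \<in> B' x" "q \<in> B' x" for p q
    proof -
      obtain k where k: "p \<in> B k x" "x \<in> V k" using mem[OF pq(1) j] by blast
      obtain l where l: "l \<ge> k" "q \<in> B l x" "x \<in> V l" using mem[OF pq(2) k(2)] by blast
      have "p \<in> B l x" using Bm[OF l(1) k(2)] k(1) by blast
      moreover have "conn adj (B l x)" using board_branch[OF b l(3)] by simp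
      ultimately show ?thesis using conn_reach[of adj "B l x" p q "B' x"] l sub[OF l(3)] by blast
    qed
    moreover have "B' x \<subseteq> W" using board_branch[OF b] by (auto simp: B'_def)
    ultimately show "conn adj (B' x) \<and> B' x \<subseteq> W" by (simp add: conn_def)
  next
    fix x y assume xy: "x \<in> (\<Union>j. V j)" "y \<in> (\<Union>j. V j)" "x \<noteq> y"
    show "B' x \<inter> B' y = {}"
    proof (rule ccontr)
      assume "B' x \<inter> B' y \<noteq> {}"
      then obtain z where z: "z \<in> B' x" "z \<in> B' y" by blast
      obtain j where j: "x \<in> V j" "z \<in> B j x" using z(1) by (auto simp: B'_def)
      obtain i where i: "y \<in> V i" using xy by blast
      have yj: "y \<in> V (max i j)" using Vm[of i "max i j"] i by auto
      obtain k where k: "k \<ge> max i j" "z \<in> B k y" "y \<in> V k" using mem[OF z(2) yj] by blast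
      have "z \<in> B k x" "x \<in> V k" using Bm[of j k x] Vm[of j k] j k(1) by auto
      then show False using board_branch_disj[OF b, of x k y] k xy(3) by blast
    qed
  next
    fix h assume "h \<in> (\<Union>j. S j)"
    then obtain j where j: "h \<in> S j" by blast
    then have hj: "h \<in> H j" using S by blast
    note hb = board_host[OF b hj]
    have "hosting B' h" by (rule hosting_mono[of "B j"]) (use hb sub in blast)+
    then show "hosting B' h \<and> set (lab h) \<subseteq> (\<Union>j. V j) \<and> inn h \<subseteq> W" using hb by blast
  next
    fix h x assume hx: "h \<in> (\<Union>j. S j)" "x \<in> (\<Union>j. V j)"
    show "inn h \<inter> B' x = {}"
    proof (rule ccontr)
      assume "inn h \<inter> B' x \<noteq> {}"
      then obtain z where z: "z \<in> inn h" "z \<in> B' x" by blast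
      obtain j where j: "h \<in> S j" using hx by blast
      obtain i where i: "x \<in> V i" using hx by blast
      have xj: "x \<in> V (max i j)" using Vm[of i "max i j"] i by auto
      obtain k where k: "k \<ge> max i j" "z \<in> B k x" "x \<in> V k" using mem[OF z(2) xj] by blast
      have "h \<in> H k" using Sm[of j k] S(1)[of k] j k(1) by auto
      then show False using board_host_branch[OF b, of h k x] k z by blast
    qed
  next
    fix h h' assume hh: "h \<in> (\<Union>j. S j)" "h' \<in> (\<Union>j. S j)" "h \<noteq> h'"
    then obtain i j where "h \<in> S i" "h' \<in> S j" by blast
    then have "h \<in> H (max i j)" "h' \<in> H (max i j)" using Sm[of i "max i j"] Sm[of j "max i j"] S(1)[of "max i j"] by auto
    then show "inn h \<inter> inn h' = {}" using board_host_disj[OF b] hh(3) by blast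
  qed
qed

end

section \<open>Ear decompositions\<close>

text \<open>Decoding an index into a pair and keeping the first component repeats each element
  beyond every bound, since the second component is free.\<close>

lemma schedule:
  assumes "countable A" "A \<noteq> {}"
  shows "\<exists>s::nat \<Rightarrow> 'a. (\<forall>j. s j \<in> A) \<and> (\<forall>a\<in>A. \<forall>m. \<exists>j\<ge>m. s j = a)"
proof -
  define s where "s j = from_nat_into A (fst (prod_decode j))" for j
  have "\<exists>j\<ge>m. s j = a" if a: "a \<in> A" for a m
  proof -
    obtain i where "from_nat_into A i = a" using from_nat_into_surj[OF assms(1) a] by blast
    then have "s (prod_encode (i, m)) = a" by (simp add: s_def)
    then show ?thesis using le_prod_encode_2 by blast
  qed
  moreover have "\<forall>j. s j \<in> A" using from_nat_into[OF assms(2)] by (simp add: s_def)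
  ultimately show ?thesis by blast
qed

lemma rotate_split:
  assumes "a \<in> set L" "b \<in> set L" "a \<noteq> b"
  shows "\<exists>r A D. rotate r L = a # A @ b # D"
proof -
  obtain X Y where L: "L = X @ a # Y" using split_list[OF assms(1)] by blast
  then have r: "rotate (length X) L = a # Y @ X" by (simp add: rotate_append)
  then have "b \<in> set (Y @ X)" using assms set_rotate[of "length X" L] by auto
  then obtain A D where "Y @ X = A @ b # D" using split_list[of b "Y @ X"] by blast
  then show ?thesis using r by auto
qed

lemma successively_take: "successively R (xs @ ys) \<Longrightarrow> successively R xs"
  by (simp add: successively_append_iff)

definition outside :: "drawing \<Rightarrow> (real^3) set \<Rightarrow> ((real^3) \<times> (real^3)) set" where
  "outside P V = {(u, w). u \<notin> V \<and> w \<notin> V \<and> padj P u w}"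

text \<open>What remains outside such a set hangs at single vertices of it, so the next block can be placed in a
  face reserved for one vertex.\<close>

definition ear_closed :: "drawing \<Rightarrow> (real^3) set \<Rightarrow> bool" where
  "ear_closed P V \<longleftrightarrow> (\<forall>x\<in>V. \<forall>y\<in>V. \<forall>a b. a \<notin> V \<longrightarrow> b \<notin> V \<longrightarrow> padj P x a \<longrightarrow> padj P y b \<longrightarrow>
     (a, b) \<in> (outside P V)\<^sup>* \<longrightarrow> x = y)"

definition subg :: "drawing \<Rightarrow> (real^3) set \<Rightarrow> (real^3) set set \<Rightarrow> bool" where
  "subg P V E \<longleftrightarrow> V \<subseteq> points P \<and> (\<forall>e\<in>E. \<exists>u\<in>V. \<exists>w\<in>V. e = {u, w} \<and> padj P u w)"

definition dr :: "drawing \<Rightarrow> (real^3) set \<Rightarrow> (real^3) set set \<Rightarrow> (real^3) set" where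
  "dr P V E = V \<union> \<Union>(cv P ` E)"

text \<open>The ends are distinct, so a cycle through a single vertex of \<open>V\<close> is no ear;
  it belongs to another block. An empty \<open>Z\<close> is a chord and has to be a new
  edge.\<close>

definition ear :: "drawing \<Rightarrow> (real^3) set \<Rightarrow> (real^3) set set \<Rightarrow> real^3 \<Rightarrow> (real^3) list \<Rightarrow> real^3 \<Rightarrow> bool" where
  "ear P V E a Z b \<longleftrightarrow> a \<in> V \<and> b \<in> V \<and> distinct (a # Z @ [b]) \<and> set Z \<subseteq> points P \<and> set Z \<inter> V = {} \<and>
     successively (padj P) (a # Z @ [b]) \<and> (Z = [] \<longrightarrow> {a, b} \<notin> E)"

text \<open>The second alternative is the starting position: one edge forms no cycle yet, and the
  complement of its arc plays the part of a disc with boundary order \<open>[x, v]\<close>.\<close>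

definition discs :: "drawing \<Rightarrow> (real^3) set \<Rightarrow> (real^3) set set \<Rightarrow> ((real^3) list \<times> (real^3) set) set \<Rightarrow> bool" where
  "discs P V E \<Delta> \<longleftrightarrow> subg P V E \<and> \<Union>(snd ` \<Delta>) = S2 - dr P V E \<and>
     (\<forall>d\<in>\<Delta>. \<forall>d'\<in>\<Delta>. d \<noteq> d' \<longrightarrow> snd d \<inter> snd d' = {}) \<and>
     ((\<forall>(L, R)\<in>\<Delta>. cyc P L \<and> region (pcyc P L) R \<and> pcyc P L \<subseteq> dr P V E) \<or>
      (\<exists>x v. V = {x, v} \<and> E = {{x, v}} \<and> \<Delta> = {([x, v], S2 - dr P V E)}))"

lemma outside_sym: "(a, b) \<in> (outside P V)\<^sup>* \<Longrightarrow> (b, a) \<in> (outside P V)\<^sup>*"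
proof -
  have "sym (outside P V)" by (auto simp: sym_def outside_def intro: padj_sym)
  then show "(a, b) \<in> (outside P V)\<^sup>* \<Longrightarrow> (b, a) \<in> (outside P V)\<^sup>*" using sym_rtrancl symD by metis
qed

lemma outside_mono: "(a, b) \<in> (outside P V)\<^sup>* \<Longrightarrow> V' \<subseteq> V \<Longrightarrow> (a, b) \<in> (outside P V')\<^sup>*"
  by (rule rev_subsetD, assumption, rule rtrancl_mono) (auto simp: outside_def)

context
  fixes P assumes plane: "plane_graph P"
begin

text \<open>A walk becomes a path by cutting it back to the earlier visit whenever a vertex is
  repeated.\<close>

lemma outside_path:
  assumes "(a, b) \<in> (outside P V)\<^sup>*" "a \<notin> V" "a \<in> points P"
  shows "\<exists>Z. Z \<noteq> [] \<and> hd Z = a \<and> last Z = b \<and> distinct Z \<and> set Z \<subseteq> points P \<and> set Z \<inter> V = {} \<and> successively (padj P) Z"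
  using assms(1)
proof (induction rule: rtrancl_induct)
  case base
  then show ?case using assms by (intro exI[of _ "[a]"]) auto
next
  case (step b c)
  then obtain Z where Z: "Z \<noteq> []" "hd Z = a" "last Z = b" "distinct Z" "set Z \<subseteq> points P" "set Z \<inter> V = {}" "successively (padj P) Z"
    by blast
  have c: "c \<notin> V" "padj P b c" "c \<in> points P" using step(2) padj_points[OF plane] by (auto simp: outside_def)
  show ?case
  proof (cases "c \<in> set Z")
    case True
    then obtain X Y where "Z = X @ c # Y" using split_list by metis
    then have Z': "Z = (X @ [c]) @ Y" by simp
    show ?thesis
    proof (intro exI[of _ "X @ [c]"] conjI)
      show "hd (X @ [c]) = a" using Z(2) Z' by (cases X) auto
      show "successively (padj P) (X @ [c])" using Z(7) successively_take unfolding Z' by blast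
    qed (use Z Z' in auto)
  next
    case False
    show ?thesis by (rule exI[of _ "Z @ [c]"]) (use Z c False in \<open>auto simp: successively_append_iff\<close>)
  qed
qed

lemma subg_dr: assumes "subg P V E" shows "dr P V E \<inter> points P = V"
proof -
  have "cv P e \<inter> points P \<subseteq> V" if e: "e \<in> E" for e
  proof -
    obtain u w where "u \<in> V" "w \<in> V" "e = {u, w}" "padj P u w" using assms e unfolding subg_def by metis
    then show ?thesis using cv_props(2)[OF plane, of u w] by auto
  qed
  then show ?thesis using assms by (auto simp: dr_def subg_def)
qed

text \<open>A common point that is no vertex would lie on a common curve. Its ends would be
  \<open>a\<close> and \<open>b\<close>, so \<open>Z\<close> would be empty and the edge old, which
  \<open>ear\<close> excludes.\<close>

lemma ear_dr:
  assumes s: "subg P V E" and e: "ear P V E a Z b"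
  shows "pc P (a # Z @ [b]) \<inter> dr P V E = {a, b}"
proof -
  let ?p = "a # Z @ [b]"
  note e' = e[unfolded ear_def]
  have V: "V \<subseteq> points P" using s by (simp add: subg_def)
  have p: "set ?p \<subseteq> points P" using e' V by auto
  have suc: "successively (padj P) ?p" using e' by blast
  have "q \<in> {a, b}" if q: "q \<in> pc P ?p" "q \<in> dr P V E" for q
  proof (cases "q \<in> points P")
    case True
    then have "q \<in> set ?p" "q \<in> V" using q pc_points[OF plane suc p] subg_dr[OF s] by auto
    then show ?thesis using e' by auto
  next
    case False
    then obtain d where d: "d \<in> les ?p" "q \<in> cv P d" using q(1) p by (auto simp: pc_def)
    obtain f where f: "f \<in> E" "q \<in> cv P f" using False q(2) V by (auto simp: dr_def)
    obtain u w where f': "f = {u, w}" "u \<in> V" "w \<in> V" "padj P u w" using s f(1) by (auto simp: subg_def)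
    have 1: "cv P d \<in> curves P" "cv P d \<inter> points P = d" using les_cv[OF plane suc d(1)] by auto
    have 2: "cv P f \<in> curves P" "cv P f \<inter> points P = f" using cv_props[OF plane f'(4)] f'(1) by auto
    have "cv P d = cv P f" using plane 1(1) 2(1) d(2) f(2) False unfolding plane_graph_def by blast
    then have df: "d = f" using 1(2) 2(2) by metis
    then have "f \<subseteq> set ?p \<inter> V" using les_sub[OF d(1)] f' by auto
    then have "f \<subseteq> {a, b}" using e' by auto
    moreover have "u \<noteq> w" using padj_points[OF plane f'(4)] by blast
    ultimately have ab: "f = {a, b}" using f'(1) by auto
    then have "Z = []" using les_ends[of a b Z] d(1) df e' by simp
    then show ?thesis using e' f(1) ab by blast
  qed
  moreover have "{a, b} \<subseteq> pc P ?p \<inter> dr P V E" using e' by (auto simp: pc_def dr_def)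
  ultimately show ?thesis by blast
qed

lemma subg_ear: assumes s: "subg P V E" and e: "ear P V E a Z b"
  shows "subg P (V \<union> set Z) (E \<union> les (a # Z @ [b]))"
proof -
  note e' = e[unfolded ear_def]
  have "\<exists>u\<in>V \<union> set Z. \<exists>w\<in>V \<union> set Z. d = {u, w} \<and> padj P u w" if d: "d \<in> les (a # Z @ [b])" for d
  proof -
    obtain u w where "d = {u, w}" "padj P u w" using les_padj[OF plane _ d] e' by blast
    moreover have "d \<subseteq> V \<union> set Z" using les_sub[OF d] e' by auto
    ultimately show ?thesis by auto
  qed
  moreover have "\<exists>u\<in>V \<union> set Z. \<exists>w\<in>V \<union> set Z. d = {u, w} \<and> padj P u w" if "d \<in> E" for d
    using s that unfolding subg_def by (metis UnI1)
  ultimately show ?thesis using s e' unfolding subg_def by (metis Un_iff Un_subset_iff)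
qed

lemma dr_ear: "a \<in> V \<Longrightarrow> b \<in> V \<Longrightarrow> dr P (V \<union> set Z) (E \<union> les (a # Z @ [b])) = dr P V E \<union> pc P (a # Z @ [b])"
  by (auto simp: dr_def pc_def)

text \<open>The open ear is connected and avoids the drawing, so it stays in one disc. Its ends lie
  in its closure, hence on the boundary cycle of this disc, and \<open>disc_split\<close>
  applies.\<close>

lemma discs_ear:
  assumes D: "discs P V E \<Delta>" and e: "ear P V E a Z b"
  shows "\<exists>L R r A D R1 R2. (L, R) \<in> \<Delta> \<and> rotate r L = a # A @ b # D \<and>
    discs P (V \<union> set Z) (E \<union> les (a # Z @ [b])) (\<Delta> - {(L, R)} \<union> {(a # A @ b # rev Z, R1), (a # rev D @ b # rev Z, R2)})"
proof -
  let ?p = "a # Z @ [b]"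
  define T where "T = pc P ?p - {a, b}"
  note e' = e[unfolded ear_def]
  have s: "subg P V E" and U: "\<Union>(snd ` \<Delta>) = S2 - dr P V E"
    and dj: "\<And>d d'. d \<in> \<Delta> \<Longrightarrow> d' \<in> \<Delta> \<Longrightarrow> d \<noteq> d' \<Longrightarrow> snd d \<inter> snd d' = {}"
    using D by (auto simp: discs_def)
  have V: "V \<subseteq> points P" using s by (simp add: subg_def)
  have p: "set ?p \<subseteq> points P" "distinct ?p" "successively (padj P) ?p" and ab: "a \<noteq> b" using e' V by auto
  have pd: "pc P ?p \<inter> dr P V E = {a, b}" by (rule ear_dr[OF s e])
  have s': "subg P (V \<union> set Z) (E \<union> les ?p)" by (rule subg_ear[OF s e])
  have dr': "dr P (V \<union> set Z) (E \<union> les ?p) = dr P V E \<union> pc P ?p" by (rule dr_ear) (use e' in auto)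
  have TS: "T \<subseteq> S2" using pc_S2[OF plane p(3) p(1)] by (auto simp: T_def)
  have Td: "T \<inter> dr P V E = {}" using pd by (auto simp: T_def)
  consider (cyc) "\<forall>(L, R)\<in>\<Delta>. cyc P L \<and> region (pcyc P L) R \<and> pcyc P L \<subseteq> dr P V E"
    | (edge) x v where "V = {x, v}" "E = {{x, v}}" "\<Delta> = {([x, v], S2 - dr P V E)}"
    using D unfolding discs_def by blast
  then show ?thesis
  proof cases
    case cyc
    obtain g where g: "arc g" "path_image g = pc P ?p" "pathstart g = a" "pathfinish g = b"
      using ear_arc[OF plane p(2,3,1)] by blast
    have Tg: "T = path_image g - {pathstart g, pathfinish g}" using g by (simp add: T_def)
    have Tc: "connected T" unfolding Tg by (rule connected_simple_path_endless) (use g(1) in \<open>rule arc_imp_simple_path\<close>)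
    have "T \<noteq> {}" unfolding Tg by (rule arc_inner_point[OF g(1)])
    then obtain q where q: "q \<in> T" by blast
    then have "q \<in> \<Union>(snd ` \<Delta>)" using TS Td U by blast
    then obtain L R where LR: "(L, R) \<in> \<Delta>" "q \<in> R" by auto
    have L: "cyc P L" "region (pcyc P L) R" "pcyc P L \<subseteq> dr P V E" using cyc LR(1) by auto
    have TR: "T \<subseteq> R" by (rule region_absorb[OF L(2) Tc TS]) (use Td L(3) q LR(2) in auto)
    have Rd: "R \<inter> dr P V E = {}" using U LR(1) by force
    have cl: "closure T \<subseteq> R \<union> pcyc P L" using closure_mono[OF TR] L(2) by (simp add: region_def)
    have "b \<in> closure T" using arc_end_closure[OF g(1)] g Tg by simp
    moreover have "a \<in> closure T" using arc_end_closure[OF arc_reversepath[OF g(1)]] g Tg by (simp add: insert_commute)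
    moreover have "a \<in> dr P V E" "b \<in> dr P V E" using e' by (auto simp: dr_def)
    ultimately have "a \<in> pcyc P L" "b \<in> pcyc P L" using cl Rd by auto
    then have abL: "a \<in> set L" "b \<in> set L" using cyc_region_points[OF plane L(1)] p(1) by auto
    obtain r A D where r: "rotate r L = a # A @ b # D" using rotate_split[OF abL ab] by blast
    have c: "cyc P (a # A @ b # D)" using cyc_rotate[OF L(1), of r] r by simp
    have pcy: "pcyc P (a # A @ b # D) = pcyc P L" using pcyc_rotate[of P r L] r by simp
    have LV: "set (a # A @ b # D) \<subseteq> V"
      using cyc_region_points[OF plane c] pcy L(3) subg_dr[OF s] by blast
    have ZL: "set Z \<inter> set (a # A @ b # D) = {}" using LV e' by blast
    have rc: "region (pcyc P (a # A @ b # D)) R" using L(2) pcy by simp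
    have Zp: "set Z \<subseteq> points P" using e' by blast
    note ds = disc_split[OF plane c rc p(2) ZL Zp p(3) TR[unfolded T_def]]
    obtain R1 R2 where R: "region (pcyc P (a # A @ b # rev Z)) R1" "region (pcyc P (a # rev D @ b # rev Z)) R2"
      "R1 \<inter> R2 = {}" "R = R1 \<union> R2 \<union> T" using ds(3) unfolding T_def by blast
    have pZ: "pc P (b # rev Z @ [a]) = pc P ?p" using pc_rev[of P ?p] by simp
    have pD: "pc P (a # rev D @ [b]) = pc P (b # D @ [a])" using pc_rev[of P "b # D @ [a]"] by simp
    have c1: "pcyc P (a # A @ b # rev Z) = pc P (a # A @ [b]) \<union> pc P ?p" using cyc_split(3)[OF plane ds(1)] pZ by simp
    have c2: "pcyc P (a # rev D @ b # rev Z) = pc P (b # D @ [a]) \<union> pc P ?p" using cyc_split(3)[OF plane ds(2)] pZ pD by simp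
    have c3: "pcyc P L = pc P (a # A @ [b]) \<union> pc P (b # D @ [a])" using cyc_split(3)[OF plane c] pcy by simp
    have RT: "R1 \<inter> pc P ?p = {}" "R2 \<inter> pc P ?p = {}" using R(1,2) c1 c2 by (auto simp: region_def)
    let ?D = "\<Delta> - {(L, R)} \<union> {(a # A @ b # rev Z, R1), (a # rev D @ b # rev Z, R2)}"
    have oth: "snd d \<inter> R = {}" if d: "d \<in> \<Delta> - {(L, R)}" for d using dj[of d "(L, R)"] d LR(1) by auto
    have Un: "\<Union>(snd ` ?D) = S2 - dr P (V \<union> set Z) (E \<union> les ?p)"
    proof -
      define O' where "O' = \<Union>(snd ` (\<Delta> - {(L, R)}))"
      have "\<Union>(snd ` insert (L, R) (\<Delta> - {(L, R)})) = O' \<union> R" unfolding O'_def by auto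
      moreover have "insert (L, R) (\<Delta> - {(L, R)}) = \<Delta>" using LR(1) by blast
      ultimately have "\<Union>(snd ` \<Delta>) = O' \<union> R" by metis
      then have 1: "O' \<union> R = S2 - dr P V E" using U by simp
      have 2: "O' \<inter> R = {}" unfolding O'_def using oth by blast
      have 3: "\<Union>(snd ` ?D) = O' \<union> R1 \<union> R2" unfolding O'_def by auto
      have 4: "pc P ?p \<subseteq> T \<union> dr P V E" using pd unfolding T_def by blast
      have 5: "O' \<inter> pc P ?p = {}" using 4 TR 1 2 by blast
      have 6: "T \<subseteq> pc P ?p" by (auto simp: T_def)
      have "(O' \<union> (R1 \<union> R2 \<union> T)) - pc P ?p = O' \<union> R1 \<union> R2" using 5 6 RT by blast
      then show ?thesis unfolding dr' 3 using 1 R(4) by (simp add: Diff_Un Diff_eq Int_assoc)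
    qed
    have "discs P (V \<union> set Z) (E \<union> les ?p) ?D" unfolding discs_def
    proof (intro conjI disjI1 ballI impI s' Un)
      fix d d' assume d: "d \<in> ?D" "d' \<in> ?D" "d \<noteq> d'"
      have "R1 \<subseteq> R" "R2 \<subseteq> R" using R(4) by auto
      then have RX: "R1 \<inter> X = {}" "R2 \<inter> X = {}" "X \<inter> R1 = {}" "X \<inter> R2 = {}" if "X \<inter> R = {}" for X using that by blast+
      have R21: "R2 \<inter> R1 = {}" using R(3) by blast
      consider "d \<in> \<Delta> - {(L, R)}" "d' \<in> \<Delta> - {(L, R)}" | "d \<in> \<Delta> - {(L, R)}" "snd d' = R1 \<or> snd d' = R2"
        | "d' \<in> \<Delta> - {(L, R)}" "snd d = R1 \<or> snd d = R2" | "snd d = R1" "snd d' = R2" | "snd d = R2" "snd d' = R1"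
        using d by auto
      then show "snd d \<inter> snd d' = {}"
      proof cases
        case 1 then show ?thesis using dj d(3) by blast
      next
        case 2 then show ?thesis using RX[OF oth[OF 2(1)]] by metis
      next
        case 3 then show ?thesis using RX[OF oth[OF 3(1)]] by metis
      qed (use R(3) R21 in simp_all)
    next
      fix d assume d: "d \<in> ?D"
      then consider "d \<in> \<Delta>" | "d = (a # A @ b # rev Z, R1)" | "d = (a # rev D @ b # rev Z, R2)" by blast
      then show "case d of (L, R) \<Rightarrow> cyc P L \<and> region (pcyc P L) R \<and> pcyc P L \<subseteq> dr P (V \<union> set Z) (E \<union> les ?p)"
      proof cases
        case 1 then show ?thesis unfolding dr' using cyc by auto
      next
        case 2 then show ?thesis unfolding dr' using ds(1) R(1) c1 c3 L(3) by auto
      next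
        case 3 then show ?thesis unfolding dr' using ds(2) R(2) c2 c3 L(3) by auto
      qed
    qed
    then show ?thesis using LR(1) r by blast
  next
    case edge
    have xv: "(a = x \<and> b = v) \<or> (a = v \<and> b = x)" using e' edge(1) ab by auto
    \<comment> \<open>The only possible chord is the edge already present, so the first ear has
      inner vertices and closes this edge to a cycle.\<close>
    have Z: "Z \<noteq> []" using e' edge(2) xv by auto
    have "padj P x v" using s edge(1,2) by (auto simp: subg_def doubleton_eq_iff intro: padj_sym)
    then have pab: "padj P a b" using xv padj_sym by blast
    have Zp: "set Z \<subseteq> points P" using e' by blast
    note di = disc_initial[OF plane pab p(2) Z Zp p(3)]
    obtain R1 R2 where R: "region (pcyc P (a # b # rev Z)) R1" "region (pcyc P (a # b # rev Z)) R2"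
      "R1 \<inter> R2 = {}" "S2 = R1 \<union> R2 \<union> pcyc P (a # b # rev Z)" using di(2) by blast
    have "dr P V E = pc P [a, b]" using edge(1,2) xv by (auto simp: dr_def pc_def insert_commute)
    then have pcy: "pcyc P (a # b # rev Z) = dr P (V \<union> set Z) (E \<union> les ?p)" unfolding dr' di(3) by simp
    have Rd: "R1 \<inter> pcyc P (a # b # rev Z) = {}" "R2 \<inter> pcyc P (a # b # rev Z) = {}" using R by (auto simp: region_def)
    obtain r where r: "rotate r [x, v] = a # [] @ b # []"
    proof (cases "a = x")
      case True then show ?thesis using xv ab that[of 0] by auto
    next
      case False then show ?thesis using xv that[of 1] by auto
    qed
    have "\<Delta> - {([x, v], S2 - dr P V E)} = {}" using edge(3) by auto
    moreover have "discs P (V \<union> set Z) (E \<union> les ?p) ({} \<union> {(a # [] @ b # rev Z, R1), (a # rev [] @ b # rev Z, R2)})"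
      unfolding discs_def using s' R(1-3) di(1) pcy R(4) Rd by auto
    ultimately show ?thesis using edge(3) r by (metis insertI1)
  qed
qed

end

section \<open>Growth of one block by scheduled ears\<close>

definition kstep :: "drawing \<Rightarrow> (real^3) set \<times> (real^3) set set \<Rightarrow> (real^3) list \<Rightarrow> (real^3) set \<times> (real^3) set set" where
  "kstep P K p = (if \<exists>a Z b. p = a # Z @ [b] \<and> ear P (fst K) (snd K) a Z b then (fst K \<union> set p, snd K \<union> les p) else K)"

text \<open>A proposed list that is not an ear at the moment is skipped. With a schedule that
  repeats every list beyond any bound it gets further chances once its ends are present.\<close>

primrec kseq :: "drawing \<Rightarrow> (nat \<Rightarrow> (real^3) list) \<Rightarrow> real^3 \<Rightarrow> real^3 \<Rightarrow> nat \<Rightarrow> (real^3) set \<times> (real^3) set set" where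
  "kseq P s x v 0 = ({x, v}, {{x, v}})"
| "kseq P s x v (Suc j) = kstep P (kseq P s x v j) (s j)"

lemma kstep_mono: "fst K \<subseteq> fst (kstep P K p)" "snd K \<subseteq> snd (kstep P K p)"
  by (auto simp: kstep_def)

lemma kseq_mono: "i \<le> j \<Longrightarrow> fst (kseq P s x v i) \<subseteq> fst (kseq P s x v j) \<and> snd (kseq P s x v i) \<subseteq> snd (kseq P s x v j)"
proof (induction j rule: dec_induct)
  case (step j)
  then show ?case using kstep_mono[of "kseq P s x v j" P "s j"] by auto
qed simp

lemma kstep_ear: "ear P (fst K) (snd K) a Z b \<Longrightarrow> kstep P K (a # Z @ [b]) = (fst K \<union> set Z, snd K \<union> les (a # Z @ [b]))"
  unfolding kstep_def ear_def by auto

lemma kstep_cases: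
  obtains "kstep P K p = K"
  | a Z b where "p = a # Z @ [b]" "ear P (fst K) (snd K) a Z b" "kstep P K p = (fst K \<union> set Z, snd K \<union> les (a # Z @ [b]))"
proof (cases "\<exists>a Z b. p = a # Z @ [b] \<and> ear P (fst K) (snd K) a Z b")
  case True then show ?thesis using kstep_ear that(2) by blast
next
  case False then show ?thesis using that(1) unfolding kstep_def by metis
qed

text \<open>An ear of the limit has both ends at some finite stage and is proposed after it. It is
  then an ear of that stage too and is added, so it is no ear of the limit.\<close>

lemma limit_no_ear:
  assumes s: "\<forall>p\<in>lists (points P). \<forall>m. \<exists>j\<ge>m. s j = p" and pts: "\<And>j. fst (kseq P s x v j) \<subseteq> points P"
  shows "\<not> ear P (\<Union>j. fst (kseq P s x v j)) (\<Union>j. snd (kseq P s x v j)) a Z b"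
proof
  let ?K = "kseq P s x v"
  assume e: "ear P (\<Union>j. fst (?K j)) (\<Union>j. snd (?K j)) a Z b"
  then obtain i j where ij: "a \<in> fst (?K i)" "b \<in> fst (?K j)" by (auto simp: ear_def)
  have "a # Z @ [b] \<in> lists (points P)" using e ij pts by (auto simp: ear_def)
  then obtain m where m: "m \<ge> max i j" "s m = a # Z @ [b]" using s by blast
  have "a \<in> fst (?K m)" "b \<in> fst (?K m)" using ij kseq_mono[of i m P s x v] kseq_mono[of j m P s x v] m(1) by auto
  then have em: "ear P (fst (?K m)) (snd (?K m)) a Z b" using e by (auto simp: ear_def)
  have "?K (Suc m) = (fst (?K m) \<union> set Z, snd (?K m) \<union> les (a # Z @ [b]))" using kstep_ear[OF em] m(2) by simp
  then have 1: "set Z \<subseteq> fst (?K (Suc m))" "les (a # Z @ [b]) \<subseteq> snd (?K (Suc m))" by auto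
  have "set Z \<inter> fst (?K (Suc m)) = {}" using e unfolding ear_def by (meson UN_I UNIV_I disjoint_iff)
  then have "Z = []" using 1(1) by (metis Int_absorb2 set_empty)
  moreover have "{a, b} \<in> snd (?K (Suc m))" using 1(2) \<open>Z = []\<close> by auto
  ultimately show False using e unfolding ear_def by blast
qed

context
  fixes P assumes plane: "plane_graph P"
begin

text \<open>A walk in the component of \<open>v\<close> outside \<open>J\<close> can enter
  \<open>J\<close> only through \<open>x\<close>, because \<open>J\<close> is
  \<open>ear_closed\<close>; and the walk avoids \<open>x\<close>.\<close>

lemma walk_outside:
  assumes cl: "ear_closed P J" and x: "x \<in> J" "padj P x v" and v: "v \<notin> J"
  shows "a \<notin> J \<Longrightarrow> (v, a) \<in> (outside P J)\<^sup>* \<Longrightarrow> successively (padj P) (a # Z) \<Longrightarrow> x \<notin> set Z \<Longrightarrow>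
    \<forall>z\<in>set Z. z \<notin> J \<and> (v, z) \<in> (outside P J)\<^sup>*"
proof (induction Z arbitrary: a)
  case (Cons z Z)
  have az: "padj P a z" using Cons.prems by (cases Z) auto
  have z: "z \<notin> J"
  proof
    assume zJ: "z \<in> J"
    have "x = z" using cl x v zJ Cons.prems(1,2) padj_sym[OF az] unfolding ear_closed_def by blast
    then show False using Cons.prems by simp
  qed
  have vz: "(v, z) \<in> (outside P J)\<^sup>*"
    by (rule rtrancl_into_rtrancl[OF Cons.prems(2)]) (use az z Cons.prems in \<open>auto simp: outside_def\<close>)
  have "\<forall>w\<in>set Z. w \<notin> J \<and> (v, w) \<in> (outside P J)\<^sup>*"
    by (rule Cons.IH[OF z vz]) (use Cons.prems in auto)
  then show ?case using z vz by simp
qed simp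

text \<open>The block that starts with the edge from \<open>x\<close> to \<open>v\<close> meets
  \<open>J\<close> in \<open>x\<close> only. Each ear has an end different from \<open>x\<close>;
  followed from that end, by \<open>walk_outside\<close>, its inner vertices never enter
  \<open>J\<close>.\<close>

lemma kseq_outside:
  assumes cl: "ear_closed P J" and x: "x \<in> J" "padj P x v" and v: "v \<notin> J"
  shows "x \<in> fst (kseq P s x v j) \<and> (\<forall>u\<in>fst (kseq P s x v j) - {x}. u \<notin> J \<and> (v, u) \<in> (outside P J)\<^sup>*)"
proof (induction j)
  case 0
  then show ?case using v by auto
next
  case (Suc j)
  show ?case
  proof (cases rule: kstep_cases[of P "kseq P s x v j" "s j"])
    case 1 then show ?thesis using Suc by simp
  next
    case (2 a Z b)
    note e = 2(2)[unfolded ear_def]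
    have xZ: "x \<notin> set Z" using e Suc by blast
    have "\<forall>z\<in>set Z. z \<notin> J \<and> (v, z) \<in> (outside P J)\<^sup>*"
    proof (cases "a = x")
      case False
      then have a: "a \<notin> J" "(v, a) \<in> (outside P J)\<^sup>*" using Suc e by auto
      have "successively (padj P) (a # Z)" using e successively_take[of "padj P" "a # Z" "[b]"] by simp
      from walk_outside[OF cl x v a this xZ] show ?thesis .
    next
      case True
      then have b: "b \<notin> J" "(v, b) \<in> (outside P J)\<^sup>*" using Suc e by auto
      have "successively (padj P) (rev (a # Z @ [b]))" using e successively_rev_padj by blast
      then have "successively (padj P) (b # rev Z)" using successively_take[of "padj P" "b # rev Z" "[a]"] by simp
      from walk_outside[OF cl x v b this] xZ show ?thesis by simp
    qed
    then show ?thesis using Suc 2(3) by auto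
  qed
qed

lemma kseq_discs:
  assumes "padj P x v"
  shows "discs P {x, v} {{x, v}} {([x, v], S2 - dr P {x, v} {{x, v}})}" "subg P (fst (kseq P s x v j)) (snd (kseq P s x v j))"
proof -
  have "subg P {x, v} {{x, v}}" using assms padj_points[OF plane assms] by (auto simp: subg_def)
  then show "discs P {x, v} {{x, v}} {([x, v], S2 - dr P {x, v} {{x, v}})}"
    unfolding discs_def by (intro conjI disjI2 exI[of _ x] exI[of _ v]) auto
  show "subg P (fst (kseq P s x v j)) (snd (kseq P s x v j))"
  proof (induction j)
    case 0 show ?case using \<open>subg P {x, v} {{x, v}}\<close> by simp
  next
    case (Suc j)
    show ?case
      by (cases rule: kstep_cases[of P "kseq P s x v j" "s j"]) (use Suc subg_ear[OF plane Suc] in auto)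
  qed
qed

text \<open>Two different attachments in \<open>V\<close> of an outside piece would yield an ear of
  \<open>V\<close>. For an attachment in \<open>J\<close> and one in \<open>V - J\<close> the piece
  is joined to \<open>v\<close> outside \<open>J\<close>, so the first attachment is
  \<open>x\<close>, which is again in \<open>V\<close>. An edge inside \<open>J \<union> V\<close>
  that is neither within \<open>J\<close> nor in \<open>E\<close> would be a chord, hence also an
  ear.\<close>

lemma block_closed:
  assumes cl: "ear_closed P J" and x: "x \<in> J" "padj P x v" and v: "v \<notin> J"
    and xV: "x \<in> V" and reach: "\<And>u. u \<in> V - {x} \<Longrightarrow> u \<notin> J \<and> (v, u) \<in> (outside P J)\<^sup>*"
    and ne: "\<And>a Z b. \<not> ear P V E a Z b"
  shows "ear_closed P (J \<union> V)" "\<And>u w. u \<in> J \<union> V \<Longrightarrow> w \<in> J \<union> V \<Longrightarrow> padj P u w \<Longrightarrow> (u \<in> J \<and> w \<in> J) \<or> {u, w} \<in> E"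
proof -
  have VV: "y = z" if a: "y \<in> V" "z \<in> V" "a \<notin> J \<union> V" "padj P y a" "padj P z b" "(a, b) \<in> (outside P (J \<union> V))\<^sup>*" for y z a b
  proof (rule ccontr)
    assume yz: "y \<noteq> z"
    obtain Z where Z: "Z \<noteq> []" "hd Z = a" "last Z = b" "distinct Z" "set Z \<subseteq> points P" "set Z \<inter> (J \<union> V) = {}" "successively (padj P) Z"
      using outside_path[OF plane a(6,3)] padj_points[OF plane a(4)] by blast
    have "successively (padj P) (y # Z @ [z])"
      using Z a padj_sym[OF a(5)] by (auto simp: successively_append_iff successively_Cons)
    then have "ear P V E y Z z" unfolding ear_def using a Z yz by auto
    then show False using ne by blast
  qed
  have JV: "y = x" if a: "y \<in> J" "z \<in> V - J" "a \<notin> J" "b \<notin> J" "padj P y a" "padj P z b" "(a, b) \<in> (outside P J)\<^sup>*" for y z a b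
  proof -
    have z: "(v, z) \<in> (outside P J)\<^sup>*" using reach[of z] x(1) a(2) by blast
    have "(b, z) \<in> outside P J" using a padj_sym[OF a(6)] by (auto simp: outside_def)
    then have "(a, v) \<in> (outside P J)\<^sup>*" using a(7) outside_sym[OF z] by (meson rtrancl.rtrancl_into_rtrancl rtrancl_trans)
    then show ?thesis using cl x v a unfolding ear_closed_def by blast
  qed
  show "ear_closed P (J \<union> V)" unfolding ear_closed_def
  proof (intro ballI allI impI)
    fix y z a b assume h: "y \<in> J \<union> V" "z \<in> J \<union> V" "a \<notin> J \<union> V" "b \<notin> J \<union> V" "padj P y a" "padj P z b" "(a, b) \<in> (outside P (J \<union> V))\<^sup>*"
    have hJ: "(a, b) \<in> (outside P J)\<^sup>*" using outside_mono[OF h(7)] by blast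
    have VV': "y \<in> V \<Longrightarrow> z \<in> V \<Longrightarrow> y = z" using VV h by blast
    consider "y \<in> J" "z \<in> J" | "y \<in> J" "z \<in> V - J" | "y \<in> V - J" "z \<in> J" | "y \<in> V" "z \<in> V" using h by blast
    then show "y = z"
    proof cases
      case 1 then show ?thesis using cl h hJ unfolding ear_closed_def by blast
    next
      case 2 then have "y = x" using JV[OF 2 _ _ h(5,6) hJ] h by blast
      then show ?thesis using VV' xV 2 by blast
    next
      case 3 then have "z = x" using JV[OF 3(2,1) _ _ h(6,5) outside_sym[OF hJ]] h by blast
      then show ?thesis using VV' xV 3 by blast
    qed (use VV' in blast)
  qed
  have x': "u = x" if a: "u \<in> J" "w \<in> V - J" "padj P u w" for u w
  proof -
    have "(v, w) \<in> (outside P J)\<^sup>*" using reach[of w] x(1) a(2) by blast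
    then show ?thesis using cl x v a outside_sym unfolding ear_closed_def by blast
  qed
  show "(u \<in> J \<and> w \<in> J) \<or> {u, w} \<in> E" if a: "u \<in> J \<union> V" "w \<in> J \<union> V" "padj P u w" for u w
  proof (cases "u \<in> J \<and> w \<in> J")
    case False
    then have "u \<in> V" "w \<in> V" using a x'[of u w] x'[of w u] padj_sym[OF a(3)] xV by blast+
    moreover have "u \<noteq> w" using padj_points[OF plane a(3)] by blast
    ultimately show ?thesis using ne[of u "[]" w] a(3) unfolding ear_def by auto
  qed blast
qed

end

section \<open>Branch sets for a plane graph\<close>

definition frozen :: "('v, 'h, 't option) host set \<Rightarrow> ('v, 'h, 't option) host set" where
  "frozen H = {h \<in> H. tag h = None}"

text \<open>The operations keep replacing hosts, so the invariants do not name particular hosts but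
  ask for some host with given labels and tag.\<close>

definition shapes :: "('v, 'h, 't) host set \<Rightarrow> ('h list \<times> 't) set" where
  "shapes H = (\<lambda>h. (lab h, tag h)) ` H"

lemma shapes_insert: "shapes (insert h H) = insert (lab h, tag h) (shapes H)"
  by (simp add: shapes_def)

lemma shapes_frozen: "([z], None) \<in> shapes H \<longleftrightarrow> (\<exists>h\<in>frozen H. lab h = [z])"
  by (force simp: shapes_def frozen_def)

context stellar_faces
begin

text \<open>The spare hosts are split off a working host, one with a tag other than
  \<open>None\<close>, so that all frozen hosts survive unchanged.\<close>

lemma add_spares:
  assumes "board W V B H" "h \<in> H" "tag h \<noteq> None" "set Z \<subseteq> set (lab h)"
  shows "\<exists>B' H'. board W V B' H' \<and> (\<forall>x\<in>V. B x \<subseteq> B' x) \<and> frozen H \<subseteq> frozen H' \<and> shapes H \<subseteq> shapes H' \<and>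
    (\<forall>z\<in>set Z. ([z], None) \<in> shapes H')"
  using assms
proof (induction Z arbitrary: B H h)
  case Nil
  then show ?case by auto
next
  case (Cons z Z)
  define H0 where "H0 = H - {h}"
  have H: "H = insert h H0" "h \<notin> H0" using Cons.prems(2) by (auto simp: H0_def)
  obtain B1 h' h'' where b: "board W V B1 (insert h' (insert h'' H0))" "h' \<notin> insert h'' H0" "h'' \<notin> H0" "lab h' = lab h"
    "tag h' = tag h" "lab h'' = [z]" "tag h'' = None" "\<forall>x\<in>V. B x \<subseteq> B1 x"
    using op_split[OF Cons.prems(1)[unfolded H(1)] H(2), of z None] Cons.prems(4) by auto
  let ?H1 = "insert h' (insert h'' H0)"
  obtain B' H' where b': "board W V B' H'" "\<forall>x\<in>V. B1 x \<subseteq> B' x" "frozen ?H1 \<subseteq> frozen H'" "shapes ?H1 \<subseteq> shapes H'"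
    "\<forall>z\<in>set Z. ([z], None) \<in> shapes H'"
    using Cons.IH[OF b(1), of h'] b(4,5) Cons.prems by auto
  have "frozen H \<subseteq> frozen ?H1" using Cons.prems(3) b(5) by (auto simp: H(1) frozen_def)
  moreover have "shapes H \<subseteq> shapes ?H1" using b(4,5) by (auto simp: H(1) shapes_insert)
  moreover have "([z], None) \<in> shapes ?H1" using b(6,7) by (simp add: shapes_insert)
  ultimately show ?case using b' b(8) by (intro exI[of _ B'] exI[of _ H']) (simp, blast)
qed

definition linked :: "('h \<Rightarrow> 'v set) \<Rightarrow> 'h \<Rightarrow> 'h \<Rightarrow> bool" where
  "linked B u w \<longleftrightarrow> (\<exists>a\<in>B u. \<exists>b\<in>B w. adj a b)"

lemma linked_sym: "linked B u w \<Longrightarrow> linked B w u"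
  unfolding linked_def using adj_sym by blast

lemma linked_mono: "linked B u w \<Longrightarrow> B u \<subseteq> B' u \<Longrightarrow> B w \<subseteq> B' w \<Longrightarrow> linked B' u w"
  unfolding linked_def by blast

text \<open>During the construction of a block, the tag \<open>Some R\<close> marks the host that stands for the disc with
  interior \<open>R\<close>, and \<open>None\<close> marks the spare hosts, which are kept for later blocks.\<close>

definition stage :: "drawing \<Rightarrow> 'v set \<Rightarrow> (real^3) set \<Rightarrow> (real^3) set \<Rightarrow> (real^3) set set \<Rightarrow>
    (real^3 \<Rightarrow> 'v set) \<Rightarrow> ('v, real^3, (real^3) set option) host set \<Rightarrow> bool" where
  "stage P W J V E B H \<longleftrightarrow> board W (J \<union> V) B H \<and>
     (\<exists>\<Delta>. discs P V E \<Delta> \<and> (\<forall>(L, R)\<in>\<Delta>. (L, Some R) \<in> shapes H)) \<and>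
     (\<forall>u w. {u, w} \<in> E \<longrightarrow> linked B u w) \<and> (\<forall>x\<in>V. ([x], None) \<in> shapes H)"

context
  fixes P assumes plane: "plane_graph P"
begin

text \<open>\<open>discs_ear\<close> splits the disc that contains the ear, and
  \<open>op_ear\<close> its host, with identical label lists, so discs and hosts stay matched. Each
  new vertex receives its spare host at once.\<close>

lemma stage_ear:
  assumes st: "stage P W J V E B H" and e: "ear P V E a Z b" and ZJ: "set Z \<inter> J = {}"
  shows "\<exists>B' H'. stage P W J (V \<union> set Z) (E \<union> les (a # Z @ [b])) B' H' \<and> (\<forall>x\<in>J \<union> V. B x \<subseteq> B' x) \<and> frozen H \<subseteq> frozen H'"
proof -
  let ?p = "a # Z @ [b]"
  obtain \<Delta> where bd: "board W (J \<union> V) B H" and D: "discs P V E \<Delta>" "\<forall>(L, R)\<in>\<Delta>. (L, Some R) \<in> shapes H"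
    and lk: "\<And>u w. {u, w} \<in> E \<Longrightarrow> linked B u w" and sp: "\<And>x. x \<in> V \<Longrightarrow> ([x], None) \<in> shapes H"
    using st unfolding stage_def by blast
  have EV: "u \<in> V \<and> w \<in> V" if uwE: "{u, w} \<in> E" for u w
  proof -
    have "\<forall>e\<in>E. \<exists>u\<in>V. \<exists>w\<in>V. e = {u, w} \<and> padj P u w" using D(1) by (simp add: discs_def subg_def)
    from bspec[OF this uwE] obtain u' w' where "u' \<in> V" "w' \<in> V" "{u, w} = {u', w'}" by blast
    then show ?thesis by (auto simp: doubleton_eq_iff)
  qed
  obtain L R r A D R1 R2 where L: "(L, R) \<in> \<Delta>" "rotate r L = a # A @ b # D"
    and D': "discs P (V \<union> set Z) (E \<union> les ?p) (\<Delta> - {(L, R)} \<union> {(a # A @ b # rev Z, R1), (a # rev D @ b # rev Z, R2)})"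
    using discs_ear[OF plane D(1) e] by (elim exE conjE)
  have "(L, Some R) \<in> shapes H" using L(1) D(2) by auto
  then obtain h where h: "h \<in> H" "lab h = L" "tag h = Some R" by (auto simp: shapes_def)
  define H0 where "H0 = H - {h}"
  have H: "H = insert h H0" "h \<notin> H0" using h(1) by (auto simp: H0_def)
  have Z: "distinct Z" "set Z \<inter> (J \<union> V) = {}" using e ZJ by (auto simp: ear_def)
  obtain B1 h1 h2 where b: "board W (J \<union> V \<union> set Z) B1 (insert h1 (insert h2 H0))" 
    "lab h1 = a # A @ b # rev Z" "tag h1 = Some R1" "lab h2 = a # rev D @ b # rev Z" "tag h2 = Some R2" "\<forall>x\<in>J \<union> V. B x \<subseteq> B1 x"
    "\<forall>i\<le>length Z. \<exists>c\<in>B1 (?p ! i). \<exists>d\<in>B1 (?p ! Suc i). adj c d"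
    using op_ear[OF bd[unfolded H(1)] H(2) L(2)[folded h(2)] Z, of "Some R1" "Some R2"] by (elim exE conjE) (rule that)
  let ?H1 = "insert h1 (insert h2 H0)"
  obtain B' H' where b': "board W (J \<union> V \<union> set Z) B' H'" "\<forall>x\<in>J \<union> V \<union> set Z. B1 x \<subseteq> B' x" "frozen ?H1 \<subseteq> frozen H'"
    "shapes ?H1 \<subseteq> shapes H'" "\<forall>z\<in>set Z. ([z], None) \<in> shapes H'"
    using add_spares[OF b(1), of h1 Z] b(2,3) by (auto simp: subset_insertI2)
  have BB: "B x \<subseteq> B' x" if "x \<in> J \<union> V" for x using that b(6) b'(2) by blast
  have fr: "frozen H \<subseteq> frozen H'" using b'(3) h(3) unfolding H(1) by (auto simp: frozen_def)
  have "(L', Some R') \<in> shapes H'" if d: "(L', R') \<in> \<Delta> - {(L, R)} \<union> {(a # A @ b # rev Z, R1), (a # rev D @ b # rev Z, R2)}" for L' R'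
  proof -
    have "(L', Some R') \<in> shapes ?H1"
    proof (cases "(L', R') \<in> \<Delta> - {(L, R)}")
      case True
      then have "(L', Some R') \<in> shapes H" using D(2) by auto
      then show ?thesis using True h(2,3) unfolding H(1) by (auto simp: shapes_insert)
    next
      case False then show ?thesis using d b(2-5) by (auto simp: shapes_insert)
    qed
    then show ?thesis using b'(4) by blast
  qed
  then have sh: "\<exists>\<Delta>. discs P (V \<union> set Z) (E \<union> les ?p) \<Delta> \<and> (\<forall>(L, R)\<in>\<Delta>. (L, Some R) \<in> shapes H')"
    by (intro exI[of _ "\<Delta> - {(L, R)} \<union> {(a # A @ b # rev Z, R1), (a # rev D @ b # rev Z, R2)}"] conjI D') auto
  have lk': "linked B' u w" if uw: "{u, w} \<in> E \<union> les ?p" for u w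
  proof (cases "{u, w} \<in> E")
    case True
    then show ?thesis using linked_mono[OF lk[OF True]] BB EV[OF True] by blast
  next
    case False
    then obtain i where i: "Suc i < length ?p" "{u, w} = {?p ! i, ?p ! Suc i}" using uw unfolding les_conv by auto
    have pin: "set ?p \<subseteq> J \<union> V \<union> set Z" using e by (auto simp: ear_def)
    have in': "?p ! i \<in> J \<union> V \<union> set Z" "?p ! Suc i \<in> J \<union> V \<union> set Z" 
      by (rule subsetD[OF pin nth_mem[OF Suc_lessD[OF i(1)]]], rule subsetD[OF pin nth_mem[OF i(1)]])
    have "i \<le> length Z" using i(1) by simp
    then have "linked B1 (?p ! i) (?p ! Suc i)" using b(7) unfolding linked_def by blast
    then have "linked B' (?p ! i) (?p ! Suc i)" by (rule linked_mono) (use b'(2) in' in blast)+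
    then show ?thesis using i(2) linked_sym by (metis doubleton_eq_iff)
  qed
  have sp': "([x], None) \<in> shapes H'" if "x \<in> V \<union> set Z" for x
    using that sp[of x] fr b'(5) by (auto simp: shapes_frozen)
  have "stage P W J (V \<union> set Z) (E \<union> les ?p) B' H'" unfolding stage_def
    using b'(1) sh lk' sp' by (simp add: Un_assoc)
  then show ?thesis using BB fr by blast
qed

text \<open>The invariant between blocks: every placed vertex has a spare host at which a further
  block can hang, one host without labels is left for further components, and no working host
  remains.\<close>

definition model :: "'v set \<Rightarrow> (real^3) set \<Rightarrow> (real^3 \<Rightarrow> 'v set) \<Rightarrow> ('v, real^3, (real^3) set option) host set \<Rightarrow> bool" where
  "model W V B H \<longleftrightarrow> board W V B H \<and> frozen H = H \<and> (\<forall>x\<in>V. ([x], None) \<in> shapes H) \<and> ([], None) \<in> shapes H \<and>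
     V \<subseteq> points P \<and> ear_closed P V \<and> (\<forall>u\<in>V. \<forall>w\<in>V. padj P u w \<longrightarrow> linked B u w)"

lemma model_block:
  assumes m: "model W J B H" and x: "x \<in> J" "padj P x v" and v: "v \<notin> J" and ct: "countable (points P)"
  shows "\<exists>V' B' H'. model W V' B' H' \<and> J \<subseteq> V' \<and> v \<in> V' \<and> (\<forall>x\<in>J. B x \<subseteq> B' x)"
proof -
  have bd: "board W J B H" and fH: "frozen H = H" and sp: "\<And>x. x \<in> J \<Longrightarrow> ([x], None) \<in> shapes H" and fr: "([], None) \<in> shapes H"
    and JP: "J \<subseteq> points P" and cl: "ear_closed P J" and lk: "\<And>u w. u \<in> J \<Longrightarrow> w \<in> J \<Longrightarrow> padj P u w \<Longrightarrow> linked B u w"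
    using m by (simp_all add: model_def)
  have vP: "v \<in> points P" using padj_points[OF plane x(2)] by blast
  have "countable (lists (points P))" "lists (points P) \<noteq> {}" using ct by (auto intro: countable_lists)
  from schedule[OF this] obtain s :: "nat \<Rightarrow> (real^3) list" where s: "\<forall>p\<in>lists (points P). \<forall>m. \<exists>j\<ge>m. s j = p" by blast
  let ?K = "kseq P s x v"
  define Vk where "Vk j = fst (?K j)" for j
  define Ek where "Ek j = snd (?K j)" for j
  have out: "x \<in> Vk j" "\<And>u. u \<in> Vk j - {x} \<Longrightarrow> u \<notin> J \<and> (v, u) \<in> (outside P J)\<^sup>*" for j
    using kseq_outside[OF plane cl x v, of s j] unfolding Vk_def by blast+
  have sub: "subg P (Vk j) (Ek j)" for j using kseq_discs(2)[OF plane x(2)] by (simp add: Vk_def Ek_def)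
  have Vmono: "Vk j \<subseteq> Vk (Suc j)" "Ek j \<subseteq> Ek (Suc j)" for j using kseq_mono[of j "Suc j" P s x v] by (auto simp: Vk_def Ek_def)
  obtain h where h: "h \<in> H" "lab h = [x]" "tag h = None" using sp[OF x(1)] by (auto simp: shapes_def)
  define H0 where "H0 = H - {h}"
  have H: "H = insert h H0" "h \<notin> H0" using h(1) by (auto simp: H0_def)
  obtain B1 h1 h2 where b1: "board W J B1 (insert h1 (insert h2 H0))" "h1 \<notin> insert h2 H0" "lab h1 = [x]" "lab h2 = [x]" "tag h2 = None"
      "\<forall>x\<in>J. B x \<subseteq> B1 x"
    using op_split[OF bd[unfolded H(1)] H(2), of x None] h(2) by auto
  define R0 where "R0 = S2 - dr P {x, v} {{x, v}}"
  obtain B2 h3 where b2: "board W (insert v J) B2 (insert h3 (insert h2 H0))" "lab h3 = [x, v]" "tag h3 = Some R0" "\<forall>x\<in>J. B1 x \<subseteq> B2 x"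
      "\<exists>a\<in>B2 x. \<exists>b\<in>B2 v. adj a b"
    using op_pendant[OF b1(1,2,3) v, of "Some R0"] by (elim exE conjE) (rule that)
  let ?H2 = "insert h3 (insert h2 H0)"
  obtain B3 H3 where b3: "board W (insert v J) B3 H3" "\<forall>x\<in>insert v J. B2 x \<subseteq> B3 x" "frozen ?H2 \<subseteq> frozen H3" "shapes ?H2 \<subseteq> shapes H3"
      "([v], None) \<in> shapes H3"
    using add_spares[OF b2(1), of h3 "[v]"] b2(2,3) by auto
  have xv: "J \<union> {x, v} = insert v J" using x by auto
  have B3: "B x \<subseteq> B3 x" if "x \<in> J" for x using that b1(6) b2(4) b3(2) by blast
  have sh3: "shapes H \<subseteq> shapes H3" using b3(4) b1(4,5) h(2,3) unfolding H(1) by (auto simp: shapes_insert)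
  have "linked B2 x v" using b2(5) by (auto simp: linked_def)
  then have l3: "linked B3 x v" by (rule linked_mono) (use b3(2) x(1) in auto)
  have st0: "stage P W J (Vk 0) (Ek 0) B3 H3" unfolding stage_def Vk_def Ek_def
  proof (intro conjI exI[of _ "{([x, v], R0)}"] allI impI ballI)
    show "board W (J \<union> fst (?K 0)) B3 H3" using b3(1) xv by simp
    show "discs P (fst (?K 0)) (snd (?K 0)) {([x, v], R0)}" using kseq_discs(1)[OF plane x(2)] by (simp add: R0_def)
    show "case d of (L, R) \<Rightarrow> (L, Some R) \<in> shapes H3" if "d \<in> {([x, v], R0)}" for d
      using that b3(4) b2(2,3) by (auto simp: shapes_insert)
    show "linked B3 u w" if "{u, w} \<in> snd (?K 0)" for u w
      using that l3 linked_sym[OF l3] by (auto simp: doubleton_eq_iff)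
    show "([y], None) \<in> shapes H3" if "y \<in> fst (?K 0)" for y
      using that sp[OF x(1)] sh3 b3(5) by auto
  qed
  have step: "\<exists>s'. stage P W J (Vk (Suc j)) (Ek (Suc j)) (fst s') (snd s') \<and> (\<forall>x\<in>J \<union> Vk j. fst st x \<subseteq> fst s' x) \<and> frozen (snd st) \<subseteq> frozen (snd s')"
    if st: "stage P W J (Vk j) (Ek j) (fst st) (snd st)" for st j
  proof (cases rule: kstep_cases[of P "?K j" "s j"])
    case 1
    then have "Vk (Suc j) = Vk j" "Ek (Suc j) = Ek j" by (simp_all add: Vk_def Ek_def)
    then show ?thesis using st by (intro exI[of _ st]) simp
  next
    case (2 a Z b)
    have e: "ear P (Vk j) (Ek j) a Z b" using 2(2) by (simp add: Vk_def Ek_def)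
    have K: "Vk (Suc j) = Vk j \<union> set Z" "Ek (Suc j) = Ek j \<union> les (a # Z @ [b])" using 2(3) by (simp_all add: Vk_def Ek_def)
    have "set Z \<inter> {x} = {}" using e out(1)[of j] unfolding ear_def by blast
    then have "set Z \<inter> J = {}" using out(2)[of _ "Suc j"] K(1) by blast
    from stage_ear[OF st e this] show ?thesis unfolding K by auto
  qed
  \<comment> \<open>The boards are chosen along the sequence of subgraphs, which is fixed in
    advance. The clause for \<open>j = 0\<close> pins the first board, so that the limit contains
    the branch sets of \<open>B\<close>.\<close>
  have "\<exists>f. \<forall>j. (stage P W J (Vk j) (Ek j) (fst (f j)) (snd (f j)) \<and> (j = 0 \<longrightarrow> f j = (B3, H3))) \<and>
      (\<forall>x\<in>J \<union> Vk j. fst (f j) x \<subseteq> fst (f (Suc j)) x) \<and> frozen (snd (f j)) \<subseteq> frozen (snd (f (Suc j)))"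
  proof (rule dependent_nat_choice[of "\<lambda>j st. stage P W J (Vk j) (Ek j) (fst st) (snd st) \<and> (j = 0 \<longrightarrow> st = (B3, H3))"
      "\<lambda>j st st'. (\<forall>x\<in>J \<union> Vk j. fst st x \<subseteq> fst st' x) \<and> frozen (snd st) \<subseteq> frozen (snd st')"])
    show "\<exists>st. stage P W J (Vk 0) (Ek 0) (fst st) (snd st) \<and> (0 = (0::nat) \<longrightarrow> st = (B3, H3))" using st0 by auto
    fix st j assume "stage P W J (Vk j) (Ek j) (fst st) (snd st) \<and> (j = 0 \<longrightarrow> st = (B3, H3))"
    then show "\<exists>st'. (stage P W J (Vk (Suc j)) (Ek (Suc j)) (fst st') (snd st') \<and> (Suc j = 0 \<longrightarrow> st' = (B3, H3))) \<and>
      (\<forall>x\<in>J \<union> Vk j. fst st x \<subseteq> fst st' x) \<and> frozen (snd st) \<subseteq> frozen (snd st')" using step[of j st] by simp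
  qed
  then obtain f where f0: "\<And>j. stage P W J (Vk j) (Ek j) (fst (f j)) (snd (f j)) \<and> (j = 0 \<longrightarrow> f j = (B3, H3))"
    and f1: "\<And>j. (\<forall>x\<in>J \<union> Vk j. fst (f j) x \<subseteq> fst (f (Suc j)) x) \<and> frozen (snd (f j)) \<subseteq> frozen (snd (f (Suc j)))"
    by metis
  define Bk where "Bk j = fst (f j)" for j
  define Hk where "Hk j = snd (f j)" for j
  define B' where "B' x = (\<Union>j\<in>{j. x \<in> J \<union> Vk j}. Bk j x)" for x
  define V' where "V' = (\<Union>j. Vk j)"
  define H' where "H' = (\<Union>j. frozen (Hk j))"
  have st: "stage P W J (Vk j) (Ek j) (Bk j) (Hk j)" for j using f0 by (simp add: Bk_def Hk_def)
  have b0: "Bk 0 = B3" "Hk 0 = H3" using f0[of 0] by (simp_all add: Bk_def Hk_def)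
  have bdj: "board W (J \<union> Vk j) (Bk j) (Hk j)" for j using st by (simp add: stage_def)
  have mono: "J \<union> Vk j \<subseteq> J \<union> Vk (Suc j)" "\<And>x. x \<in> J \<union> Vk j \<Longrightarrow> Bk j x \<subseteq> Bk (Suc j) x"
     "frozen (Hk j) \<subseteq> Hk j" "frozen (Hk j) \<subseteq> frozen (Hk (Suc j))" for j
    using Vmono[of j] f1[of j] by (auto simp: Bk_def Hk_def frozen_def)
  note lim = board_limit[of W "\<lambda>j. J \<union> Vk j" Bk Hk "\<lambda>j. frozen (Hk j)", OF bdj mono, folded B'_def]
  have JV: "(\<Union>j. J \<union> Vk j) = J \<union> V'" by (auto simp: V'_def)
  have bd': "board W (J \<union> V') B' H'" using lim(1) unfolding JV H'_def B'_def by (simp cong: image_cong)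
  have Bj: "Bk j x \<subseteq> B' x" if "x \<in> J \<union> Vk j" for j x unfolding B'_def using that by blast
  have fr': "frozen H' = H'" by (auto simp: H'_def frozen_def)
  have spx: "([y], None) \<in> shapes H'" if "y \<in> Vk j" for y j
  proof -
    have "([y], None) \<in> shapes (Hk j)" using that st[of j] by (simp add: stage_def)
    then obtain g where "g \<in> frozen (Hk j)" "lab g = [y]" by (auto simp: shapes_frozen)
    then show ?thesis unfolding shapes_frozen fr' by (auto simp: H'_def)
  qed
  have s3: "(l, None) \<in> shapes H'" if l: "(l, None) \<in> shapes H" for l
  proof -
    have "(l, None) \<in> shapes H3" using l sh3 by blast
    then obtain g where "g \<in> frozen (Hk 0)" "lab g = l" "tag g = None" unfolding b0 by (auto simp: shapes_def frozen_def)
    then show ?thesis unfolding H'_def shapes_def by force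
  qed
  have ne: "\<not> ear P V' (\<Union>j. Ek j) a Z b" for a Z b
    unfolding V'_def Vk_def Ek_def by (rule limit_no_ear[OF s]) (use sub in \<open>auto simp: subg_def Vk_def\<close>)
  have xV: "x \<in> V'" "v \<in> V'" using out(1)[of 0] by (auto simp: V'_def Vk_def intro!: exI[of _ 0])
  have reach: "u \<notin> J \<and> (v, u) \<in> (outside P J)\<^sup>*" if "u \<in> V' - {x}" for u using that out(2) by (auto simp: V'_def)
  have bc1: "ear_closed P (J \<union> V')" by (rule block_closed(1)[OF plane cl x v xV(1) reach ne])
  have bc2: "(u \<in> J \<and> w \<in> J) \<or> {u, w} \<in> (\<Union>j. Ek j)" if a: "u \<in> J \<union> V'" "w \<in> J \<union> V'" "padj P u w" for u w
    by (rule block_closed(2)[OF plane cl x v xV(1) reach ne a])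
  have lk': "linked B' u w" if uw: "u \<in> J \<union> V'" "w \<in> J \<union> V'" "padj P u w" for u w
  proof (cases "u \<in> J \<and> w \<in> J")
    case True
    have "linked B u w" using True lk uw(3) by blast
    then show ?thesis by (rule linked_mono) (use True B3 Bj[of _ 0] b0 in blast)+
  next
    case False
    then obtain j where j: "{u, w} \<in> Ek j" using bc2[OF uw] by blast
    then have l: "linked (Bk j) u w" using st[of j] by (simp add: stage_def)
    have "u \<in> Vk j" "w \<in> Vk j" using sub[of j] j unfolding subg_def by (metis doubleton_eq_iff)+
    then show ?thesis using linked_mono[OF l] Bj by blast
  qed
  have "V' \<subseteq> points P" using sub by (auto simp: V'_def subg_def)
  then have "model W (J \<union> V') B' H'" unfolding model_def using bd' fr' spx s3 sp fr JP bc1 lk' by (auto simp: V'_def)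
  moreover have "\<forall>x\<in>J. B x \<subseteq> B' x" using B3 Bj[of _ 0] b0 by blast
  ultimately show ?thesis using xV by blast
qed

text \<open>A vertex in a component not yet touched goes into one half of the label-free host.
  Nothing is connected to both \<open>v\<close> and \<open>J\<close>, so \<open>ear_closed\<close>
  persists.\<close>

lemma model_start:
  assumes m: "model W J B H" and vP: "v \<in> points P" and v: "\<And>x. x \<in> J \<Longrightarrow> (x, v) \<notin> {(u, w). padj P u w}\<^sup>*"
  shows "\<exists>V' B' H'. model W V' B' H' \<and> J \<subseteq> V' \<and> v \<in> V' \<and> (\<forall>x\<in>J. B x \<subseteq> B' x)"
proof -
  have bd: "board W J B H" and fH: "frozen H = H" and sp: "\<And>x. x \<in> J \<Longrightarrow> ([x], None) \<in> shapes H" and fr: "([], None) \<in> shapes H"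
    and JP: "J \<subseteq> points P" and cl: "ear_closed P J" and lk: "\<And>u w. u \<in> J \<Longrightarrow> w \<in> J \<Longrightarrow> padj P u w \<Longrightarrow> linked B u w"
    using m by (simp_all add: model_def)
  have vJ: "v \<notin> J" using v by blast
  obtain h where h: "h \<in> H" "lab h = []" "tag h = None" using fr by (auto simp: shapes_def)
  define H0 where "H0 = H - {h}"
  have H: "H = insert h H0" "h \<notin> H0" using h(1) by (auto simp: H0_def)
  obtain h1 h2 where b1: "board W J B (insert h1 (insert h2 H0))" "h1 \<notin> insert h2 H0" "lab h1 = []" "lab h2 = []" "tag h2 = None"
    using op_split_free[OF bd[unfolded H(1)] H(2) h(2), of None] by auto
  obtain B2 h3 where b2: "board W (insert v J) B2 (insert h3 (insert h2 H0))" "lab h3 = [v]" "tag h3 = None" "\<forall>x\<in>J. B x \<subseteq> B2 x"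
    using op_start[OF b1(1,2,3) vJ, of None] by (elim exE conjE) (rule that)
  let ?H2 = "insert h3 (insert h2 H0)"
  let ?A = "{(u, w). padj P u w}"
  have "H0 \<subseteq> frozen H" using fH by (auto simp: H0_def)
  then have 1: "frozen ?H2 = ?H2" using b2(3) b1(5) by (auto simp: frozen_def)
  have 2: "insert ([v], None) (shapes H) \<subseteq> shapes ?H2" using h b1(4,5) b2(2,3) unfolding H(1) by (auto simp: shapes_insert)
  have symA: "(a, b) \<in> ?A\<^sup>* \<Longrightarrow> (b, a) \<in> ?A\<^sup>*" for a b
    using sym_rtrancl[of ?A] padj_sym[of P] by (auto simp: sym_def)
  have out: "(a, b) \<in> (outside P (insert v J))\<^sup>* \<Longrightarrow> (a, b) \<in> ?A\<^sup>*" for a b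
    by (rule rev_subsetD, assumption, rule rtrancl_mono) (auto simp: outside_def)
  have 3: "ear_closed P (insert v J)" unfolding ear_closed_def
  proof (intro ballI allI impI)
    fix y z a b assume g: "y \<in> insert v J" "z \<in> insert v J" "a \<notin> insert v J" "b \<notin> insert v J" "padj P y a" "padj P z b" "(a, b) \<in> (outside P (insert v J))\<^sup>*"
    have "(y, a) \<in> ?A" "(b, z) \<in> ?A" using g(5) padj_sym[OF g(6)] by auto
    then have gA: "(y, z) \<in> ?A\<^sup>*" using out[OF g(7)] by (meson converse_rtrancl_into_rtrancl rtrancl.rtrancl_into_rtrancl)
    show "y = z"
    proof (cases "y \<in> J \<and> z \<in> J")
      case True
      have "(a, b) \<in> (outside P J)\<^sup>*" using outside_mono[OF g(7)] by blast
      then show ?thesis using cl True g unfolding ear_closed_def by blast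
    next
      case False
      then show ?thesis using g(1,2) gA symA[OF gA] v by blast
    qed
  qed
  have nv: "\<not> padj P u v" "\<not> padj P v u" if "u \<in> J" for u
    using v[OF that] padj_sym[of P v u] by blast+
  have 4: "linked B2 u w" if uw: "u \<in> insert v J" "w \<in> insert v J" "padj P u w" for u w
  proof -
    have uwJ: "u \<in> J" "w \<in> J" using uw nv padj_points[OF plane uw(3)] by auto
    show ?thesis by (rule linked_mono[OF lk[OF uwJ uw(3)]]) (use uwJ b2(4) in auto)
  qed
  have "model W (insert v J) B2 ?H2" unfolding model_def using b2(1) 1 2 3 4 sp fr JP vP by auto
  then show ?thesis using b2(4) by blast
qed

text \<open>Blocks are added by a second schedule, over single vertices. Every vertex keeps coming
  back, so a touched component is exhausted along its paths, and no component stays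
  untouched.\<close>

theorem branch_sets:
  assumes ct: "countable (points P)" and C: "face 0 C I" "I \<subseteq> W"
  shows "\<exists>B. (\<forall>x\<in>points P. conn adj (B x) \<and> B x \<subseteq> W) \<and> (\<forall>x\<in>points P. \<forall>y\<in>points P. x \<noteq> y \<longrightarrow> B x \<inter> B y = {}) \<and>
    (\<forall>u w. padj P u w \<longrightarrow> (\<exists>a\<in>B u. \<exists>b\<in>B w. adj a b))"
proof (cases "points P = {}")
  case True
  then have "\<not> padj P u w" for u w using padj_points[OF plane] by blast
  then show ?thesis using True by simp
next
  case False
  let ?A = "{(u, w). padj P u w}"
  obtain s :: "nat \<Rightarrow> real^3" where s: "\<And>j. s j \<in> points P" "\<And>v m. v \<in> points P \<Longrightarrow> \<exists>j\<ge>m. s j = v"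
    using schedule[OF ct False] by (elim exE conjE) blast
  define M where "M st \<longleftrightarrow> model W (fst st) (fst (snd st)) (snd (snd st))"
    for st :: "(real^3) set \<times> (real^3 \<Rightarrow> 'v set) \<times> ('v, real^3, (real^3) set option) host set"
  \<comment> \<open>A vertex not yet placed that has no placed neighbour although its component is
    touched is deferred to a later turn.\<close>
  define Q where "Q j st st' \<longleftrightarrow> fst st \<subseteq> fst st' \<and> (\<forall>x\<in>fst st. fst (snd st) x \<subseteq> fst (snd st') x) \<and>
    ((\<exists>x\<in>fst st. padj P x (s j)) \<or> (\<forall>x\<in>fst st. (x, s j) \<notin> ?A\<^sup>*) \<longrightarrow> s j \<in> fst st')"
    for j and st st' :: "(real^3) set \<times> (real^3 \<Rightarrow> 'v set) \<times> ('v, real^3, (real^3) set option) host set"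
  have M0: "M ({}, \<lambda>x. {}, {Host 0 C I [] None})"
    unfolding M_def model_def board_def hosting_def using C by (auto simp: frozen_def shapes_def ear_closed_def)
  have step: "\<exists>st'. M st' \<and> Q j st st'" if M: "M st" for st j
  proof -
    obtain V B H where st: "st = (V, B, H)" by (cases st)
    have m: "model W V B H" using M by (simp add: M_def st)
    have "\<exists>V' B' H'. model W V' B' H' \<and> V \<subseteq> V' \<and> (\<forall>x\<in>V. B x \<subseteq> B' x) \<and>
      ((\<exists>x\<in>V. padj P x (s j)) \<or> (\<forall>x\<in>V. (x, s j) \<notin> ?A\<^sup>*) \<longrightarrow> s j \<in> V')"
    proof (cases "s j \<in> V")
      case True then show ?thesis using m by blast
    next
      case False
      show ?thesis
      proof (cases "\<exists>x\<in>V. padj P x (s j)")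
        case True
        then obtain x where "x \<in> V" "padj P x (s j)" by blast
        from model_block[OF m this False ct] show ?thesis by blast
      next
        case nb: False
        show ?thesis
        proof (cases "\<forall>x\<in>V. (x, s j) \<notin> ?A\<^sup>*")
          case True
          from model_start[OF m s(1)[of j]] True show ?thesis by blast
        next
          case False then show ?thesis using m nb by blast
        qed
      qed
    qed
    then obtain V' B' H' where "model W V' B' H'" "V \<subseteq> V'" "\<forall>x\<in>V. B x \<subseteq> B' x"
      "(\<exists>x\<in>V. padj P x (s j)) \<or> (\<forall>x\<in>V. (x, s j) \<notin> ?A\<^sup>*) \<longrightarrow> s j \<in> V'" by (elim exE conjE)
    then show ?thesis unfolding M_def Q_def st by (intro exI[of _ "(V', B', H')"]) simp
  qed
  obtain f where f: "\<And>j. M (f j)" "\<And>j. Q j (f j) (f (Suc j))"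
    using dependent_nat_choice[of "\<lambda>j. M" Q] M0 step by blast
  define V where "V j = fst (f j)" for j
  define B where "B j = fst (snd (f j))" for j
  define H where "H j = snd (snd (f j))" for j
  define B' where "B' x = (\<Union>j\<in>{j. x \<in> V j}. B j x)" for x
  have m: "model W (V j) (B j) (H j)" for j using f(1)[of j] by (simp add: M_def V_def B_def H_def)
  have mono: "V j \<subseteq> V (Suc j)" "\<And>x. x \<in> V j \<Longrightarrow> B j x \<subseteq> B (Suc j) x" for j using f(2)[of j] by (auto simp: Q_def V_def B_def)
  have bd: "board W (V j) (B j) (H j)" for j using m by (simp add: model_def)
  have Vm: "i \<le> j \<Longrightarrow> V i \<subseteq> V j" for i j using lift_Suc_mono_le[of V] mono(1) by blast
  \<comment> \<open>Nothing remains to be placed after the outer limit, so the family of kept hosts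
    is empty.\<close>
  have bd': "board W (\<Union>j. V j) B' (\<Union>j::nat. {} :: ('v, real^3, (real^3) set option) host set)"
    using board_limit(1)[of W V B H "\<lambda>j. {}", OF bd mono] unfolding B'_def by (simp cong: image_cong)
  have Bj: "x \<in> V j \<Longrightarrow> B j x \<subseteq> B' x" for x j by (auto simp: B'_def)
  have nb: "w \<in> (\<Union>j. V j)" if a: "x \<in> (\<Union>j. V j)" "padj P x w" for x w
  proof -
    obtain i where "x \<in> V i" using a by blast
    moreover obtain j where j: "j \<ge> i" "s j = w" using s(2)[of w i] padj_points[OF plane a(2)] by blast
    ultimately have "x \<in> V j" using Vm[of i j] by blast
    then have "w \<in> V (Suc j)" using f(2)[of j] a(2) j(2) by (auto simp: Q_def V_def)
    then show ?thesis by blast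
  qed
  have reach: "w \<in> (\<Union>j. V j)" if "(x, w) \<in> ?A\<^sup>*" "x \<in> (\<Union>j. V j)" for x w
    using that by (induction rule: rtrancl_induct) (use nb in auto)
  have all: "v \<in> (\<Union>j. V j)" if v: "v \<in> points P" for v
  proof -
    obtain j where j: "s j = v" using s(2)[OF v, of 0] by blast
    show ?thesis
    proof (cases "\<forall>x\<in>V j. (x, v) \<notin> ?A\<^sup>*")
      case True then have "v \<in> V (Suc j)" using f(2)[of j] j by (auto simp: Q_def V_def)
      then show ?thesis by blast
    next
      case False then show ?thesis using reach by blast
    qed
  qed
  have "V j \<subseteq> points P" for j using m[of j] by (simp add: model_def)
  then have PV: "(\<Union>j. V j) = points P" using all by blast
  have "\<exists>a\<in>B' u. \<exists>b\<in>B' w. adj a b" if uw: "padj P u w" for u w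
  proof -
    have "u \<in> points P" "w \<in> points P" using padj_points[OF plane uw] by auto
    then obtain i j where "u \<in> V i" "w \<in> V j" using PV by blast
    then have k: "u \<in> V (max i j)" "w \<in> V (max i j)" using Vm[of i "max i j"] Vm[of j "max i j"] by auto
    then have "linked (B (max i j)) u w" using m[of "max i j"] uw unfolding model_def by blast
    then have "linked B' u w" by (rule linked_mono) (use Bj k in auto)
    then show ?thesis by (simp add: linked_def)
  qed
  moreover have "\<forall>x\<in>points P. conn adj (B' x) \<and> B' x \<subseteq> W" using board_branch[OF bd'] unfolding PV by blast
  moreover have "\<forall>x\<in>points P. \<forall>y\<in>points P. x \<noteq> y \<longrightarrow> B' x \<inter> B' y = {}" using board_branch_disj[OF bd'] unfolding PV by blast
  ultimately show ?thesis by blast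
qed

end

end

section \<open>Existence of a stellar sequence\<close>

text \<open>For independent unit vectors this is the great-circle arc between them that is shorter
  than a half circle, written as the trace of a cone on the sphere; \<open>gs_coords\<close> turns
  it into linear conditions.\<close>

definition gs :: "real^3 \<Rightarrow> real^3 \<Rightarrow> (real^3) set" where
  "gs u v = {x \<in> S2. \<exists>a b. 0 \<le> a \<and> 0 \<le> b \<and> x = a *\<^sub>R u + b *\<^sub>R v}"

text \<open>The chord from \<open>u\<close> to \<open>v\<close>, projected from the origin to the
  sphere.\<close>

definition geo :: "real^3 \<Rightarrow> real^3 \<Rightarrow> real \<Rightarrow> real^3" where
  "geo u v t = sgn ((1 - t) *\<^sub>R u + t *\<^sub>R v)"

lemma gs_sym: "gs u v = gs v u"
  unfolding gs_def by (intro Collect_cong conj_cong refl) (metis add.commute)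

lemma sgn_S2: "x \<in> S2 \<Longrightarrow> sgn x = (x :: real^3)"
  by (simp add: sgn_div_norm)

lemma S2_sgn: "x \<noteq> 0 \<Longrightarrow> sgn x \<in> (S2 :: (real^3) set)"
  by (simp add: norm_sgn)

lemma sgn_eq_pos: "x = r *\<^sub>R y \<Longrightarrow> 0 < r \<Longrightarrow> sgn x = sgn (y :: real^3)"
  by (simp add: sgn_scaleR)

lemma cross_comb: "cross3 (a *\<^sub>R u + b *\<^sub>R v) (c *\<^sub>R u + d *\<^sub>R v) = (a * d - b * c) *\<^sub>R cross3 u v"
  by (simp add: cross_add_left cross_add_right cross_mult_left cross_mult_right cross_skew[of v u] algebra_simps)

lemma comb_eqD:
  assumes "cross3 u v \<noteq> 0" "a *\<^sub>R u + b *\<^sub>R v = c *\<^sub>R u + d *\<^sub>R v"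
  shows "a = c" "b = d"
proof -
  have 1: "(a - c) *\<^sub>R u + (b - d) *\<^sub>R v = 0" using assms(2) by (simp add: algebra_simps)
  have "cross3 ((a - c) *\<^sub>R u + (b - d) *\<^sub>R v) (0 *\<^sub>R u + 1 *\<^sub>R v) = (a - c) *\<^sub>R cross3 u v" by (subst cross_comb) simp
  then show "a = c" using assms(1) 1 by simp
  have "cross3 ((a - c) *\<^sub>R u + (b - d) *\<^sub>R v) (1 *\<^sub>R u + 0 *\<^sub>R v) = (- (b - d)) *\<^sub>R cross3 u v" by (subst cross_comb) simp
  then show "b = d" using assms(1) 1 by simp
qed

lemma cross_unit_zero:
  assumes "u \<in> S2" "v \<in> S2" "cross3 u v = 0"
  shows "u = v \<or> u = - v"
proof -
  have n: "norm u = 1" "norm v = 1" using assms by auto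
  have "(u \<bullet> v)\<^sup>2 = 1" using norm_cross[of u v] assms(3) n by simp
  then have "u \<bullet> v = 1 \<or> u \<bullet> v = -1" by (simp add: power2_eq_1_iff)
  moreover have "(norm (u - v))\<^sup>2 = 2 - 2 * (u \<bullet> v)" "(norm (u + v))\<^sup>2 = 2 + 2 * (u \<bullet> v)"
    using n by (simp_all add: power2_norm_eq_inner inner_diff inner_add inner_commute norm_eq_1)
  ultimately have "norm (u - v) = 0 \<or> norm (u + v) = 0" by auto
  then show ?thesis by (auto simp: eq_neg_iff_add_eq_0)
qed

lemma geo_nz: "cross3 u v \<noteq> 0 \<Longrightarrow> (1 - t) *\<^sub>R u + t *\<^sub>R v \<noteq> 0"
  using comb_eqD[of u v "1 - t" t 0 0] by auto

lemma geo_ends: "u \<in> S2 \<Longrightarrow> geo u v 0 = u" "v \<in> S2 \<Longrightarrow> geo u v 1 = v"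
  by (simp_all add: geo_def sgn_S2)

lemma norm_scaleR_sgn: "x = norm x *\<^sub>R sgn (x :: real^3)"
  by (cases "x = 0") (simp_all add: sgn_div_norm)

lemma geo_scale: "(1 - t) *\<^sub>R u + t *\<^sub>R v = norm ((1 - t) *\<^sub>R u + t *\<^sub>R v) *\<^sub>R geo u v t"
  unfolding geo_def by (rule norm_scaleR_sgn)

lemma geo_arc:
  assumes "u \<in> S2" "v \<in> S2" "cross3 u v \<noteq> 0"
  shows "arc (geo u v)" "pathstart (geo u v) = u" "pathfinish (geo u v) = v"
proof -
  have "continuous_on {0..1} (geo u v)" unfolding geo_def
    by (intro continuous_on_sgn continuous_intros) (use geo_nz[OF assms(3)] in blast)
  moreover have "inj_on (geo u v) {0..1}"
  proof (rule inj_onI)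
    fix s t :: real assume "geo u v s = geo u v t"
    let ?p = "\<lambda>t. (1 - t) *\<^sub>R u + t *\<^sub>R v"
    \<comment> \<open>Two chord points with the same projection differ by a factor \<open>l\<close>.
      Their coefficients sum to 1, so comparing them gives \<open>l = 1\<close>.\<close>
    define l where "l = norm (?p s) / norm (?p t)"
    have t: "norm (?p t) \<noteq> 0" using geo_nz[OF assms(3)] by simp
    have "?p s = norm (?p s) *\<^sub>R geo u v t" using geo_scale \<open>geo u v s = geo u v t\<close> by metis
    also have "\<dots> = l *\<^sub>R (norm (?p t) *\<^sub>R geo u v t)" using t by (simp add: l_def)
    also have "\<dots> = l *\<^sub>R ?p t" using geo_scale by metis
    finally have "(1 - s) *\<^sub>R u + s *\<^sub>R v = (l * (1 - t)) *\<^sub>R u + (l * t) *\<^sub>R v" by (simp add: scaleR_add_right)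
    from comb_eqD[OF assms(3) this] have l: "1 - s = l * (1 - t)" "s = l * t" .
    then have "l = 1" by (simp add: algebra_simps)
    then show "s = t" using l(2) by simp
  qed
  ultimately show "arc (geo u v)" by (simp add: arc_def path_def)
  show "pathstart (geo u v) = u" "pathfinish (geo u v) = v" using geo_ends assms by (simp_all add: pathstart_def pathfinish_def)
qed

lemma geo_cross:
  assumes "cross3 u v \<noteq> 0" "s \<noteq> t"
  shows "cross3 (geo u v s) (geo u v t) \<noteq> 0"
proof -
  let ?p = "\<lambda>t. (1 - t) *\<^sub>R u + t *\<^sub>R v"
  have "cross3 (?p s) (?p t) = (t - s) *\<^sub>R cross3 u v" unfolding cross_comb by (simp add: algebra_simps)
  then have "cross3 (?p s) (?p t) \<noteq> 0" using assms by simp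
  moreover have "cross3 (?p s) (?p t) = (norm (?p s) * norm (?p t)) *\<^sub>R cross3 (geo u v s) (geo u v t)"
    using arg_cong2[where f = cross3, OF geo_scale[of s u v] geo_scale[of t u v]] by (simp only: cross_mult_left cross_mult_right scaleR_scaleR mult.commute)
  ultimately show ?thesis by auto
qed

text \<open>A part of a projected chord is again a great-circle arc, so subdividing an edge keeps
  all edges of the form \<open>gs\<close>.\<close>

lemma geo_image:
  assumes uv: "cross3 u v \<noteq> 0" and st: "s < t"
  shows "geo u v ` {s..t} = gs (geo u v s) (geo u v t)"
proof
  let ?p = "\<lambda>t. (1 - t) *\<^sub>R u + t *\<^sub>R v"
  show "geo u v ` {s..t} \<subseteq> gs (geo u v s) (geo u v t)"
  proof
    fix x assume "x \<in> geo u v ` {s..t}"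
    then obtain r where r: "s \<le> r" "r \<le> t" "x = geo u v r" by auto
    define a where "a = (t - r) / (t - s)"
    have "a * (t - s) = t - r" using st by (simp add: a_def)
    moreover have "a * s + (1 - a) * t = t - a * (t - s)" by (simp add: algebra_simps)
    ultimately have a: "0 \<le> a" "a \<le> 1" "a * s + (1 - a) * t = r" using r st by (auto simp: a_def)
    have "?p r = a *\<^sub>R ?p s + (1 - a) *\<^sub>R ?p t" unfolding a(3)[symmetric] by (simp add: algebra_simps)
    also have "\<dots> = (a * norm (?p s)) *\<^sub>R geo u v s + ((1 - a) * norm (?p t)) *\<^sub>R geo u v t"
      using arg_cong2[where f = "\<lambda>x y. a *\<^sub>R x + (1 - a) *\<^sub>R y", OF geo_scale[of s u v] geo_scale[of t u v]] by (simp only: scaleR_scaleR)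
    finally have "x = (a * norm (?p s) / norm (?p r)) *\<^sub>R geo u v s + ((1 - a) * norm (?p t) / norm (?p r)) *\<^sub>R geo u v t"
      unfolding r(3) by (simp add: geo_def[of u v r] sgn_div_norm scaleR_add_right divide_inverse mult.commute)
    moreover have "x \<in> S2" unfolding r(3) geo_def by (rule S2_sgn[OF geo_nz[OF uv]])
    ultimately show "x \<in> gs (geo u v s) (geo u v t)" unfolding gs_def using a
      by (intro CollectI conjI exI[of _ "a * norm (?p s) / norm (?p r)"] exI[of _ "(1 - a) * norm (?p t) / norm (?p r)"]) auto
  qed
  show "gs (geo u v s) (geo u v t) \<subseteq> geo u v ` {s..t}"
  proof
    fix x assume "x \<in> gs (geo u v s) (geo u v t)"
    then obtain a b where x: "x \<in> S2" "0 \<le> a" "0 \<le> b" "x = a *\<^sub>R geo u v s + b *\<^sub>R geo u v t" by (auto simp: gs_def)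
    define a' b' where "a' = a / norm (?p s)" and "b' = b / norm (?p t)"
    have nz: "norm (?p s) \<noteq> 0" "norm (?p t) \<noteq> 0" using geo_nz[OF uv] by auto
    have x': "x = a' *\<^sub>R ?p s + b' *\<^sub>R ?p t" unfolding x(4) a'_def b'_def geo_def sgn_div_norm by (simp add: divide_inverse)
    have ab: "0 \<le> a'" "0 \<le> b'" using x by (auto simp: a'_def b'_def)
    have "a' + b' \<noteq> 0"
    proof
      assume "a' + b' = 0"
      then have "a' = 0" "b' = 0" using ab by auto
      then show False using x(1) x' by simp
    qed
    then have pos: "0 < a' + b'" using ab by simp
    define r where "r = (a' * s + b' * t) / (a' + b')"
    have r: "(a' + b') * r = a' * s + b' * t" using pos by (simp add: r_def)
    have "a' * s + b' * s \<le> a' * s + b' * t" "a' * s + b' * t \<le> a' * t + b' * t" using ab st by (auto intro: mult_left_mono)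
    then have rr: "s \<le> r" "r \<le> t" unfolding r_def using pos by (simp_all add: field_simps)
    have "x = (a' + b' - (a' * s + b' * t)) *\<^sub>R u + (a' * s + b' * t) *\<^sub>R v" unfolding x' by (simp add: algebra_simps)
    also have "\<dots> = (a' + b') *\<^sub>R ?p r" unfolding r[symmetric] by (simp add: algebra_simps)
    finally have "sgn x = geo u v r" unfolding geo_def using pos by (rule sgn_eq_pos)
    then show "x \<in> geo u v ` {s..t}" using rr sgn_S2[OF x(1)] by auto
  qed
qed

lemma geo_path_image: "u \<in> S2 \<Longrightarrow> v \<in> S2 \<Longrightarrow> cross3 u v \<noteq> 0 \<Longrightarrow> path_image (geo u v) = gs u v"
  unfolding path_image_def using geo_image[of u v 0 1] by (simp add: geo_ends)

text \<open>Convexity without 0 excludes antipodal pairs. This is what makes great-circle arcs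
  between points of such a face unambiguous and keeps them inside the face.\<close>

definition open_cone :: "(real^3) set \<Rightarrow> bool" where
  "open_cone K \<longleftrightarrow> open K \<and> convex K \<and> (\<forall>x\<in>K. \<forall>r>0. r *\<^sub>R x \<in> K) \<and> 0 \<notin> K"

lemma open_cone_sgn:
  assumes "open_cone K"
  shows "x \<in> K \<Longrightarrow> sgn x \<in> S2 \<inter> K" "connected (S2 \<inter> K)"
proof -
  have K: "open K" "convex K" "\<And>x r. x \<in> K \<Longrightarrow> 0 < r \<Longrightarrow> r *\<^sub>R x \<in> K" "0 \<notin> K" using assms by (auto simp: open_cone_def)
  show s: "sgn x \<in> S2 \<inter> K" if x: "x \<in> K" for x
  proof -
    have x0: "x \<noteq> 0" using x K(4) by auto
    then have "inverse (norm x) *\<^sub>R x \<in> K" using K(3)[OF x] by simp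
    then show ?thesis using S2_sgn[OF x0] by (simp add: sgn_div_norm)
  qed
  have "sgn ` K = S2 \<inter> K" using s sgn_S2 by force
  moreover have "connected (sgn ` K)"
    by (rule connected_continuous_image) (use K convex_connected in \<open>auto intro!: continuous_on_sgn continuous_intros\<close>)
  ultimately show "connected (S2 \<inter> K)" by simp
qed

text \<open>The open segment from a point of an open convex set to a point of its closure stays in
  the set; the segment from \<open>x\<close> to \<open>- x\<close> would pass through 0.\<close>

lemma open_cone_antipode: "open_cone K \<Longrightarrow> x \<in> K \<Longrightarrow> - x \<notin> closure K"
proof
  assume K: "open_cone K" and x: "x \<in> K" and cl: "- x \<in> closure K"
  have "x \<noteq> 0" "open K" "convex K" "0 \<notin> K" using K x by (auto simp: open_cone_def)
  then have "open_segment x (- x) \<subseteq> K" using in_interior_closure_convex_segment[of K x "- x"] x cl interior_open by metis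
  moreover have "0 \<in> open_segment x (- x)" using \<open>x \<noteq> 0\<close> unfolding in_segment
    by (auto simp: eq_neg_iff_add_eq_0 scaleR_2[symmetric] intro!: exI[of _ "1/2"])
  ultimately show False using \<open>0 \<notin> K\<close> by blast
qed

text \<open>Finitely many planes through 0 form a null set and cannot cover a nonempty open
  cone.\<close>

lemma open_cone_generic:
  assumes K: "open_cone K" "K \<noteq> {}" and N: "finite N" "0 \<notin> N"
  shows "\<exists>c\<in>S2 \<inter> K. \<forall>n\<in>N. n \<bullet> c \<noteq> 0"
proof -
  have "negligible (\<Union>n\<in>N. {x::real^3. n \<bullet> x = 0})"
    using N by (intro negligible_Union) (auto intro!: negligible_hyperplane)
  moreover have "\<not> negligible K" using K open_not_negligible unfolding open_cone_def by blast
  ultimately have "\<not> K \<subseteq> (\<Union>n\<in>N. {x. n \<bullet> x = 0})" using negligible_subset by blast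
  then obtain x where x: "x \<in> K" "\<And>n. n \<in> N \<Longrightarrow> n \<bullet> x \<noteq> 0" by blast
  have "n \<bullet> sgn x \<noteq> 0" if "n \<in> N" for n using x that K(1) by (auto simp: sgn_div_norm open_cone_def)
  then show ?thesis using open_cone_sgn(1)[OF K(1) x(1)] by blast
qed

text \<open>\<open>c\<close> and \<open>u\<close> are independent: \<open>u = c\<close> would lie in
  \<open>K\<close>, and \<open>u = - c\<close> is excluded by \<open>open_cone_antipode\<close>. The
  chord stays in \<open>K\<close> up to \<open>u\<close> by convexity, and projection does not leave
  a cone.\<close>

lemma spoke_in_cone:
  assumes K: "open_cone K" and c: "c \<in> S2 \<inter> K" and u: "u \<in> S2" "u \<in> closure K" "u \<notin> K"
  shows "cross3 c u \<noteq> 0" "path_image (geo c u) - {u} \<subseteq> S2 \<inter> K"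
proof -
  show cr: "cross3 c u \<noteq> 0" using cross_unit_zero[of c u] c u open_cone_antipode[OF K, of c] by auto
  show "path_image (geo c u) - {u} \<subseteq> S2 \<inter> K"
  proof
    fix x assume x: "x \<in> path_image (geo c u) - {u}"
    then obtain t where t: "0 \<le> t" "t \<le> 1" "x = geo c u t" by (auto simp: path_image_def)
    have "t \<noteq> 1" using x t geo_ends[OF u(1)] by auto
    have "(1 - t) *\<^sub>R c + t *\<^sub>R u \<in> K"
    proof (cases "t = 0")
      case True then show ?thesis using c by simp
    next
      case False
      have "interior K = K" "convex K" using K by (auto simp: open_cone_def interior_open)
      then have "open_segment c u \<subseteq> K" using in_interior_closure_convex_segment[of K c u] c u(2) by simp
      moreover have "(1 - t) *\<^sub>R c + t *\<^sub>R u \<in> open_segment c u" unfolding in_segment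
        by (intro conjI exI[of _ t]) (use c u False t \<open>t \<noteq> 1\<close> in auto)
      ultimately show ?thesis by blast
    qed
    then show "x \<in> S2 \<inter> K" using open_cone_sgn(1)[OF K] t(3) by (simp add: geo_def)
  qed
qed

text \<open>\<open>f\<close>, \<open>g\<close>, \<open>h\<close> read off the coordinates with
  respect to \<open>a\<close>, \<open>b\<close>, \<open>c\<close>, so that spherical triangles and
  their sides become sign conditions.\<close>

definition dual_basis :: "real^3 \<Rightarrow> real^3 \<Rightarrow> real^3 \<Rightarrow> real^3 \<Rightarrow> real^3 \<Rightarrow> real^3 \<Rightarrow> bool" where
  "dual_basis a b c f g h \<longleftrightarrow> (\<forall>x. x = (x \<bullet> f) *\<^sub>R a + (x \<bullet> g) *\<^sub>R b + (x \<bullet> h) *\<^sub>R c) \<and>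
     a \<bullet> f = 1 \<and> a \<bullet> g = 0 \<and> a \<bullet> h = 0 \<and> b \<bullet> f = 0 \<and> b \<bullet> g = 1 \<and> b \<bullet> h = 0 \<and> c \<bullet> f = 0 \<and> c \<bullet> g = 0 \<and> c \<bullet> h = 1"

lemma dual_basis_exists:
  assumes "cross3 b c \<bullet> a \<noteq> 0"
  shows "\<exists>f g h. dual_basis a b c f g h"
proof -
  let ?D = "cross3 b c \<bullet> a"
  \<comment> \<open>Cramer's rule, written with triple products.\<close>
  have id: "?D *\<^sub>R x = (x \<bullet> cross3 b c) *\<^sub>R a + (x \<bullet> cross3 c a) *\<^sub>R b + (x \<bullet> cross3 a b) *\<^sub>R c" for x :: "real^3"
    by (simp add: cross3_simps forall_3)
  have "dual_basis a b c (cross3 b c /\<^sub>R ?D) (cross3 c a /\<^sub>R ?D) (cross3 a b /\<^sub>R ?D)" unfolding dual_basis_def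
  proof (intro conjI allI)
    fix x :: "real^3"
    have "x = inverse ?D *\<^sub>R (?D *\<^sub>R x)" using assms by simp
    also have "\<dots> = (x \<bullet> (cross3 b c /\<^sub>R ?D)) *\<^sub>R a + (x \<bullet> (cross3 c a /\<^sub>R ?D)) *\<^sub>R b + (x \<bullet> (cross3 a b /\<^sub>R ?D)) *\<^sub>R c"
      unfolding id by (simp add: scaleR_add_right)
    finally show "x = (x \<bullet> (cross3 b c /\<^sub>R ?D)) *\<^sub>R a + (x \<bullet> (cross3 c a /\<^sub>R ?D)) *\<^sub>R b + (x \<bullet> (cross3 a b /\<^sub>R ?D)) *\<^sub>R c" .
  qed (use assms cross_triple[of b c a] cross_triple[of c a b] in \<open>simp_all add: dot_cross_self inner_commute\<close>)
  then show ?thesis by blast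
qed

lemma dual_basis_rotate: "dual_basis a b c f g h \<Longrightarrow> dual_basis b c a g h f"
  unfolding dual_basis_def by (metis add.assoc add.commute)

lemma dual_basis_swap: "dual_basis a b c f g h \<Longrightarrow> dual_basis a c b f h g"
  unfolding dual_basis_def by (metis add.assoc add.commute)

lemma gs_coords:
  assumes d: "dual_basis a b c f g h"
  shows "x \<in> gs a b \<longleftrightarrow> x \<in> S2 \<and> 0 \<le> x \<bullet> f \<and> 0 \<le> x \<bullet> g \<and> x \<bullet> h = 0"
proof
  assume "x \<in> gs a b"
  then obtain r s where "x \<in> S2" "0 \<le> r" "0 \<le> s" "x = r *\<^sub>R a + s *\<^sub>R b" by (auto simp: gs_def)
  then show "x \<in> S2 \<and> 0 \<le> x \<bullet> f \<and> 0 \<le> x \<bullet> g \<and> x \<bullet> h = 0" using d by (simp add: dual_basis_def inner_add_left)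
next
  assume r: "x \<in> S2 \<and> 0 \<le> x \<bullet> f \<and> 0 \<le> x \<bullet> g \<and> x \<bullet> h = 0"
  have "x = (x \<bullet> f) *\<^sub>R a + (x \<bullet> g) *\<^sub>R b + (x \<bullet> h) *\<^sub>R c" using d unfolding dual_basis_def by blast
  then have "x = (x \<bullet> f) *\<^sub>R a + (x \<bullet> g) *\<^sub>R b" using r by simp
  then show "x \<in> gs a b" unfolding gs_def using r by blast
qed

lemma gs_Int:
  assumes d: "dual_basis a b c f g h" and a: "a \<in> S2"
  shows "gs a b \<inter> gs a c = {a}"
proof -
  have "x = a" if x: "x \<in> gs a b" "x \<in> gs a c" for x
  proof -
    have "x \<in> S2" "0 \<le> x \<bullet> f" "x \<bullet> g = 0" "x \<bullet> h = 0" using x gs_coords[OF d] gs_coords[OF dual_basis_swap[OF d]] by auto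
    moreover have "x = (x \<bullet> f) *\<^sub>R a + (x \<bullet> g) *\<^sub>R b + (x \<bullet> h) *\<^sub>R c" using d unfolding dual_basis_def by blast
    ultimately have x': "x = (x \<bullet> f) *\<^sub>R a" by simp
    then have "norm x = \<bar>x \<bullet> f\<bar> * norm a" by (metis norm_scaleR)
    then have "x \<bullet> f = 1" using \<open>x \<in> S2\<close> a \<open>0 \<le> x \<bullet> f\<close> by simp
    then show ?thesis using x' by simp
  qed
  moreover have "\<exists>r s. 0 \<le> r \<and> 0 \<le> s \<and> a = r *\<^sub>R a + s *\<^sub>R v" for v
    by (rule exI[of _ 1], rule exI[of _ 0]) simp
  then have "a \<in> gs a v" for v unfolding gs_def using a by blast
  ultimately show ?thesis by blast
qed

lemma dual_basis_cross: "dual_basis a b c f g h \<Longrightarrow> cross3 a b \<noteq> 0"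
proof
  assume d: "dual_basis a b c f g h" and z: "cross3 a b = 0"
  have "a \<noteq> 0" using d by (auto simp: dual_basis_def)
  have "cross3 a (cross3 a b) = (a \<bullet> b) *\<^sub>R a - (a \<bullet> a) *\<^sub>R b" by (rule Lagrange)
  then have "(a \<bullet> a) *\<^sub>R b = (a \<bullet> b) *\<^sub>R a" using z by simp
  then have "(a \<bullet> a) * (b \<bullet> g) = (a \<bullet> b) * (a \<bullet> g)" by (metis inner_scaleR_left)
  then show False using d \<open>a \<noteq> 0\<close> by (simp add: dual_basis_def)
qed

text \<open>The open triangle is the set where all three coordinates are positive, and on each side
  one of them vanishes.\<close>

lemma triangle_region:
  assumes d: "dual_basis a b c f g h"
  defines "K \<equiv> {x. 0 < x \<bullet> f \<and> 0 < x \<bullet> g \<and> 0 < x \<bullet> h}"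
  shows "open_cone K" "region (gs a b \<union> gs b c \<union> gs a c) (S2 \<inter> K)"
proof -
  have K: "K = {x. 0 < f \<bullet> x} \<inter> {x. 0 < g \<bullet> x} \<inter> {x. 0 < h \<bullet> x}" by (auto simp: K_def inner_commute)
  show oc: "open_cone K" unfolding open_cone_def
  proof (intro conjI)
    have "open {x. 0 < v \<bullet> x}" "convex {x. 0 < v \<bullet> x}" for v :: "real^3"
      using open_halfspace_gt[of 0 v] convex_halfspace_gt[of 0 v] by simp_all
    then show "open K" "convex K" unfolding K by (auto intro: convex_Int)
  qed (auto simp: K_def)
  define m where "m = a + b + c"
  have m: "m \<bullet> f = 1" "m \<bullet> g = 1" "m \<bullet> h = 1" using d by (auto simp: m_def inner_add_left dual_basis_def)
  have ab: "x \<in> gs a b \<longleftrightarrow> x \<in> S2 \<and> 0 \<le> x \<bullet> f \<and> 0 \<le> x \<bullet> g \<and> x \<bullet> h = 0"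
    and bc: "x \<in> gs b c \<longleftrightarrow> x \<in> S2 \<and> 0 \<le> x \<bullet> g \<and> 0 \<le> x \<bullet> h \<and> x \<bullet> f = 0"
    and ac: "x \<in> gs a c \<longleftrightarrow> x \<in> S2 \<and> 0 \<le> x \<bullet> f \<and> 0 \<le> x \<bullet> h \<and> x \<bullet> g = 0" for x
    using gs_coords[OF d] gs_coords[OF dual_basis_rotate[OF d]] gs_coords[OF dual_basis_swap[OF d]] by blast+
  let ?C = "S2 \<inter> {x. 0 \<le> x \<bullet> f \<and> 0 \<le> x \<bullet> g \<and> 0 \<le> x \<bullet> h}"
  have C: "S2 \<inter> K \<union> (gs a b \<union> gs b c \<union> gs a c) = ?C" using ab bc ac unfolding K_def by fastforce
  have "closure (S2 \<inter> K) \<subseteq> ?C"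
  proof (rule closure_minimal)
    show "S2 \<inter> K \<subseteq> ?C" by (auto simp: K_def)
    have "?C = S2 \<inter> {x. 0 \<le> f \<bullet> x} \<inter> {x. 0 \<le> g \<bullet> x} \<inter> {x. 0 \<le> h \<bullet> x}" by (auto simp: inner_commute)
    also have "closed \<dots>" using closed_halfspace_ge[of 0 f] closed_halfspace_ge[of 0 g] closed_halfspace_ge[of 0 h] by (intro closed_Int) simp_all
    finally show "closed ?C" .
  qed
  moreover have "x \<in> closure (S2 \<inter> K)" if x: "x \<in> ?C" for x
  proof -
    \<comment> \<open>All coordinates of \<open>m\<close> are 1, so adding a small multiple of it
      moves a point of the closed triangle into the open cone; normalising brings it back to the
      sphere.\<close>
    define y where "y n = x + inverse (real (Suc n)) *\<^sub>R m" for n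
    have "y n \<in> K" for n using x m by (simp add: y_def K_def inner_add_left add_nonneg_pos)
    then have "\<forall>n. sgn (y n) \<in> S2 \<inter> K" using open_cone_sgn(1)[OF oc] by blast
    moreover have "y \<longlonglongrightarrow> x + 0 *\<^sub>R m" unfolding y_def by (intro tendsto_intros LIMSEQ_inverse_real_of_nat)
    then have "(\<lambda>n. sgn (y n)) \<longlonglongrightarrow> sgn x" using x by (intro tendsto_sgn) auto
    then have "(\<lambda>n. sgn (y n)) \<longlonglongrightarrow> x" using x sgn_S2[of x] by simp
    ultimately show ?thesis unfolding closure_sequential by (intro exI[of _ "\<lambda>n. sgn (y n)"]) blast
  qed
  ultimately have cl: "closure (S2 \<inter> K) = S2 \<inter> K \<union> (gs a b \<union> gs b c \<union> gs a c)" unfolding C by blast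
  have "m \<in> K" using m by (simp add: K_def)
  then have "S2 \<inter> K \<noteq> {}" using open_cone_sgn(1)[OF oc] by blast
  moreover have "S2 \<inter> K \<inter> (gs a b \<union> gs b c \<union> gs a c) = {}" using ab bc ac by (auto simp: K_def)
  moreover have "openin (top_of_set S2) (S2 \<inter> K)" using oc by (auto simp: open_cone_def)
  ultimately show "region (gs a b \<union> gs b c \<union> gs a c) (S2 \<inter> K)" unfolding region_def using cl open_cone_sgn(2)[OF oc] by blast
qed

lemma region_eq:
  assumes "region J R" "region J T" "R \<inter> T \<noteq> {}"
  shows "R = T"
proof
  show "R \<subseteq> T" by (rule region_absorb[OF assms(2)]) (use assms region_sub[OF assms(1)] in \<open>auto simp: region_def\<close>)
  show "T \<subseteq> R" by (rule region_absorb[OF assms(1)]) (use assms region_sub[OF assms(2)] in \<open>auto simp: region_def\<close>)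
qed

text \<open>Exactly two regions have the triangle as boundary. The convex one and the boundary do
  not contain \<open>- a\<close>, so the other one does; a region that avoids \<open>- a\<close>
  must be the convex one.\<close>

lemma triangle_face:
  assumes d: "dual_basis a b c f g h" and S: "a \<in> S2" "b \<in> S2" "c \<in> S2"
    and R: "region (gs a b \<union> gs b c \<union> gs a c) R" and aR: "- a \<notin> R"
  shows "\<exists>K. open_cone K \<and> R = S2 \<inter> K"
proof -
  let ?J = "gs a b \<union> gs b c \<union> gs a c"
  define K where "K = {x. 0 < x \<bullet> f \<and> 0 < x \<bullet> g \<and> 0 < x \<bullet> h}"
  note T = triangle_region[OF d, folded K_def]
  have db: "dual_basis b c a g h f" "dual_basis c a b h f g" "dual_basis a c b f h g" "dual_basis b a c g f h"
    using dual_basis_rotate[OF d] dual_basis_rotate[OF dual_basis_rotate[OF d]] dual_basis_swap[OF d]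
      dual_basis_swap[OF dual_basis_rotate[OF d]] by blast+
  have x: "cross3 a b \<noteq> 0" "cross3 b c \<noteq> 0" "cross3 a c \<noteq> 0"
    using dual_basis_cross[OF d] dual_basis_cross[OF db(1)] dual_basis_cross[OF db(3)] by auto
  note ab = geo_arc[OF S(1,2) x(1)] geo_path_image[OF S(1,2) x(1)]
  note bc = geo_arc[OF S(2,3) x(2)] geo_path_image[OF S(2,3) x(2)]
  note ac = geo_arc[OF S(1,3) x(3)] geo_path_image[OF S(1,3) x(3)]
  have i1: "gs a b \<inter> gs b c = {b}" using gs_Int[OF db(4) S(2)] gs_sym[of a b] by simp
  have i2: "gs a c \<inter> gs b c = {c}" using gs_Int[OF db(2) S(3)] gs_sym[of a c] gs_sym[of b c] by simp
  have i3: "gs a b \<inter> gs a c = {a}" by (rule gs_Int[OF d S(1)])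
  let ?p = "geo a b +++ geo b c"
  have p: "arc ?p" "pathstart ?p = a" "pathfinish ?p = c" "path_image ?p = gs a b \<union> gs b c"
    using ab bc i1 by (auto simp: path_image_join intro!: arc_join)
  have ac': "a \<noteq> c" using x(3) by auto
  have int: "path_image ?p \<inter> path_image (geo a c) = {a, c}" 
  proof -
    have "(gs a b \<union> gs b c) \<inter> gs a c = gs a b \<inter> gs a c \<union> gs a c \<inter> gs b c" by blast
    then show ?thesis unfolding p(4) ac(4) i2 i3 by auto
  qed
  have sub: "path_image ?p \<subseteq> S2" "path_image (geo a c) \<subseteq> S2" unfolding p(4) ac(4) by (auto simp: gs_def)
  obtain R1 R2 where R12: "region (path_image ?p \<union> path_image (geo a c)) R1" "region (path_image ?p \<union> path_image (geo a c)) R2"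
    "R1 \<inter> R2 = {}" "S2 = R1 \<union> R2 \<union> (path_image ?p \<union> path_image (geo a c))"
    using S2_Jordan[OF p(1) ac(1) int ac' p(2,3) ac(2,3) sub] by blast
  have J: "path_image ?p \<union> path_image (geo a c) = ?J" unfolding p(4) ac(4) by blast
  have one: "X = R1 \<or> X = R2" if X: "region ?J X" for X
  proof -
    have "X \<noteq> {}" "X \<inter> ?J = {}" "X \<subseteq> S2" using X region_sub(1)[OF X] by (auto simp: region_def)
    then have "X \<inter> R1 \<noteq> {} \<or> X \<inter> R2 \<noteq> {}" using R12(4) unfolding J by blast
    then show ?thesis using region_eq[OF X] R12(1,2) unfolding J by blast
  qed
  have na: "- a \<in> S2" "- a \<notin> ?J" "- a \<notin> K" using S(1) d gs_coords[OF d] gs_coords[OF db(1)] gs_coords[OF db(3)] gs_coords[OF db(1)]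
    by (auto simp: K_def dual_basis_def gs_def inner_add_left)
  have "R = S2 \<inter> K"
  proof (rule ccontr)
    assume "R \<noteq> S2 \<inter> K"
    then have "S2 = R \<union> (S2 \<inter> K) \<union> ?J" using one[OF R] one[OF T(2)] R12(4) unfolding J by blast
    then show False using na aR by blast
  qed
  then show ?thesis using T(1) by blast
qed


text \<open>Describes a new face by two spokes and one old edge instead of a vertex list, which is
  the form that \<open>triangle_face\<close> can take.\<close>

lemma step_faces:
  assumes good: "good P" and star: "star P c g"
    and Q: "points Q = star_points (Suc m) P c g" "curves Q = star_curves (Suc m) P g" and C: "C \<in> faces Q"
  shows "\<exists>F\<in>faces P. \<exists>u\<in>boundary_vertices P F. \<exists>w\<in>boundary_vertices P F. padj P u w \<and> C \<subseteq> F \<and>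
    region (path_image (g F u) \<union> cv P {u, w} \<union> path_image (g F w)) C"
proof -
  have planeP: "plane_graph P" using good by (simp add: good_def)
  note planeQ = planeQ[OF good star Q] and extQ = extQ[OF good star Q]
  obtain z where z: "z \<in> C" using faces_props(5)[OF C] by blast
  then have "z \<in> S2 - drawn Q" using C Union_faces[of Q] by blast
  moreover have "drawn P \<subseteq> drawn Q" using extQ by (auto simp: extends_def)
  ultimately have "z \<in> \<Union>(faces P)" and zQ: "z \<notin> drawn Q" using Union_faces[of P] by auto
  then obtain F where F: "F \<in> faces P" "z \<in> F" by blast
  obtain L where L: "cyc P L" "region (pcyc P L) F" using good F(1) by (auto simp: good_def)
  let ?S = "\<lambda>t. sector m (sp g m F L t) (sp g m F L (Suc t))"
  obtain R where R: "\<forall>t<length L. R t \<in> faces Q \<and> cyc Q (?S t) \<and> region (pcyc Q (?S t)) (R t) \<and> R t \<subseteq> F"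
    "F \<subseteq> (\<Union>t<length L. R t) \<union> drawn Q" using fan_faces[OF good star Q F(1) L] by (elim exE conjE) (rule that)
  obtain t where t: "t < length L" "z \<in> R t" using R(2) F(2) zQ by blast
  have Rt: "R t \<in> faces Q" "region (pcyc Q (?S t)) (R t)" "R t \<subseteq> F" using R(1) t(1) by blast+
  have CR: "C = R t" using faces_disjoint[OF C Rt(1)] z t(2) by blast
  let ?u = "rim L t" and ?w = "rim L (Suc t)"
  have uw: "?u \<in> boundary_vertices P F" "?w \<in> boundary_vertices P F"
    using rim_bv[OF good star Q F(1) L, of t] rim_bv[OF good star Q F(1) L, of "Suc t"] t(1) by auto
  have pa: "padj P ?u ?w" by (rule rim_adj[OF good star Q F(1) L t(1)])
  have "pc Q [?u, ?w] = cv P {?u, ?w}"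
    using extends_cv[OF planeP planeQ extQ pa] cv_props(2)[OF planeP pa] by (auto simp: pc_def)
  then have "pcyc Q (?S t) = path_image (g F ?u) \<union> cv P {?u, ?w} \<union> path_image (g F ?w)"
    using child_cyc(2)[OF good star Q F(1) L t(1)] by simp
  then show ?thesis using F(1) uw pa Rt CR by (intro bexI[of _ F] bexI[of _ ?u] bexI[of _ ?w]) auto
qed

definition geodesic :: "drawing \<Rightarrow> bool" where
  "geodesic P \<longleftrightarrow> good P \<and> (\<forall>e\<in>curves P. \<exists>u v. e \<inter> points P = {u, v} \<and> cross3 u v \<noteq> 0 \<and> e = gs u v) \<and>
     (\<forall>F\<in>faces P. \<exists>K. open_cone K \<and> F = S2 \<inter> K)"

lemma geodesic_step:
  assumes "geodesic P"
  shows "\<exists>Q. stellar_step (Suc m) P Q \<and> geodesic Q"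
proof -
  have good: "good P" and cur: "\<And>e. e \<in> curves P \<Longrightarrow> \<exists>u v. e \<inter> points P = {u, v} \<and> cross3 u v \<noteq> 0 \<and> e = gs u v"
    and fac: "\<And>F. F \<in> faces P \<Longrightarrow> \<exists>K. open_cone K \<and> F = S2 \<inter> K" using assms by (simp_all add: geodesic_def)
  have plane: "plane_graph P" and fin: "finite (points P)" using good by (auto simp: good_def)
  \<comment> \<open>Normals of all planes spanned by two vertices. A centre off these planes is
    independent of every two independent vertices, so that the new faces are proper spherical
    triangles.\<close>
  define N where "N = {cross3 u w | u w. u \<in> points P \<and> w \<in> points P} - {0}"
  have "{cross3 u w | u w. u \<in> points P \<and> w \<in> points P} = (\<lambda>(u, w). cross3 u w) ` Sigma (points P) (\<lambda>_. points P)" by auto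
  then have N: "finite N" "0 \<notin> N" using fin by (auto simp: N_def)
  have "\<forall>F\<in>faces P. \<exists>x. x \<in> F \<and> (\<forall>n\<in>N. n \<bullet> x \<noteq> 0)"
  proof
    fix F assume F: "F \<in> faces P"
    obtain K where K: "open_cone K" "F = S2 \<inter> K" using fac[OF F] by blast
    then have "K \<noteq> {}" using faces_props(5)[OF F] by blast
    from open_cone_generic[OF K(1) this N] show "\<exists>x. x \<in> F \<and> (\<forall>n\<in>N. n \<bullet> x \<noteq> 0)" using K(2) by blast
  qed
  then obtain c where c0: "\<forall>F\<in>faces P. c F \<in> F \<and> (\<forall>n\<in>N. n \<bullet> c F \<noteq> 0)" by (rule bchoice[THEN exE])
  have c: "c F \<in> F" "\<And>u w. u \<in> points P \<Longrightarrow> w \<in> points P \<Longrightarrow> cross3 u w \<noteq> 0 \<Longrightarrow> cross3 u w \<bullet> c F \<noteq> 0" if "F \<in> faces P" for F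
    using c0 that by (auto simp: N_def)
  define g where "g F = geo (c F)" for F
  have pS: "points P \<subseteq> S2" using plane by (simp add: plane_graph_def)
  have bv: "u \<in> points P" "u \<in> closure F" "u \<notin> F" if u: "u \<in> boundary_vertices P F" and F: "F \<in> faces P" for u F
  proof -
    obtain L where L: "cyc P L" "region (pcyc P L) F" using good F by (auto simp: good_def)
    have "u \<in> set L" using u boundary_vertices_region[OF plane L] by simp
    then have "u \<in> pcyc P L" using cyc_region_points[OF plane L(1)] by blast
    then show "u \<in> closure F" using L(2) by (simp add: region_def)
    show p: "u \<in> points P" using u by (simp add: boundary_vertices_def)
    show "u \<notin> F" using faces_props(2)[OF F] p by blast
  qed
  have cS: "c F \<in> S2" if "F \<in> faces P" for F using c(1)[OF that] faces_props(1)[OF that] by blast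
  have spoke: "u \<in> S2" "cross3 (c F) u \<noteq> 0" "path_image (g F u) - {u} \<subseteq> F" "arc (g F u)" "path_image (g F u) = gs (c F) u"
      "pathstart (g F u) = c F" "pathfinish (g F u) = u"
    if F: "F \<in> faces P" and u: "u \<in> boundary_vertices P F" for F u
  proof -
    obtain K where K: "open_cone K" "F = S2 \<inter> K" using fac[OF F] by blast
    show uS: "u \<in> S2" using bv(1)[OF u F] pS by blast
    have "closure F \<subseteq> closure K" using K(2) by (simp add: closure_mono)
    then have uK: "u \<in> closure K" "u \<notin> K" using bv[OF u F] uS K(2) by auto
    have cK: "c F \<in> S2 \<inter> K" using c(1)[OF F] K(2) by simp
    note s = spoke_in_cone[OF K(1) cK uS uK]
    show cr: "cross3 (c F) u \<noteq> 0" by (rule s(1))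
    show "path_image (g F u) - {u} \<subseteq> F" using s(2) unfolding g_def K(2) .
    show "arc (g F u)" "pathstart (g F u) = c F" "pathfinish (g F u) = u" unfolding g_def using geo_arc[OF cS[OF F] uS cr] by auto
    show "path_image (g F u) = gs (c F) u" unfolding g_def using geo_path_image[OF cS[OF F] uS cr] .
  qed
  have star: "star P c g" unfolding star_def
  proof (intro conjI ballI impI)
    fix F u w assume F: "F \<in> faces P" and u: "u \<in> boundary_vertices P F" and w: "w \<in> boundary_vertices P F" and uw: "u \<noteq> w"
    show "path_image (g F u) \<inter> path_image (g F w) = {c F}"
    proof (cases "cross3 u w = 0")
      case False
      obtain f1 f2 f3 where "dual_basis (c F) u w f1 f2 f3" using dual_basis_exists[OF c(2)[OF F bv(1)[OF u F] bv(1)[OF w F] False]] by blast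
      from gs_Int[OF this cS[OF F]] show ?thesis using spoke(5)[OF F u] spoke(5)[OF F w] by simp
    next
      \<comment> \<open>Here the two boundary vertices are antipodal and no dual basis exists. Their
        spokes lie on one great circle, on opposite sides of the centre.\<close>
      case True
      then have wu: "w = - u" using cross_unit_zero[OF spoke(1)[OF F u] spoke(1)[OF F w]] uw by auto
      have "x = c F" if x: "x \<in> gs (c F) u" "x \<in> gs (c F) w" for x
      proof -
        obtain r s r' s' where rs: "x \<in> S2" "0 \<le> r" "0 \<le> s" "x = r *\<^sub>R c F + s *\<^sub>R u" "0 \<le> r'" "0 \<le> s'" "x = r' *\<^sub>R c F + s' *\<^sub>R w"
          using x by (auto simp: gs_def)
        then have "r *\<^sub>R c F + s *\<^sub>R u = r' *\<^sub>R c F + (- s') *\<^sub>R u" using wu by simp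
        from comb_eqD(2)[OF spoke(2)[OF F u] this] have "s = 0" using rs by simp
        then have x': "x = r *\<^sub>R c F" using rs by simp
        then have "norm x = r * norm (c F)" using rs(2) by simp
        then have "r = 1" using rs(1) cS[OF F] by simp
        then show ?thesis using x' by simp
      qed
      moreover have "c F \<in> path_image (g F u)" "c F \<in> path_image (g F w)"
        using spoke(6)[OF F u] spoke(6)[OF F w] pathstart_in_path_image by metis+
      ultimately show ?thesis using spoke(5)[OF F u] spoke(5)[OF F w] by blast
    qed
  qed (use c(1) spoke in auto)
  define Q where "Q = \<lparr>points = star_points (Suc m) P c g, curves = star_curves (Suc m) P g\<rparr>"
  have Q: "points Q = star_points (Suc m) P c g" "curves Q = star_curves (Suc m) P g" by (simp_all add: Q_def)
  have ext: "extends P Q" by (rule extQ[OF good star Q])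
  have "\<exists>u v. e \<inter> points Q = {u, v} \<and> cross3 u v \<noteq> 0 \<and> e = gs u v" if e: "e \<in> curves Q" for e
  proof (cases "e \<in> curves P")
    case True
    then have "e \<inter> points Q = e \<inter> points P" using ext by (simp add: extends_def)
    then show ?thesis using cur[OF True] by simp
  next
    case False
    then obtain F u i where F: "F \<in> faces P" "u \<in> boundary_vertices P F" "i \<le> Suc m"
      and e': "e = g F u ` {real i / real (Suc m + 1) .. real (i + 1) / real (Suc m + 1)}"
      using e unfolding Q(2) star_curves_def by blast
    have lt: "real i / real (Suc m + 1) < real (i + 1) / real (Suc m + 1)" by (simp add: divide_strict_right_mono)
    have 1: "e \<inter> points Q = {g F u (real i / real (Suc m + 1)), g F u (real (i + 1) / real (Suc m + 1))}"
      unfolding e' by (rule piece_points[OF plane star Q _ F]) simp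
    have 2: "e = gs (g F u (real i / real (Suc m + 1))) (g F u (real (i + 1) / real (Suc m + 1)))"
      unfolding e' g_def by (rule geo_image[OF spoke(2)[OF F(1,2)] lt])
    have 3: "cross3 (g F u (real i / real (Suc m + 1))) (g F u (real (i + 1) / real (Suc m + 1))) \<noteq> 0"
      unfolding g_def by (rule geo_cross[OF spoke(2)[OF F(1,2)]]) (use lt in simp)
    show ?thesis using 1 2 3 by blast
  qed
  moreover have "\<exists>K. open_cone K \<and> C = S2 \<inter> K" if C: "C \<in> faces Q" for C
  proof -
    obtain F u w where F: "F \<in> faces P" and u: "u \<in> boundary_vertices P F" and w: "w \<in> boundary_vertices P F" and pa: "padj P u w"
      and CF: "C \<subseteq> F" and reg: "region (path_image (g F u) \<union> cv P {u, w} \<union> path_image (g F w)) C"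
      using step_faces[OF good star Q C] by blast
    obtain u' w' where uw': "cv P {u, w} \<inter> points P = {u', w'}" "cross3 u' w' \<noteq> 0" "cv P {u, w} = gs u' w'"
      using cur cv_props(1)[OF plane pa] by blast
    then have "{u, w} = {u', w'}" using cv_props(2)[OF plane pa] by simp
    then have uw: "cross3 u w \<noteq> 0" "cv P {u, w} = gs u w"
      using uw' gs_sym cross_skew[of u w] by (auto simp: doubleton_eq_iff)
    obtain f1 f2 f3 where d: "dual_basis (c F) u w f1 f2 f3"
      using dual_basis_exists[OF c(2)[OF F bv(1)[OF u F] bv(1)[OF w F] uw(1)]] by blast
    obtain K where K: "open_cone K" "F = S2 \<inter> K" using fac[OF F] by blast
    \<comment> \<open>The new face lies in the old one, hence in a convex cone that contains the
      centre. This excludes the antipode and thus selects the right side in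
      \<open>triangle_face\<close>.\<close>
    have "- c F \<notin> closure K" using open_cone_antipode[OF K(1), of "c F"] c(1)[OF F] K(2) by blast
    then have nc: "- c F \<notin> C" using CF K(2) closure_subset by blast
    have "region (gs (c F) u \<union> gs u w \<union> gs (c F) w) C" using reg uw(2) spoke(5)[OF F u] spoke(5)[OF F w] by simp
    from triangle_face[OF d cS[OF F] spoke(1)[OF F u] spoke(1)[OF F w] this nc] show ?thesis .
  qed
  ultimately have "geodesic Q" unfolding geodesic_def using step_good[OF good star Q] by blast
  moreover have "stellar_step (Suc m) P Q" unfolding stellar_step_alt using star Q by blast
  ultimately show ?thesis by blast
qed

lemma equator_triangle: "\<exists>P. embedded_triangle P \<and> geodesic P"
proof -
  \<comment> \<open>Since \<open>a + b + sqrt 2 * d = 0\<close>, the three points on the equator do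
    not lie in a half circle. So their pairwise short arcs fill the equator, and the two faces are
    open hemispheres, which are cut out by half-spaces.\<close>
  define a b d :: "real^3" where "a = axis 1 1" and "b = axis 2 1" and "d = - (1 / sqrt 2) *\<^sub>R (a + b)"
  have co: "a $ 1 = 1" "a $ 2 = 0" "a $ 3 = 0" "b $ 1 = 0" "b $ 2 = 1" "b $ 3 = 0"
    by (simp_all add: a_def b_def axis_def)
  have cd: "d $ 1 = - (1 / sqrt 2)" "d $ 2 = - (1 / sqrt 2)" "d $ 3 = 0" by (simp_all add: d_def co)
  have S: "x \<in> S2 \<longleftrightarrow> (x $ 1)\<^sup>2 + (x $ 2)\<^sup>2 + (x $ 3)\<^sup>2 = 1" for x :: "real^3"
    by (simp add: norm_eq_sqrt_inner inner_vec_def sum_3 power2_eq_square)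
  have veq: "x = y \<longleftrightarrow> x $ 1 = y $ 1 \<and> x $ 2 = y $ 2 \<and> x $ 3 = y $ 3" for x y :: "real^3" by (simp add: vec_eq_iff forall_3)
  have abd: "a \<in> S2" "b \<in> S2" "d \<in> S2" unfolding S by (simp_all add: co cd power_divide)
  have ab: "x \<in> gs a b \<longleftrightarrow> x \<in> S2 \<and> x $ 3 = 0 \<and> 0 \<le> x $ 1 \<and> 0 \<le> x $ 2" for x
  proof
    assume "x \<in> S2 \<and> x $ 3 = 0 \<and> 0 \<le> x $ 1 \<and> 0 \<le> x $ 2"
    then show "x \<in> gs a b" unfolding gs_def by (intro CollectI conjI, simp, intro exI[of _ "x $ 1"] exI[of _ "x $ 2"]) (simp add: veq co)
  qed (auto simp: gs_def co)
  have s2: "sqrt 2 * (1 / sqrt 2) = 1" "0 < 1 / sqrt 2" by simp_all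
  have bd: "x \<in> gs b d \<longleftrightarrow> x \<in> S2 \<and> x $ 3 = 0 \<and> x $ 1 \<le> 0 \<and> x $ 1 \<le> x $ 2" for x
  proof
    assume h: "x \<in> S2 \<and> x $ 3 = 0 \<and> x $ 1 \<le> 0 \<and> x $ 1 \<le> x $ 2"
    have "x = (x $ 2 - x $ 1) *\<^sub>R b + (- (sqrt 2 * x $ 1)) *\<^sub>R d" using h by (simp add: veq co cd)
    moreover have "0 \<le> x $ 2 - x $ 1" "0 \<le> - (sqrt 2 * x $ 1)" using h by (auto simp: mult_nonneg_nonpos)
    ultimately show "x \<in> gs b d" unfolding gs_def using h by blast
  next
    assume "x \<in> gs b d"
    then obtain r s where "x \<in> S2" "0 \<le> r" "0 \<le> s" "x = r *\<^sub>R b + s *\<^sub>R d" by (auto simp: gs_def)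
    then show "x \<in> S2 \<and> x $ 3 = 0 \<and> x $ 1 \<le> 0 \<and> x $ 1 \<le> x $ 2" by (simp add: co cd)
  qed
  have ad: "x \<in> gs a d \<longleftrightarrow> x \<in> S2 \<and> x $ 3 = 0 \<and> x $ 2 \<le> 0 \<and> x $ 2 \<le> x $ 1" for x
  proof
    assume h: "x \<in> S2 \<and> x $ 3 = 0 \<and> x $ 2 \<le> 0 \<and> x $ 2 \<le> x $ 1"
    have "x = (x $ 1 - x $ 2) *\<^sub>R a + (- (sqrt 2 * x $ 2)) *\<^sub>R d" using h by (simp add: veq co cd)
    moreover have "0 \<le> x $ 1 - x $ 2" "0 \<le> - (sqrt 2 * x $ 2)" using h by (auto simp: mult_nonneg_nonpos)
    ultimately show "x \<in> gs a d" unfolding gs_def using h by blast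
  next
    assume "x \<in> gs a d"
    then obtain r s where "x \<in> S2" "0 \<le> r" "0 \<le> s" "x = r *\<^sub>R a + s *\<^sub>R d" by (auto simp: gs_def)
    then show "x \<in> S2 \<and> x $ 3 = 0 \<and> x $ 2 \<le> 0 \<and> x $ 2 \<le> x $ 1" by (simp add: co cd)
  qed
  have ne: "a \<noteq> b" "b \<noteq> d" "a \<noteq> d" using s2(2) by (auto simp: veq co cd)
  have cr: "cross3 a b \<noteq> 0" "cross3 b d \<noteq> 0" "cross3 a d \<noteq> 0"
    using s2(2) by (auto simp: veq cross_components co cd)
  define P where "P = \<lparr>points = {a, b, d}, curves = {gs a b, gs b d, gs a d}\<rparr>"
  have P: "points P = {a, b, d}" "curves P = {gs a b, gs b d, gs a d}" by (simp_all add: P_def)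
  have i: "gs a b \<inter> points P = {a, b}" "gs b d \<inter> points P = {b, d}" "gs a d \<inter> points P = {a, d}"
    using abd s2(2) by (auto simp: P(1) ab bd ad co cd)
  have j: "gs a b \<inter> gs b d \<subseteq> {a, b, d}" "gs a b \<inter> gs a d \<subseteq> {a, b, d}" "gs b d \<inter> gs a d \<subseteq> {a, b, d}"
  proof -
    show "gs a b \<inter> gs b d \<subseteq> {a, b, d}"
    proof
      fix x assume "x \<in> gs a b \<inter> gs b d"
      then have h: "x $ 3 = 0" "x $ 1 = 0" "0 \<le> x $ 2" "x \<in> S2" by (auto simp: ab bd)
      then have "(x $ 2)\<^sup>2 = 1" using S[of x] by simp
      then have "x $ 2 = 1" using h(3) by (auto simp: power2_eq_1_iff)
      then show "x \<in> {a, b, d}" using h by (simp add: veq co)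
    qed
    show "gs a b \<inter> gs a d \<subseteq> {a, b, d}"
    proof
      fix x assume "x \<in> gs a b \<inter> gs a d"
      then have h: "x $ 3 = 0" "x $ 2 = 0" "0 \<le> x $ 1" "x \<in> S2" by (auto simp: ab ad)
      then have "(x $ 1)\<^sup>2 = 1" using S[of x] by simp
      then have "x $ 1 = 1" using h(3) by (auto simp: power2_eq_1_iff)
      then show "x \<in> {a, b, d}" using h by (simp add: veq co)
    qed
    show "gs b d \<inter> gs a d \<subseteq> {a, b, d}"
    proof
      fix x assume "x \<in> gs b d \<inter> gs a d"
      then have h: "x $ 3 = 0" "x $ 1 = x $ 2" "x $ 1 \<le> 0" "x \<in> S2" by (auto simp: ad bd)
      then have "(sqrt 2 * x $ 1)\<^sup>2 = 1" using S[of x] by (simp add: power_mult_distrib)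
      moreover have "sqrt 2 * x $ 1 \<le> 0" using h(3) by (simp add: mult_nonneg_nonpos)
      ultimately have "sqrt 2 * x $ 1 = -1" by (auto simp: power2_eq_1_iff)
      then have "x $ 1 = - (1 / sqrt 2)" by (simp add: field_simps)
      then show "x \<in> {a, b, d}" using h by (simp add: veq cd)
    qed
  qed
  have arcs: "\<exists>h. arc h \<and> path_image h = gs u v \<and> {u, v} = {pathstart h, pathfinish h}"
    if "u \<in> S2" "v \<in> S2" "cross3 u v \<noteq> 0" for u v
    using geo_arc[OF that] geo_path_image[OF that] by (intro exI[of _ "geo u v"]) simp
  have plane: "plane_graph P" unfolding plane_graph_def
  proof (intro conjI)
    show "points P \<subseteq> S2" using abd by (simp add: P)
    show "\<forall>e\<in>curves P. e \<subseteq> S2 \<and> (\<exists>g. arc g \<and> path_image g = e \<and> e \<inter> points P = {pathstart g, pathfinish g})"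
    proof
      fix e assume "e \<in> curves P"
      then consider "e = gs a b" | "e = gs b d" | "e = gs a d" by (auto simp: P)
      then have "\<exists>g. arc g \<and> path_image g = e \<and> e \<inter> points P = {pathstart g, pathfinish g}"
        using arcs[OF abd(1,2) cr(1)] arcs[OF abd(2,3) cr(2)] arcs[OF abd(1,3) cr(3)] i by cases metis+
      moreover have "e \<subseteq> S2" using \<open>e \<in> curves P\<close> by (auto simp: P gs_def)
      ultimately show "e \<subseteq> S2 \<and> (\<exists>g. arc g \<and> path_image g = e \<and> e \<inter> points P = {pathstart g, pathfinish g})" by blast
    qed
    show "\<forall>e\<in>curves P. \<forall>f\<in>curves P. e \<noteq> f \<longrightarrow> e \<inter> f \<subseteq> points P" using j by (auto simp: P)
    show "inj_on (\<lambda>e. e \<inter> points P) (curves P)" unfolding P(2) inj_on_def using i ne by (auto simp: doubleton_eq_iff)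
  qed
  have ag: "abstract_graph P = \<lparr>verts = {a, b, d}, edges = {{a, b}, {b, d}, {a, d}}\<rparr>"
    unfolding abstract_graph_def P(2) using i by (simp add: P(1))
  have et: "embedded_triangle P" unfolding embedded_triangle_def using plane ne ag by blast
  have "x \<in> gs a b \<or> x \<in> gs b d \<or> x \<in> gs a d" if "x \<in> S2" "x $ 3 = 0" for x using that unfolding ab bd ad by argo
  then have dr: "drawn P = S2 \<inter> {x. x $ 3 = 0}" using abd by (auto simp: P ab bd ad co cd)
  have h: "{x. 0 < x $ 3} = {x :: real^3. 0 < axis 3 1 \<bullet> x}" "{x. x $ 3 < 0} = {x :: real^3. axis 3 1 \<bullet> x < 0}"
    by (simp_all add: inner_axis')
  have K: "open_cone {x. 0 < x $ 3}" "open_cone {x. x $ 3 < 0}"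
    unfolding open_cone_def using open_halfspace_gt[of 0 "axis 3 1 :: real^3"] convex_halfspace_gt[of 0 "axis 3 1 :: real^3"]
      open_halfspace_lt[of "axis 3 1 :: real^3" 0] convex_halfspace_lt[of "axis 3 1 :: real^3" 0] h by (auto simp: mult_pos_neg)
  have "\<exists>K. open_cone K \<and> F = S2 \<inter> K" if F: "F \<in> faces P" for F
  proof -
    let ?U = "{x :: real^3. 0 < x $ 3}" and ?L = "{x :: real^3. x $ 3 < 0}"
    have Fc: "F \<in> components (S2 - drawn P)" using F by (simp add: faces_def)
    have cov: "S2 - drawn P = (S2 \<inter> ?U) \<union> (S2 \<inter> ?L)" unfolding dr by auto
    have "F \<subseteq> ?U \<union> ?L" using in_components_subset[OF Fc] cov by blast
    moreover have "?U \<inter> ?L \<inter> F = {}" by auto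
    moreover have "open ?U" "open ?L" using K by (auto simp: open_cone_def)
    ultimately have side: "?U \<inter> F = {} \<or> ?L \<inter> F = {}" using connectedD[OF in_components_connected[OF Fc]] by blast
    have FS: "F \<subseteq> S2" using faces_props(1)[OF F] .
    have max: "S2 \<inter> X \<subseteq> F" if "X = ?U \<or> X = ?L" "F \<inter> X \<noteq> {}" for X
      by (rule components_maximal[OF Fc]) (use that open_cone_sgn(2)[OF K(1)] open_cone_sgn(2)[OF K(2)] cov FS in auto)
    have "F \<noteq> {}" using faces_props(5)[OF F] .
    then have "F = S2 \<inter> ?U \<or> F = S2 \<inter> ?L" using side max[of ?U] max[of ?L] \<open>F \<subseteq> ?U \<union> ?L\<close> FS by blast
    then show ?thesis using K by blast
  qed
  moreover have "\<exists>u v. e \<inter> points P = {u, v} \<and> cross3 u v \<noteq> 0 \<and> e = gs u v" if "e \<in> curves P" for e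
    using that i cr unfolding P(2) by blast
  ultimately have "geodesic P" unfolding geodesic_def using triangle_good(1)[OF et] by blast
  then show ?thesis using et by blast
qed

theorem stellar_sequence_exists: "\<exists>\<G>. stellar_sequence \<G>"
proof -
  obtain P where P: "embedded_triangle P" "geodesic P" using equator_triangle by blast
  have "\<exists>\<G>. \<forall>n. (geodesic (\<G> n) \<and> (n = 0 \<longrightarrow> \<G> n = P)) \<and> stellar_step (Suc n) (\<G> n) (\<G> (Suc n))"
    by (rule dependent_nat_choice[of "\<lambda>n D. geodesic D \<and> (n = 0 \<longrightarrow> D = P)" "\<lambda>n. stellar_step (Suc n)"])
      (use P(2) geodesic_step in auto)
  then obtain \<G> where G: "\<And>n. n = 0 \<longrightarrow> \<G> n = P" "\<And>n. stellar_step (Suc n) (\<G> n) (\<G> (Suc n))" by metis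
  have "stellar_step n (\<G> (n - 1)) (\<G> n)" if "0 < n" for n using G(2)[of "n - 1"] that by simp
  then have "stellar_sequence \<G>" unfolding stellar_sequence_def using P(1) G(1)[of 0] by simp
  then show ?thesis by blast
qed

section \<open>Universality\<close>

text \<open>Each branch set becomes the subgraph it induces, and each edge of \<open>H\<close> an
  open path without inner vertices, that is, one edge between two branch sets.\<close>

lemma graph_minor_branch_sets:
  fixes H :: "'a sgraph" and G :: "'b sgraph"
  assumes sH: "simple_graph H" and sG: "simple_graph G"
    and B: "\<And>v. v \<in> verts H \<Longrightarrow> B v \<subseteq> verts G \<and> conn (\<lambda>u w. {u, w} \<in> edges G) (B v)"
    and dj: "\<And>v w. v \<in> verts H \<Longrightarrow> w \<in> verts H \<Longrightarrow> v \<noteq> w \<Longrightarrow> B v \<inter> B w = {}"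
    and E: "\<And>x y. {x, y} \<in> edges H \<Longrightarrow> \<exists>a\<in>B x. \<exists>b\<in>B y. {a, b} \<in> edges G"
  shows "graph_minor H G"
proof -
  have Hv: "x \<in> verts H" "y \<in> verts H" "x \<noteq> y" if e: "{x, y} \<in> edges H" for x y
  proof -
    from sH[unfolded simple_graph_def, rule_format, OF e] obtain x' y' where "x' \<in> verts H" "y' \<in> verts H" "x' \<noteq> y'" "{x, y} = {x', y'}" by blast
    then show "x \<in> verts H" "y \<in> verts H" "x \<noteq> y" by (auto simp: doubleton_eq_iff)
  qed
  \<comment> \<open>One edge is chosen for the unordered pair \<open>e\<close>, because the path
    assigned to it has to serve both orders of its ends.\<close>
  have "\<forall>e\<in>edges H. \<exists>d. d \<in> edges G \<and> (\<exists>x y a b. e = {x, y} \<and> a \<in> B x \<and> b \<in> B y \<and> d = {a, b})"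
  proof
    fix e assume e: "e \<in> edges H"
    from sH[unfolded simple_graph_def, rule_format, OF e] obtain x y where xy: "e = {x, y}" by blast
    then obtain a b where "a \<in> B x" "b \<in> B y" "{a, b} \<in> edges G" using E e by blast
    then show "\<exists>d. d \<in> edges G \<and> (\<exists>x y a b. e = {x, y} \<and> a \<in> B x \<and> b \<in> B y \<and> d = {a, b})" using xy by blast
  qed
  then obtain \<epsilon> where eps: "\<forall>e\<in>edges H. \<epsilon> e \<in> edges G \<and> (\<exists>x y a b. e = {x, y} \<and> a \<in> B x \<and> b \<in> B y \<and> \<epsilon> e = {a, b})"
    by (rule bchoice[THEN exE])
  have link: "\<exists>a\<in>B x. \<exists>b\<in>B y. \<epsilon> {x, y} = {a, b}" if e: "{x, y} \<in> edges H" for x y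
  proof -
    from eps[rule_format, OF e] obtain x' y' a b where h: "{x, y} = {x', y'}" "a \<in> B x'" "b \<in> B y'" "\<epsilon> {x, y} = {a, b}" by blast
    consider "x = x'" "y = y'" | "x = y'" "y = x'" using h(1) by (auto simp: doubleton_eq_iff)
    then show ?thesis
    proof cases
      case 1 then show ?thesis using h(2-4) by blast
    next
      case 2 then show ?thesis using h(2-4) insert_commute by metis
    qed
  qed
  define \<phi> where "\<phi> v = \<lparr>verts = B v, edges = {d \<in> edges G. d \<subseteq> B v}\<rparr>" for v
  define \<psi> where "\<psi> e = \<lparr>verts = {}, edges = {\<epsilon> e}\<rparr>" for e
  define K where "K = \<lparr>verts = \<Union>v\<in>verts H. B v, edges = (\<Union>v\<in>verts H. {d \<in> edges G. d \<subseteq> B v}) \<union> \<epsilon> ` edges H\<rparr>"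
  have Gs: "\<exists>x y. x \<noteq> y \<and> d = {x, y}" if "d \<in> edges G" for d
    using sG[unfolded simple_graph_def, rule_format, OF that] by blast
  have epsV: "\<epsilon> e \<subseteq> (\<Union>v\<in>verts H. B v)" if e: "e \<in> edges H" for e
  proof -
    obtain x y where xy: "e = {x, y}" using sH[unfolded simple_graph_def, rule_format, OF e] by blast
    then show ?thesis using link[of x y] Hv[of x y] e by auto
  qed
  have inB: "x = v" if "a \<in> B x" "a \<in> B v" "x \<in> verts H" "v \<in> verts H" for a x v using dj that by blast
  have KV: "d \<subseteq> verts K" if "d \<in> edges K" for d using that epsV by (auto simp: K_def)
  have KG: "edges K \<subseteq> edges G" using eps by (auto simp: K_def)
  have "simple_graph K" unfolding simple_graph_def
  proof
    fix d assume d: "d \<in> edges K"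
    then obtain x y where "x \<noteq> y" "d = {x, y}" using Gs KG by blast
    then show "\<exists>x\<in>verts K. \<exists>y\<in>verts K. x \<noteq> y \<and> d = {x, y}" using KV[OF d] by auto
  qed
  moreover have "verts K \<subseteq> verts G" using B by (auto simp: K_def)
  ultimately have sub: "subgraph K G" using KG by (simp add: subgraph_def)
  have "inflated_copy H K \<phi> \<psi>" unfolding inflated_copy_def
  proof (intro conjI ballI allI impI)
    fix v assume v: "v \<in> verts H"
    have "simple_graph (\<phi> v)" unfolding simple_graph_def
    proof
      fix d assume d: "d \<in> edges (\<phi> v)"
      then have "d \<in> edges G" by (simp add: \<phi>_def)
      then obtain x y where "x \<noteq> y" "d = {x, y}" using Gs by blast
      then show "\<exists>x\<in>verts (\<phi> v). \<exists>y\<in>verts (\<phi> v). x \<noteq> y \<and> d = {x, y}" using d by (auto simp: \<phi>_def)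
    qed
    then show "subgraph (\<phi> v) K" using v by (auto simp: subgraph_def \<phi>_def K_def)
    have "{(u, w). u \<in> B v \<and> w \<in> B v \<and> {u, w} \<in> edges G} \<subseteq> {(u, w). {u, w} \<in> edges (\<phi> v)}" by (auto simp: \<phi>_def)
    then have "{(u, w). u \<in> B v \<and> w \<in> B v \<and> {u, w} \<in> edges G}\<^sup>* \<subseteq> {(u, w). {u, w} \<in> edges (\<phi> v)}\<^sup>*" by (rule rtrancl_mono)
    then show "connected_graph (\<phi> v)" using B[OF v] unfolding connected_graph_def conn_def by (simp add: \<phi>_def subset_iff)
  next
    fix x y assume e: "{x, y} \<in> edges H"
    obtain a b where ab: "a \<in> B x" "b \<in> B y" "\<epsilon> {x, y} = {a, b}" using link[OF e] by blast
    have "a \<noteq> b" using ab dj Hv[OF e] by blast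
    then show "open_path_between (\<psi> {x, y}) (\<phi> x) (\<phi> y)" unfolding open_path_between_def
      by (intro exI[of _ "[a, b]"]) (use ab in \<open>auto simp: \<psi>_def \<phi>_def less_Suc_eq\<close>)
  next
    fix v w assume vw: "v \<in> verts H" "w \<in> verts H" "v \<noteq> w"
    have "d \<noteq> {}" if "d \<in> edges G" for d using Gs[OF that] by blast
    then show "disjoint_parts (\<phi> v) (\<phi> w)" using dj[OF vw] by (fastforce simp: disjoint_parts_def \<phi>_def)
  next
    fix e f assume ef: "e \<in> edges H" "f \<in> edges H" "e \<noteq> f"
    obtain x y where xy: "e = {x, y}" using sH[unfolded simple_graph_def, rule_format, OF ef(1)] by blast
    obtain z w where zw: "f = {z, w}" using sH[unfolded simple_graph_def, rule_format, OF ef(2)] by blast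
    obtain a b where ab: "a \<in> B x" "b \<in> B y" "\<epsilon> e = {a, b}" using link ef(1) xy by blast
    obtain a' b' where ab': "a' \<in> B z" "b' \<in> B w" "\<epsilon> f = {a', b'}" using link ef(2) zw by blast
    have V: "x \<in> verts H" "y \<in> verts H" "z \<in> verts H" "w \<in> verts H" using Hv ef(1,2) xy zw by blast+
    \<comment> \<open>The branch sets are disjoint, so the chosen edge determines the branch sets at
      its ends and thereby the edge of \<open>H\<close>.\<close>
    have "\<epsilon> e \<noteq> \<epsilon> f"
    proof
      assume "\<epsilon> e = \<epsilon> f"
      then have "(a = a' \<and> b = b') \<or> (a = b' \<and> b = a')" using ab(3) ab'(3) by (auto simp: doubleton_eq_iff)
      then have "(x = z \<and> y = w) \<or> (x = w \<and> y = z)" using ab ab' V inB by blast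
      then show False using ef(3) xy zw by auto
    qed
    then show "disjoint_parts (\<psi> e) (\<psi> f)" by (simp add: disjoint_parts_def \<psi>_def)
  next
    fix v e assume v: "v \<in> verts H" and e: "e \<in> edges H"
    obtain x y where xy: "e = {x, y}" using sH[unfolded simple_graph_def, rule_format, OF e] by blast
    obtain a b where ab: "a \<in> B x" "b \<in> B y" "\<epsilon> e = {a, b}" using link e xy by blast
    have "x \<in> verts H" "y \<in> verts H" "x \<noteq> y" using Hv e xy by blast+
    then have "\<not> \<epsilon> e \<subseteq> B v" using ab inB v by (metis insert_subset)
    then show "disjoint_parts (\<phi> v) (\<psi> e)" by (simp add: disjoint_parts_def \<phi>_def \<psi>_def)
  next
    show "verts K = (\<Union>v\<in>verts H. verts (\<phi> v)) \<union> (\<Union>e\<in>edges H. verts (\<psi> e))" by (simp add: K_def \<phi>_def \<psi>_def)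
    show "edges K = (\<Union>v\<in>verts H. edges (\<phi> v)) \<union> (\<Union>e\<in>edges H. edges (\<psi> e))" by (auto simp: K_def \<phi>_def \<psi>_def)
  qed
  then show ?thesis unfolding graph_minor_def using sub by blast
qed

lemma padj_edges: "padj P u v \<longleftrightarrow> {u, v} \<in> edges (abstract_graph P)"
  by (auto simp: padj_def abstract_graph_def)

lemma abstract_graph_simple: assumes "plane_graph P" shows "simple_graph (abstract_graph P)"
  unfolding simple_graph_def
proof
  fix d assume "d \<in> edges (abstract_graph P)"
  then obtain e where e: "e \<in> curves P" "d = e \<inter> points P" by (auto simp: abstract_graph_def)
  have "\<exists>g. arc g \<and> path_image g = e \<and> e \<inter> points P = {pathstart g, pathfinish g}" using assms e(1) by (simp add: plane_graph_def)
  then obtain g where g: "arc g" "d = {pathstart g, pathfinish g}" unfolding e(2) by blast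
  have "pathstart g \<noteq> pathfinish g" using arc_distinct_ends[OF g(1)] by simp
  moreover have "d \<subseteq> verts (abstract_graph P)" using e by (auto simp: abstract_graph_def)
  ultimately show "\<exists>x\<in>verts (abstract_graph P). \<exists>y\<in>verts (abstract_graph P). x \<noteq> y \<and> d = {x, y}" using g(2) by auto
qed

context
  fixes \<G> assumes seq: "stellar_sequence \<G>"
begin

lemma union_countable_planar: "countable_planar_graph (abstract_graph (union_drawing \<G>))"
proof -
  let ?G = "abstract_graph (union_drawing \<G>)"
  have "isomorphic_graphs ?G ?G" unfolding isomorphic_graphs_def by (intro exI[of _ id]) (simp add: bij_betw_id)
  then have "planar ?G" unfolding planar_def using union_plane[OF seq] by blast
  then show ?thesis unfolding countable_planar_graph_def
    using abstract_graph_simple[OF union_plane[OF seq]] union_countable[OF seq] by (simp add: abstract_graph_def)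
qed

lemma union_universal:
  assumes H: "countable_planar_graph H"
  shows "graph_minor H (abstract_graph (union_drawing \<G>))"
proof -
  let ?U = "union_drawing \<G>"
  have sH: "simple_graph H" and cH: "countable (verts H)" using H by (auto simp: countable_planar_graph_def)
  obtain P f where plane: "plane_graph P" and f: "bij_betw f (verts H) (points P)" "edges (abstract_graph P) = (\<lambda>e. f ` e) ` edges H"
    using H unfolding countable_planar_graph_def planar_def isomorphic_graphs_def by (auto simp: abstract_graph_def)
  have ct: "countable (points P)" using cH f(1) by (metis bij_betw_def countable_image)
  obtain C I where C: "gface \<G> 0 C I" "I \<subseteq> points ?U" using gface_exists[OF seq] by blast
  obtain B where B: "\<forall>x\<in>points P. conn (padj ?U) (B x) \<and> B x \<subseteq> points ?U"
    "\<forall>x\<in>points P. \<forall>y\<in>points P. x \<noteq> y \<longrightarrow> B x \<inter> B y = {}"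
    "\<forall>u w. padj P u w \<longrightarrow> (\<exists>a\<in>B u. \<exists>b\<in>B w. padj ?U a b)"
    using stellar_faces.branch_sets[OF gface_stellar[OF seq] plane ct C] by (elim exE conjE) (rule that)
  have fP: "f v \<in> points P" if "v \<in> verts H" for v using that f(1) by (auto simp: bij_betw_def)
  show ?thesis
  proof (rule graph_minor_branch_sets[OF sH abstract_graph_simple[OF union_plane[OF seq]], of "\<lambda>v. B (f v)"])
    show "B (f v) \<subseteq> verts (abstract_graph ?U) \<and> conn (\<lambda>u w. {u, w} \<in> edges (abstract_graph ?U)) (B (f v))" if "v \<in> verts H" for v
      using B(1) fP[OF that] unfolding padj_edges[symmetric] by (simp add: abstract_graph_def)
    show "B (f v) \<inter> B (f w) = {}" if vw: "v \<in> verts H" "w \<in> verts H" "v \<noteq> w" for v w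
    proof -
      have "f v \<noteq> f w" using vw f(1) by (meson bij_betw_def inj_onD)
      then show ?thesis using B(2) fP vw by blast
    qed
    show "\<exists>a\<in>B (f x). \<exists>b\<in>B (f y). {a, b} \<in> edges (abstract_graph ?U)" if "{x, y} \<in> edges H" for x y
    proof -
      have "{f x, f y} \<in> edges (abstract_graph P)" unfolding f(2) by (rule image_eqI[OF _ that]) simp
      then show ?thesis using B(3) unfolding padj_edges[symmetric] by blast
    qed
  qed
qed

end

theorem theorem1:
  "(\<exists>\<G>. stellar_sequence \<G>) \<and>
   (\<forall>\<G>. stellar_sequence \<G> \<longrightarrow>
      countable_planar_graph (abstract_graph (union_drawing \<G>)) \<and>
      (\<forall>H :: 'a sgraph. countable_planar_graph H \<longrightarrow>
         graph_minor H (abstract_graph (union_drawing \<G>))))"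
  using stellar_sequence_exists union_countable_planar union_universal by blast

end
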